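(* Let $(E,\phi)$ be an Anderson $A$-module over $L$ and $u\in A$ a separating element. Then: (i) the $\mathbb{T}$-linear endomorphism $1\otimes\partial u-u\otimes1$ of $\operatorname{Lie}_E(\mathbb{T})$ is bijective, and the map $A\otimes\Lambda_E\to E(\mathbb{T})$, $x\mapsto(\mathrm{id}\hat\otimes\exp_E)\big((1\otimes\partial u-u\otimes1)^{-1}x\big)$ factors through an $A$-linear map $\tilde\delta_u:A\otimes_{\mathbb{F}[u]}\Lambda_E\to\{\omega\in E(\mathbb{T}):(u\otimes1)\omega=(1\otimes u)\omega\}$; (ii) letting $\mathcal{D}=\{x\in A\otimes_{\mathbb{F}[u]}\Lambda_E : (a\otimes1)x=(1\otimes a)x\ \forall a\in A\}$ and $\mu:A\otimes_{\mathbb{F}[u]}\Lambda_E\to\Lambda_E$, $a\otimes\lambda\mapsto\partial a(\lambda)$, the map $\mu$ restricts to a bijection $\mathcal{D}\to\mathfrak{d}_{A/\mathbb{F}[u]}\cdot\Lambda_E$ and $\tilde\delta_u$ restricts to a bijection $\mathcal{D}\to\mathfrak{sf}(E)$, so that $\delta_u=\tilde\delta_u\circ(\mu|_{\mathcal{D}})^{-1}$ is an isomorphism of $A$-modules \[\delta_u:\mathfrak{d}_{A/\mathbb{F}[u]}\cdot\Lambda_E\xrightarrow{\ \cong\ }\mathfrak{sf}(E).\]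
   Context: Let $\mathbb{F}$ be a finite field with $q$ elements, $C$ a smooth projective geometrically irreducible curve over $\mathbb{F}$, $\infty$ a closed point, $A=H^0(C\setminus\{\infty\},\mathcal{O}_C)$, $K=\operatorname{Frac}A$, $\mathbb{C}_\infty$ the completion of an algebraic closure of $K$ at a place above $\infty$ (absolute value $|\cdot|$), $K\subseteq L\subseteq\mathbb{C}_\infty$, $\ell:K\to L$ the inclusion; unlabeled tensors are over $\mathbb{F}$. An Anderson $A$-module $(E,\phi)$ over $L$ of dimension $d$: an $\mathbb{F}$-vector space scheme $E\cong\mathbb{G}_{a,L}^d$ with an $\mathbb{F}$-algebra map $\phi:A\to\operatorname{End}_{\mathbb{F},L}(E)$ such that $\partial\phi_a-\ell(a)\mathrm{id}$ is nilpotent on $\operatorname{Lie}_E(L)$ for all $a$; write $\partial a=\partial\phi_a$. $\exp_E:\operatorname{Lie}_E(\mathbb{C}_\infty)\to E(\mathbb{C}_\infty)$ is the unique $\mathbb{F}$-linear map with $\exp_E(\partial a\,x)=\phi_a(\exp_E x)$ given in any coordinates $E\cong\mathbb{G}_{a,L}^d$ by a convergent series $x+e_1\tau(x)+e_2\tau^2(x)+\cdots$ ($\tau$ the $q$-Frobenius); $\Lambda_E=\ker\exp_E$, an $A$-module via $\partial$. For countably dimensional $B$ and complete normed $V$, $B\hat\otimes V$ is the completion of $B\otimes V$ for $\|x\|=\inf\max|v_i|$ over representations $x=\sum b_i\otimes v_i$. $\mathbb{T}=A\hat\otimes\mathbb{C}_\infty$. $E(\mathbb{T})=A\hat\otimes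 E(\mathbb{C}_\infty)$ and $\operatorname{Lie}_E(\mathbb{T})=A\hat\otimes\operatorname{Lie}_E(\mathbb{C}_\infty)$ (norms from any coordinate system $E\cong\mathbb{G}_{a,L}^d$, the completions being independent of it), $A\otimes A$-modules with $a\otimes1$ acting on the $A$-factor and $1\otimes a$ acting by $\phi_a$, resp. $\partial a$, extended continuously; $\operatorname{Lie}_E(\mathbb{T})$ is also a $\mathbb{T}$-module. $\mathrm{id}\hat\otimes\exp_E:\operatorname{Lie}_E(\mathbb{T})\to E(\mathbb{T})$ is the continuous extension of $\mathrm{id}\otimes\exp_E$, and $A\otimes\Lambda_E\subseteq\operatorname{Lie}_E(\mathbb{T})$. $\mathfrak{sf}(E)=\{\omega\in E(\mathbb{T}):(a\otimes1)\omega=(1\otimes a)\omega\ \forall a\in A\}$. An element $u\in A$ is separating if $K/\mathbb{F}(u)$ is finite separable. $\mathfrak{d}_{A/\mathbb{F}[u]}$ is the different of $\mathbb{F}[u]\subset A$ (inverse of $\{x\in K:\operatorname{tr}_{K/\mathbb{F}(u)}(xA)\subseteq\mathbb{F}[u]\}$), and $\mathfrak{d}_{A/\mathbb{F}[u]}\cdot\Lambda_E$ is the $A$-submodule of $\Lambda_E$ generated by $\partial a(\lambda)$, $a\in\mathfrak{d}_{A/\mathbb{F}[u]}$, $\lambda\in\Lambda_E$. In $A\otimes_{\mathbb{F}[u]}\Lambda_E$, $u$ acts on $\Lambda_E$ via $\partial u$; $a\otimes1$ acts on the left factor and $1\otimes a$ via $\partial a$. *)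

theory Defs
  imports
    "HOL-Analysis.Analysis"
    "HOL-Library.Multiset"
    "HOL-Computational_Algebra.Polynomial"
begin

section \<open>Subfields, algebraic and separable elements, trace\<close>

definition subring_of :: "'c::field set \<Rightarrow> bool" where
  "subring_of S \<longleftrightarrow> 0 \<in> S \<and> 1 \<in> S \<and>
     (\<forall>x\<in>S. \<forall>y\<in>S. x + y \<in> S \<and> x - y \<in> S \<and> x * y \<in> S)"

definition subfield_of :: "'c::field set \<Rightarrow> bool" where
  "subfield_of S \<longleftrightarrow> subring_of S \<and> (\<forall>x\<in>S. inverse x \<in> S)"

definition polys_over :: "'c::field set \<Rightarrow> 'c poly set" where
  "polys_over S = {p. \<forall>i. coeff p i \<in> S}"

definition algebraic_over :: "'c::field set \<Rightarrow> 'c \<Rightarrow> bool" where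
  "algebraic_over k x \<longleftrightarrow> (\<exists>p\<in>polys_over k. p \<noteq> 0 \<and> poly p x = 0)"

definition adjoin_ring :: "'c::field set \<Rightarrow> 'c \<Rightarrow> 'c set" where
  "adjoin_ring k x = (\<lambda>p. poly p x) ` polys_over k"

definition adjoin_field :: "'c::field set \<Rightarrow> 'c \<Rightarrow> 'c set" where
  "adjoin_field k x = subfield_of hull (insert x k)"

definition is_basis :: "'c::field set \<Rightarrow> 'c set \<Rightarrow> 'c set \<Rightarrow> bool" where
  "is_basis k K B \<longleftrightarrow> finite B \<and> B \<subseteq> K \<and>
     (\<forall>y\<in>K. \<exists>!c. c \<in> B \<rightarrow>\<^sub>E k \<and> y = (\<Sum>b\<in>B. c b * b))"

definition finite_extension :: "'c::field set \<Rightarrow> 'c set \<Rightarrow> bool" where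
  "finite_extension k K \<longleftrightarrow> k \<subseteq> K \<and> (\<exists>B. is_basis k K B)"

definition is_minpoly :: "'c::field set \<Rightarrow> 'c \<Rightarrow> 'c poly \<Rightarrow> bool" where
  "is_minpoly k x p \<longleftrightarrow> p \<in> polys_over k \<and> lead_coeff p = 1 \<and> poly p x = 0 \<and>
     (\<forall>r\<in>polys_over k. r \<noteq> 0 \<longrightarrow> poly r x = 0 \<longrightarrow> degree p \<le> degree r)"

text \<open>Below, the ambient field \<^typ>\<open>'c\<close> is algebraically closed, so that \<^const>\<open>rsquarefree\<close>
  (all roots in the ambient field are simple) is separability of a polynomial.\<close>

definition separable_over :: "'c::field set \<Rightarrow> 'c \<Rightarrow> bool" where
  "separable_over k x \<longleftrightarrow> (\<exists>p. is_minpoly k x p \<and> rsquarefree p)"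

definition finite_separable :: "'c::field set \<Rightarrow> 'c set \<Rightarrow> bool" where
  "finite_separable k K \<longleftrightarrow> finite_extension k K \<and> (\<forall>x\<in>K. separable_over k x)"

text \<open>The trace of multiplication by \<open>x\<close> on \<open>K\<close>, read off from its matrix in a \<open>k\<close>-basis of \<open>K\<close>.\<close>

definition field_trace :: "'c::field set \<Rightarrow> 'c set \<Rightarrow> 'c \<Rightarrow> 'c" where
  "field_trace k K x = (THE t. \<exists>B c. is_basis k K B \<and>
     (\<forall>b\<in>B. (\<forall>b'\<in>B. c b b' \<in> k) \<and> x * b = (\<Sum>b'\<in>B. c b b' * b')) \<and> t = (\<Sum>b\<in>B. c b b))"


section \<open>The curve, the point at infinity, and the field of definition\<close>

text \<open>A smooth projective geometrically irreducible curve over a finite field \<open>F\<close> is encoded by its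
  function field \<open>K\<close>: a finitely generated extension of transcendence degree one in which \<open>F\<close> is
  algebraically closed. Its closed points are the valuation rings of \<open>K\<close> over \<open>F\<close>
  (the local rings), and the regular functions on an open set are the intersection of the
  corresponding local rings. All fields are realised inside the carrier
  type \<^typ>\<open>'c\<close>, which plays the role of \<open>\<complex>\<^sub>\<infinity>\<close>.\<close>

record 'c curve_data =
  const_field :: "'c set"
  fun_field :: "'c set"
  infty_pt :: "'c set"
  absv :: "'c \<Rightarrow> real"

definition function_field :: "'c::field set \<Rightarrow> 'c set \<Rightarrow> bool" where
  "function_field F K \<longleftrightarrow> subfield_of F \<and> subfield_of K \<and> F \<subseteq> K \<and>
     (\<exists>x\<in>K. \<not> algebraic_over F x \<and> finite_extension (adjoin_field F x) K) \<and>
     (\<forall>x\<in>K. algebraic_over F x \<longrightarrow> x \<in> F)"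

definition closed_points :: "'c::field set \<Rightarrow> 'c set \<Rightarrow> 'c set set" where
  "closed_points F K =
     {R. subring_of R \<and> F \<subseteq> R \<and> R \<subset> K \<and> (\<forall>x\<in>K. x \<in> R \<or> inverse x \<in> R)}"

definition regular_functions :: "'c::field set \<Rightarrow> 'c set set \<Rightarrow> 'c set" where
  "regular_functions K U = {f\<in>K. \<forall>P\<in>U. f \<in> P}"

definition coord_ring :: "('c::field, 'z) curve_data_scheme \<Rightarrow> 'c set" where
  "coord_ring C = regular_functions (fun_field C)
     (closed_points (const_field C) (fun_field C) - {infty_pt C})"

definition absolute_value :: "('c::field \<Rightarrow> real) \<Rightarrow> bool" where
  "absolute_value N \<longleftrightarrow> (\<forall>x. N x \<ge> 0) \<and> (\<forall>x. N x = 0 \<longleftrightarrow> x = 0) \<and>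
     (\<forall>x y. N (x * y) = N x * N y) \<and> (\<forall>x y. N (x + y) \<le> max (N x) (N y))"

definition complete_wrt :: "('c::field \<Rightarrow> real) \<Rightarrow> bool" where
  "complete_wrt N \<longleftrightarrow> (\<forall>s :: nat \<Rightarrow> 'c.
     (\<forall>\<epsilon>>0. \<exists>n0. \<forall>m\<ge>n0. \<forall>n\<ge>n0. N (s m - s n) < \<epsilon>) \<longrightarrow>
     (\<exists>l. (\<lambda>n. N (s n - l)) \<longlonglongrightarrow> 0))"

text \<open>The type \<^typ>\<open>'c\<close> is a completion of an algebraic closure of \<open>K\<close>, for an absolute value
  whose restriction to \<open>K\<close> belongs to the place \<open>\<infinity>\<close> (this fixes it up to a positive power):
  the elements algebraic over \<open>K\<close> form an algebraically closed, dense subset.\<close>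

definition is_C_infty :: "('c::field, 'z) curve_data_scheme \<Rightarrow> bool" where
  "is_C_infty C \<longleftrightarrow>
     absolute_value (absv C) \<and> {x \<in> fun_field C. absv C x \<le> 1} = infty_pt C \<and>
     (let Kbar = {x. algebraic_over (fun_field C) x} in
        (\<forall>p\<in>polys_over Kbar. degree p > 0 \<longrightarrow> (\<exists>x\<in>Kbar. poly p x = 0)) \<and>
        (\<forall>x. \<forall>\<epsilon>>0. \<exists>y\<in>Kbar. absv C (x - y) < \<epsilon>)) \<and>
     complete_wrt (absv C)"

definition curve_setup :: "('c::field, 'z) curve_data_scheme \<Rightarrow> bool" where
  "curve_setup C \<longleftrightarrow>
     finite (const_field C) \<and> function_field (const_field C) (fun_field C) \<and>
     infty_pt C \<in> closed_points (const_field C) (fun_field C) \<and> is_C_infty C"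

abbreviation const_poly_ring :: "('c::field, 'z) curve_data_scheme \<Rightarrow> 'c \<Rightarrow> 'c set" where
  "const_poly_ring C u \<equiv> adjoin_ring (const_field C) u"

abbreviation const_rat_field :: "('c::field, 'z) curve_data_scheme \<Rightarrow> 'c \<Rightarrow> 'c set" where
  "const_rat_field C u \<equiv> adjoin_field (const_field C) u"

definition separating :: "('c::field, 'z) curve_data_scheme \<Rightarrow> 'c \<Rightarrow> bool" where
  "separating C u \<longleftrightarrow> finite_separable (const_rat_field C u) (fun_field C)"

definition codifferent :: "('c::field, 'z) curve_data_scheme \<Rightarrow> 'c \<Rightarrow> 'c set" where
  "codifferent C u = {x \<in> fun_field C. \<forall>a\<in>coord_ring C.
     field_trace (const_rat_field C u) (fun_field C) (x * a) \<in> const_poly_ring C u}"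

definition different :: "('c::field, 'z) curve_data_scheme \<Rightarrow> 'c \<Rightarrow> 'c set" where
  "different C u = {y \<in> fun_field C. \<forall>x\<in>codifferent C u. y * x \<in> coord_ring C}"


section \<open>Tensor products\<close>

definition quot_map :: "('b \<times> 'b) set \<Rightarrow> ('a \<Rightarrow> 'b) \<Rightarrow> 'a set \<Rightarrow> 'b set" where
  "quot_map r f X = (\<Union>x\<in>X. r `` {f x})"

definition quot_map2 :: "('c \<times> 'c) set \<Rightarrow> ('a \<Rightarrow> 'b \<Rightarrow> 'c) \<Rightarrow> 'a set \<Rightarrow> 'b set \<Rightarrow> 'c set" where
  "quot_map2 r f X Y = (\<Union>x\<in>X. \<Union>y\<in>Y. r `` {f x y})"

text \<open>The tensor product \<open>A \<otimes>\<^sub>R M\<close> of a commutative \<open>R\<close>-algebra \<open>A \<supseteq> R\<close> and an \<open>R\<close>-module \<open>M\<close>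
  (with scalar multiplication \<open>act\<close>). A multiset of pairs \<open>(a\<^sub>i, m\<^sub>i)\<close> is the formal
  sum \<open>\<Sum>\<^sub>i a\<^sub>i \<otimes> m\<^sub>i\<close>; formal sums are taken modulo the additive congruence generated by
  the bilinearity and balancing relations. The rule \<open>zero\<close> provides additive inverses.\<close>

inductive tensor_cong ::
  "'a::comm_ring_1 set \<Rightarrow> 'a set \<Rightarrow> ('a \<Rightarrow> 'm \<Rightarrow> 'm) \<Rightarrow> 'm::ab_group_add set \<Rightarrow>
   ('a \<times> 'm) multiset \<Rightarrow> ('a \<times> 'm) multiset \<Rightarrow> bool"
  for R A act M where
  refl: "set_mset x \<subseteq> A \<times> M \<Longrightarrow> tensor_cong R A act M x x"
| sym: "tensor_cong R A act M x y \<Longrightarrow> tensor_cong R A act M y x"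
| trans: "tensor_cong R A act M x y \<Longrightarrow> tensor_cong R A act M y z \<Longrightarrow> tensor_cong R A act M x z"
| add: "tensor_cong R A act M x y \<Longrightarrow> set_mset z \<subseteq> A \<times> M \<Longrightarrow>
    tensor_cong R A act M (x + z) (y + z)"
| zero: "m \<in> M \<Longrightarrow> tensor_cong R A act M {#(0, m)#} {#}"
| add_left: "a \<in> A \<Longrightarrow> a' \<in> A \<Longrightarrow> m \<in> M \<Longrightarrow>
    tensor_cong R A act M {#(a + a', m)#} {#(a, m), (a', m)#}"
| add_right: "a \<in> A \<Longrightarrow> m \<in> M \<Longrightarrow> m' \<in> M \<Longrightarrow>
    tensor_cong R A act M {#(a, m + m')#} {#(a, m), (a, m')#}"
| balance: "r \<in> R \<Longrightarrow> a \<in> A \<Longrightarrow> m \<in> M \<Longrightarrow>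
    tensor_cong R A act M {#(r * a, m)#} {#(a, act r m)#}"

definition tensor_rel ::
  "'a::comm_ring_1 set \<Rightarrow> 'a set \<Rightarrow> ('a \<Rightarrow> 'm \<Rightarrow> 'm) \<Rightarrow> 'm::ab_group_add set \<Rightarrow>
   (('a \<times> 'm) multiset \<times> ('a \<times> 'm) multiset) set" where
  "tensor_rel R A act M = {(x, y). tensor_cong R A act M x y}"

definition tensor ::
  "'a::comm_ring_1 set \<Rightarrow> 'a set \<Rightarrow> ('a \<Rightarrow> 'm \<Rightarrow> 'm) \<Rightarrow> 'm::ab_group_add set \<Rightarrow>
   ('a \<times> 'm) multiset set set" where
  "tensor R A act M = {x. set_mset x \<subseteq> A \<times> M} // tensor_rel R A act M"

definition fs_map_left :: "('a \<Rightarrow> 'a) \<Rightarrow> ('a \<times> 'm) multiset \<Rightarrow> ('a \<times> 'm) multiset" where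
  "fs_map_left f = image_mset (\<lambda>(a, m). (f a, m))"

definition fs_map_right :: "('m \<Rightarrow> 'n) \<Rightarrow> ('a \<times> 'm) multiset \<Rightarrow> ('a \<times> 'n) multiset" where
  "fs_map_right f = image_mset (\<lambda>(a, m). (a, f m))"

definition fs_diff ::
  "('a::comm_ring_1 \<times> 'm) multiset \<Rightarrow> ('a \<times> 'm) multiset \<Rightarrow> ('a \<times> 'm) multiset" where
  "fs_diff x y = x + fs_map_left uminus y"

text \<open>\<open>(\<Sum>\<^sub>i a\<^sub>i \<otimes> c\<^sub>i) \<cdot> (\<Sum>\<^sub>j b\<^sub>j \<otimes> v\<^sub>j) = \<Sum>\<^sub>i\<^sub>,\<^sub>j a\<^sub>i b\<^sub>j \<otimes> c\<^sub>i v\<^sub>j\<close>\<close>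

definition fs_scale :: "('a \<Rightarrow> 'm \<Rightarrow> 'm) \<Rightarrow>
    ('a::comm_ring_1 \<times> 'a) multiset \<Rightarrow> ('a \<times> 'm) multiset \<Rightarrow> ('a \<times> 'm) multiset" where
  "fs_scale act x y =
     (\<Sum>p\<in>#x. image_mset (\<lambda>q. (fst p * fst q, act (snd p) (snd q))) y)"

text \<open>The elements of a class \<open>X\<close> are exactly the representations \<open>\<Sum>\<^sub>i b\<^sub>i \<otimes> v\<^sub>i\<close> of the tensor.\<close>

definition tensor_norm :: "('m \<Rightarrow> real) \<Rightarrow> ('a \<times> 'm) multiset set \<Rightarrow> real" where
  "tensor_norm N X = (INF x\<in>X. Max (insert 0 ((\<lambda>(b, v). N v) ` set_mset x)))"

definition tensor_dist ::
  "(('a::comm_ring_1 \<times> 'm) multiset \<times> ('a \<times> 'm) multiset) set \<Rightarrow> ('m \<Rightarrow> real) \<Rightarrow>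
   ('a \<times> 'm) multiset set \<Rightarrow> ('a \<times> 'm) multiset set \<Rightarrow> real" where
  "tensor_dist r N X Y = tensor_norm N (quot_map2 r fs_diff X Y)"


section \<open>Completion\<close>

definition cauchy_seqs :: "'a set \<Rightarrow> ('a \<Rightarrow> 'a \<Rightarrow> real) \<Rightarrow> (nat \<Rightarrow> 'a) set" where
  "cauchy_seqs S d = {s. (\<forall>n. s n \<in> S) \<and>
     (\<forall>\<epsilon>>0. \<exists>n0. \<forall>m\<ge>n0. \<forall>n\<ge>n0. d (s m) (s n) < \<epsilon>)}"

definition null_rel :: "'a set \<Rightarrow> ('a \<Rightarrow> 'a \<Rightarrow> real) \<Rightarrow> ((nat \<Rightarrow> 'a) \<times> (nat \<Rightarrow> 'a)) set" where
  "null_rel S d = {(s, t). s \<in> cauchy_seqs S d \<and> t \<in> cauchy_seqs S d \<and>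
     (\<lambda>n. d (s n) (t n)) \<longlonglongrightarrow> 0}"

definition completion :: "'a set \<Rightarrow> ('a \<Rightarrow> 'a \<Rightarrow> real) \<Rightarrow> (nat \<Rightarrow> 'a) set set" where
  "completion S d = cauchy_seqs S d // null_rel S d"

text \<open>The completion of \<open>A \<otimes> V\<close> over the constant field, for a vector space \<open>V\<close>
  filling its type, with scalar multiplication \<open>act\<close> and norm \<open>N\<close>. Continuous extensions
  of maps are computed termwise on Cauchy sequences.\<close>

type_synonym ('c, 'v) ctens = "(nat \<Rightarrow> ('c \<times> 'v) multiset set) set"

definition ct_base :: "('c::field, 'z) curve_data_scheme \<Rightarrow> ('c \<Rightarrow> 'v \<Rightarrow> 'v) \<Rightarrow>
    (('c \<times> 'v::ab_group_add) multiset \<times> ('c \<times> 'v) multiset) set" where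
  "ct_base C act = tensor_rel (const_field C) (coord_ring C) act UNIV"

definition ct_rel :: "('c::field, 'z) curve_data_scheme \<Rightarrow> ('c \<Rightarrow> 'v \<Rightarrow> 'v) \<Rightarrow> ('v \<Rightarrow> real) \<Rightarrow>
    ((nat \<Rightarrow> ('c \<times> 'v::ab_group_add) multiset set) \<times> (nat \<Rightarrow> ('c \<times> 'v) multiset set)) set" where
  "ct_rel C act N = null_rel (tensor (const_field C) (coord_ring C) act UNIV)
     (tensor_dist (ct_base C act) N)"

definition ctensor :: "('c::field, 'z) curve_data_scheme \<Rightarrow> ('c \<Rightarrow> 'v \<Rightarrow> 'v) \<Rightarrow> ('v \<Rightarrow> real) \<Rightarrow>
    ('c, 'v::ab_group_add) ctens set" where
  "ctensor C act N = completion (tensor (const_field C) (coord_ring C) act UNIV)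
     (tensor_dist (ct_base C act) N)"

definition ct_map :: "('c::field, 'z) curve_data_scheme \<Rightarrow> ('c \<Rightarrow> 'v \<Rightarrow> 'v) \<Rightarrow> ('v \<Rightarrow> real) \<Rightarrow>
    (('c \<times> 'v) multiset \<Rightarrow> ('c \<times> 'v) multiset) \<Rightarrow>
    ('c, 'v::ab_group_add) ctens \<Rightarrow> ('c, 'v) ctens" where
  "ct_map C act N f = quot_map (ct_rel C act N) (\<lambda>s n. quot_map (ct_base C act) f (s n))"

definition ct_map2 :: "('c::field, 'z) curve_data_scheme \<Rightarrow> ('c \<Rightarrow> 'v \<Rightarrow> 'v) \<Rightarrow> ('v \<Rightarrow> real) \<Rightarrow>
    (('c \<times> 'w) multiset \<Rightarrow> ('c \<times> 'v) multiset \<Rightarrow> ('c \<times> 'v) multiset) \<Rightarrow>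
    ('c, 'w) ctens \<Rightarrow> ('c, 'v::ab_group_add) ctens \<Rightarrow> ('c, 'v) ctens" where
  "ct_map2 C act N f =
     quot_map2 (ct_rel C act N) (\<lambda>s t n. quot_map2 (ct_base C act) f (s n) (t n))"

definition tate_ring :: "('c::field, 'z) curve_data_scheme \<Rightarrow> ('c, 'c) ctens set" where
  "tate_ring C = ctensor C (*) (absv C)"


section \<open>Anderson modules\<close>

text \<open>In coordinates \<open>E \<cong> G\<^sub>a\<^sup>d\<close> (with \<open>d\<close> the cardinality of \<^typ>\<open>'d\<close>) the \<open>F\<close>-linear
  endomorphisms of \<open>E\<close> over \<open>L\<close> are the twisted polynomials \<open>\<Sum>\<^sub>n M\<^sub>n \<tau>\<^sup>n\<close> with \<open>M\<^sub>n \<in> Mat\<^sub>d(L)\<close>;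
  \<open>phi E a n\<close> is the coefficient of \<open>\<tau>\<^sup>n\<close> in \<open>\<phi>\<^sub>a\<close>. Both \<open>E(\<complex>\<^sub>\<infinity>)\<close> and \<open>Lie\<^sub>E(\<complex>\<^sub>\<infinity>)\<close>
  have underlying space \<^typ>\<open>'c ^ 'd\<close>, with the maximum norm.\<close>

record ('c, 'd) anderson_data = "'c curve_data" +
  base_field :: "'c set"
  phi :: "'c \<Rightarrow> nat \<Rightarrow> 'c ^ 'd ^ 'd"

definition frob_vec :: "nat \<Rightarrow> nat \<Rightarrow> 'c::field ^ 'd \<Rightarrow> 'c ^ 'd" where
  "frob_vec q n x = (\<chi> i. (x $ i) ^ (q ^ n))"

definition frob_mat :: "nat \<Rightarrow> nat \<Rightarrow> 'c::field ^ 'd ^ 'd \<Rightarrow> 'c ^ 'd ^ 'd" where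
  "frob_mat q n M = (\<chi> i j. (M $ i $ j) ^ (q ^ n))"

abbreviation card_const :: "('c, 'z) curve_data_scheme \<Rightarrow> nat" where
  "card_const C \<equiv> card (const_field C)"

definition lie_act :: "('c::field, 'd::finite) anderson_data \<Rightarrow> 'c \<Rightarrow> 'c ^ 'd \<Rightarrow> 'c ^ 'd" where
  "lie_act E a x = phi E a 0 *v x"

definition phi_act :: "('c::field, 'd::finite) anderson_data \<Rightarrow> 'c \<Rightarrow> 'c ^ 'd \<Rightarrow> 'c ^ 'd" where
  "phi_act E a x = (\<Sum>n | phi E a n \<noteq> 0. phi E a n *v frob_vec (card_const E) n x)"

definition anderson_module :: "('c::field, 'd::finite) anderson_data \<Rightarrow> bool" where
  "anderson_module E \<longleftrightarrow>
     curve_setup E \<and> subfield_of (base_field E) \<and> fun_field E \<subseteq> base_field E \<and>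
     (\<forall>a\<in>coord_ring E. finite {n. phi E a n \<noteq> 0} \<and>
        (\<forall>n i j. phi E a n $ i $ j \<in> base_field E)) \<and>
     (\<forall>c\<in>const_field E. \<forall>n. phi E c n = (if n = 0 then mat c else 0)) \<and>
     (\<forall>a\<in>coord_ring E. \<forall>b\<in>coord_ring E. \<forall>n.
        phi E (a + b) n = phi E a n + phi E b n \<and>
        phi E (a * b) n = (\<Sum>i\<le>n. phi E a i ** frob_mat (card_const E) i (phi E b (n - i)))) \<and>
     (\<forall>a\<in>coord_ring E. \<exists>m. \<forall>x. (\<forall>i. x $ i \<in> base_field E) \<longrightarrow>
        ((\<lambda>y. lie_act E a y - a *s y) ^^ m) x = 0)"

definition vnorm :: "('c, 'z) curve_data_scheme \<Rightarrow> 'c ^ 'd::finite \<Rightarrow> real" where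
  "vnorm C x = (MAX i. absv C (x $ i))"

definition is_exp :: "('c::field, 'd::finite) anderson_data \<Rightarrow> ('c ^ 'd \<Rightarrow> 'c ^ 'd) \<Rightarrow> bool" where
  "is_exp E f \<longleftrightarrow>
     (\<forall>x y. f (x + y) = f x + f y) \<and> (\<forall>c\<in>const_field E. \<forall>x. f (c *s x) = c *s f x) \<and>
     (\<exists>e :: nat \<Rightarrow> 'c ^ 'd ^ 'd. e 0 = mat 1 \<and>
        (\<forall>x. (\<lambda>m. vnorm E ((\<Sum>n<m. e n *v frob_vec (card_const E) n x) - f x)) \<longlonglongrightarrow> 0)) \<and>
     (\<forall>a\<in>coord_ring E. \<forall>x. f (lie_act E a x) = phi_act E a (f x))"

definition exp_E :: "('c::field, 'd::finite) anderson_data \<Rightarrow> 'c ^ 'd \<Rightarrow> 'c ^ 'd" where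
  "exp_E E = (THE f. is_exp E f)"

definition periods :: "('c::field, 'd::finite) anderson_data \<Rightarrow> ('c ^ 'd) set" where
  "periods E = {x. exp_E E x = 0}"

definition A_submodule :: "('c::field, 'd::finite) anderson_data \<Rightarrow> ('c ^ 'd) set \<Rightarrow> bool" where
  "A_submodule E S \<longleftrightarrow> 0 \<in> S \<and> (\<forall>x\<in>S. \<forall>y\<in>S. x + y \<in> S) \<and>
     (\<forall>a\<in>coord_ring E. \<forall>x\<in>S. lie_act E a x \<in> S)"

definition different_periods :: "('c::field, 'd::finite) anderson_data \<Rightarrow> 'c \<Rightarrow> ('c ^ 'd) set" where
  "different_periods E u =
     A_submodule E hull {lie_act E a l | a l. a \<in> different E u \<and> l \<in> periods E}"


section \<open>\<open>Lie\<^sub>E(T)\<close> and \<open>E(T)\<close>\<close>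

text \<open>In coordinates these have the same underlying additive group, the completion of \<open>A \<otimes> \<complex>\<^sub>\<infinity>\<^sup>d\<close>; they differ in
  the action of \<open>1 \<otimes> a\<close> (\<open>lieT_right\<close> versus \<open>ET_right\<close>).\<close>

definition LieT :: "('c::field, 'd::finite) anderson_data \<Rightarrow> ('c, 'c ^ 'd) ctens set" where
  "LieT E = ctensor E (*s) (vnorm E)"

definition ET :: "('c::field, 'd::finite) anderson_data \<Rightarrow> ('c, 'c ^ 'd) ctens set" where
  "ET E = ctensor E (*s) (vnorm E)"

definition ct_add :: "('c::field, 'd::finite) anderson_data \<Rightarrow>
    ('c, 'c ^ 'd) ctens \<Rightarrow> ('c, 'c ^ 'd) ctens \<Rightarrow> ('c, 'c ^ 'd) ctens" where
  "ct_add E = ct_map2 E (*s) (vnorm E) (+)"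

definition ct_diff :: "('c::field, 'd::finite) anderson_data \<Rightarrow>
    ('c, 'c ^ 'd) ctens \<Rightarrow> ('c, 'c ^ 'd) ctens \<Rightarrow> ('c, 'c ^ 'd) ctens" where
  "ct_diff E = ct_map2 E (*s) (vnorm E) fs_diff"

definition ct_left :: "('c::field, 'd::finite) anderson_data \<Rightarrow> 'c \<Rightarrow>
    ('c, 'c ^ 'd) ctens \<Rightarrow> ('c, 'c ^ 'd) ctens" where
  "ct_left E a = ct_map E (*s) (vnorm E) (fs_map_left ((*) a))"

definition lieT_right :: "('c::field, 'd::finite) anderson_data \<Rightarrow> 'c \<Rightarrow>
    ('c, 'c ^ 'd) ctens \<Rightarrow> ('c, 'c ^ 'd) ctens" where
  "lieT_right E a = ct_map E (*s) (vnorm E) (fs_map_right (lie_act E a))"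

definition ET_right :: "('c::field, 'd::finite) anderson_data \<Rightarrow> 'c \<Rightarrow>
    ('c, 'c ^ 'd) ctens \<Rightarrow> ('c, 'c ^ 'd) ctens" where
  "ET_right E a = ct_map E (*s) (vnorm E) (fs_map_right (phi_act E a))"

definition lieT_scale :: "('c::field, 'd::finite) anderson_data \<Rightarrow>
    ('c, 'c) ctens \<Rightarrow> ('c, 'c ^ 'd) ctens \<Rightarrow> ('c, 'c ^ 'd) ctens" where
  "lieT_scale E = ct_map2 E (*s) (vnorm E) (fs_scale (*s))"

definition T_linear_endo :: "('c::field, 'd::finite) anderson_data \<Rightarrow>
    (('c, 'c ^ 'd) ctens \<Rightarrow> ('c, 'c ^ 'd) ctens) \<Rightarrow> bool" where
  "T_linear_endo E f \<longleftrightarrow> f \<in> LieT E \<rightarrow> LieT E \<and>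
     (\<forall>X\<in>LieT E. \<forall>Y\<in>LieT E. f (ct_add E X Y) = ct_add E (f X) (f Y)) \<and>
     (\<forall>t\<in>tate_ring E. \<forall>X\<in>LieT E. f (lieT_scale E t X) = lieT_scale E t (f X))"

definition id_exp :: "('c::field, 'd::finite) anderson_data \<Rightarrow>
    ('c, 'c ^ 'd) ctens \<Rightarrow> ('c, 'c ^ 'd) ctens" where
  "id_exp E = ct_map E (*s) (vnorm E) (fs_map_right (exp_E E))"

text \<open>The endomorphism \<open>1 \<otimes> \<partial>u - u \<otimes> 1\<close>.\<close>

definition theta :: "('c::field, 'd::finite) anderson_data \<Rightarrow> 'c \<Rightarrow>
    ('c, 'c ^ 'd) ctens \<Rightarrow> ('c, 'c ^ 'd) ctens" where
  "theta E u X = ct_diff E (lieT_right E u X) (ct_left E u X)"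

definition special_functions :: "('c::field, 'd::finite) anderson_data \<Rightarrow> ('c, 'c ^ 'd) ctens set" where
  "special_functions E = {w \<in> ET E. \<forall>a\<in>coord_ring E. ct_left E a w = ET_right E a w}"


section \<open>\<open>A \<otimes> \<Lambda>\<^sub>E\<close> and \<open>A \<otimes>\<^bsub>F[u]\<^esub> \<Lambda>\<^sub>E\<close>\<close>

definition A_periods :: "('c::field, 'd::finite) anderson_data \<Rightarrow> ('c \<times> ('c ^ 'd)) multiset set set" where
  "A_periods E = tensor (const_field E) (coord_ring E) (*s) (periods E)"

text \<open>The inclusion \<open>A \<otimes> \<Lambda>\<^sub>E \<subseteq> A \<otimes> Lie\<^sub>E(\<complex>\<^sub>\<infinity>) \<subseteq> Lie\<^sub>E(T)\<close>, the latter by constant sequences.\<close>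

definition A_periods_incl :: "('c::field, 'd::finite) anderson_data \<Rightarrow>
    ('c \<times> ('c ^ 'd)) multiset set \<Rightarrow> ('c, 'c ^ 'd) ctens" where
  "A_periods_incl E X =
     ct_rel E (*s) (vnorm E) `` {\<lambda>n. quot_map (ct_base E (*s)) (\<lambda>x. x) X}"

definition Au_rel :: "('c::field, 'd::finite) anderson_data \<Rightarrow> 'c \<Rightarrow>
    (('c \<times> ('c ^ 'd)) multiset \<times> ('c \<times> ('c ^ 'd)) multiset) set" where
  "Au_rel E u = tensor_rel (const_poly_ring E u) (coord_ring E) (lie_act E) (periods E)"

definition Au_periods :: "('c::field, 'd::finite) anderson_data \<Rightarrow> 'c \<Rightarrow>
    ('c \<times> ('c ^ 'd)) multiset set set" where
  "Au_periods E u = tensor (const_poly_ring E u) (coord_ring E) (lie_act E) (periods E)"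

definition Au_add :: "('c::field, 'd::finite) anderson_data \<Rightarrow> 'c \<Rightarrow>
    ('c \<times> ('c ^ 'd)) multiset set \<Rightarrow> ('c \<times> ('c ^ 'd)) multiset set \<Rightarrow> ('c \<times> ('c ^ 'd)) multiset set" where
  "Au_add E u = quot_map2 (Au_rel E u) (+)"

definition Au_left :: "('c::field, 'd::finite) anderson_data \<Rightarrow> 'c \<Rightarrow>
    'c \<Rightarrow> ('c \<times> ('c ^ 'd)) multiset set \<Rightarrow> ('c \<times> ('c ^ 'd)) multiset set" where
  "Au_left E u a = quot_map (Au_rel E u) (fs_map_left ((*) a))"

definition Au_right :: "('c::field, 'd::finite) anderson_data \<Rightarrow> 'c \<Rightarrow>
    'c \<Rightarrow> ('c \<times> ('c ^ 'd)) multiset set \<Rightarrow> ('c \<times> ('c ^ 'd)) multiset set" where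
  "Au_right E u a = quot_map (Au_rel E u) (fs_map_right (lie_act E a))"

text \<open>The canonical surjection \<open>A \<otimes> \<Lambda>\<^sub>E \<rightarrow> A \<otimes>\<^bsub>F[u]\<^esub> \<Lambda>\<^sub>E\<close>.\<close>

definition Au_proj :: "('c::field, 'd::finite) anderson_data \<Rightarrow> 'c \<Rightarrow>
    ('c \<times> ('c ^ 'd)) multiset set \<Rightarrow> ('c \<times> ('c ^ 'd)) multiset set" where
  "Au_proj E u = quot_map (Au_rel E u) (\<lambda>x. x)"

definition Au_mult :: "('c::field, 'd::finite) anderson_data \<Rightarrow> 'c \<Rightarrow>
    ('c \<times> ('c ^ 'd)) multiset set \<Rightarrow> 'c ^ 'd" where
  "Au_mult E u X = the_elem ((\<lambda>x. \<Sum>(a, l)\<in>#x. lie_act E a l) ` X)"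

definition Au_diagonal :: "('c::field, 'd::finite) anderson_data \<Rightarrow> 'c \<Rightarrow>
    ('c \<times> ('c ^ 'd)) multiset set set" where
  "Au_diagonal E u = {X \<in> Au_periods E u. \<forall>a\<in>coord_ring E. Au_left E u a X = Au_right E u a X}"

end

theory Submission
  imports Defs "HOL-Computational_Algebra.Primes"
begin

text \<open>
  Write \<open>R = F[u]\<close>. Since \<open>A\<close> is the integral closure of \<open>R\<close> in the separable extension \<open>K\<close> of \<open>F(u)\<close>, it is free over
  \<open>R\<close> with a basis \<open>a\<^sub>i\<close> whose trace-dual basis \<open>c\<^sub>i\<close> lies in the codifferent. The products \<open>u\<^sup>n a\<^sub>i\<close> form an
  \<open>F\<close>-basis of \<open>A\<close>, which identifies the completion of \<open>A \<otimes> V\<close> with the space of null sequences in \<open>V\<close>; there \<open>u \<otimes> 1\<close> is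
  a shift. A \<open>p\<close>-power of \<open>\<partial>u\<close> is a scalar of absolute value \<open>> 1\<close>, so \<open>1 \<otimes> \<partial>u - u \<otimes> 1\<close> is inverted by a
  convergent geometric series, and the exponential series is obtained by solving a scalar recursion.

  A null sequence \<open>\<omega>\<close> with \<open>(u \<otimes> 1)\<omega> = (1 \<otimes> u)\<omega>\<close> satisfies \<open>\<omega>\<^sub>m = \<phi>\<^sub>u(\<omega>\<^sub>m\<^sub>+\<^sub>r)\<close>; its late terms are small, hence values of
  \<open>exp\<close>, hence so are all its terms. As periods are discrete, this identifies these \<open>\<omega>\<close> with \<open>A \<otimes>\<^bsub>R\<^esub> \<Lambda>\<close>.
  Finally, an element of \<open>A \<otimes>\<^bsub>R\<^esub> \<Lambda>\<close> is determined by the map \<open>c \<mapsto> \<Sum> tr(ca) l\<close> on the codifferent; on the diagonal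
  part this is \<open>c \<mapsto> c \<cdot> \<mu>\<close>, and the invertibility of the codifferent turns \<open>{\<mu>. c \<mu> \<in> \<Lambda> for all c}\<close> into the different times \<open>\<Lambda>\<close>.
\<close>

section \<open>Subrings, polynomials and valuation rings\<close>

text \<open>The norm on \<open>A \<otimes> V\<close> is an infimum over representations, and
  completed tensors are classes of Cauchy sequences. Both become explicit because nonzero constants
  have absolute value 1: every representation has an entry at least as large as each coordinate of
  the tensor in an \<open>F\<close>-basis of \<open>A\<close>, and the coordinates are themselves
  the entries of a representation. The inequality \<open>|u| > 1\<close> holds because otherwise
  \<open>u\<close> would lie in every valuation ring of \<open>K\<close> over \<open>F\<close> and
  so be algebraic over \<open>F\<close>. It also shows that a valuation ring containing
  \<open>F[u]\<close> is not the one at infinity, so that \<open>A\<close>, given as an intersection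
  of valuation rings, is integral over \<open>F[u]\<close>. Separability enters through an element
  of \<open>K \<otimes> K\<close> over \<open>F(u)\<close> on which left and right multiplication by
  \<open>K\<close> agree; it makes the trace form nondegenerate with explicit dual families. The
  different is defined only as the set of multipliers of the codifferent into \<open>A\<close>; that
  the two multiply to the unit ideal is a theorem of its own, needed to recover a vector
  \<open>v\<close> from its multiples \<open>c v\<close>.\<close>

lemma subring_of_simps:
  assumes "subring_of S"
  shows subring_of_0: "0 \<in> S" and subring_of_1: "1 \<in> S"
    and subring_of_add: "x \<in> S \<Longrightarrow> y \<in> S \<Longrightarrow> x + y \<in> S"
    and subring_of_diff: "x \<in> S \<Longrightarrow> y \<in> S \<Longrightarrow> x - y \<in> S"
    and subring_of_mult: "x \<in> S \<Longrightarrow> y \<in> S \<Longrightarrow> x * y \<in> S"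
  using assms unfolding subring_of_def by auto

lemma subring_of_uminus: "subring_of S \<Longrightarrow> x \<in> S \<Longrightarrow> - x \<in> S"
  using subring_of_diff[of S 0 x] subring_of_0[of S] by simp

lemma subring_of_power: "subring_of S \<Longrightarrow> x \<in> S \<Longrightarrow> x ^ n \<in> S"
  by (induction n) (auto intro: subring_of_1 subring_of_mult)

lemma subring_of_sum: "subring_of S \<Longrightarrow> (\<And>i. i \<in> I \<Longrightarrow> f i \<in> S) \<Longrightarrow> sum f I \<in> S"
  by (induction I rule: infinite_finite_induct) (auto intro: subring_of_0 subring_of_add)

lemma subfield_of_subring: "subfield_of S \<Longrightarrow> subring_of S"
  by (simp add: subfield_of_def)

lemma subfield_of_inverse: "subfield_of S \<Longrightarrow> x \<in> S \<Longrightarrow> inverse x \<in> S"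
  by (simp add: subfield_of_def)

lemma subfield_of_divide: "subfield_of S \<Longrightarrow> x \<in> S \<Longrightarrow> y \<in> S \<Longrightarrow> x / y \<in> S"
  by (simp add: divide_inverse subfield_of_inverse subfield_of_subring subring_of_mult)

lemmas subring_rules = subring_of_0 subring_of_1 subring_of_add subring_of_diff subring_of_mult
  subring_of_uminus subring_of_power subring_of_sum

lemma polys_over_add: "subring_of S \<Longrightarrow> p \<in> polys_over S \<Longrightarrow> q \<in> polys_over S \<Longrightarrow> p + q \<in> polys_over S"
  by (simp add: polys_over_def subring_of_add)

lemma polys_over_diff: "subring_of S \<Longrightarrow> p \<in> polys_over S \<Longrightarrow> q \<in> polys_over S \<Longrightarrow> p - q \<in> polys_over S"
  by (simp add: polys_over_def subring_of_diff)

lemma polys_over_mult: "subring_of S \<Longrightarrow> p \<in> polys_over S \<Longrightarrow> q \<in> polys_over S \<Longrightarrow> p * q \<in> polys_over S"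
  by (auto simp: polys_over_def coeff_mult intro!: subring_of_sum subring_of_mult)

lemma polys_over_monom: "subring_of S \<Longrightarrow> c \<in> S \<Longrightarrow> monom c n \<in> polys_over S"
  by (auto simp: polys_over_def subring_of_0)

lemma polys_over_0: "subring_of S \<Longrightarrow> 0 \<in> polys_over S"
  by (auto simp: polys_over_def subring_of_0)

lemma polys_over_1: "subring_of S \<Longrightarrow> 1 \<in> polys_over S"
  by (auto simp: polys_over_def coeff_1 subring_of_0 subring_of_1)

lemma polys_over_smult: "subring_of S \<Longrightarrow> c \<in> S \<Longrightarrow> p \<in> polys_over S \<Longrightarrow> smult c p \<in> polys_over S"
  by (auto simp: polys_over_def subring_of_mult)

lemma polys_over_pCons: "c \<in> S \<Longrightarrow> p \<in> polys_over S \<Longrightarrow> pCons c p \<in> polys_over S"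
  by (auto simp: polys_over_def coeff_pCons split: nat.splits)

lemma polys_over_reflect: "subring_of S \<Longrightarrow> p \<in> polys_over S \<Longrightarrow> reflect_poly p \<in> polys_over S"
  by (auto simp: polys_over_def coeff_reflect_poly subring_of_0)

lemma polys_over_mono: "S \<subseteq> T \<Longrightarrow> polys_over S \<subseteq> polys_over T"
  by (auto simp: polys_over_def)

lemma polys_over_coeff: "p \<in> polys_over S \<Longrightarrow> coeff p i \<in> S"
  by (simp add: polys_over_def)

lemmas polys_over_rules = polys_over_add polys_over_diff polys_over_mult polys_over_monom
  polys_over_0 polys_over_1 polys_over_smult polys_over_pCons polys_over_reflect

lemma poly_in_subring: "subring_of S \<Longrightarrow> p \<in> polys_over S \<Longrightarrow> x \<in> S \<Longrightarrow> poly p x \<in> S"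
  unfolding poly_altdef by (intro subring_rules) (auto simp: polys_over_coeff)

text \<open>Cancelling leading terms stays inside \<open>S\<close> as soon as the leading
  coefficient of \<open>g\<close> is a unit of \<open>S\<close>; this covers division over a field
  and division by a monic polynomial over a ring.\<close>

lemma poly_division_over:
  fixes f g :: "'c::field poly"
  assumes S: "subring_of S" and g: "g \<in> polys_over S" "g \<noteq> 0" "inverse (lead_coeff g) \<in> S"
    and f: "f \<in> polys_over S"
  shows "\<exists>h\<in>polys_over S. \<exists>r\<in>polys_over S. f = g * h + r \<and> (r = 0 \<or> degree r < degree g)"
proof -
  have "\<forall>f\<in>polys_over S. f = 0 \<or> degree f < n \<longrightarrow>
    (\<exists>h\<in>polys_over S. \<exists>r\<in>polys_over S. f = g * h + r \<and> (r = 0 \<or> degree r < degree g))" for n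
  proof (induction n)
    case 0
    show ?case using polys_over_0[OF S] by force
  next
    case (Suc n)
    show ?case
    proof (intro ballI impI)
      fix f assume f: "f \<in> polys_over S" "f = 0 \<or> degree f < Suc n"
      show "\<exists>h\<in>polys_over S. \<exists>r\<in>polys_over S. f = g * h + r \<and> (r = 0 \<or> degree r < degree g)"
      proof (cases "f = 0 \<or> degree f < degree g")
        case True
        then show ?thesis using f polys_over_0[OF S] by force
      next
        case False
        define m where "m = monom (lead_coeff f * inverse (lead_coeff g)) (degree f - degree g)"
        have m: "m \<in> polys_over S" unfolding m_def
          by (intro polys_over_rules S subring_rules) (auto simp: polys_over_coeff f g)
        have "m \<noteq> 0" using False g by (simp add: m_def)
        have dm: "degree (m * g) = degree f"
          using False g \<open>m \<noteq> 0\<close> by (simp add: degree_mult_eq m_def degree_monom_eq)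
        have lm: "lead_coeff (m * g) = lead_coeff f"
          using False g by (simp add: lead_coeff_mult m_def degree_monom_eq)
        define f' where "f' = f - m * g"
        have f': "f' \<in> polys_over S" unfolding f'_def by (intro polys_over_rules S f m g)
        have "f' = 0 \<or> degree f' < n"
        proof (cases "degree f = 0")
          case True
          then have "degree f' \<le> 0" using dm degree_diff_le[of f 0 "m*g"] by (simp add: f'_def)
          moreover have "coeff f' 0 = 0" using lm dm True by (simp add: f'_def)
          ultimately show ?thesis by (metis leading_coeff_0_iff le_zero_eq)
        next
          case False
          have "degree f' \<le> degree f" using dm degree_diff_le[of f "degree f" "m*g"] by (simp add: f'_def)
          moreover have "coeff f' (degree f) = 0" using lm dm by (simp add: f'_def)
          ultimately have "f' = 0 \<or> degree f' < degree f"
            by (metis le_neq_implies_less leading_coeff_0_iff)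
          then show ?thesis using f \<open>\<not> (f = 0 \<or> degree f < degree g)\<close> by auto
        qed
        then obtain h r where hr: "h \<in> polys_over S" "r \<in> polys_over S" "f' = g * h + r"
          "r = 0 \<or> degree r < degree g" using Suc.IH f' by blast
        have "f = g * (h + m) + r" using hr(3) by (simp add: f'_def algebra_simps)
        moreover have "h + m \<in> polys_over S" by (intro polys_over_rules S hr m)
        ultimately show ?thesis using hr by blast
      qed
    qed
  qed
  then show ?thesis using f by blast
qed

lemma adjoin_ring_subring:
  assumes S: "subring_of S" shows "subring_of (adjoin_ring S x)"
  unfolding subring_of_def adjoin_ring_def
proof (intro conjI ballI)
  show "0 \<in> (\<lambda>p. poly p x) ` polys_over S" using polys_over_0[OF S] by force
  show "1 \<in> (\<lambda>p. poly p x) ` polys_over S" using polys_over_1[OF S] by force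
  fix y z assume "y \<in> (\<lambda>p. poly p x) ` polys_over S" "z \<in> (\<lambda>p. poly p x) ` polys_over S"
  then obtain p q where "p \<in> polys_over S" "y = poly p x" "q \<in> polys_over S" "z = poly q x" by auto
  then show "y + z \<in> (\<lambda>p. poly p x) ` polys_over S" "y - z \<in> (\<lambda>p. poly p x) ` polys_over S"
    "y * z \<in> (\<lambda>p. poly p x) ` polys_over S"
    using polys_over_add[OF S, of p q] polys_over_diff[OF S, of p q] polys_over_mult[OF S, of p q]
    by (metis imageI poly_add, metis imageI poly_diff, metis imageI poly_mult)
qed

lemma adjoin_ring_base: "subring_of S \<Longrightarrow> S \<subseteq> adjoin_ring S x"
proof
  fix c assume "subring_of S" "c \<in> S"
  then have "[:c:] \<in> polys_over S" by (intro polys_over_rules)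
  then show "c \<in> adjoin_ring S x" by (auto simp: adjoin_ring_def intro!: image_eqI[of _ _ "[:c:]"])
qed

lemma adjoin_ring_gen: "subring_of S \<Longrightarrow> x \<in> adjoin_ring S x"
proof -
  assume S: "subring_of S"
  then have "[:0, 1:] \<in> polys_over S" by (intro polys_over_rules subring_rules)
  then show "x \<in> adjoin_ring S x" by (auto simp: adjoin_ring_def intro!: image_eqI[of _ _ "[:0,1:]"])
qed

lemma adjoin_ring_least: "subring_of T \<Longrightarrow> S \<subseteq> T \<Longrightarrow> x \<in> T \<Longrightarrow> adjoin_ring S x \<subseteq> T"
  unfolding adjoin_ring_def using poly_in_subring[of T _ x] polys_over_mono[of S T] by auto

definition integral_over :: "'c::field set \<Rightarrow> 'c \<Rightarrow> bool" where
  "integral_over S x \<longleftrightarrow> (\<exists>p\<in>polys_over S. lead_coeff p = 1 \<and> poly p x = 0)"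

text \<open>Chevalley's extension theorem: a subring maximal among those containing \<open>1/f\<close> but
  not \<open>f\<close> is a valuation ring.\<close>

lemma exists_valuation_ring:
  assumes K: "subfield_of K" and R0: "subring_of R0" "R0 \<subseteq> K" and fK: "f \<in> K"
    and nint: "\<not> integral_over R0 f"
  shows "\<exists>P. subring_of P \<and> R0 \<subseteq> P \<and> P \<subseteq> K \<and> f \<notin> P \<and> (\<forall>x\<in>K. x \<in> P \<or> inverse x \<in> P)"
proof -
  note Kr = subfield_of_subring[OF K]
  have f0: "f \<noteq> 0"
  proof
    assume "f = 0"
    have "monom 1 1 \<in> polys_over R0" by (intro polys_over_rules R0 subring_rules)
    then have "integral_over R0 f" unfolding integral_over_def \<open>f = 0\<close>
      by (intro bexI[of _ "monom 1 1"]) (auto simp: poly_monom degree_monom_eq)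
    then show False using nint by simp
  qed
  define g where "g = inverse f"
  have fg: "f * g = 1" "g * f = 1" using f0 by (auto simp: g_def)
  define \<A> where "\<A> = {P. subring_of P \<and> R0 \<subseteq> P \<and> P \<subseteq> K \<and> g \<in> P \<and> f \<notin> P}"
  have "adjoin_ring R0 g \<in> \<A>"
  proof -
    have "f \<notin> adjoin_ring R0 g"
    proof
      \<comment> \<open>If \<open>f = p(1/f)\<close>, multiplying by \<open>f^n\<close> gives a
        monic equation for \<open>f\<close> over \<open>R0\<close>: the term \<open>f^(n+1)\<close>
        dominates the reflected polynomial, whose degree is at most \<open>n\<close>.\<close>
      assume "f \<in> adjoin_ring R0 g"
      then obtain p where p: "p \<in> polys_over R0" "poly p g = f" by (auto simp: adjoin_ring_def)
      define n where "n = degree p"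
      have "poly (reflect_poly p) f = f ^ n * f"
        using poly_reflect_poly_nz[OF f0, of p] p by (simp add: n_def g_def)
      moreover have "degree (reflect_poly p) < Suc n"
        using degree_reflect_poly_le[of p] by (simp add: n_def)
      ultimately have "lead_coeff (monom 1 (Suc n) - reflect_poly p) = 1"
          "poly (monom 1 (Suc n) - reflect_poly p) f = 0"
        by (auto simp: poly_monom coeff_eq_0 degree_monom_eq degree_diff_less mult.commute
            lead_coeff_monom intro!: degree_diff_less
            simp: degree_add_eq_left[of "- reflect_poly p" "monom 1 (Suc n)", simplified])
      moreover have "monom 1 (Suc n) - reflect_poly p \<in> polys_over R0"
        by (intro polys_over_rules R0 subring_rules p)
      ultimately show False using nint by (auto simp: integral_over_def)
    qed
    moreover have "g \<in> K" using fK K by (simp add: g_def subfield_of_inverse)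
    ultimately show ?thesis unfolding \<A>_def
      using adjoin_ring_subring[OF R0(1)] adjoin_ring_base[OF R0(1)] adjoin_ring_gen[OF R0(1)]
        adjoin_ring_least[OF Kr R0(2)] by auto
  qed
  then have "\<A> \<noteq> {}" by auto
  then have "\<exists>P\<in>\<A>. \<forall>X\<in>\<A>. P \<subseteq> X \<longrightarrow> X = P"
  proof (rule subset_Zorn_nonempty)
    fix C assume C: "C \<noteq> {}" "subset.chain \<A> C"
    have ch: "X \<subseteq> Y \<or> Y \<subseteq> X" if "X \<in> C" "Y \<in> C" for X Y
      using C(2) that by (auto simp: subset.chain_def)
    have CA: "X \<in> \<A>" if "X \<in> C" for X using C(2) that by (auto simp: subset.chain_def)
    have "subring_of (\<Union>C)" unfolding subring_of_def
    proof (intro conjI ballI)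
      show "0 \<in> \<Union>C" "1 \<in> \<Union>C" using C(1) CA by (auto simp: \<A>_def intro: subring_of_0 subring_of_1)
      fix x y assume "x \<in> \<Union>C" "y \<in> \<Union>C"
      then obtain X Y where "X \<in> C" "Y \<in> C" "x \<in> X" "y \<in> Y" by auto
      then obtain Z where Z: "Z \<in> C" "x \<in> Z" "y \<in> Z" using ch by blast
      then have "subring_of Z" using CA by (auto simp: \<A>_def)
      with Z show "x + y \<in> \<Union>C" "x - y \<in> \<Union>C" "x * y \<in> \<Union>C"
        by (auto intro: subring_of_add subring_of_diff subring_of_mult)
    qed
    then show "\<Union>C \<in> \<A>" using C(1) CA by (fastforce simp: \<A>_def)
  qed
  then obtain P where P: "P \<in> \<A>" and Pmax: "\<And>X. X \<in> \<A> \<Longrightarrow> P \<subseteq> X \<Longrightarrow> X = P" by blast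
  have Pr: "subring_of P" and "R0 \<subseteq> P" "P \<subseteq> K" "g \<in> P" "f \<notin> P" using P by (auto simp: \<A>_def)
  have ex: "\<exists>p\<in>polys_over P. poly p y = f" if "y \<in> K" "y \<notin> P" for y
  proof (rule ccontr)
    assume "\<not> ?thesis"
    then have "f \<notin> adjoin_ring P y" by (auto simp: adjoin_ring_def)
    then have "adjoin_ring P y \<in> \<A>" unfolding \<A>_def
      using adjoin_ring_subring[OF Pr] adjoin_ring_base[OF Pr, of y] \<open>R0 \<subseteq> P\<close> \<open>g \<in> P\<close>
        adjoin_ring_least[OF Kr \<open>P \<subseteq> K\<close> that(1)] by auto
    then have "adjoin_ring P y = P" using Pmax adjoin_ring_base[OF Pr, of y] by auto
    then show False using adjoin_ring_gen[OF Pr, of y] that by auto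
  qed
  \<comment> \<open>\<open>g\<close> lies in every maximal ideal of \<open>P\<close>: if
    \<open>w = 1 - g s\<close> had no inverse in \<open>P\<close>, maximality would express
    \<open>f\<close> as a polynomial in \<open>1/w\<close>; clearing denominators puts
    \<open>w^n f\<close> in \<open>P\<close>, and since \<open>w^n\<close> is 1 modulo
    \<open>g\<close> while \<open>g f = 1\<close>, also \<open>f\<close> would be in
    \<open>P\<close>.\<close>
  have unit: "1 - g * s \<noteq> 0 \<and> inverse (1 - g * s) \<in> P" if s: "s \<in> P" for s
  proof -
    define w where "w = 1 - g * s"
    have "w \<noteq> 0"
    proof
      assume "w = 0"
      then have "f * (g * s) = f" by (simp add: w_def)
      then have "s = f" using fg by (simp add: mult.assoc[symmetric])
      then show False using s \<open>f \<notin> P\<close> by simp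
    qed
    have wP: "w \<in> P" unfolding w_def by (intro subring_rules Pr \<open>g \<in> P\<close> s)
    have "inverse w \<in> P"
    proof (rule ccontr)
      assume "inverse w \<notin> P"
      moreover have "inverse w \<in> K" using wP \<open>P \<subseteq> K\<close> K by (auto intro: subfield_of_inverse)
      ultimately obtain p where p: "p \<in> polys_over P" "poly p (inverse w) = f" using ex by blast
      have "w ^ degree p * f \<in> P"
        using poly_reflect_poly_nz[OF \<open>w \<noteq> 0\<close>, of p] p poly_in_subring[OF Pr polys_over_reflect[OF Pr p(1)] wP]
        by simp
      moreover have "\<exists>b\<in>P. w ^ n = 1 - g * b" for n
      proof (induction n)
        case 0 then show ?case using subring_of_0[OF Pr] by force
      next
        case (Suc n)
        then obtain b where "b \<in> P" "w ^ n = 1 - g * b" by auto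
        then have "w ^ Suc n = w * (1 - g * b)" by simp
        then have "w ^ Suc n = 1 - g * (s + b - s * g * b)" by (simp add: w_def algebra_simps)
        moreover have "s + b - s * g * b \<in> P" by (intro subring_rules Pr s \<open>b \<in> P\<close> \<open>g \<in> P\<close>)
        ultimately show ?case by blast
      qed
      then obtain b where "b \<in> P" "w ^ degree p = 1 - g * b" by blast
      moreover have "(1 - g * b) * f + b = f" using fg by (simp add: algebra_simps)
      ultimately have "f \<in> P" using subring_of_add[OF Pr] by metis
      then show False using \<open>f \<notin> P\<close> by simp
    qed
    then show ?thesis using \<open>w \<noteq> 0\<close> by (simp add: w_def)
  qed
  \<comment> \<open>The constant coefficient \<open>s\<close> of \<open>q\<close> turns
    \<open>f = q(1/x)\<close> into \<open>x^m (1 - g s) = g Q(x)\<close> with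
    \<open>deg Q < m\<close>. As \<open>1 - g s\<close> is a unit, \<open>x^m\<close> is a
    combination of lower powers, which removes the leading term of \<open>p\<close>.\<close>
  have red: "\<exists>p'\<in>polys_over P. poly p' x = f \<and> degree p' < degree p"
    if "p \<in> polys_over P" "q \<in> polys_over P" "poly p x = f" "poly q (inverse x) = f" "x \<noteq> 0"
      "degree q \<le> degree p" for p q x
  proof -
    define m where "m = degree q"
    define n where "n = degree p"
    define s where "s = coeff q 0"
    have sP: "s \<in> P" using that by (simp add: s_def polys_over_coeff)
    have m0: "m > 0"
    proof (rule ccontr)
      assume "\<not> m > 0"
      then obtain c where "q = [:c:]" by (metis m_def degree_eq_zeroE gr0I)
      then have "f = s" using that by (simp add: s_def)
      then show False using sP \<open>f \<notin> P\<close> by simp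
    qed
    define e where "e = inverse (1 - g * s)"
    have e: "e \<in> P" "e * (1 - g * s) = 1" using unit[OF sP] by (auto simp: e_def)
    define Q where "Q = reflect_poly q - monom s m"
    have QP: "Q \<in> polys_over P" unfolding Q_def by (intro polys_over_rules Pr that sP)
    have dQ: "degree Q < m"
    proof -
      have "degree Q \<le> m" unfolding Q_def
        using degree_reflect_poly_le[of q] degree_monom_le[of s m] by (intro degree_diff_le) (auto simp: m_def)
      moreover have "coeff Q m = 0" by (simp add: Q_def coeff_reflect_poly m_def s_def)
      ultimately show ?thesis using m0
        by (metis degree_0 le_neq_implies_less leading_coeff_0_iff)
    qed
    have Qx: "poly Q x = x ^ m * f - s * x ^ m"
      using poly_reflect_poly_nz[OF \<open>x \<noteq> 0\<close>, of q] that by (simp add: Q_def poly_monom m_def)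
    have "g * poly Q x = x ^ m * (g * f) - g * s * x ^ m" unfolding Qx by (simp add: algebra_simps)
    then have "g * poly Q x = x ^ m * (1 - g * s)" unfolding fg by (simp add: algebra_simps)
    then have xm: "e * g * poly Q x = x ^ m" using e(2) by (simp add: mult.assoc mult.left_commute)
    define l where "l = coeff p n"
    have lP: "l \<in> P" using that by (simp add: l_def polys_over_coeff)
    define p' where "p' = p - monom l n + monom (l * e * g) (n - m) * Q"
    have "p' \<in> polys_over P" unfolding p'_def
      by (intro polys_over_rules Pr that subring_rules QP lP e \<open>g \<in> P\<close>)
    moreover have "poly p' x = f"
    proof -
      have "poly p' x = f - l * x ^ n + l * x ^ (n - m) * (e * g * poly Q x)"
        using that by (simp add: p'_def poly_monom algebra_simps)
      also have "\<dots> = f" using xm that by (simp add: mult.assoc power_add[symmetric] m_def n_def)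
      finally show ?thesis .
    qed
    moreover have "degree p' < n"
    proof -
      have n0: "n > 0" using m0 that by (simp add: m_def n_def)
      have "degree (p - monom l n) \<le> n"
        using degree_monom_le[of l n] by (intro degree_diff_le) (auto simp: n_def)
      moreover have "coeff (p - monom l n) n = 0" by (simp add: l_def)
      ultimately have 1: "degree (p - monom l n) < n" using n0
        by (metis degree_0 le_neq_implies_less leading_coeff_0_iff)
      have "degree (monom (l * e * g) (n - m) * Q) \<le> (n - m) + degree Q"
        using degree_mult_le[of "monom (l * e * g) (n - m)" Q] degree_monom_le[of "l*e*g" "n-m"] by linarith
      then have 2: "degree (monom (l * e * g) (n - m) * Q) < n" using dQ that m0 by (simp add: m_def n_def)
      show ?thesis unfolding p'_def using 1 2 by (rule degree_add_less)
    qed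
    ultimately show ?thesis by (auto simp: n_def)
  qed
  have "x \<in> P \<or> inverse x \<in> P" if "x \<in> K" for x
  proof (rule ccontr)
    assume neg: "\<not> ?thesis"
    then have x0: "x \<noteq> 0" using subring_of_0[OF Pr] by auto
    \<comment> \<open>Descent on the sum of the degrees: of the two expressions of \<open>f\<close>,
      in \<open>x\<close> and in \<open>1/x\<close>, the one of larger degree can be
      shortened.\<close>
    have False if "p \<in> polys_over P" "q \<in> polys_over P" "poly p x = f" "poly q (inverse x) = f" for p q
      using that
    proof (induction "degree p + degree q" arbitrary: p q rule: less_induct)
      case less
      show False
      proof (cases "degree q \<le> degree p")
        case True
        then obtain p' where "p' \<in> polys_over P" "poly p' x = f" "degree p' < degree p"
          using red[of p q x] less.prems x0 by blast
        then show False using less.hyps[of p' q] less.prems by auto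
      next
        case False
        then obtain q' where "q' \<in> polys_over P" "poly q' (inverse x) = f" "degree q' < degree q"
          using red[of q p "inverse x"] less.prems x0 by auto
        then show False using less.hyps[of p q'] less.prems by auto
      qed
    qed
    then show False using ex[of x] ex[of "inverse x"] neg that subfield_of_inverse[OF K] by blast
  qed
  then show ?thesis using Pr \<open>R0 \<subseteq> P\<close> \<open>P \<subseteq> K\<close> \<open>f \<notin> P\<close> by blast
qed

text \<open>Valuation rings are integrally closed: multiplying the equation by \<open>l^n\<close>,
  with \<open>l\<close> the leading coefficient and \<open>n + 1\<close> the degree, makes it monic
  in \<open>y = l b\<close>; were \<open>y\<close> outside \<open>P\<close>, dividing by
  \<open>y^n\<close> would write \<open>y\<close> as a polynomial in \<open>1/y\<close>, hence as an
  element of \<open>P\<close>.\<close>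

lemma valuation_ring_lead_coeff_mult:
  assumes P: "subring_of P" and val: "\<forall>x\<in>K. x \<in> P \<or> inverse x \<in> P" and K: "subring_of K" "P \<subseteq> K"
    and p: "p \<in> polys_over P" "p \<noteq> 0" "poly p b = 0" and b: "b \<in> K"
  shows "lead_coeff p * b \<in> P"
proof (rule ccontr)
  define l where "l = lead_coeff p"
  define y where "y = l * b"
  define z where "z = inverse y"
  assume "lead_coeff p * b \<notin> P"
  then have yP: "y \<notin> P" by (simp add: y_def l_def)
  have lP: "l \<in> P" using p by (simp add: l_def polys_over_coeff)
  have "y \<in> K" unfolding y_def using lP K b by (auto intro: subring_rules)
  then have zP: "z \<in> P" using val yP by (auto simp: z_def)
  have y0: "y \<noteq> 0" using yP subring_of_0[OF P] by auto
  obtain n where n: "degree p = Suc n"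
    using p by (cases "degree p") (auto elim!: degree_eq_zeroE)
  have "0 = l ^ n * poly p b" using p by simp
  also have "\<dots> = (\<Sum>i\<le>n. coeff p i * (l ^ n * b ^ i)) + l ^ n * (l * b ^ Suc n)"
    by (simp add: poly_altdef n sum_distrib_left l_def mult_ac distrib_left)
  also have "l ^ n * (l * b ^ Suc n) = y ^ Suc n" by (simp add: y_def power_mult_distrib mult_ac)
  also have "(\<Sum>i\<le>n. coeff p i * (l ^ n * b ^ i)) = (\<Sum>i\<le>n. coeff p i * (l ^ (n - i) * y ^ i))"
    by (intro sum.cong HOL.refl) (auto simp: y_def power_mult_distrib power_add[symmetric] mult.assoc[symmetric])
  finally have "y ^ Suc n = - (\<Sum>i\<le>n. coeff p i * (l ^ (n - i) * y ^ i))"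
    by (metis add.commute add.right_inverse add_left_cancel)
  then have "z ^ n * y ^ Suc n = - (\<Sum>i\<le>n. coeff p i * (l ^ (n - i) * (y ^ i * z ^ n)))"
    by (simp add: sum_distrib_left mult_ac)
  also have "\<dots> = - (\<Sum>i\<le>n. coeff p i * (l ^ (n - i) * z ^ (n - i)))"
  proof (rule arg_cong[of _ _ uminus], rule sum.cong[OF HOL.refl])
    fix i assume "i \<in> {..n}"
    then have "z ^ n = z ^ i * z ^ (n - i)" by (simp add: power_add[symmetric])
    then show "coeff p i * (l ^ (n - i) * (y ^ i * z ^ n)) = coeff p i * (l ^ (n - i) * z ^ (n - i))"
      using y0 by (simp add: z_def mult.assoc[symmetric] power_mult_distrib[symmetric])
  qed
  also have "\<dots> \<in> P"
    by (intro subring_rules P lP zP) (use p in \<open>auto simp: polys_over_coeff\<close>)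
  also have "z ^ n * y ^ Suc n = y" using y0 by (simp add: z_def power_inverse)
  finally show False using yP by simp
qed

section \<open>The maximal ideal of a valuation ring and the Gauss lemma\<close>

context
  fixes P K :: "'c::field set"
  assumes P: "subring_of P" and val: "\<forall>x\<in>K. x \<in> P \<or> inverse x \<in> P" and K: "subfield_of K" "P \<subseteq> K"
begin

text \<open>This is the maximal ideal of \<open>P\<close>; its closure under addition is the point
  where comparability of \<open>x/y\<close> and \<open>y/x\<close> enters.\<close>

definition "nonunits = {x \<in> P. x = 0 \<or> inverse x \<notin> P}"

lemma nonunits_mult: assumes a: "a \<in> P" and x: "x \<in> nonunits" shows "a * x \<in> nonunits"
proof -
  have "inverse x \<in> P" if "inverse (a * x) \<in> P" "a * x \<noteq> 0"
  proof -
    have "a * inverse (a * x) \<in> P" by (intro subring_rules P a that)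
    then show ?thesis using that by (simp add: field_simps)
  qed
  then show ?thesis using a x subring_of_mult[OF P] by (auto simp: nonunits_def)
qed

lemma nonunits_add: assumes "x \<in> nonunits" "y \<in> nonunits" shows "x + y \<in> nonunits"
proof (cases "x = 0 \<or> y = 0")
  case False
  then have xy: "x \<noteq> 0" "y \<noteq> 0" by auto
  have "x \<in> K" "y \<in> K" using assms K by (auto simp: nonunits_def)
  then have "x / y \<in> P \<or> inverse (x / y) \<in> P" using val subfield_of_divide[OF K(1)] by blast
  then consider "x / y \<in> P" | "y / x \<in> P" by (auto simp: inverse_eq_divide)
  then show ?thesis
  proof cases
    case 1
    then have "(x / y + 1) * y \<in> nonunits" by (intro nonunits_mult subring_rules P assms)
    then show ?thesis using xy by (simp add: distrib_right add.commute)
  next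
    case 2
    then have "(y / x + 1) * x \<in> nonunits" by (intro nonunits_mult subring_rules P assms)
    then show ?thesis using xy by (simp add: distrib_right add.commute)
  qed
qed (use assms in auto)

lemma nonunits_sum: "(\<And>i. i \<in> I \<Longrightarrow> f i \<in> nonunits) \<Longrightarrow> sum f I \<in> nonunits"
proof (induction I rule: infinite_finite_induct)
  case (insert x I)
  then show ?case by (simp add: nonunits_add)
qed (auto simp: nonunits_def subring_of_0[OF P])

lemma inverse_one_plus_nonunit: assumes "x \<in> nonunits" shows "1 + x \<noteq> 0 \<and> inverse (1 + x) \<in> P"
proof (rule ccontr)
  assume neg: "\<not> ?thesis"
  have "1 + x \<in> P" using assms by (auto simp: nonunits_def intro: subring_rules P)
  then have "1 + x \<in> nonunits" using neg by (auto simp: nonunits_def)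
  moreover have "- 1 * x \<in> nonunits" by (intro nonunits_mult subring_rules P assms)
  ultimately have "(1 + x) + (- 1 * x) \<in> nonunits" by (rule nonunits_add)
  then show False using subring_of_1[OF P] by (simp add: nonunits_def)
qed

lemma exists_dominating:
  assumes "finite S" "S \<noteq> {}" "S \<subseteq> K" "0 \<notin> S"
  shows "\<exists>a\<in>S. \<forall>b\<in>S. b / a \<in> P"
  using assms
proof (induction S rule: finite_ne_induct)
  case (singleton x)
  then show ?case using subring_of_1[OF P] by auto
next
  case (insert x S)
  then obtain a where a: "a \<in> S" "\<forall>b\<in>S. b / a \<in> P" by auto
  have "a \<in> K" "x \<in> K" "a \<noteq> 0" "x \<noteq> 0" using insert a by auto
  then have "x / a \<in> P \<or> inverse (x / a) \<in> P" using val subfield_of_divide[OF K(1)] by blast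
  then consider "x / a \<in> P" | "a / x \<in> P" by (auto simp: inverse_eq_divide)
  then show ?case
  proof cases
    case 1 then show ?thesis using a by auto
  next
    case 2
    have "b / x \<in> P" if "b \<in> S" for b
    proof -
      have "(b / a) * (a / x) \<in> P" by (intro subring_rules P 2) (use a that in auto)
      then show ?thesis using \<open>a \<noteq> 0\<close> by simp
    qed
    then show ?thesis using \<open>x \<noteq> 0\<close> subring_of_1[OF P] by (intro bexI[of _ x]) auto
  qed
qed

text \<open>Preparation for the Gauss lemma: among the coefficients of largest value the one of
  smallest index is chosen, so that all earlier ones are strictly smaller, that is, their quotients
  by it are nonunits.\<close>

lemma exists_first_dominating_coeff:
  assumes f: "f \<in> polys_over K" "f \<noteq> 0"
  shows "\<exists>i. coeff f i \<noteq> 0 \<and> (\<forall>j. coeff f j / coeff f i \<in> P) \<and> (\<forall>j<i. coeff f j / coeff f i \<in> nonunits)"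
proof -
  define Q where "Q = (\<lambda>i. coeff f i \<noteq> 0 \<and> (\<forall>j. coeff f j / coeff f i \<in> P))"
  define S where "S = coeff f ` {i. coeff f i \<noteq> 0}"
  have "finite {i. coeff f i \<noteq> 0}"
    by (rule finite_subset[of _ "{..degree f}"]) (auto intro: le_degree)
  then have "finite S" by (simp add: S_def)
  moreover have "S \<noteq> {}" using f(2) leading_coeff_0_iff[of f] by (auto simp: S_def simp del: leading_coeff_0_iff)
  ultimately have "\<exists>a\<in>S. \<forall>b\<in>S. b / a \<in> P"
    using f by (intro exists_dominating) (auto simp: S_def polys_over_coeff)
  then obtain i where "coeff f i \<noteq> 0" "\<forall>j. coeff f j \<noteq> 0 \<longrightarrow> coeff f j / coeff f i \<in> P"
    by (auto simp: S_def)
  then have "Q i" unfolding Q_def using subring_of_0[OF P] by (metis div_0)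
  then obtain i0 where i0: "Q i0" and min: "\<And>j. j < i0 \<Longrightarrow> \<not> Q j" by (metis exists_least_iff)
  have "coeff f j / coeff f i0 \<in> nonunits" if "j < i0" for j
  proof (rule ccontr)
    assume "coeff f j / coeff f i0 \<notin> nonunits"
    then have j: "coeff f j \<noteq> 0" "coeff f i0 / coeff f j \<in> P" using i0
      by (auto simp: nonunits_def Q_def inverse_eq_divide)
    have "coeff f l / coeff f j \<in> P" for l
    proof -
      have "(coeff f l / coeff f i0) * (coeff f i0 / coeff f j) \<in> P"
        by (intro subring_rules P j) (use i0 in \<open>auto simp: Q_def\<close>)
      then show ?thesis using i0 by (simp add: Q_def)
    qed
    then have "Q j" using j by (simp add: Q_def)
    then show False using min that by simp
  qed
  then show ?thesis using i0 by (auto simp: Q_def)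
qed

text \<open>At index \<open>i0 + j0\<close> of the product every other term is strictly smaller than
  the product of the two chosen dominating coefficients, so that product differs from a coefficient
  of \<open>f g\<close> by a unit of \<open>P\<close>; all other products of coefficients are
  multiples of it.\<close>

lemma valuation_ring_gauss:
  assumes f: "f \<in> polys_over K" and g: "g \<in> polys_over K" and fg: "f * g \<in> polys_over P"
  shows "coeff f i * coeff g j \<in> P"
proof (cases "f = 0 \<or> g = 0")
  case True
  then show ?thesis using subring_of_0[OF P] by auto
next
  case False
  then obtain i0 j0 where
    i0: "coeff f i0 \<noteq> 0" "\<And>j. coeff f j / coeff f i0 \<in> P" "\<And>j. j < i0 \<Longrightarrow> coeff f j / coeff f i0 \<in> nonunits" and
    j0: "coeff g j0 \<noteq> 0" "\<And>j. coeff g j / coeff g j0 \<in> P" "\<And>j. j < j0 \<Longrightarrow> coeff g j / coeff g j0 \<in> nonunits"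
    using exists_first_dominating_coeff f g by meson
  define T where "T = (\<lambda>l. (coeff f l / coeff f i0) * (coeff g (i0 + j0 - l) / coeff g j0))"
  define m where "m = (\<Sum>l\<in>{..i0+j0} - {i0}. T l)"
  have "m \<in> nonunits" unfolding m_def
  proof (rule nonunits_sum)
    fix l assume l: "l \<in> {..i0+j0} - {i0}"
    show "T l \<in> nonunits"
    proof (cases "l < i0")
      case True
      then show ?thesis unfolding T_def using nonunits_mult[OF j0(2) i0(3)] by (simp add: mult.commute)
    next
      case False
      then have "i0 + j0 - l < j0" using l by auto
      then show ?thesis unfolding T_def using nonunits_mult[OF i0(2) j0(3)] by simp
    qed
  qed
  then have m: "1 + m \<noteq> 0" "inverse (1 + m) \<in> P" using inverse_one_plus_nonunit by auto
  have "coeff (f * g) (i0 + j0) = (\<Sum>l\<le>i0+j0. coeff f i0 * coeff g j0 * T l)"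
    unfolding coeff_mult by (intro sum.cong HOL.refl) (use i0(1) j0(1) in \<open>simp add: T_def field_simps\<close>)
  also have "\<dots> = coeff f i0 * coeff g j0 * (T i0 + m)"
    unfolding m_def by (subst sum.remove[of _ i0]) (auto simp: sum_distrib_left distrib_left)
  also have "T i0 = 1" using i0 j0 by (simp add: T_def)
  finally have "coeff (f * g) (i0 + j0) * inverse (1 + m) = coeff f i0 * coeff g j0"
    using m by (simp add: field_simps)
  then have "coeff f i0 * coeff g j0 \<in> P"
    using subring_of_mult[OF P polys_over_coeff[OF fg] m(2)] by metis
  then have "(coeff f i0 * coeff g j0) * ((coeff f i / coeff f i0) * (coeff g j / coeff g j0)) \<in> P"
    using subring_of_mult[OF P] i0(2) j0(2) by meson
  then show ?thesis using i0 j0 by simp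
qed

end

section \<open>Finite extensions: frames, traces and separability\<close>

lemma sum_list_concat_map_upt:
  fixes f :: "'a \<Rightarrow> 'b::comm_monoid_add"
  shows "(\<Sum>x\<leftarrow>concat (map h [0..<n]). f x) = (\<Sum>i<n. \<Sum>x\<leftarrow>h i. f x)"
  by (induction n) (auto simp: add.commute)

lemma rsquarefree_pderiv_nonzero:
  fixes p :: "'a::field poly"
  assumes "rsquarefree p" "poly p x = 0"
  shows "poly (pderiv p) x \<noteq> 0"
proof -
  have p0: "p \<noteq> 0" and "order x p = 1"
    using assms rsquarefree_root_order by (auto simp: rsquarefree_def)
  then have nd: "\<not> [:- x, 1:] ^ 2 dvd p" using order_divides[of x 2 p] by auto
  obtain h where h: "p = [:- x, 1:] * h" using assms(2) by (metis dvdE poly_eq_0_iff_dvd)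
  have "poly h x \<noteq> 0"
  proof
    assume "poly h x = 0"
    then obtain h' where "h = [:- x, 1:] * h'" by (metis dvdE poly_eq_0_iff_dvd)
    then have "p = [:- x, 1:] ^ 2 * h'" unfolding h power2_eq_square by (simp only: mult.assoc)
    then show False using nd by simp
  qed
  moreover have "poly (pderiv p) x = poly h x"
    unfolding h pderiv_mult by (simp add: pderiv_pCons)
  ultimately show ?thesis by simp
qed

definition principal_ideals :: "'c::field set \<Rightarrow> bool" where
  "principal_ideals R \<longleftrightarrow> (\<forall>I\<subseteq>R. 0 \<in> I \<and> (\<forall>x\<in>I. \<forall>y\<in>I. x + y \<in> I) \<and> (\<forall>r\<in>R. \<forall>x\<in>I. r * x \<in> I) \<longrightarrow>
     (\<exists>g\<in>I. \<forall>x\<in>I. \<exists>r\<in>R. x = r * g))"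

text \<open>The degree is minimised over polynomials whose value at \<open>u\<close> is a nonzero
  element of the ideal, so a remainder is excluded by its value at \<open>u\<close> alone.\<close>

lemma principal_ideals_adjoin_ring:
  assumes F: "subfield_of F"
  shows "principal_ideals (adjoin_ring F u)"
  unfolding principal_ideals_def
proof (intro allI impI, elim conjE)
  note Fr = subfield_of_subring[OF F]
  fix I assume I: "I \<subseteq> adjoin_ring F u" "0 \<in> I" "\<forall>x\<in>I. \<forall>y\<in>I. x + y \<in> I"
    "\<forall>r\<in>adjoin_ring F u. \<forall>x\<in>I. r * x \<in> I"
  show "\<exists>g\<in>I. \<forall>x\<in>I. \<exists>r\<in>adjoin_ring F u. x = r * g"
  proof (cases "I = {0}")
    case True
    then show ?thesis using subring_of_0[OF adjoin_ring_subring[OF Fr]] by auto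
  next
    case False
    then obtain x where x: "x \<in> I" "x \<noteq> 0" using I(2) by auto
    define Q where "Q = (\<lambda>p. p \<in> polys_over F \<and> poly p u \<in> I \<and> poly p u \<noteq> 0)"
    obtain p0 where "Q p0" using x I(1) by (force simp: adjoin_ring_def Q_def)
    from ex_has_least_nat[of Q p0 degree, OF this]
    obtain p where p: "Q p" and pmin: "\<And>r. Q r \<Longrightarrow> degree p \<le> degree r" by blast
    define g where "g = poly p u"
    have "\<exists>r\<in>adjoin_ring F u. x = r * g" if xI: "x \<in> I" for x
    proof -
      obtain f where f: "f \<in> polys_over F" "x = poly f u"
        using subsetD[OF I(1) xI] by (auto simp: adjoin_ring_def)
      have pF: "p \<in> polys_over F" "p \<noteq> 0" using p by (auto simp: Q_def)
      have "inverse (lead_coeff p) \<in> F" using pF F by (simp add: polys_over_coeff subfield_of_inverse)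
      from poly_division_over[OF Fr pF this f(1)]
      obtain h r where hr: "h \<in> polys_over F" "r \<in> polys_over F" "f = p * h + r" "r = 0 \<or> degree r < degree p"
        by blast
      have hu: "- poly h u \<in> adjoin_ring F u"
        using hr by (auto simp: adjoin_ring_def intro!: subring_of_uminus adjoin_ring_subring[OF Fr, unfolded adjoin_ring_def])
      have "poly r u = x + (- poly h u) * g" using hr f by (simp add: g_def)
      moreover have "(- poly h u) * g \<in> I" using I(4) hu p by (auto simp only: g_def Q_def)
      ultimately have rI: "poly r u \<in> I" using I(3) xI by metis
      have "poly r u = 0"
      proof (rule ccontr)
        assume "poly r u \<noteq> 0"
        then have "Q r" using rI hr by (simp add: Q_def)
        then have "degree p \<le> degree r" by (rule pmin)
        then show False using hr \<open>poly r u \<noteq> 0\<close> by auto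
      qed
      then have "x = poly h u * g" using hr f by (simp add: g_def)
      then show ?thesis using hr by (auto simp: adjoin_ring_def)
    qed
    then show ?thesis using p by (auto simp: g_def Q_def)
  qed
qed

locale field_ext =
  fixes k K :: "'c::field set"
  assumes k: "subfield_of k" and K: "subfield_of K" and kK: "k \<subseteq> K"
begin

lemmas kr = subfield_of_subring[OF k]
lemmas Kr = subfield_of_subring[OF K]

definition functional :: "('c \<Rightarrow> 'c) \<Rightarrow> bool" where
  "functional f \<longleftrightarrow> (\<forall>x\<in>K. f x \<in> k) \<and> (\<forall>x\<in>K. \<forall>y\<in>K. f (x + y) = f x + f y) \<and>
     (\<forall>c\<in>k. \<forall>x\<in>K. f (c * x) = c * f x)"

lemma functionalD:
  assumes "functional f" "x \<in> K"
  shows "f x \<in> k" "y \<in> K \<Longrightarrow> f (x + y) = f x + f y" "c \<in> k \<Longrightarrow> f (c * x) = c * f x"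
  using assms by (auto simp: functional_def)

lemma functional_0: "functional f \<Longrightarrow> f 0 = 0"
  using functionalD(3)[of f 0 0] subring_of_0[OF kr] subring_of_0[OF Kr] by auto

lemma functional_diff:
  assumes "functional f" "x \<in> K" "y \<in> K" shows "f (x - y) = f x - f y"
  using functionalD(2)[OF assms(1), of "x - y" y] subring_of_diff[OF Kr] assms by (simp add: algebra_simps)

lemma functional_sum:
  assumes "functional f" "\<And>i. i \<in> I \<Longrightarrow> x i \<in> K"
  shows "f (\<Sum>i\<in>I. x i) = (\<Sum>i\<in>I. f (x i))"
  using assms(2)
  by (induction I rule: infinite_finite_induct)
    (auto simp: functional_0[OF assms(1)] functionalD(2)[OF assms(1)] subring_of_sum[OF Kr])

lemma functional_lin_comb:
  assumes "functional f" "\<And>i. i \<in> I \<Longrightarrow> x i \<in> K" "\<And>i. i \<in> I \<Longrightarrow> c i \<in> k"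
  shows "f (\<Sum>i\<in>I. c i * x i) = (\<Sum>i\<in>I. c i * f (x i))"
proof -
  have "f (\<Sum>i\<in>I. c i * x i) = (\<Sum>i\<in>I. f (c i * x i))"
    by (rule functional_sum[OF assms(1)]) (use assms kK in \<open>auto intro!: subring_of_mult[OF Kr]\<close>)
  also have "\<dots> = (\<Sum>i\<in>I. c i * f (x i))"
    by (rule sum.cong[OF HOL.refl]) (use assms functionalD(3)[OF assms(1)] in auto)
  finally show ?thesis .
qed

text \<open>A finite family with functionals reproducing every element, as in the dual basis
  criterion for projective modules. Independence is not part of it, so any spanning family with
  chosen coordinates may be used to compute a trace.\<close>

definition frame :: "nat \<Rightarrow> (nat \<Rightarrow> 'c) \<Rightarrow> (nat \<Rightarrow> 'c \<Rightarrow> 'c) \<Rightarrow> bool" where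
  "frame n m \<psi> \<longleftrightarrow> (\<forall>i<n. m i \<in> K \<and> functional (\<psi> i)) \<and> (\<forall>y\<in>K. y = (\<Sum>i<n. \<psi> i y * m i))"

lemma frameD:
  assumes "frame n m \<psi>"
  shows "i < n \<Longrightarrow> m i \<in> K" "i < n \<Longrightarrow> functional (\<psi> i)" "y \<in> K \<Longrightarrow> (\<Sum>i<n. \<psi> i y * m i) = y"
  using assms unfolding frame_def by (blast, blast, metis)

lemma frame_extend:
  assumes f: "frame n m \<psi>" and m': "\<And>i. i < n' \<Longrightarrow> m' i \<in> K \<and> functional (\<psi>' i)"
    and eq: "\<And>j. j < n \<Longrightarrow> (\<Sum>i<n'. \<psi>' i (m j) * m' i) = m j"
  shows "frame n' m' \<psi>'"
  unfolding frame_def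
proof (intro conjI allI impI ballI)
  fix y assume y: "y \<in> K"
  have "(\<Sum>i<n'. \<psi>' i y * m' i) = (\<Sum>i<n'. \<psi>' i (\<Sum>j<n. \<psi> j y * m j) * m' i)"
    using frameD(3)[OF f y] by simp
  also have "\<dots> = (\<Sum>i<n'. (\<Sum>j<n. \<psi> j y * \<psi>' i (m j)) * m' i)"
    by (intro sum.cong HOL.refl arg_cong2[of _ _ _ _ "(*)"] functional_lin_comb)
      (use m' frameD[OF f] functionalD y in auto)
  also have "\<dots> = (\<Sum>j<n. \<psi> j y * (\<Sum>i<n'. \<psi>' i (m j) * m' i))"
    unfolding sum_distrib_left sum_distrib_right by (subst sum.swap) (simp add: mult_ac)
  also have "\<dots> = (\<Sum>j<n. \<psi> j y * m j)" by (rule sum.cong[OF HOL.refl]) (simp add: eq)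
  also have "\<dots> = y" using frameD(3)[OF f y] .
  finally show "y = (\<Sum>i<n'. \<psi>' i y * m' i)" by simp
qed (use m' in auto)

text \<open>This is \<open>tr(PQ) = tr(QP)\<close>: with the transition coefficients
  \<open>\<psi> i (m' j)\<close> and \<open>\<psi>' j (x * m i)\<close>, both sides equal the same
  double sum.\<close>

lemma frame_trace_unique:
  assumes f: "frame n m \<psi>" and f': "frame n' m' \<psi>'" and x: "x \<in> K"
  shows "(\<Sum>i<n. \<psi> i (x * m i)) = (\<Sum>i<n'. \<psi>' i (x * m' i))"
proof -
  note mK = subring_of_mult[OF Kr]
  have "(\<Sum>i<n. \<psi> i (x * m i)) = (\<Sum>i<n. \<psi> i (\<Sum>j<n'. \<psi>' j (x * m i) * m' j))"
    by (rule sum.cong[OF HOL.refl]) (use frameD[OF f] frameD(3)[OF f'] x mK in auto)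
  also have "\<dots> = (\<Sum>i<n. \<Sum>j<n'. \<psi>' j (x * m i) * \<psi> i (m' j))"
    by (intro sum.cong HOL.refl functional_lin_comb)
     (use frameD[OF f] frameD[OF f'] functionalD x mK in auto)
  also have "\<dots> = (\<Sum>j<n'. \<Sum>i<n. \<psi> i (m' j) * \<psi>' j (x * m i))"
    by (subst sum.swap) (simp add: mult.commute)
  also have "\<dots> = (\<Sum>j<n'. \<psi>' j (\<Sum>i<n. \<psi> i (m' j) * (x * m i)))"
    by (intro sum.cong HOL.refl functional_lin_comb[symmetric])
     (use frameD[OF f] frameD[OF f'] functionalD x mK in auto)
  also have "\<dots> = (\<Sum>j<n'. \<psi>' j (x * m' j))"
  proof (rule sum.cong[OF HOL.refl])
    fix j assume "j \<in> {..<n'}"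
    then have "m' j \<in> K" using frameD[OF f'] by auto
    then have "m' j = (\<Sum>i<n. \<psi> i (m' j) * m i)" using frameD(3)[OF f] by simp
    then have "x * m' j = x * (\<Sum>i<n. \<psi> i (m' j) * m i)" by simp
    also have "\<dots> = (\<Sum>i<n. \<psi> i (m' j) * (x * m i))"
      unfolding sum_distrib_left by (simp add: mult.left_commute)
    finally have "x * m' j = (\<Sum>i<n. \<psi> i (m' j) * (x * m i))" .
    then show "\<psi>' j (\<Sum>i<n. \<psi> i (m' j) * (x * m i)) = \<psi>' j (x * m' j)" by simp
  qed
  finally show ?thesis .
qed

definition basis_coord :: "'c set \<Rightarrow> 'c \<Rightarrow> 'c \<Rightarrow> 'c" where
  "basis_coord B y = (THE c. c \<in> B \<rightarrow>\<^sub>E k \<and> y = (\<Sum>b\<in>B. c b * b))"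

lemma basis_coord:
  assumes "is_basis k K B" "y \<in> K"
  shows "basis_coord B y \<in> B \<rightarrow>\<^sub>E k" "(\<Sum>b\<in>B. basis_coord B y b * b) = y"
    and basis_coord_unique:
      "\<And>c. (\<And>b. b \<in> B \<Longrightarrow> c b \<in> k) \<Longrightarrow> y = (\<Sum>b\<in>B. c b * b) \<Longrightarrow> b \<in> B \<Longrightarrow> basis_coord B y b = c b"
proof -
  have ex: "\<exists>!c. c \<in> B \<rightarrow>\<^sub>E k \<and> y = (\<Sum>b\<in>B. c b * b)"
    using assms by (auto simp: is_basis_def)
  from theI'[OF this] show 1: "basis_coord B y \<in> B \<rightarrow>\<^sub>E k" "(\<Sum>b\<in>B. basis_coord B y b * b) = y"
    unfolding basis_coord_def by auto
  fix c assume c: "\<And>b. b \<in> B \<Longrightarrow> c b \<in> k" "y = (\<Sum>b\<in>B. c b * b)" "b \<in> B"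
  have "restrict c B \<in> B \<rightarrow>\<^sub>E k \<and> y = (\<Sum>b\<in>B. restrict c B b * b)" using c by auto
  then have "restrict c B = basis_coord B y" using ex 1 by metis
  then show "basis_coord B y b = c b" using c(3) by (metis restrict_apply')
qed

lemma basis_coord_functional:
  assumes B: "is_basis k K B" and b: "b \<in> B"
  shows "functional (\<lambda>y. basis_coord B y b)"
  unfolding functional_def
proof (intro conjI ballI)
  fix x assume x: "x \<in> K"
  note bx = basis_coord[OF B x]
  show "basis_coord B x b \<in> k" using bx(1) b by auto
  show "basis_coord B (x + y) b = basis_coord B x b + basis_coord B y b" if "y \<in> K" for y
  proof (rule basis_coord_unique[OF B])
    show "basis_coord B x b' + basis_coord B y b' \<in> k" if "b' \<in> B" for b'
      using that bx(1) basis_coord(1)[OF B \<open>y \<in> K\<close>] subring_of_add[OF kr] by (blast dest: PiE_mem)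
    show "x + y = (\<Sum>b\<in>B. (basis_coord B x b + basis_coord B y b) * b)"
      using bx(2) basis_coord(2)[OF B that] by (simp add: distrib_right sum.distrib)
  qed (use x that b subring_of_add[OF Kr] in auto)
  show "basis_coord B (c * x) b = c * basis_coord B x b" if "c \<in> k" for c
  proof (rule basis_coord_unique[OF B])
    show "c * x = (\<Sum>b\<in>B. c * basis_coord B x b * b)"
      using bx(2) by (simp add: mult.assoc sum_distrib_left[symmetric])
    show "c * basis_coord B x b' \<in> k" if "b' \<in> B" for b'
      using that bx(1) \<open>c \<in> k\<close> subring_of_mult[OF kr] by (blast dest: PiE_mem)
  qed (use x that subring_of_mult[OF Kr] b kK in auto)
qed

lemma frame_of_basis:
  assumes B: "is_basis k K B" and h: "bij_betw h {..<n} B"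
  shows "frame n h (\<lambda>i y. basis_coord B y (h i))"
  unfolding frame_def
proof (intro conjI allI impI ballI)
  fix i assume "i < n"
  then have "h i \<in> B" using h by (auto simp: bij_betw_def)
  then show "h i \<in> K" "functional (\<lambda>y. basis_coord B y (h i))"
    using B basis_coord_functional[OF B] by (auto simp: is_basis_def)
next
  fix y assume "y \<in> K"
  then show "y = (\<Sum>i<n. basis_coord B y (h i) * h i)"
    using basis_coord(2)[OF B] sum.reindex_bij_betw[OF h, of "\<lambda>b. basis_coord B y b * b"] by simp
qed

abbreviation tr :: "'c \<Rightarrow> 'c" where "tr \<equiv> field_trace k K"

text \<open>The definition of \<open>field_trace\<close> describes a value by all bases and matrices
  at once. Each basis is a frame, so independence of the frame shows that only one value qualifies;
  later computations of the trace start from this formula.\<close>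

lemma field_trace_frame:
  assumes f: "frame n m \<psi>" and ex: "\<exists>B. is_basis k K B" and x: "x \<in> K"
  shows "tr x = (\<Sum>i<n. \<psi> i (x * m i))"
proof -
  have eq: "(\<Sum>b\<in>B. c b b) = (\<Sum>i<n. \<psi> i (x * m i))"
    if B: "is_basis k K B" and c: "\<forall>b\<in>B. (\<forall>b'\<in>B. c b b' \<in> k) \<and> x * b = (\<Sum>b'\<in>B. c b b' * b')" for B c
  proof -
    have "finite B" "B \<subseteq> K" using B by (auto simp: is_basis_def)
    then obtain h and n' :: nat where h: "bij_betw h {..<n'} B"
      using ex_bij_betw_nat_finite[of B] unfolding atLeast0LessThan by blast
    have "(\<Sum>b\<in>B. c b b) = (\<Sum>b\<in>B. basis_coord B (x * b) b)"
    proof (rule sum.cong[OF HOL.refl])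
      fix b assume b: "b \<in> B"
      have "x * b \<in> K" using b \<open>B \<subseteq> K\<close> x subring_of_mult[OF Kr] by auto
      from basis_coord_unique[OF B this, of "c b" b] show "c b b = basis_coord B (x * b) b" using c b by auto
    qed
    also have "\<dots> = (\<Sum>i<n'. basis_coord B (x * h i) (h i))"
      using sum.reindex_bij_betw[OF h, of "\<lambda>b. basis_coord B (x * b) b"] by simp
    also have "\<dots> = (\<Sum>i<n. \<psi> i (x * m i))"
      by (rule frame_trace_unique[OF frame_of_basis[OF B h] f x])
    finally show ?thesis .
  qed
  obtain B where B: "is_basis k K B" using ex by blast
  define c where "c = (\<lambda>b. basis_coord B (x * b))"
  have c: "\<forall>b\<in>B. (\<forall>b'\<in>B. c b b' \<in> k) \<and> x * b = (\<Sum>b'\<in>B. c b b' * b')"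
  proof
    fix b assume "b \<in> B"
    then have "x * b \<in> K" using B x subring_of_mult[OF Kr] by (auto simp: is_basis_def)
    from basis_coord[OF B this] show "(\<forall>b'\<in>B. c b b' \<in> k) \<and> x * b = (\<Sum>b'\<in>B. c b b' * b')"
      by (auto simp: c_def)
  qed
  show ?thesis unfolding field_trace_def
  proof (rule the_equality)
    show "\<exists>B c. is_basis k K B \<and> (\<forall>b\<in>B. (\<forall>b'\<in>B. c b b' \<in> k) \<and> x * b = (\<Sum>b'\<in>B. c b b' * b')) \<and>
        (\<Sum>i<n. \<psi> i (x * m i)) = (\<Sum>b\<in>B. c b b)"
      using B c eq[OF B c] by (intro exI[of _ B] exI[of _ c]) auto
  next
    fix t assume "\<exists>B c. is_basis k K B \<and> (\<forall>b\<in>B. (\<forall>b'\<in>B. c b b' \<in> k) \<and> x * b = (\<Sum>b'\<in>B. c b b' * b')) \<and>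
        t = (\<Sum>b\<in>B. c b b)"
    then obtain B c where *: "is_basis k K B" "\<forall>b\<in>B. (\<forall>b'\<in>B. c b b' \<in> k) \<and> x * b = (\<Sum>b'\<in>B. c b b' * b')"
      "t = (\<Sum>b\<in>B. c b b)" by blast
    show "t = (\<Sum>i<n. \<psi> i (x * m i))" unfolding *(3) by (rule eq[OF *(1,2)])
  qed
qed

text \<open>Balanced maps are the additive maps out of \<open>K \<otimes> K\<close> over
  \<open>k\<close>. The tensor square itself is never formed: its elements are lists of pairs,
  tested against all balanced maps.\<close>

definition balanced :: "('c \<Rightarrow> 'c \<Rightarrow> 'c) \<Rightarrow> bool" where
  "balanced \<beta> \<longleftrightarrow> (\<forall>x\<in>K. \<forall>x'\<in>K. \<forall>y\<in>K. \<beta> (x + x') y = \<beta> x y + \<beta> x' y) \<and>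
     (\<forall>x\<in>K. \<forall>y\<in>K. \<forall>y'\<in>K. \<beta> x (y + y') = \<beta> x y + \<beta> x y') \<and>
     (\<forall>c\<in>k. \<forall>x\<in>K. \<forall>y\<in>K. \<beta> (c * x) y = \<beta> x (c * y))"

lemma balancedD:
  assumes "balanced \<beta>" "x \<in> K" "y \<in> K"
  shows "x' \<in> K \<Longrightarrow> \<beta> (x + x') y = \<beta> x y + \<beta> x' y" "y' \<in> K \<Longrightarrow> \<beta> x (y + y') = \<beta> x y + \<beta> x y'"
    "c \<in> k \<Longrightarrow> \<beta> (c * x) y = \<beta> x (c * y)"
  using assms by (auto simp: balanced_def)

lemma balanced_diff:
  assumes "balanced \<beta>" "x \<in> K" "y \<in> K"
  shows "x' \<in> K \<Longrightarrow> \<beta> (x - x') y = \<beta> x y - \<beta> x' y" "y' \<in> K \<Longrightarrow> \<beta> x (y - y') = \<beta> x y - \<beta> x y'"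
  using balancedD(1)[OF assms(1), of "x - x'" y x'] balancedD(2)[OF assms(1), of x "y - y'" y']
    subring_of_diff[OF Kr] assms by (auto simp: algebra_simps)

lemma balanced_0: 
  assumes "balanced \<beta>" "x \<in> K" shows "\<beta> 0 x = 0" "\<beta> x 0 = 0"
  using balanced_diff(1)[OF assms(1), of 0 x 0] balanced_diff(2)[OF assms(1), of x 0 0] 
    subring_of_0[OF Kr] assms by auto

lemma balanced_sum_left:
  assumes "balanced \<beta>" "y \<in> K" "\<And>i. i \<in> I \<Longrightarrow> x i \<in> K"
  shows "\<beta> (\<Sum>i\<in>I. x i) y = (\<Sum>i\<in>I. \<beta> (x i) y)"
  using assms(3)
  by (induction I rule: infinite_finite_induct)
    (auto simp: balanced_0[OF assms(1,2)] balancedD(1)[OF assms(1)] subring_of_sum[OF Kr] assms(2))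

lemma balanced_mult:
  assumes "balanced \<beta>" "a \<in> K" "b \<in> K"
  shows "balanced (\<lambda>s t. \<beta> (a * s) (t * b))"
  unfolding balanced_def
proof (intro conjI ballI)
  note mK = subring_of_mult[OF Kr]
  fix x y z assume x: "x \<in> K" and y: "y \<in> K" and z: "z \<in> K"
  show "\<beta> (a * (x + y)) (z * b) = \<beta> (a * x) (z * b) + \<beta> (a * y) (z * b)"
    unfolding distrib_left by (intro balancedD assms mK x y z)
  show "\<beta> (a * x) ((y + z) * b) = \<beta> (a * x) (y * b) + \<beta> (a * x) (z * b)"
    unfolding distrib_right by (intro balancedD assms mK x y z)
next
  note mK = subring_of_mult[OF Kr]
  fix c x y assume c: "c \<in> k" and x: "x \<in> K" and y: "y \<in> K"
  show "\<beta> (a * (c * x)) (y * b) = \<beta> (a * x) (c * y * b)"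
    using balancedD(3)[OF assms(1), of "a * x" "y * b" c] c mK[of a x] mK[of y b] x y assms
    by (simp add: mult_ac)
qed

text \<open>For \<open>e = \<Sum> s \<otimes> t\<close> this says
  \<open>(a \<otimes> 1) e = (1 \<otimes> a) e\<close>.\<close>

definition commutes :: "('c \<times> 'c) list \<Rightarrow> 'c \<Rightarrow> bool" where
  "commutes ps a \<longleftrightarrow> (\<forall>\<beta>. balanced \<beta> \<longrightarrow>
     (\<Sum>(s, t)\<leftarrow>ps. \<beta> (a * s) t) = (\<Sum>(s, t)\<leftarrow>ps. \<beta> s (a * t)))"

lemma commutesD:
  "commutes ps a \<Longrightarrow> balanced \<beta> \<Longrightarrow> (\<Sum>(s, t)\<leftarrow>ps. \<beta> (a * s) t) = (\<Sum>(s, t)\<leftarrow>ps. \<beta> s (a * t))"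
  by (simp add: commutes_def)

lemma sum_list_pair_cong:
  assumes "set ps \<subseteq> K \<times> K" "\<And>s t. s \<in> K \<Longrightarrow> t \<in> K \<Longrightarrow> f s t = g s t"
  shows "(\<Sum>(s, t)\<leftarrow>ps. f s t) = (\<Sum>(s, t)\<leftarrow>ps. g s t)"
  by (rule arg_cong[of _ _ sum_list], rule map_cong[OF HOL.refl]) (use assms in auto)

lemma sum_list_pair_add:
  "(\<Sum>(s, t)\<leftarrow>ps. f s t + g s t) = (\<Sum>(s, t)\<leftarrow>ps. f s t) + (\<Sum>(s, t)\<leftarrow>ps. (g s t :: 'c))"
  by (induction ps) (auto simp: algebra_simps)

lemma sum_list_pair_diff:
  "(\<Sum>(s, t)\<leftarrow>ps. f s t - g s t) = (\<Sum>(s, t)\<leftarrow>ps. f s t) - (\<Sum>(s, t)\<leftarrow>ps. (g s t :: 'c))"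
  by (induction ps) (auto simp: algebra_simps)

lemma sum_list_pair_sum:
  "(\<Sum>i\<in>I. \<Sum>(s, t)\<leftarrow>ps. f i s t) = (\<Sum>(s, t)\<leftarrow>ps. \<Sum>i\<in>I. (f i s t :: 'c))"
  by (induction ps) (auto simp: sum.distrib)

lemma sum_list_pair_mult:
  "(\<Sum>(s, t)\<leftarrow>ps. c * f s t) = c * (\<Sum>(s, t)\<leftarrow>ps. (f s t :: 'c))"
  by (induction ps) (auto simp: algebra_simps)

text \<open>For the inverse, the relation for \<open>a\<close> is applied to the balanced map
  \<open>(s, t) \<mapsto> \<beta> (s/a) (t/a)\<close>. That the commuting elements form a field over
  \<open>k\<close> is what permits a minimal polynomial over them in the next construction.\<close>

lemma commutes_subfield:
  assumes ps: "set ps \<subseteq> K \<times> K"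
  shows "subfield_of {a \<in> K. commutes ps a}" "k \<subseteq> {a \<in> K. commutes ps a}"
proof -
  note mK = subring_of_mult[OF Kr]
  show kC: "k \<subseteq> {a \<in> K. commutes ps a}"
  proof
    fix c assume c: "c \<in> k"
    have "commutes ps c" unfolding commutes_def
      by (intro allI impI sum_list_pair_cong[OF ps] balancedD c)
    then show "c \<in> {a \<in> K. commutes ps a}" using c kK by auto
  qed
  show "subfield_of {a \<in> K. commutes ps a}" unfolding subfield_of_def subring_of_def
  proof (intro conjI ballI)
    show "0 \<in> {a \<in> K. commutes ps a}" "1 \<in> {a \<in> K. commutes ps a}"
      using kC subring_of_0[OF kr] subring_of_1[OF kr] by auto
  next
    fix a b assume "a \<in> {a \<in> K. commutes ps a}" "b \<in> {a \<in> K. commutes ps a}"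
    then have a: "a \<in> K" "commutes ps a" and b: "b \<in> K" "commutes ps b" by auto
    have "(\<Sum>(s, t)\<leftarrow>ps. \<beta> ((a + b) * s) t) = (\<Sum>(s, t)\<leftarrow>ps. \<beta> s ((a + b) * t))" if \<beta>: "balanced \<beta>" for \<beta>
    proof -
      have "(\<Sum>(s, t)\<leftarrow>ps. \<beta> ((a + b) * s) t) = (\<Sum>(s, t)\<leftarrow>ps. \<beta> (a * s) t + \<beta> (b * s) t)"
        by (rule sum_list_pair_cong[OF ps]) (use balancedD(1)[OF \<beta>] a b mK in \<open>auto simp: distrib_right\<close>)
      also have "\<dots> = (\<Sum>(s, t)\<leftarrow>ps. \<beta> s (a * t) + \<beta> s (b * t))"
        unfolding sum_list_pair_add using commutesD[OF a(2) \<beta>] commutesD[OF b(2) \<beta>] by simp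
      also have "\<dots> = (\<Sum>(s, t)\<leftarrow>ps. \<beta> s ((a + b) * t))"
        by (rule sum_list_pair_cong[OF ps]) (use balancedD(2)[OF \<beta>] a b mK in \<open>auto simp: distrib_right\<close>)
      finally show ?thesis .
    qed
    then show "a + b \<in> {a \<in> K. commutes ps a}" using a b subring_of_add[OF Kr] by (auto simp: commutes_def)
    have "(\<Sum>(s, t)\<leftarrow>ps. \<beta> ((a - b) * s) t) = (\<Sum>(s, t)\<leftarrow>ps. \<beta> s ((a - b) * t))" if \<beta>: "balanced \<beta>" for \<beta>
    proof -
      have "(\<Sum>(s, t)\<leftarrow>ps. \<beta> ((a - b) * s) t) = (\<Sum>(s, t)\<leftarrow>ps. \<beta> (a * s) t - \<beta> (b * s) t)"
        by (rule sum_list_pair_cong[OF ps]) (use balanced_diff(1)[OF \<beta>] a b mK in \<open>auto simp: left_diff_distrib\<close>)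
      also have "\<dots> = (\<Sum>(s, t)\<leftarrow>ps. \<beta> s (a * t) - \<beta> s (b * t))"
        unfolding sum_list_pair_diff using commutesD[OF a(2) \<beta>] commutesD[OF b(2) \<beta>] by simp
      also have "\<dots> = (\<Sum>(s, t)\<leftarrow>ps. \<beta> s ((a - b) * t))"
        by (rule sum_list_pair_cong[OF ps]) (use balanced_diff(2)[OF \<beta>] a b mK in \<open>auto simp: left_diff_distrib\<close>)
      finally show ?thesis .
    qed
    then show "a - b \<in> {a \<in> K. commutes ps a}" using a b subring_of_diff[OF Kr] by (auto simp: commutes_def)
    have "(\<Sum>(s, t)\<leftarrow>ps. \<beta> (a * b * s) t) = (\<Sum>(s, t)\<leftarrow>ps. \<beta> s (a * b * t))" if \<beta>: "balanced \<beta>" for \<beta>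
      using commutesD[OF a(2) balanced_mult[OF \<beta> b(1) subring_of_1[OF Kr]]]
        commutesD[OF b(2) balanced_mult[OF \<beta> subring_of_1[OF Kr] a(1)]] by (simp add: mult_ac)
    then show "a * b \<in> {a \<in> K. commutes ps a}" using a b mK by (auto simp: commutes_def)
  next
    fix a assume "a \<in> {a \<in> K. commutes ps a}"
    then have a: "a \<in> K" "commutes ps a" by auto
    show "inverse a \<in> {a \<in> K. commutes ps a}"
    proof (cases "a = 0")
      case True then show ?thesis using a by simp
    next
      case False
      have i: "inverse a \<in> K" using a subfield_of_inverse[OF K] by auto
      have "(\<Sum>(s, t)\<leftarrow>ps. \<beta> (inverse a * s) t) = (\<Sum>(s, t)\<leftarrow>ps. \<beta> s (inverse a * t))" if \<beta>: "balanced \<beta>" for \<beta>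

      proof -
        have "(\<Sum>(s, t)\<leftarrow>ps. \<beta> (inverse a * (a * s)) (t * inverse a)) = (\<Sum>(s, t)\<leftarrow>ps. \<beta> (inverse a * s) (a * t * inverse a))"
          using commutesD[OF a(2) balanced_mult[OF \<beta> i i]] .
        moreover have "inverse a * (a * s) = s" "a * s * inverse a = s" for s using False by auto
        ultimately show ?thesis by (simp add: mult.commute[of "inverse a"])
      qed
      then show ?thesis using i by (auto simp: commutes_def)
    qed
  qed
qed

text \<open>Adjoining \<open>y\<close> to the elements commuting with the tensor \<open>\<Sum> s \<otimes> t\<close>: with \<open>g\<close> the minimal
  polynomial of \<open>y\<close> over the field of commuting elements and \<open>g = (X - y) \<cdot> \<Sum> Q\<^sub>i X\<^sup>i\<close>, Euler's element
  \<open>\<Sum> y\<^sup>i \<otimes> Q\<^sub>i / g'(y)\<close> commutes with \<open>y\<close>.\<close>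

lemma separability_idempotent_step:
  assumes ps: "set ps \<subseteq> K \<times> K" and one: "(\<Sum>(s, t)\<leftarrow>ps. s * t) = 1"
    and y: "y \<in> K" "separable_over k y"
  shows "\<exists>ps'. set ps' \<subseteq> K \<times> K \<and> (\<Sum>(s, t)\<leftarrow>ps'. s * t) = 1 \<and> commutes ps' y \<and>
     (\<forall>a\<in>K. commutes ps a \<longrightarrow> commutes ps' a)"
proof -
  note mK = subring_of_mult[OF Kr]
  define L where "L = {a \<in> K. commutes ps a}"
  have L: "subfield_of L" "k \<subseteq> L" "L \<subseteq> K" using commutes_subfield[OF ps] by (auto simp: L_def)
  note Lr = subfield_of_subring[OF L(1)]
  obtain f where f: "is_minpoly k y f" "rsquarefree f" using y(2) by (auto simp: separable_over_def)
  then have f': "f \<in> polys_over L" "f \<noteq> 0" "poly f y = 0" "poly (pderiv f) y \<noteq> 0"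
    using polys_over_mono[OF L(2)] rsquarefree_pderiv_nonzero[OF f(2)] by (auto simp: is_minpoly_def)
  define Z where "Z = (\<lambda>g. g \<in> polys_over L \<and> g \<noteq> 0 \<and> poly g y = 0)"
  have "Z f" using f' by (simp add: Z_def)
  from ex_has_least_nat[of Z f degree, OF this]
  obtain g where g: "Z g" and gmin: "\<And>r. Z r \<Longrightarrow> degree g \<le> degree r" by blast
  have gL: "g \<in> polys_over L" "g \<noteq> 0" "poly g y = 0" using g by (auto simp: Z_def)
  have "inverse (lead_coeff g) \<in> L" using gL L by (simp add: polys_over_coeff subfield_of_inverse)
  from poly_division_over[OF Lr gL(1,2) this f'(1)]
  obtain h r where hr: "r \<in> polys_over L" "f = g * h + r" "r = 0 \<or> degree r < degree g" by blast
  \<comment> \<open>The minimal polynomial \<open>g\<close> over the larger field \<open>L\<close>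
    divides the separable polynomial \<open>f\<close>, so \<open>g'(y)\<close> cannot vanish
    either.\<close>
  have "poly r y = 0" using hr f' gL by simp
  then have "r = 0" using gmin[of r] hr by (force simp: Z_def)
  then have "poly (pderiv f) y = poly (pderiv g) y * poly h y"
    using hr gL by (simp add: pderiv_mult)
  then have gd: "poly (pderiv g) y \<noteq> 0" using f' by auto
  define Q where "Q = synthetic_div g y"
  have gQ: "g = [:- y, 1:] * Q" using synthetic_div_correct'[of y g] gL by (simp add: Q_def)
  have Qy: "poly Q y = poly (pderiv g) y" unfolding gQ pderiv_mult by (simp add: pderiv_pCons)
  have gK: "coeff g i \<in> K" for i using gL L polys_over_coeff by blast
  define N where "N = Suc (degree Q)"
  have g0: "coeff g 0 = - y * coeff Q 0" and gS: "coeff g (Suc i) = coeff Q i - y * coeff Q (Suc i)" for i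
    by (auto simp: gQ coeff_pCons)
  have QK: "coeff Q i \<in> K" for i
  proof (cases "i \<le> N")
    case True
    then show ?thesis
    proof (induction i rule: inc_induct)
      case base
      then show ?case using subring_of_0[OF Kr] by (simp add: N_def coeff_eq_0)
    next
      case (step i)
      have "coeff Q i = coeff g (Suc i) + y * coeff Q (Suc i)" using gS[of i] by simp
      then show ?case using step gK y subring_of_add[OF Kr] mK by metis
    qed
  next
    case False
    then show ?thesis using subring_of_0[OF Kr] by (simp add: N_def coeff_eq_0)
  qed
  define D where "D = inverse (poly (pderiv g) y)"
  have "poly Q y \<in> K" by (rule poly_in_subring[OF Kr]) (use QK y in \<open>auto simp: polys_over_def\<close>)
  then have DK: "D \<in> K" unfolding D_def using Qy subfield_of_inverse[OF K] by auto
  define \<gamma> where "\<gamma> i = coeff Q i * D" for i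
  have gam: "\<gamma> i \<in> K" for i unfolding \<gamma>_def using QK DK mK by auto
  have yK: "y ^ i \<in> K" for i using y subring_of_power[OF Kr] by auto
  define ps' where "ps' = concat (map (\<lambda>i. map (\<lambda>(s, t). (y ^ i * s, t * \<gamma> i)) ps) [0..<N])"
  have sum': "(\<Sum>(s, t)\<leftarrow>ps'. F s t) = (\<Sum>i<N. \<Sum>(s, t)\<leftarrow>ps. F (y ^ i * s) (t * \<gamma> i))" for F :: "'c \<Rightarrow> 'c \<Rightarrow> 'c"
    unfolding ps'_def sum_list_concat_map_upt
    by (intro sum.cong HOL.refl arg_cong[of _ _ sum_list]) (auto intro!: map_cong)
  have ps'K: "set ps' \<subseteq> K \<times> K" using ps yK gam mK by (fastforce simp: ps'_def)
  moreover have "(\<Sum>(s, t)\<leftarrow>ps'. s * t) = 1"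
  proof -
    have "(\<Sum>(s, t)\<leftarrow>ps'. s * t) = (\<Sum>i<N. y ^ i * \<gamma> i * (\<Sum>(s, t)\<leftarrow>ps. s * t))"
      unfolding sum' sum_list_pair_mult[symmetric] by (simp add: mult_ac)
    also have "\<dots> = D * (\<Sum>i<N. coeff Q i * y ^ i)" unfolding one by (simp add: \<gamma>_def sum_distrib_left mult_ac)
    also have "(\<Sum>i<N. coeff Q i * y ^ i) = poly Q y" by (simp add: poly_altdef N_def lessThan_Suc_atMost)
    finally show ?thesis using gd Qy by (simp add: D_def)
  qed
  moreover have "commutes ps' a" if a: "a \<in> K" "commutes ps a" for a
    unfolding commutes_def
  proof (intro allI impI)
    fix \<beta> assume \<beta>: "balanced \<beta>"
    show "(\<Sum>(s, t)\<leftarrow>ps'. \<beta> (a * s) t) = (\<Sum>(s, t)\<leftarrow>ps'. \<beta> s (a * t))"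
      unfolding sum'
    proof (rule sum.cong[OF HOL.refl])
      fix i
      show "(\<Sum>(s, t)\<leftarrow>ps. \<beta> (a * (y ^ i * s)) (t * \<gamma> i)) = (\<Sum>(s, t)\<leftarrow>ps. \<beta> (y ^ i * s) (a * (t * \<gamma> i)))"
        using commutesD[OF a(2) balanced_mult[OF \<beta> yK[of i] gam[of i]]] by (simp add: mult_ac)
    qed
  qed
  moreover have "commutes ps' y" unfolding commutes_def
  proof (intro allI impI)
    fix \<beta> assume \<beta>: "balanced \<beta>"
    \<comment> \<open>\<open>Bf i c\<close> is the value of \<open>\<beta>\<close> on
      \<open>(y^i \<otimes> c) e\<close>. In the difference of both sides the relation between the
      coefficients of \<open>g\<close> and \<open>Q\<close> turns neighbouring terms into
      \<open>Bf i (coeff g i * D)\<close>; the coefficients of \<open>g\<close> lie in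
      \<open>L\<close>, so they can be moved to the left factor, where they add up to
      \<open>g(y) = 0\<close>.\<close>
    define Bf where "Bf i c = (\<Sum>(s, t)\<leftarrow>ps. \<beta> (y ^ i * s) (t * c))" for i c
    have Bdiff: "Bf i (c - c') = Bf i c - Bf i c'" if "c \<in> K" "c' \<in> K" for i c c'
      unfolding Bf_def sum_list_pair_diff[symmetric]
      by (rule sum_list_pair_cong[OF ps])
       (use balanced_diff[OF \<beta>] yK that mK in \<open>auto simp: right_diff_distrib\<close>)
    have B0: "Bf i 0 = 0" for i using Bdiff[of 0 0 i] subring_of_0[OF Kr] by simp
    have Bg: "Bf i (coeff g i * D) = (\<Sum>(s, t)\<leftarrow>ps. \<beta> (coeff g i * y ^ i * s) (t * D))" for i
    proof -
      have "commutes ps (coeff g i)" using gL(1) polys_over_coeff[of g L i] by (auto simp: L_def)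
      from commutesD[OF this balanced_mult[OF \<beta> yK[of i] DK]] show ?thesis
        by (simp add: Bf_def mult_ac)
    qed
    have "(\<Sum>(s, t)\<leftarrow>ps'. \<beta> (y * s) t) - (\<Sum>(s, t)\<leftarrow>ps'. \<beta> s (y * t))
        = (\<Sum>i<N. Bf (Suc i) (\<gamma> i)) - (\<Sum>i<N. Bf i (y * \<gamma> i))"
      unfolding sum' Bf_def by (simp add: mult_ac)
    \<comment> \<open>The added term vanishes because \<open>N\<close> exceeds the degree of
      \<open>Q\<close>; it makes room for the index shift.\<close>
    also have "(\<Sum>i<N. Bf i (y * \<gamma> i)) = (\<Sum>i<Suc N. Bf i (y * \<gamma> i))"
      by (simp add: \<gamma>_def N_def coeff_eq_0 B0)
    also have "\<dots> = Bf 0 (y * \<gamma> 0) + (\<Sum>i<N. Bf (Suc i) (y * \<gamma> (Suc i)))"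
      by (rule sum.lessThan_Suc_shift)
    also have "(\<Sum>i<N. Bf (Suc i) (\<gamma> i)) - (Bf 0 (y * \<gamma> 0) + (\<Sum>i<N. Bf (Suc i) (y * \<gamma> (Suc i))))
        = (Bf 0 0 - Bf 0 (y * \<gamma> 0)) + (\<Sum>i<N. Bf (Suc i) (\<gamma> i) - Bf (Suc i) (y * \<gamma> (Suc i)))"
      by (simp add: sum_subtractf B0)
    also have "\<dots> = Bf 0 (coeff g 0 * D) + (\<Sum>i<N. Bf (Suc i) (coeff g (Suc i) * D))"
    proof -
      have "Bf 0 0 - Bf 0 (y * \<gamma> 0) = Bf 0 (0 - y * \<gamma> 0)"
        by (rule Bdiff[symmetric]) (use gam y mK subring_of_0[OF Kr] in auto)
      also have "0 - y * \<gamma> 0 = coeff g 0 * D" by (simp add: g0 \<gamma>_def)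
      finally have 1: "Bf 0 0 - Bf 0 (y * \<gamma> 0) = Bf 0 (coeff g 0 * D)" .
      have "Bf (Suc i) (\<gamma> i) - Bf (Suc i) (y * \<gamma> (Suc i)) = Bf (Suc i) (coeff g (Suc i) * D)" for i
      proof -
        have "Bf (Suc i) (\<gamma> i) - Bf (Suc i) (y * \<gamma> (Suc i)) = Bf (Suc i) (\<gamma> i - y * \<gamma> (Suc i))"
          by (rule Bdiff[symmetric]) (use gam y mK in auto)
        also have "\<gamma> i - y * \<gamma> (Suc i) = coeff g (Suc i) * D"
          by (simp add: gS \<gamma>_def algebra_simps)
        finally show ?thesis .
      qed
      with 1 show ?thesis by simp
    qed
    also have "\<dots> = (\<Sum>i<Suc N. Bf i (coeff g i * D))"
      by (rule sum.lessThan_Suc_shift[symmetric])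
    also have "\<dots> = (\<Sum>(s, t)\<leftarrow>ps. \<Sum>i<Suc N. \<beta> (coeff g i * y ^ i * s) (t * D))"
      unfolding Bg by (rule sum_list_pair_sum)
    also have "\<dots> = (\<Sum>(s, t)\<leftarrow>ps. 0)"
    proof (rule sum_list_pair_cong[OF ps])
      fix s t assume st: "s \<in> K" "t \<in> K"
      have "(\<Sum>i<Suc N. \<beta> (coeff g i * y ^ i * s) (t * D)) = \<beta> (\<Sum>i<Suc N. coeff g i * y ^ i * s) (t * D)"
        by (rule balanced_sum_left[OF \<beta>, symmetric]) (use st DK gK yK mK in auto)
      also have "(\<Sum>i<Suc N. coeff g i * y ^ i * s) = poly g y * s"
      proof -
        have "degree g \<le> N" unfolding gQ N_def using degree_mult_le[of "[:-y,1:]" Q] by simp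
        then have "poly g y = (\<Sum>i\<le>N. coeff g i * y ^ i)"
          unfolding poly_altdef by (intro sum.mono_neutral_left) (auto simp: coeff_eq_0)
        then show ?thesis by (simp add: lessThan_Suc_atMost sum_distrib_right)
      qed
      finally show "(\<Sum>i<Suc N. \<beta> (coeff g i * y ^ i * s) (t * D)) = 0"
        using gL st DK mK balanced_0[OF \<beta>] by simp
    qed
    also have "\<dots> = 0" by (induction ps) auto
    finally show "(\<Sum>(s, t)\<leftarrow>ps'. \<beta> (y * s) t) = (\<Sum>(s, t)\<leftarrow>ps'. \<beta> s (y * t))" by simp
  qed
  ultimately show ?thesis by blast
qed

end

text \<open>Gaussian elimination, by induction on the number of equations: an unknown with nonzero
  coefficient in one equation is eliminated from the others. All divisions take place in
  \<open>k\<close>, so the solution has its entries there.\<close>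

lemma homogeneous_system_solution:
  fixes k :: "'c::field set"
  assumes k: "subfield_of k" and I: "finite I"
  shows "finite J \<Longrightarrow> card I < card J \<Longrightarrow> (\<And>i j. i \<in> I \<Longrightarrow> j \<in> J \<Longrightarrow> a i j \<in> k) \<Longrightarrow>
    \<exists>x. (\<forall>j\<in>J. x j \<in> k) \<and> (\<exists>j\<in>J. x j \<noteq> 0) \<and> (\<forall>i\<in>I. (\<Sum>j\<in>J. a i j * x j) = 0)"
  using I
proof (induction I arbitrary: J a rule: finite_induct)
  case empty
  then have "J \<noteq> {}" by auto
  then show ?case using subring_of_1[OF subfield_of_subring[OF k]] by (intro exI[of _ "\<lambda>_. 1"]) auto
next
  case (insert i I)
  note kr = subfield_of_subring[OF k]
  show ?case
  proof (cases "\<forall>j\<in>J. a i j = 0")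
    case True
    have "card I < card J" using insert by simp
    then obtain x where "\<forall>j\<in>J. x j \<in> k" "\<exists>j\<in>J. x j \<noteq> 0" "\<forall>i\<in>I. (\<Sum>j\<in>J. a i j * x j) = 0"
      using insert.IH[of J a] insert.prems by blast
    then show ?thesis using True by (intro exI[of _ x]) auto
  next
    case False
    then obtain p where p: "p \<in> J" "a i p \<noteq> 0" by auto
    define J' where "J' = J - {p}"
    define a' where "a' l j = a l j - a l p * (a i j / a i p)" for l j
    have "finite J'" "card I < card J'" using insert p by (auto simp: J'_def)
    moreover have "a' l j \<in> k" if "l \<in> I" "j \<in> J'" for l j
      unfolding a'_def using insert.prems(3) that p
      by (intro subring_rules kr subfield_of_divide k) (auto simp: J'_def)
    ultimately obtain x where x: "\<forall>j\<in>J'. x j \<in> k" "\<exists>j\<in>J'. x j \<noteq> 0" "\<forall>l\<in>I. (\<Sum>j\<in>J'. a' l j * x j) = 0"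
      using insert.IH[of J' a'] by blast
    define s where "s = (\<Sum>j\<in>J'. a i j * x j)"
    define x' where "x' = x(p := - s / a i p)"
    have sum: "(\<Sum>j\<in>J. a l j * x' j) = (\<Sum>j\<in>J'. a l j * x j) - a l p * (s / a i p)" for l
    proof -
      have "(\<Sum>j\<in>J. a l j * x' j) = a l p * x' p + (\<Sum>j\<in>J'. a l j * x' j)"
        unfolding J'_def using p insert.prems(1) by (simp add: sum.remove)
      also have "(\<Sum>j\<in>J'. a l j * x' j) = (\<Sum>j\<in>J'. a l j * x j)"
        by (rule sum.cong) (auto simp: x'_def J'_def)
      finally show ?thesis by (simp add: x'_def)
    qed
    have "(\<Sum>j\<in>J. a i j * x' j) = 0" unfolding sum using p by (simp add: s_def)
    moreover have "(\<Sum>j\<in>J. a l j * x' j) = 0" if "l \<in> I" for l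
    proof -
      have "(\<Sum>j\<in>J'. a' l j * x j) = (\<Sum>j\<in>J'. a l j * x j) - a l p * (s / a i p)"
        unfolding s_def sum_divide_distrib sum_distrib_left
        by (subst sum_subtractf[symmetric], rule sum.cong) (auto simp: a'_def left_diff_distrib)
      then show ?thesis unfolding sum using x that by auto
    qed
    moreover have "s \<in> k" unfolding s_def
      by (intro subring_rules kr) (use x insert.prems(3) in \<open>auto simp: J'_def\<close>)
    then have "- s / a i p \<in> k" using insert.prems(3) p
      by (intro subfield_of_divide[OF k] subring_of_uminus[OF kr]) auto
    then have "\<forall>j\<in>J. x' j \<in> k" using x by (auto simp: x'_def J'_def)
    moreover have "\<exists>j\<in>J. x' j \<noteq> 0" using x(2) by (auto simp: x'_def J'_def)
    ultimately show ?thesis by auto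
  qed
qed

section \<open>Modules over a principal ideal domain and integrality of the trace\<close>

locale finite_ext = field_ext +
  fixes R :: "'a::field set"
  assumes R: "subring_of R" and Rk: "R \<subseteq> k" and pid: "principal_ideals R"
    and frac: "\<And>c. c \<in> k \<Longrightarrow> \<exists>r\<in>R. r \<noteq> 0 \<and> r * c \<in> R"
    and ex_basis: "\<exists>B. is_basis k K B"
begin

lemma common_denominator:
  assumes "finite S" "S \<subseteq> k" shows "\<exists>r\<in>R. r \<noteq> 0 \<and> (\<forall>c\<in>S. r * c \<in> R)"
  using assms
proof (induction S rule: finite_induct)
  case empty
  then show ?case using subring_of_1[OF R] by (intro bexI[of _ 1]) auto
next
  case (insert x S)
  then obtain r r' where r: "r \<in> R" "r \<noteq> 0" "\<forall>c\<in>S. r * c \<in> R" and r': "r' \<in> R" "r' \<noteq> 0" "r' * x \<in> R"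
    using frac[of x] by auto
  have "r * r' * x \<in> R" using subring_of_mult[OF R r(1) r'(3)] by (simp add: mult.assoc)
  moreover have "r * r' * c \<in> R" if "c \<in> S" for c
    using subring_of_mult[OF R r'(1), of "r * c"] r(3) that by (simp add: mult_ac)
  ultimately show ?case using r r' subring_of_mult[OF R] by (intro bexI[of _ "r * r'"]) auto
qed

lemma exists_frame: "\<exists>n m \<psi>. frame n m \<psi>"
proof -
  obtain B where B: "is_basis k K B" using ex_basis by auto
  then have "finite B" by (simp add: is_basis_def)
  then obtain h and n :: nat where "bij_betw h {..<n} B"
    using ex_bij_betw_nat_finite[of B] unfolding atLeast0LessThan by blast
  then show ?thesis using frame_of_basis[OF B] by blast
qed

text \<open>A module that embeds into \<open>R^n\<close> by \<open>n\<close> functionals is free.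
  The values of the last functional form an ideal, generated by its value at some \<open>m0\<close>;
  if that is nonzero, \<open>m0\<close> splits off and the kernel is treated by induction. The
  coordinates come out as functionals on all of \<open>K\<close>, which lets them be represented by
  the trace.\<close>

lemma exists_dual_basis:
  fixes n :: nat
  assumes M: "M \<subseteq> K" "0 \<in> M" "\<And>x y. x \<in> M \<Longrightarrow> y \<in> M \<Longrightarrow> x + y \<in> M" "\<And>r x. r \<in> R \<Longrightarrow> x \<in> M \<Longrightarrow> r * x \<in> M"
    and \<phi>: "\<And>j. j < n \<Longrightarrow> functional (\<phi> j)" "\<And>j x. j < n \<Longrightarrow> x \<in> M \<Longrightarrow> \<phi> j x \<in> R"
    and inj: "\<And>x. x \<in> M \<Longrightarrow> (\<And>j. j < n \<Longrightarrow> \<phi> j x = 0) \<Longrightarrow> x = 0"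
  shows "\<exists>(l::nat) m \<psi>. (\<forall>i<l. m i \<in> M \<and> functional (\<psi> i) \<and> (\<forall>x\<in>M. \<psi> i x \<in> R)) \<and>
      (\<forall>x\<in>M. x = (\<Sum>i<l. \<psi> i x * m i)) \<and> (\<forall>i<l. \<forall>j<l. \<psi> i (m j) = (if i = j then 1 else 0))"
  using M \<phi> inj
proof (induction n arbitrary: M)
  case 0
  then show ?case by (intro exI[of _ 0]) auto
next
  case (Suc n)
  define I where "I = \<phi> n ` M"
  have fn: "functional (\<phi> n)" using Suc.prems by auto
  have "I \<subseteq> R" using Suc.prems by (auto simp: I_def)
  moreover have "0 \<in> I" unfolding I_def using functional_0[OF fn] Suc.prems(2) by (metis imageI)
  moreover have "x + y \<in> I" if xy: "x \<in> I" "y \<in> I" for x y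
  proof -
    obtain x' y' where "x' \<in> M" "y' \<in> M" "x = \<phi> n x'" "y = \<phi> n y'" using xy by (auto simp: I_def)
    then show ?thesis unfolding I_def
      using functionalD(2)[OF fn, of x' y'] Suc.prems(1) Suc.prems(3)[of x' y'] by (metis imageI subsetD)
  qed
  moreover have "r * x \<in> I" if rx: "r \<in> R" "x \<in> I" for r x
  proof -
    obtain x' where "x' \<in> M" "x = \<phi> n x'" using rx by (auto simp: I_def)
    then show ?thesis unfolding I_def
      using functionalD(3)[OF fn, of x' r] Suc.prems(1) Suc.prems(4)[of r x'] rx Rk by (metis imageI subsetD)
  qed
  ultimately have "\<exists>g\<in>I. \<forall>x\<in>I. \<exists>r\<in>R. x = r * g"
    by (intro pid[unfolded principal_ideals_def, THEN spec[of _ I], THEN mp, THEN mp] conjI ballI)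
  then obtain m0 where m0: "m0 \<in> M" "\<And>x. x \<in> M \<Longrightarrow> \<exists>r\<in>R. \<phi> n x = r * \<phi> n m0" by (auto simp: I_def)
  define g where "g = \<phi> n m0"
  have m0K: "m0 \<in> K" using m0 Suc.prems by auto
  show ?case
  proof (cases "g = 0")
    case True
    then have z: "\<phi> n x = 0" if "x \<in> M" for x using m0(2)[OF that] by (auto simp: g_def)
    show ?thesis
    proof (rule Suc.IH)
      show "x = 0" if "x \<in> M" "\<And>j. j < n \<Longrightarrow> \<phi> j x = 0" for x
        by (rule Suc.prems(7)) (use z that in \<open>auto simp: less_Suc_eq\<close>)
    qed (use Suc.prems in auto)
  next
    case False
    define M' where "M' = {x \<in> M. \<phi> n x = 0}"
    have "\<exists>(l::nat) m \<psi>. (\<forall>i<l. m i \<in> M' \<and> functional (\<psi> i) \<and> (\<forall>x\<in>M'. \<psi> i x \<in> R)) \<and>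
      (\<forall>x\<in>M'. x = (\<Sum>i<l. \<psi> i x * m i)) \<and> (\<forall>i<l. \<forall>j<l. \<psi> i (m j) = (if i = j then 1 else 0))"
    proof (rule Suc.IH)
      show "M' \<subseteq> K" "0 \<in> M'" using Suc.prems functional_0[OF fn] by (auto simp: M'_def)
      show "x + y \<in> M'" if "x \<in> M'" "y \<in> M'" for x y
        using that Suc.prems(1,3) functionalD(2)[OF fn] by (auto simp: M'_def subset_iff)
      show "r * x \<in> M'" if "r \<in> R" "x \<in> M'" for r x
        using that Suc.prems(1,4) functionalD(3)[OF fn] Rk by (auto simp: M'_def subset_iff)
      show "functional (\<phi> j)" "x \<in> M' \<Longrightarrow> \<phi> j x \<in> R" if "j < n" for j x
        using Suc.prems that by (auto simp: M'_def)
      show "x = 0" if "x \<in> M'" "\<And>j. j < n \<Longrightarrow> \<phi> j x = 0" for x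
        using Suc.prems(7)[of x] that by (auto simp: M'_def less_Suc_eq)
    qed
    then obtain l :: nat and m \<psi> where
      "\<forall>i<l. m i \<in> M' \<and> functional (\<psi> i) \<and> (\<forall>x\<in>M'. \<psi> i x \<in> R)"
      "\<forall>x\<in>M'. x = (\<Sum>i<l. \<psi> i x * m i)" "\<forall>i<l. \<forall>j<l. \<psi> i (m j) = (if i = j then 1 else 0)"
      by (elim exE conjE) (rule that)
    note IH = this(1)[THEN spec, THEN mp] this(2)[THEN bspec] this(3)[THEN spec, THEN mp, THEN spec, THEN mp]
    \<comment> \<open>The coordinate along \<open>m0\<close>; on \<open>M\<close> it has values in
      \<open>R\<close> because \<open>g\<close> generates the ideal of values. The map
      \<open>\<pi>\<close> below subtracts this component and lands in the kernel.\<close>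
    define \<kappa> where "\<kappa> x = \<phi> n x / g" for x
    have gk: "g \<in> k" using functionalD(1)[OF fn m0K] by (simp add: g_def)
    have chi: "functional \<kappa>" unfolding functional_def \<kappa>_def
      using functionalD[OF fn] subfield_of_divide[OF k _ gk] by (auto simp: add_divide_distrib)
    have chiR: "\<kappa> x \<in> R" if "x \<in> M" for x using m0(2)[OF that] False by (auto simp: \<kappa>_def g_def)
    define \<pi> where "\<pi> x = x - \<kappa> x * m0" for x
    have piK: "\<pi> x \<in> K" if "x \<in> K" for x unfolding \<pi>_def using that m0K functionalD(1)[OF chi that] kK
      by (auto intro!: subring_rules Kr)
    have piM: "\<pi> x \<in> M'" if "x \<in> M" for x
    proof -
      have xK: "x \<in> K" using that Suc.prems by auto
      have "- \<kappa> x \<in> R" using chiR[OF that] subring_of_uminus[OF R] by auto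
      then have "x + (- \<kappa> x) * m0 \<in> M" using Suc.prems(3,4) that m0 by blast
      moreover have "\<phi> n (\<pi> x) = \<phi> n x - \<phi> n (\<kappa> x * m0)"
        unfolding \<pi>_def by (rule functional_diff[OF fn xK]) (use functionalD(1)[OF chi xK] kK m0K subring_of_mult[OF Kr] in auto)
      moreover have "\<phi> n (\<kappa> x * m0) = \<kappa> x * g"
        unfolding g_def by (rule functionalD(3)[OF fn m0K functionalD(1)[OF chi xK]])
      ultimately show ?thesis using False by (simp add: M'_def \<pi>_def \<kappa>_def)
    qed
    define m' where "m' = m(l := m0)"
    define \<psi>' where "\<psi>' i = (if i = l then \<kappa> else (\<lambda>x. \<psi> i (\<pi> x)))" for i
    have pi_add: "\<pi> (x + y) = \<pi> x + \<pi> y" if "x \<in> K" "y \<in> K" for x y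
      using functionalD(2)[OF chi] that by (simp add: \<pi>_def algebra_simps)
    have pi_mult: "\<pi> (c * x) = c * \<pi> x" if "x \<in> K" "c \<in> k" for x c
      using functionalD(3)[OF chi that] by (simp add: \<pi>_def right_diff_distrib mult.assoc)
    have 1: "functional (\<psi>' i)" if "i < Suc l" for i
    proof (cases "i = l")
      case True then show ?thesis using chi by (simp add: \<psi>'_def)
    next
      case False
      then have f: "functional (\<psi> i)" using IH that by auto
      have "functional (\<lambda>x. \<psi> i (\<pi> x))" unfolding functional_def
        using functionalD[OF f] piK by (auto simp: pi_add pi_mult)
      then show ?thesis using False by (simp add: \<psi>'_def)
    qed
    have 2: "m' i \<in> M" "\<forall>x\<in>M. \<psi>' i x \<in> R" if "i < Suc l" for i
      using that IH(1)[of i] m0 chiR piM by (auto simp: m'_def \<psi>'_def M'_def)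
    have 3: "x = (\<Sum>i<Suc l. \<psi>' i x * m' i)" if "x \<in> M" for x
    proof -
      have "(\<Sum>i<l. \<psi>' i x * m' i) = (\<Sum>i<l. \<psi> i (\<pi> x) * m i)"
        by (rule sum.cong) (auto simp: \<psi>'_def m'_def)
      also have "\<dots> = \<pi> x" using IH(2)[OF piM[OF that]] by simp
      finally show ?thesis by (simp add: \<psi>'_def m'_def \<pi>_def)
    qed
    have chim0: "\<kappa> m0 = 1" using False by (simp add: \<kappa>_def g_def)
    have 4: "\<psi>' i (m' j) = (if i = j then 1 else 0)" if "i < Suc l" "j < Suc l" for i j
    proof (cases "j = l")
      case True
      have "\<pi> m0 = 0" using chim0 by (simp add: \<pi>_def)
      then show ?thesis using True chim0 IH(1)[of i] that functional_0[of "\<psi> i"] by (auto simp: \<psi>'_def m'_def)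
    next
      case False
      then have "m j \<in> M'" using IH(1)[of j] that by auto
      then have c: "\<kappa> (m j) = 0" by (simp add: \<kappa>_def M'_def)
      then have "\<pi> (m j) = m j" by (simp add: \<pi>_def)
      then show ?thesis using False c IH(3)[of i j] that by (auto simp: \<psi>'_def m'_def)
    qed
    show ?thesis using 1 2 3 4 by (intro exI[of _ "Suc l"] exI[of _ m'] exI[of _ \<psi>']) auto
  qed
qed

lemma tr_functional: "functional tr"
proof -
  obtain n m \<psi> where f: "frame n m \<psi>" using exists_frame by blast
  note tf = field_trace_frame[OF f ex_basis]
  note mK = subring_of_mult[OF Kr]
  show ?thesis unfolding functional_def
  proof (intro conjI ballI)
    fix x assume x: "x \<in> K"
    show "tr x \<in> k" unfolding tf[OF x]
      by (intro subring_of_sum[OF kr] functionalD(1)[OF frameD(2)[OF f]]) (use frameD[OF f] mK x in auto)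
    show "tr (x + y) = tr x + tr y" if "y \<in> K" for y
      unfolding tf[OF x] tf[OF that] tf[OF subring_of_add[OF Kr x that]] sum.distrib[symmetric] distrib_right
      by (intro sum.cong HOL.refl functionalD(2)[OF frameD(2)[OF f]]) (use frameD[OF f] mK x that in auto)
    show "tr (c * x) = c * tr x" if "c \<in> k" for c
    proof -
      have "c * x \<in> K" using that kK x mK by auto
      then show ?thesis unfolding tf[OF x] tf[OF \<open>c * x \<in> K\<close>] sum_distrib_left mult.assoc
        by (intro sum.cong HOL.refl functionalD(3)[OF frameD(2)[OF f]]) (use frameD[OF f] mK x that in auto)
    qed
  qed
qed

text \<open>Since \<open>x\<close> is integral, the \<open>R[x]\<close>-module spanned by a frame is
  finitely generated over \<open>R\<close>, hence free; in a basis of it multiplication by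
  \<open>x\<close> has a matrix over \<open>R\<close>, whose trace is \<open>tr x\<close>.\<close>

lemma tr_integral:
  assumes x: "x \<in> K" and int: "integral_over R x"
  shows "tr x \<in> R"
proof -
  note mK = subring_of_mult[OF Kr]
  obtain n b \<phi> where f: "frame n b \<phi>" using exists_frame by blast
  obtain P where P: "P \<in> polys_over R" "lead_coeff P = 1" "poly P x = 0" using int by (auto simp: integral_over_def)
  define D where "D = degree P"
  have RK: "R \<subseteq> K" using Rk kK by auto
  have reduce: "\<exists>p'\<in>polys_over R. poly p x = poly p' x \<and> (\<forall>i\<ge>D. coeff p' i = 0)" if p: "p \<in> polys_over R" for p
  proof -
    have "P \<noteq> 0" using P by auto
    moreover have "inverse (lead_coeff P) \<in> R" using P subring_of_1[OF R] by simp
    ultimately obtain h r where hr: "h \<in> polys_over R" "r \<in> polys_over R" "p = P * h + r" "r = 0 \<or> degree r < degree P"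
      using poly_division_over[OF R P(1) _ _ p] by blast
    then show ?thesis using P by (intro bexI[of _ r]) (auto simp: D_def coeff_eq_0)
  qed
  \<comment> \<open>Modulo the monic equation only powers below \<open>D\<close> occur, so finitely
    many coordinate values generate all values on \<open>M\<close>. Their common denominator
    \<open>\<rho>\<close> makes the functionals \<open>R\<close>-valued on \<open>M\<close>, as the
    freeness lemma demands.\<close>
  define S where "S = (\<lambda>(j, i, j'). \<phi> j (x ^ i * b j')) ` ({..<n} \<times> {..<D} \<times> {..<n})"
  have xiK: "x ^ i * b j \<in> K" if "j < n" for i j using that x frameD[OF f] mK subring_of_power[OF Kr] by auto
  have "finite S" by (simp add: S_def)
  moreover have "S \<subseteq> k" using xiK functionalD(1)[OF frameD(2)[OF f]] by (auto simp: S_def)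
  ultimately obtain \<rho> where rho: "\<rho> \<in> R" "\<rho> \<noteq> 0" "\<forall>c\<in>S. \<rho> * c \<in> R" using common_denominator by blast
  define M where "M = {y. \<exists>p. (\<forall>j<n. p j \<in> polys_over R) \<and> y = (\<Sum>j<n. poly (p j) x * b j)}"
  have pK: "poly p x \<in> K" if "p \<in> polys_over R" for p
    using poly_in_subring[OF Kr _ x] polys_over_mono[OF RK] that by blast
  have "\<exists>(l::nat) m \<psi>. (\<forall>i<l. m i \<in> M \<and> functional (\<psi> i) \<and> (\<forall>x\<in>M. \<psi> i x \<in> R)) \<and>
      (\<forall>x\<in>M. x = (\<Sum>i<l. \<psi> i x * m i)) \<and> (\<forall>i<l. \<forall>j<l. \<psi> i (m j) = (if i = j then 1 else 0))"
  proof (rule exists_dual_basis[where \<phi> = "\<lambda>j y. \<rho> * \<phi> j y" and n = n])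
    show MK: "M \<subseteq> K" using pK frameD[OF f] mK by (auto simp: M_def intro!: subring_of_sum[OF Kr])
    show "0 \<in> M" unfolding M_def by (auto intro!: exI[of _ "\<lambda>_. 0"] polys_over_0 R)
    show "y + z \<in> M" if yz: "y \<in> M" "z \<in> M" for y z
    proof -
      obtain p p' where "\<forall>j<n. p j \<in> polys_over R" "y = (\<Sum>j<n. poly (p j) x * b j)"
        "\<forall>j<n. p' j \<in> polys_over R" "z = (\<Sum>j<n. poly (p' j) x * b j)" using yz by (auto simp: M_def)
      then show ?thesis unfolding M_def
        by (auto intro!: exI[of _ "\<lambda>j. p j + p' j"] polys_over_add R simp: distrib_right sum.distrib)
    qed
    show "r * y \<in> M" if ry: "r \<in> R" "y \<in> M" for r y
    proof -
      obtain p where "\<forall>j<n. p j \<in> polys_over R" "y = (\<Sum>j<n. poly (p j) x * b j)" using ry by (auto simp: M_def)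
      then show ?thesis unfolding M_def using ry
        by (auto intro!: exI[of _ "\<lambda>j. smult r (p j)"] polys_over_smult R simp: sum_distrib_left mult.assoc)
    qed
    show "functional (\<lambda>y. \<rho> * \<phi> j y)" if "j < n" for j
      using functionalD[OF frameD(2)[OF f that]] rho Rk subring_of_mult[OF kr]
      by (auto simp: functional_def distrib_left)
    show "\<rho> * \<phi> j y \<in> R" if jy: "j < n" "y \<in> M" for j y
    proof -
      obtain p where p: "\<forall>j<n. p j \<in> polys_over R" "y = (\<Sum>j<n. poly (p j) x * b j)" using jy by (auto simp: M_def)
      have "\<forall>j<n. \<exists>p'\<in>polys_over R. poly (p j) x = poly p' x \<and> (\<forall>i\<ge>D. coeff p' i = 0)"
        using reduce p by blast
      then obtain p' where p': "\<And>j. j < n \<Longrightarrow> p' j \<in> polys_over R" "\<And>j. j < n \<Longrightarrow> poly (p j) x = poly (p' j) x"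
        "\<And>j i. j < n \<Longrightarrow> D \<le> i \<Longrightarrow> coeff (p' j) i = 0" by metis
      have "poly (p' j') x = (\<Sum>i<D. coeff (p' j') i * x ^ i)" if "j' < n" for j'
      proof -
        have "poly (p' j') x = (\<Sum>i\<le>degree (p' j'). coeff (p' j') i * x ^ i)" by (rule poly_altdef)
        also have "\<dots> = (\<Sum>i\<le>degree (p' j') + D. coeff (p' j') i * x ^ i)"
          by (rule sum.mono_neutral_left) (auto simp: coeff_eq_0)
        also have "\<dots> = (\<Sum>i<D. coeff (p' j') i * x ^ i)"
          by (rule sum.mono_neutral_right) (use p'(3)[OF that] in auto)
        finally show ?thesis .
      qed
      then have "y = (\<Sum>j'<n. \<Sum>i<D. coeff (p' j') i * (x ^ i * b j'))"
        unfolding p using p' by (simp add: sum_distrib_right mult.assoc)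
      then have "\<phi> j y = \<phi> j (\<Sum>j'<n. \<Sum>i<D. coeff (p' j') i * (x ^ i * b j'))" by simp
      also have "\<dots> = (\<Sum>j'<n. \<phi> j (\<Sum>i<D. coeff (p' j') i * (x ^ i * b j')))"
        by (rule functional_sum[OF frameD(2)[OF f jy(1)]])
          (rule subring_of_sum[OF Kr], rule mK, use xiK subsetD[OF RK polys_over_coeff[OF p'(1)]] in auto)
      also have "\<dots> = (\<Sum>j'<n. \<Sum>i<D. coeff (p' j') i * \<phi> j (x ^ i * b j'))"
        by (intro sum.cong HOL.refl functional_lin_comb[OF frameD(2)[OF f jy(1)]])
          (use xiK subsetD[OF Rk polys_over_coeff[OF p'(1)]] in auto)
      finally have "\<rho> * \<phi> j y = (\<Sum>j'<n. \<Sum>i<D. coeff (p' j') i * (\<rho> * \<phi> j (x ^ i * b j')))"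
        by (simp add: sum_distrib_left mult_ac)
      also have "\<dots> \<in> R"
        by (intro subring_of_sum[OF R], rule subring_of_mult[OF R])
          (use p' rho(3) jy(1) in \<open>auto simp: S_def polys_over_coeff\<close>)
      finally show ?thesis .
    qed
    show "y = 0" if "y \<in> M" "\<And>j. j < n \<Longrightarrow> \<rho> * \<phi> j y = 0" for y
      using frameD(3)[OF f, of y] that rho MK by auto
  qed
  then obtain l :: nat and m \<psi> where
      "\<forall>i<l. m i \<in> M \<and> functional (\<psi> i) \<and> (\<forall>x\<in>M. \<psi> i x \<in> R)" "\<forall>x\<in>M. x = (\<Sum>i<l. \<psi> i x * m i)"
    by (elim exE conjE) (rule that)
  note mp = this(1)[THEN spec, THEN mp] this(2)[THEN bspec]
  have MK: "M \<subseteq> K" using pK frameD[OF f] mK by (auto simp: M_def intro!: subring_of_sum[OF Kr])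
  have "frame l m \<psi>"
  proof (rule frame_extend[OF f])
    show "m i \<in> K \<and> functional (\<psi> i)" if "i < l" for i using mp that MK by auto
    fix j assume j: "j < n"
    have "(\<Sum>j'<n. poly (if j' = j then 1 else 0) x * b j') = (\<Sum>j'<n. if j' = j then b j' else 0)"
      by (rule sum.cong) auto
    then have "b j = (\<Sum>j'<n. poly (if j' = j then 1 else 0) x * b j')" using j by simp
    then have "b j \<in> M" unfolding M_def
      by (auto intro!: exI[of _ "\<lambda>j'. if j' = j then 1 else 0"] polys_over_0 polys_over_1 R)
    then show "(\<Sum>i<l. \<psi> i (b j) * m i) = b j" using mp(2) by metis
  qed
  then have "tr x = (\<Sum>i<l. \<psi> i (x * m i))" using field_trace_frame[OF _ ex_basis x] by blast
  also have "\<dots> \<in> R"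
  proof (intro subring_rules R)
    fix i assume i: "i \<in> {..<l}"
    then obtain p where p: "\<forall>j<n. p j \<in> polys_over R" "m i = (\<Sum>j<n. poly (p j) x * b j)"
      using mp(1)[of i] by (auto simp: M_def)
    have "x * m i = (\<Sum>j<n. poly (pCons 0 (p j)) x * b j)" unfolding p by (simp add: sum_distrib_left mult.assoc)
    then have "x * m i \<in> M" unfolding M_def using p(1)
      by (auto intro!: exI[of _ "\<lambda>j. pCons 0 (p j)"] polys_over_pCons subring_of_0 R)
    then show "\<psi> i (x * m i) \<in> R" using mp(1)[of i] i by auto
  qed
  finally show ?thesis .
qed

end

locale separable_ext = finite_ext +
  assumes sep: "\<And>x. x \<in> K \<Longrightarrow> separable_over k x"
begin

text \<open>Starting from \<open>1 \<otimes> 1\<close>, which commutes with \<open>k\<close>, the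
  members of a frame are adjoined one after the other; elements that already commute keep doing
  so.\<close>

lemma exists_separability_idempotent:
  "\<exists>ps. set ps \<subseteq> K \<times> K \<and> (\<Sum>(s, t)\<leftarrow>ps. s * t) = 1 \<and> (\<forall>a\<in>K. commutes ps a)"
proof -
  obtain n b \<phi> where f: "frame n b \<phi>" using exists_frame by blast
  have "l \<le> n \<Longrightarrow> \<exists>ps. set ps \<subseteq> K \<times> K \<and> (\<Sum>(s, t)\<leftarrow>ps. s * t) = 1 \<and> (\<forall>i<l. commutes ps (b i))" for l
  proof (induction l)
    case 0
    then show ?case using subring_of_1[OF Kr] by (intro exI[of _ "[(1, 1)]"]) auto
  next
    case (Suc l)
    then obtain ps where ps: "set ps \<subseteq> K \<times> K" "(\<Sum>(s, t)\<leftarrow>ps. s * t) = 1" "\<forall>i<l. commutes ps (b i)" by auto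
    have bl: "b i \<in> K" if "i < n" for i using frameD[OF f] that by auto
    obtain ps' where "set ps' \<subseteq> K \<times> K \<and> (\<Sum>(s, t)\<leftarrow>ps'. s * t) = 1 \<and> commutes ps' (b l) \<and>
       (\<forall>a\<in>K. commutes ps a \<longrightarrow> commutes ps' a)"
      using separability_idempotent_step[OF ps(1,2) bl[of l] sep[OF bl[of l]]] Suc.prems by auto
    then show ?case using ps bl Suc.prems by (intro exI[of _ ps']) (auto simp: less_Suc_eq)
  qed
  from this[of n] obtain ps where ps: "set ps \<subseteq> K \<times> K" "(\<Sum>(s, t)\<leftarrow>ps. s * t) = 1" "\<forall>i<n. commutes ps (b i)"
    by auto
  note C = commutes_subfield[OF ps(1)]
  have "commutes ps a" if a: "a \<in> K" for a
  proof -
    have "(\<Sum>i<n. \<phi> i a * b i) \<in> {a \<in> K. commutes ps a}"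
    proof (intro subring_of_sum subring_of_mult subfield_of_subring[OF C(1)])
      fix i assume "i \<in> {..<n}"
      then show "\<phi> i a \<in> {a \<in> K. commutes ps a}" "b i \<in> {a \<in> K. commutes ps a}"
        using C(2) functionalD(1)[OF frameD(2)[OF f]] a ps(3) frameD(1)[OF f] by auto
    qed
    then show ?thesis using frameD(3)[OF f a] by simp
  qed
  then show ?thesis using ps by blast
qed

text \<open>Moving the frame elements across the tensor turns \<open>\<Sum> tr(s) t\<close> into
  \<open>\<Sum> s t = 1\<close>; moving \<open>a\<close> across then gives the expansion of
  \<open>a\<close>. This identity contains the nondegeneracy of the trace form.\<close>

lemma exists_trace_dual:
  "\<exists>N s t. (\<forall>j<N. s j \<in> K \<and> t j \<in> K) \<and> (\<Sum>j<(N::nat). s j * t j) = 1 \<and>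
     (\<forall>a\<in>K. (\<Sum>j<N. tr (a * s j) * t j) = a)"
proof -
  note mK = subring_of_mult[OF Kr]
  obtain ps where ps: "set ps \<subseteq> K \<times> K" "(\<Sum>(s, t)\<leftarrow>ps. s * t) = 1" "\<And>a. a \<in> K \<Longrightarrow> commutes ps a"
    using exists_separability_idempotent by blast
  obtain n b \<phi> where f: "frame n b \<phi>" using exists_frame by blast
  have bal: "balanced (\<lambda>s t. \<psi> s * t)" if "functional \<psi>" for \<psi>
    unfolding balanced_def using functionalD[OF that] by (auto simp: distrib_right distrib_left)
  have "(\<Sum>(s, t)\<leftarrow>ps. tr s * t) = (\<Sum>(s, t)\<leftarrow>ps. \<Sum>i<n. \<phi> i (b i * s) * t)"
    by (rule sum_list_pair_cong[OF ps(1)])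
      (simp add: field_trace_frame[OF f ex_basis] sum_distrib_right mult.commute[of "b _"])
  also have "\<dots> = (\<Sum>i<n. \<Sum>(s, t)\<leftarrow>ps. \<phi> i (b i * s) * t)" by (rule sum_list_pair_sum[symmetric])
  also have "\<dots> = (\<Sum>i<n. \<Sum>(s, t)\<leftarrow>ps. \<phi> i s * (b i * t))"
    by (rule sum.cong[OF HOL.refl]) (use commutesD[OF ps(3) bal] frameD[OF f] in auto)
  also have "\<dots> = (\<Sum>(s, t)\<leftarrow>ps. \<Sum>i<n. \<phi> i s * (b i * t))" by (rule sum_list_pair_sum)
  also have "\<dots> = (\<Sum>(s, t)\<leftarrow>ps. s * t)"
  proof (rule sum_list_pair_cong[OF ps(1)])
    fix s t assume "s \<in> K"
    then have "(\<Sum>i<n. \<phi> i s * b i) * t = s * t" using frameD(3)[OF f] by simp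
    then show "(\<Sum>i<n. \<phi> i s * (b i * t)) = s * t" by (simp add: sum_distrib_right mult.assoc)
  qed
  finally have one: "(\<Sum>(s, t)\<leftarrow>ps. tr s * t) = 1" using ps(2) by simp
  have all: "(\<Sum>(s, t)\<leftarrow>ps. tr (a * s) * t) = a" if "a \<in> K" for a
  proof -
    have "(\<Sum>(s, t)\<leftarrow>ps. tr (a * s) * t) = (\<Sum>(s, t)\<leftarrow>ps. tr s * (a * t))"
      using commutesD[OF ps(3)[OF that] bal[OF tr_functional]] .
    also have "\<dots> = a * (\<Sum>(s, t)\<leftarrow>ps. tr s * t)"
      unfolding sum_list_pair_mult[symmetric] by (simp add: mult_ac)
    finally show ?thesis using one by simp
  qed
  have conv: "(\<Sum>(s, t)\<leftarrow>ps. F s t) = (\<Sum>j<length ps. F (fst (ps ! j)) (snd (ps ! j)))" for F :: "'a \<Rightarrow> 'a \<Rightarrow> 'a"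
    by (simp add: sum_list_sum_nth atLeast0LessThan case_prod_unfold)
  have "fst (ps ! j) \<in> K \<and> snd (ps ! j) \<in> K" if "j < length ps" for j
    using nth_mem[OF that] ps(1) by (metis mem_Times_iff subsetD)
  then show ?thesis using ps(2) all unfolding conv
    by (intro exI[of _ "length ps"] exI[of _ "\<lambda>j. fst (ps ! j)"] exI[of _ "\<lambda>j. snd (ps ! j)"]) auto
qed

end

section \<open>The codifferent and its invertibility\<close>

text \<open>\<open>A\<close> is presented as an intersection of valuation rings, besides being
  integral over \<open>R\<close>, because the Gauss lemma is applied in each of them
  separately.\<close>

locale integral_closure_ext = separable_ext +
  fixes A :: "'a set" and \<P> :: "'a set set"
  assumes A_eq: "A = {x \<in> K. \<forall>P\<in>\<P>. x \<in> P}"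
    and valuation: "\<And>P. P \<in> \<P> \<Longrightarrow> subring_of P \<and> P \<subseteq> K \<and> (\<forall>x\<in>K. x \<in> P \<or> inverse x \<in> P)"
    and RA: "R \<subseteq> A" and A_integral: "\<And>a. a \<in> A \<Longrightarrow> integral_over R a"
    and A_frac: "\<And>x. x \<in> K \<Longrightarrow> \<exists>r\<in>R. r \<noteq> 0 \<and> r * x \<in> A"
begin

definition cod :: "'a set" where "cod = {x \<in> K. \<forall>a\<in>A. tr (x * a) \<in> R}"

definition dif :: "'a set" where "dif = {y \<in> K. \<forall>x\<in>cod. y * x \<in> A}"

lemma A_subring: "subring_of A"
proof -
  have "subring_of (\<Inter>(insert K \<P>))"
    using valuation Kr unfolding subring_of_def by auto
  moreover have "\<Inter>(insert K \<P>) = A" by (auto simp: A_eq)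
  ultimately show ?thesis by simp
qed

lemma AK: "A \<subseteq> K" by (auto simp: A_eq)

lemma cod_mult: "a \<in> A \<Longrightarrow> c \<in> cod \<Longrightarrow> a * c \<in> cod"
  using AK subring_of_mult[OF Kr] subring_of_mult[OF A_subring]
  by (auto simp: cod_def mult.commute[of a] mult.assoc)

lemma cod_0: "0 \<in> cod"
  using subring_of_0[OF Kr] subring_of_0[OF R] functional_0[OF tr_functional] by (simp add: cod_def)

lemma tr_nondegenerate:
  assumes "x \<in> K" "y \<in> K" "\<And>z. z \<in> K \<Longrightarrow> tr (x * z) = tr (y * z)"
  shows "x = y"
proof -
  obtain N :: nat and s t where st: "\<forall>j<N. s j \<in> K \<and> t j \<in> K" "\<forall>a\<in>K. (\<Sum>j<N. tr (a * s j) * t j) = a"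
    using exists_trace_dual by blast
  have "x = (\<Sum>j<N. tr (x * s j) * t j)" using st(2) assms(1) by (metis (no_types, lifting))
  also have "\<dots> = (\<Sum>j<N. tr (y * s j) * t j)" by (rule sum.cong) (use st assms in auto)
  also have "\<dots> = y" using st assms by simp
  finally show ?thesis .
qed

text \<open>The trace pairings with frame elements scaled into \<open>A\<close> embed
  \<open>A\<close> into a power of \<open>R\<close>, since traces of integral elements lie in
  \<open>R\<close> and the trace form is nondegenerate. Hence \<open>A\<close> is free, and its
  coordinate functions, written as trace pairings, supply the dual basis.\<close>

lemma exists_trace_dual_basis:
  "\<exists>n a c. (\<forall>i<n. a i \<in> A \<and> c i \<in> cod) \<and> (\<forall>x\<in>K. (\<Sum>i<n. tr (c i * x) * a i) = x) \<and>
     (\<forall>i<n. \<forall>j<(n::nat). tr (c i * a j) = (if i = j then 1 else 0)) \<and>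
     (\<forall>x\<in>K. (\<Sum>i<n. tr (x * a i) * c i) = x) \<and> (\<Sum>i<n. a i * c i) = 1"
proof -
  note mK = subring_of_mult[OF Kr]
  obtain N :: nat and s t where st: "\<forall>j<N. s j \<in> K \<and> t j \<in> K" "(\<Sum>j<N. s j * t j) = 1"
    "\<forall>a\<in>K. (\<Sum>j<N. tr (a * s j) * t j) = a"
    using exists_trace_dual by blast
  obtain n b \<phi> where f: "frame n b \<phi>" using exists_frame by blast
  have "\<forall>j<n. \<exists>r\<in>R. r \<noteq> 0 \<and> r * b j \<in> A" using A_frac frameD[OF f] by auto
  then obtain \<rho> where rho: "\<And>j. j < n \<Longrightarrow> \<rho> j \<in> R" "\<And>j. j < n \<Longrightarrow> \<rho> j \<noteq> 0" "\<And>j. j < n \<Longrightarrow> \<rho> j * b j \<in> A"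
    by metis
  define \<beta> where "\<beta> j = \<rho> j * b j" for j
  have bA: "\<beta> j \<in> A" if "j < n" for j using rho that by (simp add: \<beta>_def)
  have "\<exists>(l::nat) m \<psi>. (\<forall>i<l. m i \<in> A \<and> functional (\<psi> i) \<and> (\<forall>x\<in>A. \<psi> i x \<in> R)) \<and>
      (\<forall>x\<in>A. x = (\<Sum>i<l. \<psi> i x * m i)) \<and> (\<forall>i<l. \<forall>j<l. \<psi> i (m j) = (if i = j then 1 else 0))"
  proof (rule exists_dual_basis[where \<phi> = "\<lambda>j y. tr (\<beta> j * y)" and n = n])
    show "A \<subseteq> K" "0 \<in> A" using AK subring_of_0[OF A_subring] by auto
    show "x + y \<in> A" if "x \<in> A" "y \<in> A" for x y using that subring_of_add[OF A_subring] by auto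
    show "r * x \<in> A" if "r \<in> R" "x \<in> A" for r x using that RA subring_of_mult[OF A_subring] by auto
    show "functional (\<lambda>y. tr (\<beta> j * y))" if "j < n" for j
    proof -
      have "\<beta> j \<in> K" using bA that AK by auto
      then show ?thesis using functionalD[OF tr_functional] mK kK
        by (simp add: functional_def distrib_left mult.left_commute[of "\<beta> j"])
    qed
    show "tr (\<beta> j * x) \<in> R" if "j < n" "x \<in> A" for j x
    proof -
      have "\<beta> j * x \<in> A" using that bA subring_of_mult[OF A_subring] by auto
      then show ?thesis using tr_integral A_integral AK by auto
    qed
    fix x assume x: "x \<in> A" "\<And>j. j < n \<Longrightarrow> tr (\<beta> j * x) = 0"
    then have xK: "x \<in> K" using AK by auto
    have bx: "tr (b j * x) = 0" if "j < n" for j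
    proof -
      have "b j * x \<in> K" using frameD(1)[OF f that] xK mK by auto
      then have "\<rho> j * tr (b j * x) = tr (\<beta> j * x)" using functionalD(3)[OF tr_functional, of "b j * x" "\<rho> j"]
          subsetD[OF Rk rho(1)[OF that]] by (simp add: \<beta>_def mult.assoc)
      then show ?thesis using x(2) rho that by auto
    qed
    show "x = 0"
    proof (rule tr_nondegenerate[OF xK subring_of_0[OF Kr]])
      fix z assume z: "z \<in> K"
      have "x * z = (\<Sum>j<n. \<phi> j z * (b j * x))"
      proof -
        have "x * z = x * (\<Sum>j<n. \<phi> j z * b j)" using frameD(3)[OF f z] by simp
        then show ?thesis by (simp add: sum_distrib_left mult_ac)
      qed
      also have "tr \<dots> = (\<Sum>j<n. \<phi> j z * tr (b j * x))"
        by (rule functional_lin_comb[OF tr_functional]) (use frameD[OF f] functionalD z xK mK in auto)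
      finally show "tr (x * z) = tr (0 * z)" using bx functional_0[OF tr_functional] by simp
    qed
  qed
  then obtain l :: nat and a \<psi> where
    ex: "\<forall>i<l. a i \<in> A \<and> functional (\<psi> i) \<and> (\<forall>x\<in>A. \<psi> i x \<in> R)" "\<forall>x\<in>A. x = (\<Sum>i<l. \<psi> i x * a i)"
      "\<forall>i<l. \<forall>j<l. \<psi> i (a j) = (if i = j then 1 else 0)"
    by (elim exE conjE) (rule that)
  note a = ex(1)[THEN spec, THEN mp] and aeq = ex(2)[THEN bspec]
    and adual = ex(3)[THEN spec, THEN mp, THEN spec, THEN mp]
  have aK: "a i \<in> K" if "i < l" for i using a[OF that] AK by auto
  have frA: "frame l a \<psi>"
  proof (rule frame_extend[OF f])
    show "a i \<in> K \<and> functional (\<psi> i)" if "i < l" for i using a[OF that] AK by auto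
    fix j assume j: "j < n"
    have bK: "b j \<in> K" using frameD[OF f] j by auto
    have rk: "\<rho> j \<in> k" using rho j Rk by auto
    have "\<rho> j * b j = (\<Sum>i<l. \<psi> i (\<rho> j * b j) * a i)" using aeq bA[OF j] by (simp add: \<beta>_def)
    also have "\<dots> = \<rho> j * (\<Sum>i<l. \<psi> i (b j) * a i)"
      unfolding sum_distrib_left
      by (rule sum.cong[OF HOL.refl]) (use functionalD(3)[OF _ bK rk] a in \<open>auto simp: mult.assoc\<close>)
    finally show "(\<Sum>i<l. \<psi> i (b j) * a i) = b j" using rho j by simp
  qed
  \<comment> \<open>The element representing the functional \<open>\<psi> i\<close> through the
    trace: expanding an argument \<open>x\<close> as \<open>\<Sum> tr(x s) t\<close> and applying
    \<open>\<psi> i\<close> shows \<open>tr(c i * x) = \<psi> i x\<close>.\<close>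
  define c where "c i = (\<Sum>j<N. s j * \<psi> i (t j))" for i
  have cK: "c i \<in> K" if "i < l" for i unfolding c_def
    by (intro subring_of_sum[OF Kr], rule mK) (use st functionalD(1)[of "\<psi> i"] a[OF that] kK in auto)
  have trc: "tr (c i * x) = \<psi> i x" if i: "i < l" and x: "x \<in> K" for i x
  proof -
    have fi: "functional (\<psi> i)" using a[OF i] by auto
    have "c i * x = (\<Sum>j<N. \<psi> i (t j) * (x * s j))" by (simp add: c_def sum_distrib_left sum_distrib_right mult_ac)
    also have "tr \<dots> = (\<Sum>j<N. \<psi> i (t j) * tr (x * s j))"
      by (rule functional_lin_comb[OF tr_functional]) (use functionalD(1)[OF fi] st x mK in auto)
    also have "\<dots> = (\<Sum>j<N. tr (x * s j) * \<psi> i (t j))" by (simp add: mult.commute)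
    also have "\<dots> = \<psi> i (\<Sum>j<N. tr (x * s j) * t j)"
      by (rule functional_lin_comb[OF fi, symmetric]) (use functionalD(1)[OF tr_functional] st x mK in auto)
    also have "(\<Sum>j<N. tr (x * s j) * t j) = x" using st x by auto
    finally show ?thesis .
  qed
  have 1: "\<forall>i<l. a i \<in> A \<and> c i \<in> cod"
    using a cK trc AK by (auto simp: cod_def)
  have 2: "\<forall>x\<in>K. (\<Sum>i<l. tr (c i * x) * a i) = x" using frameD(3)[OF frA] trc by simp
  have 3: "\<forall>i<l. \<forall>j<l. tr (c i * a j) = (if i = j then 1 else 0)" using trc aK adual by simp
  have 4: "(\<Sum>i<l. tr (x * a i) * c i) = x" if x: "x \<in> K" for x
  proof (rule tr_nondegenerate[OF _ x])
    show "(\<Sum>i<l. tr (x * a i) * c i) \<in> K"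
      by (intro subring_of_sum[OF Kr], rule mK) (use functionalD(1)[OF tr_functional] kK x aK cK mK in auto)
    fix z assume z: "z \<in> K"
    have "(\<Sum>i<l. tr (x * a i) * c i) * z = (\<Sum>i<l. tr (x * a i) * (c i * z))"
      by (simp add: sum_distrib_right mult.assoc)
    also have "tr \<dots> = (\<Sum>i<l. tr (x * a i) * tr (c i * z))"
      by (rule functional_lin_comb[OF tr_functional]) (use functionalD(1)[OF tr_functional] x aK cK mK z in auto)
    also have "\<dots> = (\<Sum>i<l. tr (c i * z) * tr (x * a i))" by (simp add: mult.commute)
    also have "\<dots> = tr (\<Sum>i<l. tr (c i * z) * (x * a i))"
      by (rule functional_lin_comb[OF tr_functional, symmetric]) (use functionalD(1)[OF tr_functional] x aK cK mK z in auto)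
    also have "(\<Sum>i<l. tr (c i * z) * (x * a i)) = x * (\<Sum>i<l. tr (c i * z) * a i)"
      by (simp add: sum_distrib_left mult_ac)
    finally show "tr ((\<Sum>i<l. tr (x * a i) * c i) * z) = tr (x * z)" using 2 z by simp
  qed
  have "(\<Sum>i<l. a i * c i) = (\<Sum>i<l. \<Sum>j<N. \<psi> i (t j) * a i * s j)"
    by (simp add: c_def sum_distrib_left mult_ac)
  also have "\<dots> = (\<Sum>j<N. (\<Sum>i<l. \<psi> i (t j) * a i) * s j)"
    by (subst sum.swap) (simp add: sum_distrib_right)
  also have "\<dots> = (\<Sum>j<N. t j * s j)" by (rule sum.cong) (use frameD(3)[OF frA] st in auto)
  also have "\<dots> = 1" using st by (simp add: mult.commute)
  finally have 5: "(\<Sum>i<l. a i * c i) = 1" .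
  show ?thesis using 1 2 3 4 5 by (intro exI[of _ l] exI[of _ a] exI[of _ c]) auto
qed

text \<open>Linear algebra in place of a norm: requiring all coordinates of \<open>f g\<close>
  except the one along \<open>a 0\<close> to vanish is a homogeneous system for the coordinates of
  \<open>g\<close>, and dividing by \<open>a 0\<close> at the end brings the coefficients into
  \<open>k\<close>.\<close>

lemma exists_multiple_over_base:
  assumes f: "f \<in> polys_over K" "f \<noteq> 0"
  shows "\<exists>g\<in>polys_over K. f * g \<in> polys_over k \<and> f * g \<noteq> 0"
proof -
  note mK = subring_of_mult[OF Kr]
  obtain n :: nat and a c where ac: "\<forall>i<n. a i \<in> A \<and> c i \<in> cod" "\<forall>x\<in>K. (\<Sum>i<n. tr (c i * x) * a i) = x"
    "\<forall>i<n. \<forall>j<n. tr (c i * a j) = (if i = j then 1 else 0)"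
    using exists_trace_dual_basis by blast
  have aK: "a i \<in> K" and cK: "c i \<in> K" if "i < n" for i using ac(1) that AK by (auto simp: cod_def)
  have fi: "functional (\<lambda>x. tr (c i * x))" if "i < n" for i
    using functionalD[OF tr_functional] mK kK cK[OF that]
    by (simp add: functional_def distrib_left mult.left_commute[of "c i"])
  have n0: "n > 0"
  proof (rule ccontr)
    assume "\<not> n > 0"
    then have "(1::'a) = 0" using ac(2) subring_of_1[OF Kr] by auto
    then show False by simp
  qed
  define m where "m = degree f"
  \<comment> \<open>The unknowns are the \<open>n D\<close> coordinates of a \<open>g\<close> of
    degree below \<open>D\<close>, and there are \<open>(n - 1) (D + m)\<close> equations; any
    \<open>D > (n - 1) m\<close> leaves more unknowns than equations.\<close>
  define D where "D = Suc (n * m)"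
  define I where "I = {1..<n} \<times> {..<D + m}"
  define J where "J = {..<D} \<times> {..<n}"
  define w where "w = (\<lambda>(i, l) (d, j). tr (c i * ((if d \<le> l then coeff f (l - d) else 0) * a j)))"
  have cf: "(if d \<le> l then coeff f (l - d) else 0) * a j \<in> K" if "j < n" for d l j
    by (rule mK[OF _ aK[OF that]]) (use f(1) polys_over_coeff subring_of_0[OF Kr] in auto)
  have "finite I" "finite J" by (auto simp: I_def J_def)
  moreover have "card I < card J"
  proof -
    obtain n' where n': "n = Suc n'" using n0 by (metis gr0_implies_Suc)
    have "card I = n' * (D + m)" "card J = D * Suc n'" by (auto simp: I_def J_def n')
    moreover have "n' * m < D" by (simp add: D_def n')
    ultimately show ?thesis by (simp add: algebra_simps)
  qed
  moreover have "w i j \<in> k" if "i \<in> I" "j \<in> J" for i j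
    using that cf functionalD(1)[OF fi] by (auto simp: I_def J_def w_def)
  ultimately obtain x where x: "\<forall>j\<in>J. x j \<in> k" "\<exists>j\<in>J. x j \<noteq> 0" "\<forall>i\<in>I. (\<Sum>j\<in>J. w i j * x j) = 0"
    using homogeneous_system_solution[OF k, of I J w] by blast
  define g where "g = (\<Sum>(d, j)\<in>J. monom (x (d, j) * a j) d)"
  have xk: "x (d, j) \<in> k" if "d < D" "j < n" for d j using x(1) that by (auto simp: J_def)
  have cg: "coeff g d = (\<Sum>j<n. x (d, j) * a j)" if "d < D" for d
  proof -
    have "coeff g d = (\<Sum>p\<in>J. if fst p = d then x p * a (snd p) else 0)"
      by (simp add: g_def coeff_sum case_prod_unfold)
    also have "\<dots> = (\<Sum>d'<D. \<Sum>j<n. if d' = d then x (d', j) * a j else 0)"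
      by (auto simp: J_def sum.cartesian_product intro!: sum.cong)
    also have "\<dots> = (\<Sum>d'<D. if d' = d then (\<Sum>j<n. x (d', j) * a j) else 0)"
      by (intro sum.cong HOL.refl) auto
    also have "\<dots> = (\<Sum>j<n. x (d, j) * a j)" using that by simp
    finally show ?thesis .
  qed
  have gK: "g \<in> polys_over K" unfolding g_def
  proof -
    have "monom (x p * a (snd p)) (fst p) \<in> polys_over K" if "p \<in> J" for p
      by (rule polys_over_monom[OF Kr], rule mK) (use x(1) that kK aK in \<open>auto simp: J_def\<close>)
    then have "S \<subseteq> J \<Longrightarrow> (\<Sum>p\<in>S. monom (x p * a (snd p)) (fst p)) \<in> polys_over K" for S
      by (induction S rule: infinite_finite_induct) (auto intro!: polys_over_0 polys_over_add Kr)
    from this[of J] show "(\<Sum>(d, j)\<in>J. monom (x (d, j) * a j) d) \<in> polys_over K" by (simp add: case_prod_unfold)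
  qed
  have g0: "g \<noteq> 0"
  proof
    assume "g = 0"
    obtain d i where di: "d < D" "i < n" "x (d, i) \<noteq> 0" using x(2) by (auto simp: J_def)
    have "0 = (\<Sum>j<n. x (d, j) * a j)" using cg[OF di(1)] \<open>g = 0\<close> by simp
    then have "tr (c i * 0) = tr (c i * (\<Sum>j<n. x (d, j) * a j))" by simp
    also have "\<dots> = (\<Sum>j<n. x (d, j) * tr (c i * a j))"
      by (rule functional_lin_comb[OF fi[OF di(2)]]) (use aK xk di in auto)
    also have "\<dots> = (\<Sum>j<n. if j = i then x (d, j) else 0)"
      by (rule sum.cong) (use ac(3) di in auto)
    finally show False using di functional_0[OF tr_functional] by simp
  qed
  have coord: "tr (c i * coeff (f * g) l) = 0" if i: "1 \<le> i" "i < n" for i l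
  proof (cases "l < D + m")
    case True
    have dg: "coeff g d = 0" if "d \<ge> D" for d
    proof -
      have "coeff g d = (\<Sum>p\<in>J. if fst p = d then x p * a (snd p) else 0)"
        by (simp add: g_def coeff_sum case_prod_unfold)
      also have "\<dots> = 0" by (rule sum.neutral) (use that in \<open>auto simp: J_def\<close>)
      finally show ?thesis .
    qed
    have "coeff (f * g) l = (\<Sum>d\<le>l. coeff f (l - d) * coeff g d)"
      unfolding mult.commute[of f g] coeff_mult by (rule sum.cong) (auto simp: mult.commute)
    also have "\<dots> = (\<Sum>d\<le>l + D. (if d \<le> l then coeff f (l - d) else 0) * coeff g d)"
      by (rule sum.mono_neutral_cong_left) auto
    also have "\<dots> = (\<Sum>d<D. (if d \<le> l then coeff f (l - d) else 0) * coeff g d)"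
      by (rule sum.mono_neutral_right) (auto simp: dg)
    also have "\<dots> = (\<Sum>d<D. \<Sum>j<n. x (d, j) * ((if d \<le> l then coeff f (l - d) else 0) * a j))"
      by (rule sum.cong[OF HOL.refl]) (simp add: cg sum_distrib_left mult_ac)
    also have "\<dots> = (\<Sum>p\<in>J. x p * ((if fst p \<le> l then coeff f (l - fst p) else 0) * a (snd p)))"
      by (simp add: J_def sum.cartesian_product case_prod_unfold)
    finally have "tr (c i * coeff (f * g) l) = tr (c i * (\<Sum>p\<in>J. x p * ((if fst p \<le> l then coeff f (l - fst p) else 0) * a (snd p))))"
      by simp
    also have "\<dots> = (\<Sum>p\<in>J. x p * tr (c i * ((if fst p \<le> l then coeff f (l - fst p) else 0) * a (snd p))))"
    proof (rule functional_lin_comb[OF fi[OF i(2)]])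
      fix p assume "p \<in> J"
      then show "(if fst p \<le> l then coeff f (l - fst p) else 0) * a (snd p) \<in> K" "x p \<in> k"
        using cf[of "snd p" "fst p" l] x(1) by (auto simp only: J_def mem_Times_iff lessThan_iff)
    qed
    also have "\<dots> = (\<Sum>p\<in>J. w (i, l) p * x p)" by (rule sum.cong) (auto simp: w_def case_prod_unfold mult.commute)
    also have "\<dots> = 0" using x(3) i True by (auto simp: I_def)
    finally show ?thesis .
  next
    case False
    have "degree g < D"
    proof (rule ccontr)
      assume "\<not> degree g < D"
      have "coeff g (degree g) = (\<Sum>p\<in>J. if fst p = degree g then x p * a (snd p) else 0)"
        by (simp add: g_def coeff_sum case_prod_unfold)
      also have "\<dots> = 0" by (rule sum.neutral) (use \<open>\<not> degree g < D\<close> in \<open>auto simp: J_def\<close>)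
      finally show False using g0 by simp
    qed
    then have "degree (f * g) < l" using False degree_mult_le[of f g] by (simp add: m_def)
    then show ?thesis using functional_0[OF tr_functional] by (simp add: coeff_eq_0)
  qed
  have fgK: "coeff (f * g) l \<in> K" for l using polys_over_coeff[OF polys_over_mult[OF Kr f(1) gK]] .
  have fga: "coeff (f * g) l = tr (c 0 * coeff (f * g) l) * a 0" for l
  proof -
    have "coeff (f * g) l = (\<Sum>i<n. tr (c i * coeff (f * g) l) * a i)" using ac(2) fgK by simp
    also have "\<dots> = (\<Sum>i\<in>{0}. tr (c i * coeff (f * g) l) * a i)"
      by (rule sum.mono_neutral_right) (use coord n0 in auto)
    finally show ?thesis by simp
  qed
  have fg0: "f * g \<noteq> 0" using f g0 by simp
  then obtain l where "coeff (f * g) l \<noteq> 0" by (metis leading_coeff_0_iff)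
  then have a0: "a 0 \<noteq> 0" using fga[of l] by auto
  define g' where "g' = smult (inverse (a 0)) g"
  have "g' \<in> polys_over K" unfolding g'_def
    by (rule polys_over_smult[OF Kr _ gK]) (use aK n0 subfield_of_inverse[OF K] in auto)
  moreover have "coeff (f * g') l \<in> k" for l
  proof -
    have "coeff (f * g') l = inverse (a 0) * coeff (f * g) l" by (simp add: g'_def)
    also have "\<dots> = inverse (a 0) * (tr (c 0 * coeff (f * g) l) * a 0)" using arg_cong[OF fga] .
    finally have "coeff (f * g') l = tr (c 0 * coeff (f * g) l)" using a0 by simp
    then show ?thesis using functionalD(1)[OF fi[OF n0] fgK] by simp
  qed
  moreover have "f * g' \<noteq> 0" using fg0 a0 by (simp add: g'_def)
  ultimately show ?thesis by (auto simp: polys_over_def)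
qed

text \<open>Dedekind's Prague theorem: if \<open>f\<close> has coefficients generating the codifferent and \<open>fg\<close> is a primitive
  polynomial over \<open>R\<close>, then by the Gauss lemma at every valuation ring the products of the
  coefficients of \<open>f\<close> and \<open>g\<close> lie in \<open>A\<close>, so the coefficients of \<open>g\<close> generate the inverse.\<close>

lemma cod_invertible:
  "\<exists>(I::(nat \<times> nat) set) d e. finite I \<and> (\<forall>p\<in>I. d p \<in> dif \<and> e p \<in> cod) \<and> (\<Sum>p\<in>I. d p * e p) = 1"
proof -
  obtain n :: nat and a c where ac: "\<forall>i<n. a i \<in> A \<and> c i \<in> cod"
    "\<forall>x\<in>K. (\<Sum>i<n. tr (x * a i) * c i) = x" "(\<Sum>i<n. a i * c i) = 1"
    using exists_trace_dual_basis by blast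
  have cK: "c i \<in> K" if "i < n" for i using ac(1) that by (auto simp: cod_def)
  define f where "f = (\<Sum>i<n. monom (c i) i)"
  have cf: "coeff f i = (if i < n then c i else 0)" for i
    by (simp add: f_def coeff_sum)
  have fK: "f \<in> polys_over K" using cK subring_of_0[OF Kr] by (auto simp: polys_over_def cf)
  have f0: "f \<noteq> 0"
  proof
    assume "f = 0"
    then have "c i = 0" if "i < n" for i using cf[of i] that by simp
    then show False using ac(3) by simp
  qed
  obtain g where g: "g \<in> polys_over K" "f * g \<in> polys_over k" "f * g \<noteq> 0"
    using exists_multiple_over_base[OF fK f0] by blast
  define h where "h = f * g"
  define N where "N = degree h"
  obtain \<rho> where rho: "\<rho> \<in> R" "\<rho> \<noteq> 0" "\<forall>x\<in>coeff h ` {..N}. \<rho> * x \<in> R"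
    using common_denominator[of "coeff h ` {..N}"] g(2) polys_over_coeff by (force simp: h_def)
  define h' where "h' l = \<rho> * coeff h l" for l
  have h'R: "h' l \<in> R" for l using rho subring_of_0[OF R]
    by (cases "l \<le> N") (auto simp: h'_def N_def coeff_eq_0)
  \<comment> \<open>The content ideal of the product after clearing denominators; dividing by its
    generator \<open>g0\<close> makes the product primitive over \<open>R\<close>.\<close>
  define Id where "Id = {x. \<exists>s. (\<forall>l\<le>N. s l \<in> R) \<and> x = (\<Sum>l\<le>N. s l * h' l)}"
  have "\<exists>g\<in>Id. \<forall>x\<in>Id. \<exists>r\<in>R. x = r * g"
  proof (intro pid[unfolded principal_ideals_def, THEN spec[of _ Id], THEN mp, THEN mp] conjI ballI)
    show "Id \<subseteq> R" using h'R subring_of_mult[OF R] by (auto simp: Id_def intro!: subring_of_sum[OF R])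
    show "0 \<in> Id" unfolding Id_def using subring_of_0[OF R] by (auto intro!: exI[of _ "\<lambda>_. 0"])
    fix x y assume "x \<in> Id" "y \<in> Id"
    then obtain s s' where "\<forall>l\<le>N. s l \<in> R" "x = (\<Sum>l\<le>N. s l * h' l)" "\<forall>l\<le>N. s' l \<in> R" "y = (\<Sum>l\<le>N. s' l * h' l)"
      by (auto simp: Id_def)
    then show "x + y \<in> Id" unfolding Id_def using subring_of_add[OF R]
      by (auto intro!: exI[of _ "\<lambda>l. s l + s' l"] simp: distrib_right sum.distrib)
  next
    fix r x assume "r \<in> R" "x \<in> Id"
    then obtain s where "\<forall>l\<le>N. s l \<in> R" "x = (\<Sum>l\<le>N. s l * h' l)" by (auto simp: Id_def)
    then show "r * x \<in> Id" unfolding Id_def using subring_of_mult[OF R \<open>r \<in> R\<close>]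
      by (auto intro!: exI[of _ "\<lambda>l. r * s l"] simp: sum_distrib_left mult.assoc)
  qed
  then obtain g0 where g0: "g0 \<in> Id" "\<And>x. x \<in> Id \<Longrightarrow> \<exists>r\<in>R. x = r * g0" by blast
  obtain s where s: "\<And>l. l \<le> N \<Longrightarrow> s l \<in> R" "g0 = (\<Sum>l\<le>N. s l * h' l)" using g0(1) by (auto simp: Id_def)
  have hId: "h' l \<in> Id" if "l \<le> N" for l
  proof -
    have "(\<Sum>l'\<le>N. (if l' = l then 1 else 0) * h' l') = (\<Sum>l'\<le>N. if l' = l then h' l' else 0)"
      by (rule sum.cong) auto
    then have "h' l = (\<Sum>l'\<le>N. (if l' = l then 1 else 0) * h' l')" using that by simp
    then show ?thesis unfolding Id_def using subring_of_0[OF R] subring_of_1[OF R]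
      by (auto intro!: exI[of _ "\<lambda>l'. if l' = l then 1 else 0"])
  qed
  have g0nz: "g0 \<noteq> 0"
  proof
    assume "g0 = 0"
    then have "h' N = 0" using g0(2)[OF hId[of N]] by auto
    then show False using rho g(3) by (simp add: h'_def N_def h_def)
  qed
  have quot: "h' l / g0 \<in> R" for l
  proof (cases "l \<le> N")
    case True
    then obtain r where "r \<in> R" "h' l = r * g0" using g0(2)[OF hId] by blast
    then show ?thesis using g0nz by simp
  next
    case False
    then show ?thesis using subring_of_0[OF R] by (simp add: h'_def N_def coeff_eq_0)
  qed
  have g0K: "g0 \<in> K"
  proof -
    have "g0 \<in> R" unfolding s(2)
      by (intro subring_of_sum[OF R], rule subring_of_mult[OF R]) (use s(1) h'R in auto)
    then show ?thesis using Rk kK by auto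
  qed
  define g' where "g' = smult (\<rho> / g0) g"
  have g'K: "g' \<in> polys_over K" unfolding g'_def
    by (rule polys_over_smult[OF Kr subfield_of_divide[OF K _ g0K] g(1)]) (use rho Rk kK in auto)
  have fg': "coeff (f * g') l = h' l / g0" for l by (simp add: g'_def h'_def h_def)
  have prodA: "coeff f i * coeff g' j \<in> A" for i j
  proof -
    have "coeff f i * coeff g' j \<in> P" if "P \<in> \<P>" for P
    proof -
      have "f * g' \<in> polys_over P" unfolding polys_over_def using fg' quot RA that by (auto simp: A_eq)
      then show ?thesis using valuation_ring_gauss[of P K f g'] valuation[OF that] K fK g'K by auto
    qed
    moreover have "coeff f i * coeff g' j \<in> K"
      by (intro subring_of_mult[OF Kr] polys_over_coeff fK g'K)
    ultimately show ?thesis by (auto simp: A_eq)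
  qed
  \<comment> \<open>Every element of the codifferent is an \<open>R\<close>-combination of the
    \<open>c i\<close>, which are the coefficients of \<open>f\<close>.\<close>
  have g'dif: "coeff g' j \<in> dif" for j
    unfolding dif_def
  proof (intro CollectI conjI ballI)
    show "coeff g' j \<in> K" using g'K polys_over_coeff by auto
    fix x assume x: "x \<in> cod"
    then have "x = (\<Sum>i<n. tr (x * a i) * c i)" using ac(2) by (auto simp: cod_def)
    then have "coeff g' j * x = coeff g' j * (\<Sum>i<n. tr (x * a i) * c i)" by simp
    also have "\<dots> = (\<Sum>i<n. tr (x * a i) * (coeff f i * coeff g' j))"
      unfolding sum_distrib_left by (rule sum.cong) (auto simp: cf mult_ac)
    also have "\<dots> \<in> A"
      by (intro subring_of_sum[OF A_subring], rule subring_of_mult[OF A_subring])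
        (use prodA x ac(1) RA in \<open>auto simp: cod_def\<close>)
    finally show "coeff g' j * x \<in> A" .
  qed
  \<comment> \<open>\<open>g0\<close> is an \<open>R\<close>-combination of the coefficients of the
    product, so dividing by \<open>g0\<close> writes 1 as a sum of products of a coefficient of
    \<open>g'\<close>, which lies in the different, with an element of the codifferent.\<close>
  have "1 = g0 / g0" using g0nz by simp
  also have "\<dots> = (\<Sum>l\<le>N. s l * (h' l / g0))"
    using arg_cong[OF s(2), of "\<lambda>x. x / g0"] by (simp add: sum_divide_distrib)
  also have "\<dots> = (\<Sum>l\<le>N. \<Sum>i\<le>l. coeff g' (l - i) * (s l * coeff f i))"
    unfolding fg'[symmetric] coeff_mult sum_distrib_left by (simp add: mult_ac)
  also have "\<dots> = (\<Sum>p\<in>Sigma {..N} (\<lambda>l. {..l}). coeff g' (fst p - snd p) * (s (fst p) * coeff f (snd p)))"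
    by (subst sum.Sigma) (auto simp: case_prod_unfold)
  finally have sum1: "(\<Sum>p\<in>Sigma {..N} (\<lambda>l. {..l}). coeff g' (fst p - snd p) * (s (fst p) * coeff f (snd p))) = 1"
    by simp
  have "s l * coeff f i \<in> cod" if "l \<le> N" for l i
    using cod_mult[of "s l" "c i"] s(1)[OF that] RA ac(1) cod_0 by (auto simp: cf)
  then show ?thesis using sum1 g'dif
    by (intro exI[of _ "Sigma {..N} (\<lambda>l. {..l})"] exI[of _ "\<lambda>p. coeff g' (fst p - snd p)"]
        exI[of _ "\<lambda>p. s (fst p) * coeff f (snd p)"]) auto
qed

end

section \<open>The coordinate ring over the polynomial ring in a separating element\<close>

lemma subfield_of_Inter: "(\<And>S. S \<in> T \<Longrightarrow> subfield_of S) \<Longrightarrow> subfield_of (\<Inter>T)"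
  unfolding subfield_of_def subring_of_def by blast

lemma adjoin_field_subfield: "subfield_of (adjoin_field F u)"
  unfolding adjoin_field_def by (rule hull_in) (rule subfield_of_Inter, blast)

text \<open>The field hull comes without a description of its elements; the set \<open>Q\<close> of
  fractions is a field containing \<open>F\<close> and \<open>u\<close>, so it contains the
  hull.\<close>

lemma adjoin_field_fraction:
  assumes F: "subfield_of F" and x: "x \<in> adjoin_field F u"
  shows "\<exists>r\<in>adjoin_ring F u. r \<noteq> 0 \<and> r * x \<in> adjoin_ring F u"
proof -
  let ?R = "adjoin_ring F u"
  note Fr = subfield_of_subring[OF F]
  note Rr = adjoin_ring_subring[OF Fr, of u]
  define Q where "Q = {x. \<exists>r\<in>?R. r \<noteq> 0 \<and> r * x \<in> ?R}"
  have QR: "?R \<subseteq> Q" unfolding Q_def using subring_of_1[OF Rr] by (auto intro!: bexI[of _ 1])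
  have "subfield_of Q" unfolding subfield_of_def subring_of_def
  proof (intro conjI ballI)
    show "0 \<in> Q" "1 \<in> Q" using QR subring_of_0[OF Rr] subring_of_1[OF Rr] by auto
    fix x y assume "x \<in> Q" "y \<in> Q"
    then obtain r s where r: "r \<in> ?R" "r \<noteq> 0" "r * x \<in> ?R" and s: "s \<in> ?R" "s \<noteq> 0" "s * y \<in> ?R"
      by (auto simp: Q_def)
    have rs: "r * s \<in> ?R" "r * s \<noteq> 0" using r s subring_of_mult[OF Rr] by auto
    have "s * (r * x) + r * (s * y) \<in> ?R" "s * (r * x) - r * (s * y) \<in> ?R" "(r * x) * (s * y) \<in> ?R"
      using r s subring_of_mult[OF Rr] subring_of_add[OF Rr] subring_of_diff[OF Rr] by auto
    then have "r * s * (x + y) \<in> ?R" "r * s * (x - y) \<in> ?R" "r * s * (x * y) \<in> ?R"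
      by (simp_all add: algebra_simps)
    then show "x + y \<in> Q" "x - y \<in> Q" "x * y \<in> Q" using rs unfolding Q_def by blast+
  next
    fix x assume "x \<in> Q"
    then obtain r where r: "r \<in> ?R" "r \<noteq> 0" "r * x \<in> ?R" by (auto simp: Q_def)
    show "inverse x \<in> Q"
    proof (cases "x = 0")
      case True
      then show ?thesis using QR subring_of_0[OF Rr] by auto
    next
      case False
      then have "r * x \<noteq> 0" "r * x * inverse x = r" using r by auto
      then show ?thesis unfolding Q_def using r by (metis (mono_tags, lifting) mem_Collect_eq)
    qed
  qed
  moreover have "insert u F \<subseteq> Q" using QR adjoin_ring_base[OF Fr, of u] adjoin_ring_gen[OF Fr, of u] by auto
  ultimately have "adjoin_field F u \<subseteq> Q" unfolding adjoin_field_def by (rule hull_minimal[rotated])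
  then show ?thesis using x by (auto simp: Q_def)
qed

section \<open>The coordinate ring over \<open>F[u]\<close> and the place at infinity\<close>

locale curve_ctx =
  fixes C :: "('c::field, 'z) curve_data_scheme" and u :: 'c
  assumes curve: "curve_setup C" and uA: "u \<in> coord_ring C" and sep_u: "separating C u"
begin

abbreviation "F \<equiv> const_field C"
abbreviation "K \<equiv> fun_field C"
abbreviation "A \<equiv> coord_ring C"
abbreviation "k \<equiv> const_rat_field C u"
abbreviation "R \<equiv> const_poly_ring C u"
abbreviation "N \<equiv> absv C"
abbreviation "q \<equiv> card_const C"

lemma ff: "function_field F K" and finF: "finite F"
  and abs: "absolute_value N" and infN: "{x \<in> K. N x \<le> 1} = infty_pt C" and complete: "complete_wrt N"
  using curve by (auto simp: curve_setup_def is_C_infty_def)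

lemma Ff: "subfield_of F" and Kf: "subfield_of K" and FK: "F \<subseteq> K"
  using ff by (auto simp: function_field_def)

lemmas Fr = subfield_of_subring[OF Ff]
lemmas Kr = subfield_of_subring[OF Kf]

lemma N_nonneg: "N x \<ge> 0" and N_0_iff: "N x = 0 \<longleftrightarrow> x = 0" and N_mult: "N (x * y) = N x * N y"
  and N_add: "N (x + y) \<le> max (N x) (N y)"
  using abs by (auto simp: absolute_value_def)

lemma N_0 [simp]: "N 0 = 0" by (simp add: N_0_iff)

lemma N_1 [simp]: "N 1 = 1"
  using N_mult[of 1 1] N_0_iff[of 1] by simp

lemma N_power: "N (x ^ n) = N x ^ n"
  by (induction n) (auto simp: N_mult)

lemma N_inverse: "N (inverse x) = inverse (N x)"
proof (cases "x = 0")
  case False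
  then have "N x * N (inverse x) = 1" by (simp add: N_mult[symmetric])
  then show ?thesis by (simp add: inverse_unique)
qed simp

text \<open>The powers of \<open>c\<close> repeat because \<open>F\<close> is finite, so
  \<open>c\<close> is a root of unity. This is what later makes the tensor norm computable from
  coordinates.\<close>

lemma F_N: assumes "c \<in> F" "c \<noteq> 0" shows "N c = 1"
proof -
  have "\<not> inj_on (\<lambda>n. c ^ n) (UNIV :: nat set)"
  proof
    assume "inj_on (\<lambda>n. c ^ n) (UNIV :: nat set)"
    moreover have "(\<lambda>n. c ^ n) ` (UNIV :: nat set) \<subseteq> F" using assms subring_of_power[OF Fr] by auto
    ultimately show False using finF by (meson finite_imageD finite_subset infinite_UNIV_nat)
  qed
  then obtain i j :: nat where ij: "i < j" "c ^ i = c ^ j" by (metis injI linorder_neqE_nat)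
  have "c ^ i * c ^ (j - i) = c ^ (i + (j - i))" by (rule power_add[symmetric])
  then have "c ^ i * c ^ (j - i) = c ^ j" using ij by simp
  then have "c ^ i * c ^ (j - i) = c ^ i * 1" using ij by simp
  then have "c ^ (j - i) = 1" using assms by simp
  then have "N c ^ (j - i) = 1" by (metis N_1 N_power)
  then show ?thesis using ij power_eq_1_iff[of "N c" "j - i"] N_nonneg[of c] by auto
qed

lemma N_uminus: "N (- x) = N x"
proof -
  have "N (-1) = 1" by (rule F_N) (use subring_of_uminus[OF Fr subring_of_1[OF Fr]] in auto)
  then show ?thesis using N_mult[of "-1" x] by simp
qed

lemma F_N_le: "c \<in> F \<Longrightarrow> N c \<le> 1"
  using F_N[of c] by (cases "c = 0") auto

lemma A_eq: "A = {x \<in> K. \<forall>P\<in>closed_points F K - {infty_pt C}. x \<in> P}"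
  by (simp add: coord_ring_def regular_functions_def)

lemma uK: "u \<in> K" using uA by (auto simp: A_eq)

lemma uext: "k \<subseteq> K" "\<exists>B. is_basis k K B" "\<And>x. x \<in> K \<Longrightarrow> separable_over k x"
  using sep_u by (auto simp: separating_def finite_separable_def finite_extension_def)

text \<open>Otherwise \<open>u\<close> would be a constant, \<open>k\<close> would be
  \<open>F\<close>, and \<open>K\<close> would be a finite set, against the existence of an element
  of \<open>K\<close> that is transcendental over \<open>F\<close>.\<close>

lemma u_transcendental: "\<not> algebraic_over F u"
proof
  assume "algebraic_over F u"
  then have "u \<in> F" using ff uK by (auto simp: function_field_def)
  then have kF: "k = F" unfolding adjoin_field_def using Ff by (simp add: insert_absorb hull_same)
  obtain B where B: "is_basis k K B" using uext by blast
  have "finite (B \<rightarrow>\<^sub>E F)" using B finF by (intro finite_PiE) (auto simp: is_basis_def)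
  moreover have "K \<subseteq> (\<lambda>c. \<Sum>b\<in>B. c b * b) ` (B \<rightarrow>\<^sub>E F)"
    using B unfolding is_basis_def kF by blast
  ultimately have "finite K" by (meson finite_imageI finite_subset)
  obtain x where x: "x \<in> K" "\<not> algebraic_over F x" using ff by (auto simp: function_field_def)
  have "\<not> inj_on (\<lambda>n. x ^ n) (UNIV :: nat set)"
  proof
    assume "inj_on (\<lambda>n. x ^ n) (UNIV :: nat set)"
    moreover have "(\<lambda>n. x ^ n) ` (UNIV :: nat set) \<subseteq> K" using x subring_of_power[OF Kr] by auto
    ultimately show False using \<open>finite K\<close> by (meson finite_imageD finite_subset infinite_UNIV_nat)
  qed
  then obtain i j :: nat where ij: "i \<noteq> j" "x ^ i = x ^ j" by (metis injI)
  have "monom 1 i - monom 1 j \<in> polys_over F" by (intro polys_over_rules Fr subring_rules)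
  moreover have "monom 1 i - monom 1 j \<noteq> (0 :: 'c poly)"
  proof
    assume "monom 1 i - monom 1 j = (0 :: 'c poly)"
    then have "coeff (monom 1 i - monom 1 j) i = (0::'c)" by simp
    then show False using ij by simp
  qed
  moreover have "poly (monom 1 i - monom 1 j) x = 0" using ij by (simp add: poly_monom)
  ultimately show False using x by (auto simp: algebraic_over_def)
qed

lemma poly_u_eq_0: "p \<in> polys_over F \<Longrightarrow> poly p u = 0 \<Longrightarrow> p = 0"
  using u_transcendental by (auto simp: algebraic_over_def)

lemma closed_points_valuation:
  "P \<in> closed_points F K \<Longrightarrow> subring_of P \<and> P \<subseteq> K \<and> (\<forall>x\<in>K. x \<in> P \<or> inverse x \<in> P)"
  by (auto simp: closed_points_def)

text \<open>If \<open>|u| \<le> 1\<close>, then \<open>u\<close> belongs to the valuation ring at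
  infinity as well as to all the others; but \<open>u\<close> is not integral over \<open>F\<close>,
  so some valuation ring omits it.\<close>

lemma u_large: "N u > 1"
proof (rule ccontr)
  assume "\<not> N u > 1"
  then have uinf: "u \<in> infty_pt C" unfolding infN[symmetric] using uK by simp
  have "\<not> integral_over F u" using poly_u_eq_0 by (force simp: integral_over_def)
  from exists_valuation_ring[OF Kf Fr FK uK this] obtain P where
    P: "subring_of P" "F \<subseteq> P" "P \<subseteq> K" "u \<notin> P" "\<forall>x\<in>K. x \<in> P \<or> inverse x \<in> P" by blast
  then have "P \<in> closed_points F K - {infty_pt C}" using uK uinf by (auto simp: closed_points_def)
  then show False using uA P by (auto simp: A_eq)
qed

lemma R_sub: "subring_of R" "F \<subseteq> R" "u \<in> R"
  by (rule adjoin_ring_subring[OF Fr] adjoin_ring_base[OF Fr] adjoin_ring_gen[OF Fr])+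

lemma k_sub: "subfield_of k" "F \<subseteq> k" "u \<in> k"
  using adjoin_field_subfield hull_subset[of "insert u F" subfield_of] by (auto simp: adjoin_field_def)

lemma R_k: "R \<subseteq> k"
  by (rule adjoin_ring_least[OF subfield_of_subring[OF k_sub(1)] k_sub(2,3)])

lemma A_subring: "subring_of A"
proof -
  have "subring_of (\<Inter>(insert K (closed_points F K - {infty_pt C})))"
    using closed_points_valuation Kr unfolding subring_of_def by auto
  moreover have "\<Inter>(insert K (closed_points F K - {infty_pt C})) = A" by (auto simp: A_eq)
  ultimately show ?thesis by simp
qed

lemma F_A: "F \<subseteq> A" using FK by (auto simp: A_eq closed_points_def)

lemma R_A: "R \<subseteq> A" by (rule adjoin_ring_least[OF A_subring F_A uA])

text \<open>A valuation ring that contains \<open>R\<close> but not \<open>a\<close> contains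
  \<open>u\<close>, hence is not the one at infinity, where \<open>u\<close> has a pole; so it is
  one of those defining \<open>A\<close>.\<close>

lemma A_integral:
  assumes a: "a \<in> A" shows "integral_over R a"
proof (rule ccontr)
  assume neg: "\<not> integral_over R a"
  have "a \<in> K" "R \<subseteq> K" using a R_A by (auto simp: A_eq)
  from exists_valuation_ring[OF Kf R_sub(1) this(2,1) neg] obtain P where
    P: "subring_of P" "R \<subseteq> P" "P \<subseteq> K" "a \<notin> P" "\<forall>x\<in>K. x \<in> P \<or> inverse x \<in> P" by blast
  have "u \<notin> infty_pt C" unfolding infN[symmetric] using u_large by simp
  then have "P \<in> closed_points F K - {infty_pt C}" using P R_sub \<open>a \<in> K\<close> by (auto simp: closed_points_def)
  then show False using a P by (auto simp: A_eq)
qed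

text \<open>After clearing denominators in the minimal polynomial, the leading coefficient times
  \<open>x\<close> lies in each valuation ring that defines \<open>A\<close>.\<close>

lemma A_frac:
  assumes x: "x \<in> K" shows "\<exists>r\<in>R. r \<noteq> 0 \<and> r * x \<in> A"
proof -
  obtain p where p: "p \<in> polys_over k" "lead_coeff p = 1" "poly p x = 0"
    using uext(3)[OF x] by (auto simp: separable_over_def is_minpoly_def)
  have "\<forall>i. \<exists>r\<in>R. r \<noteq> 0 \<and> r * coeff p i \<in> R"
    using adjoin_field_fraction[OF Ff] polys_over_coeff[OF p(1)] by blast
  then obtain \<rho> where rho: "\<And>i. \<rho> i \<in> R" "\<And>i. \<rho> i \<noteq> 0" "\<And>i. \<rho> i * coeff p i \<in> R" by metis
  define r where "r = (\<Prod>i\<le>degree p. \<rho> i)"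
  have prodR: "finite S \<Longrightarrow> prod \<rho> S \<in> R" for S
    by (induction S rule: finite_induct) (auto intro: subring_of_1 subring_of_mult R_sub(1) rho)
  have r: "r \<in> R" "r \<noteq> 0" unfolding r_def using prodR rho by auto
  have "r * coeff p i \<in> R" for i
  proof (cases "i \<le> degree p")
    case True
    then have "r * coeff p i = prod \<rho> ({..degree p} - {i}) * (\<rho> i * coeff p i)"
      unfolding r_def by (subst prod.remove[of _ i]) (auto simp: mult_ac)
    also have "\<dots> \<in> R" by (intro subring_of_mult[OF R_sub(1)] prodR rho(3)) simp
    finally show ?thesis .
  next
    case False
    then show ?thesis using subring_of_0[OF R_sub(1)] by (simp add: coeff_eq_0)
  qed
  then have rp: "smult r p \<in> polys_over R" "smult r p \<noteq> 0" "poly (smult r p) x = 0" "lead_coeff (smult r p) = r"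
    using p r by (auto simp: polys_over_def)
  have "r * x \<in> P" if P: "P \<in> closed_points F K - {infty_pt C}" for P
  proof -
    have "A \<subseteq> P" using P by (auto simp: A_eq)
    then have "smult r p \<in> polys_over P" using rp R_A polys_over_mono[of R P] by auto
    then show ?thesis
      using valuation_ring_lead_coeff_mult[of P K "smult r p" x] closed_points_valuation P rp Kr x by auto
  qed
  moreover have "r * x \<in> K" using r R_A x subring_of_mult[OF Kr] by (auto simp: A_eq)
  ultimately show ?thesis using r by (auto simp: A_eq)
qed

sublocale ext: integral_closure_ext k K R A "closed_points F K - {infty_pt C}"
proof
  show "subfield_of k" "subfield_of K" "k \<subseteq> K" "\<exists>B. is_basis k K B" "\<And>x. x \<in> K \<Longrightarrow> separable_over k x"
    using k_sub Kf uext by auto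
  show "principal_ideals R" by (rule principal_ideals_adjoin_ring[OF Ff])
  show "\<And>c. c \<in> k \<Longrightarrow> \<exists>r\<in>R. r \<noteq> 0 \<and> r * c \<in> R" by (rule adjoin_field_fraction[OF Ff])
qed (use A_eq A_frac A_integral R_A R_k R_sub closed_points_valuation in auto)

lemma cod_eq: "codifferent C u = ext.cod" by (simp add: codifferent_def ext.cod_def)

lemma dif_eq: "different C u = ext.dif" by (simp add: different_def ext.dif_def cod_eq)

text \<open>The inverse of evaluation at \<open>u\<close> from polynomials over \<open>F\<close> to
  \<open>R\<close>, well defined because \<open>u\<close> is transcendental.\<close>

definition pol :: "'c \<Rightarrow> 'c poly" where "pol x = (THE p. p \<in> polys_over F \<and> poly p u = x)"

lemma pol_poly: assumes "p \<in> polys_over F" shows "pol (poly p u) = p"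
  unfolding pol_def
proof (rule the_equality)
  fix p' assume "p' \<in> polys_over F \<and> poly p' u = poly p u"
  then have "p' - p \<in> polys_over F" "poly (p' - p) u = 0" using assms polys_over_diff[OF Fr] by auto
  then show "p' = p" using poly_u_eq_0 by fastforce
qed (use assms in auto)

lemma pol: assumes "x \<in> R" shows "pol x \<in> polys_over F" "poly (pol x) u = x"
  using assms pol_poly by (auto simp: adjoin_ring_def)

lemma pol_add: assumes "x \<in> R" "y \<in> R" shows "pol (x + y) = pol x + pol y"
  using pol_poly[of "pol x + pol y"] pol[OF assms(1)] pol[OF assms(2)] polys_over_add[OF Fr] by simp

lemma pol_smult: assumes "x \<in> R" "c \<in> F" shows "pol (c * x) = smult c (pol x)"
  using pol_poly[of "smult c (pol x)"] pol[OF assms(1)] polys_over_smult[OF Fr assms(2)] by simp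

lemma pol_u_mult: assumes "x \<in> R" shows "pol (u * x) = pCons 0 (pol x)"
  using pol_poly[of "pCons 0 (pol x)"] pol[OF assms] polys_over_pCons[OF subring_of_0[OF Fr]] by simp

section \<open>Characteristic and Frobenius on the constant field\<close>

lemma q_ge_2: "q \<ge> 2"
proof -
  have "card {0, 1::'c} \<le> q" by (rule card_mono[OF finF]) (use subring_of_0[OF Fr] subring_of_1[OF Fr] in auto)
  then show ?thesis by simp
qed

lemma char_pos: "CHAR('c) > 0"
proof -
  have "\<not> inj_on (\<lambda>n. of_nat n :: 'c) (UNIV :: nat set)"
  proof
    assume "inj_on (\<lambda>n. of_nat n :: 'c) (UNIV :: nat set)"
    moreover have "(of_nat n :: 'c) \<in> F" for n
      by (induction n) (auto intro: subring_rules Fr)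
    then have "(\<lambda>n. of_nat n :: 'c) ` (UNIV :: nat set) \<subseteq> F" by auto
    ultimately show False using finF by (meson finite_imageD finite_subset infinite_UNIV_nat)
  qed
  then obtain i j :: nat where ij: "i < j" "(of_nat i :: 'c) = of_nat j" by (metis injI linorder_neqE_nat)
  then have "(of_nat (j - i) :: 'c) = 0" by (simp add: of_nat_diff)
  then show ?thesis using ij CHAR_pos_iff by (metis zero_less_diff)
qed

lemma prime_char: "prime CHAR('c)" using char_pos prime_CHAR_semidom by blast

text \<open>A maximal subgroup of \<open>F\<close> of order a power of the characteristic \<open>p\<close> is \<open>F\<close>, since adjoining
  an element outside multiplies the order by \<open>p\<close>.\<close>

lemma q_power: "\<exists>e. q = CHAR('c) ^ e"
proof -
  let ?p = "CHAR('c)"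
  define \<G> where "\<G> = {H. H \<subseteq> F \<and> 0 \<in> H \<and> (\<forall>x\<in>H. \<forall>y\<in>H. x + y \<in> H) \<and> (\<exists>e. card H = ?p ^ e)}"
  have "finite \<G>" by (rule finite_subset[of _ "Pow F"]) (use finF in \<open>auto simp: \<G>_def\<close>)
  moreover have "{0} \<in> \<G>" unfolding \<G>_def using subring_of_0[OF Fr] by (auto intro!: exI[of _ 0])
  ultimately obtain H where H: "H \<in> \<G>" "\<And>H'. H' \<in> \<G> \<Longrightarrow> H \<subseteq> H' \<Longrightarrow> H' = H"
    using finite_has_maximal[of \<G>] by blast
  have HF: "H \<subseteq> F" "0 \<in> H" "\<And>x y. x \<in> H \<Longrightarrow> y \<in> H \<Longrightarrow> x + y \<in> H" using H by (auto simp: \<G>_def)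
  have Hn: "of_nat n * x \<in> H" if "x \<in> H" for n x
    using that HF by (induction n) (auto simp: distrib_right)
  have pz: "of_nat (m * ?p) = (0::'c)" for m by simp
  have Hminus: "- x \<in> H" if "x \<in> H" for x
  proof -
    have "of_nat (?p - 1) * x = of_nat ?p * x - x"
      using char_pos by (simp add: of_nat_diff algebra_simps del: of_nat_CHAR)
    then have "of_nat (?p - 1) * x = - x" by simp
    then show ?thesis using Hn[OF that, of "?p - 1"] by simp
  qed
  have Hdiff: "x - y \<in> H" if "x \<in> H" "y \<in> H" for x y
    using HF(3)[OF that(1) Hminus[OF that(2)]] by simp
  have "H = F"
  proof (rule ccontr)
    assume "H \<noteq> F"
    then obtain x where x: "x \<in> F" "x \<notin> H" using HF by auto
    define f where "f = (\<lambda>(n::nat, h). of_nat n * x + h)"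
    \<comment> \<open>With \<open>p\<close> the characteristic, a multiple \<open>n x\<close> in
      \<open>H\<close> with \<open>0 < n < p\<close> would bring \<open>x\<close> itself into
      \<open>H\<close>, by Bezout.\<close>
    have mult_x: "n = 0" if "of_nat n * x \<in> H" "n < ?p" for n
    proof (rule ccontr)
      assume "n \<noteq> 0"
      then have "coprime n ?p" using that prime_char
        by (metis coprime_commute dvd_imp_le gr0I linorder_not_less prime_imp_coprime)
      obtain m y where "n * m = ?p * y + gcd n ?p" using bezout_nat[OF \<open>n \<noteq> 0\<close>] by blast
      then have "n * m = y * ?p + 1" using \<open>coprime n ?p\<close> by (simp add: mult.commute)
      then have "(of_nat (n * m) :: 'c) = of_nat (y * ?p) + of_nat 1" by (simp only: of_nat_add)
      then have "(of_nat (n * m) :: 'c) = of_nat 1" using pz by simp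
      then have "of_nat m * (of_nat n * x) = x" by (metis mult.assoc mult.commute mult_1 of_nat_1 of_nat_mult)
      then show False using Hn[OF that(1), of m] x by metis
    qed
    have inj: "inj_on f ({..<?p} \<times> H)"
    proof (rule inj_onI)
      have aux: "n = n'" if "n \<le> n'" "n' < ?p" "h \<in> H" "h' \<in> H" "of_nat n * x + h = of_nat n' * x + h'" for n n' h h'
      proof -
        have "of_nat (n' - n) * x = h - h'" using that by (simp add: of_nat_diff algebra_simps)
        then have "n' - n = 0" using mult_x[of "n' - n"] Hdiff that by auto
        then show ?thesis using that by simp
      qed
      fix a b assume ab: "a \<in> {..<?p} \<times> H" "b \<in> {..<?p} \<times> H" "f a = f b"
      obtain n h n' h' where e: "a = (n, h)" "b = (n', h')" by (metis surj_pair)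
      have "n = n'" using aux[of n n' h h'] aux[of n' n h' h] ab unfolding e f_def by (cases "n \<le> n'") auto
      then show "a = b" using ab by (simp add: e f_def)
    qed
    define H' where "H' = f ` ({..<?p} \<times> H)"
    have "H \<subseteq> H'"
    proof
      fix h assume "h \<in> H"
      then show "h \<in> H'" unfolding H'_def f_def using char_pos by (intro image_eqI[of _ _ "(0, h)"]) auto
    qed
    moreover have "H' \<in> \<G>" unfolding \<G>_def
    proof (intro CollectI conjI ballI)
      have "of_nat n * x \<in> F" for n using x by (induction n) (auto simp: distrib_right intro: subring_rules Fr)
      then show "H' \<subseteq> F" using HF subring_of_add[OF Fr] by (auto simp: H'_def f_def)
      show "0 \<in> H'" using \<open>H \<subseteq> H'\<close> HF by auto
      obtain e where "card H = ?p ^ e" using H by (auto simp: \<G>_def)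
      then have "card H' = ?p ^ Suc e" unfolding H'_def using card_image[OF inj] by (simp add: card_cartesian_product)
      then show "\<exists>e. card H' = ?p ^ e" by blast
      fix a b assume "a \<in> H'" "b \<in> H'"
      then obtain n h n' h' where e: "a = of_nat n * x + h" "b = of_nat n' * x + h'" "h \<in> H" "h' \<in> H"
        by (auto simp: H'_def f_def)
      have "of_nat (n + n') * x = of_nat ((n + n') mod ?p) * x"
      proof -
        have "(of_nat (n + n') :: 'c) = of_nat ((n + n') div ?p * ?p + (n + n') mod ?p)" by simp
        also have "\<dots> = of_nat ((n + n') mod ?p)" using pz by (simp only: of_nat_add add_0)
        finally show ?thesis by simp
      qed
      then have "a + b = f ((n + n') mod ?p, h + h')" using e by (simp add: f_def algebra_simps)
      moreover have "((n + n') mod ?p, h + h') \<in> {..<?p} \<times> H" using e HF char_pos by auto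
      ultimately show "a + b \<in> H'" unfolding H'_def by blast
    qed
    ultimately have "H' = H" using H by blast
    moreover have "x \<in> H'" unfolding H'_def f_def using HF prime_gt_1_nat[OF prime_char]
      by (intro image_eqI[of _ _ "(1, 0)"]) auto
    ultimately show False using x by simp
  qed
  then show ?thesis using H by (auto simp: \<G>_def)
qed

lemma frob_add: "(x + y :: 'c) ^ (q ^ n) = x ^ (q ^ n) + y ^ (q ^ n)"
proof -
  obtain e where "q = CHAR('c) ^ e" using q_power by blast
  then have "q ^ n = CHAR('c) ^ (e * n)" by (simp add: power_mult)
  then show ?thesis using freshmans_dream'[OF prime_char] by blast
qed

text \<open>Multiplication by \<open>c\<close> permutes the nonzero constants; comparing their
  product before and after gives \<open>c^(q - 1) = 1\<close>.\<close>

lemma frob_F: assumes c: "c \<in> F" shows "c ^ (q ^ n) = c"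
proof (cases "c = 0")
  case True
  then show ?thesis using q_ge_2 by simp
next
  case False
  define P where "P = (\<Prod>x\<in>F - {0}. x)"
  have P0: "P \<noteq> 0" unfolding P_def using finF by auto
  have "inj_on ((*) c) (F - {0})" using False by (auto intro: inj_onI)
  moreover have "(*) c ` (F - {0}) = F - {0}"
  proof (rule card_subset_eq)
    show "(*) c ` (F - {0}) \<subseteq> F - {0}" using c False subring_of_mult[OF Fr] by auto
    show "card ((*) c ` (F - {0})) = card (F - {0})" by (rule card_image) fact
  qed (use finF in auto)
  ultimately have "P = (\<Prod>x\<in>F - {0}. c * x)" unfolding P_def by (metis (no_types, lifting) prod.reindex_cong)
  also have "\<dots> = c ^ card (F - {0}) * P" by (simp add: P_def prod.distrib)
  finally have "c ^ (q - 1) = 1" using P0 finF subring_of_0[OF Fr] by (simp add: card_Diff_singleton)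
  then have cq: "c ^ q = c" using q_ge_2 by (metis One_nat_def Suc_diff_1 less_le_trans mult_1_right pos2 power_Suc)
  show ?thesis by (induction n) (auto simp: cq power_mult)
qed

end

section \<open>Complete ultrametric norms\<close>

locale ultranorm =
  fixes nm :: "'v::ab_group_add \<Rightarrow> real"
  assumes nonneg: "nm x \<ge> 0" and zero_iff: "nm x = 0 \<longleftrightarrow> x = 0" and minus: "nm (- x) = nm x"
    and ultra: "nm (x + y) \<le> max (nm x) (nm y)"
    and cauchy_converges: "(\<forall>\<epsilon>>0. \<exists>n0. \<forall>m\<ge>n0. \<forall>n\<ge>n0. nm (s m - s n) < \<epsilon>) \<Longrightarrow>
      \<exists>l. (\<lambda>n. nm (s n - l)) \<longlonglongrightarrow> 0"
begin

definition tends :: "(nat \<Rightarrow> 'v) \<Rightarrow> 'v \<Rightarrow> bool" where "tends s l \<longleftrightarrow> (\<lambda>n. nm (s n - l)) \<longlonglongrightarrow> 0"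

lemma zero [simp]: "nm 0 = 0" by (simp add: zero_iff)

lemma ultra_diff: "nm (x - y) \<le> max (nm x) (nm y)"
  using ultra[of x "- y"] minus[of y] by simp

lemma minus_commute: "nm (x - y) = nm (y - x)"
  using minus[of "x - y"] by simp

lemma add_le: "nm x \<le> B \<Longrightarrow> nm y \<le> B \<Longrightarrow> nm (x + y) \<le> B"
  using ultra[of x y] by linarith

lemma diff_le: "nm x \<le> B \<Longrightarrow> nm y \<le> B \<Longrightarrow> nm (x - y) \<le> B"
  using ultra_diff[of x y] by linarith

lemma sum_le: "B \<ge> 0 \<Longrightarrow> (\<And>i. i \<in> I \<Longrightarrow> nm (f i) \<le> B) \<Longrightarrow> nm (\<Sum>i\<in>I. f i) \<le> B"
  by (induction I rule: infinite_finite_induct) (auto intro: add_le)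

text \<open>In an ultrametric space the two longest sides of a triangle are equal.\<close>

lemma eq_of_close: assumes "nm (x - y) < nm y" shows "nm x = nm y"
proof -
  have "nm x \<le> max (nm (x - y)) (nm y)" using ultra[of "x - y" y] by simp
  moreover have "nm y \<le> max (nm (x - y)) (nm x)" using ultra_diff[of x "x - y"] by (simp add: max.commute)
  ultimately show ?thesis using assms by linarith
qed

lemma tends_eventually: "tends s l \<longleftrightarrow> (\<forall>\<epsilon>>0. \<forall>\<^sub>F n in sequentially. nm (s n - l) < \<epsilon>)"
  unfolding tends_def tendsto_iff by (simp add: nonneg)

lemma tendsI_le:
  assumes "b \<longlonglongrightarrow> 0" "\<forall>\<^sub>F n in sequentially. nm (s n - l) \<le> b n" shows "tends s l"
  unfolding tends_def
  by (rule tendsto_sandwich[OF _ assms(2) tendsto_const assms(1)]) (simp add: nonneg)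

lemma tends_add: assumes "tends s l" "tends s' l'" shows "tends (\<lambda>n. s n + s' n) (l + l')"
proof (rule tendsI_le)
  show "(\<lambda>n. nm (s n - l) + nm (s' n - l')) \<longlonglongrightarrow> 0"
    using tendsto_add[OF assms[unfolded tends_def]] by simp
  have "nm (s n + s' n - (l + l')) \<le> nm (s n - l) + nm (s' n - l')" for n
    using ultra[of "s n - l" "s' n - l'"] nonneg[of "s n - l"] nonneg[of "s' n - l'"] by (simp add: algebra_simps)
  then show "\<forall>\<^sub>F n in sequentially. nm (s n + s' n - (l + l')) \<le> nm (s n - l) + nm (s' n - l')" by simp
qed

lemma tends_const: "tends (\<lambda>_. l) l" by (simp add: tends_def)

lemma tends_uminus: "tends s l \<Longrightarrow> tends (\<lambda>n. - s n) (- l)"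
  unfolding tends_def by (simp add: minus_commute)

lemma tends_diff: assumes "tends s l" "tends s' l'" shows "tends (\<lambda>n. s n - s' n) (l - l')"
  using tends_add[OF assms(1) tends_uminus[OF assms(2)]] by simp

lemma tends_bound:
  assumes "tends s l" "\<forall>\<^sub>F n in sequentially. nm (s n) \<le> B" shows "nm l \<le> B"
proof (rule ccontr)
  assume "\<not> nm l \<le> B"
  have "\<forall>\<^sub>F n in sequentially. nm (s n - l) < nm l \<or> nm l = 0"
  proof (cases "nm l = 0")
    case False
    then have "nm l > 0" using nonneg[of l] by simp
    then have "\<forall>\<^sub>F n in sequentially. nm (s n - l) < nm l" using assms(1) by (simp add: tends_eventually)
    then show ?thesis by eventually_elim simp
  qed simp
  with assms(2) have "\<forall>\<^sub>F n in sequentially. False"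
  proof eventually_elim
    case (elim n)
    have "nm (s n) \<ge> 0" by (rule nonneg)
    then have "nm (s n) = nm l" using elim eq_of_close[of "s n" l] \<open>\<not> nm l \<le> B\<close> by auto
    then show False using elim \<open>\<not> nm l \<le> B\<close> by simp
  qed
  then show False by simp
qed

lemma tends_unique: assumes "tends s l" "tends s l'" shows "l = l'"
proof -
  have "nm (l - l') \<le> 0" using tends_bound[OF tends_diff[OF assms], of 0] by simp
  then show ?thesis using nonneg[of "l - l'"] zero_iff[of "l - l'"] by simp
qed

lemma tends_Suc: "tends (\<lambda>n. s (Suc n)) l \<longleftrightarrow> tends s l"
  unfolding tends_def by (rule filterlim_sequentially_Suc)

lemma tends_0_diff: "tends s l \<Longrightarrow> tends (\<lambda>n. s (Suc n) - s n) 0"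
  using tends_diff[of "\<lambda>n. s (Suc n)" l s l] by (simp add: tends_Suc)

lemma sum_converges:
  assumes "(\<lambda>n. nm (f n)) \<longlonglongrightarrow> 0" shows "\<exists>l. tends (\<lambda>m. \<Sum>n<m. f n) l"
  unfolding tends_def
proof (rule cauchy_converges, intro allI impI)
  fix \<epsilon> :: real assume e: "\<epsilon> > 0"
  then have "\<forall>\<^sub>F n in sequentially. nm (f n) < \<epsilon> / 2"
    using assms unfolding tendsto_iff by (force simp: nonneg elim: allE[of _ "\<epsilon> / 2"])
  then obtain n0 where n0: "\<And>n. n \<ge> n0 \<Longrightarrow> nm (f n) < \<epsilon> / 2" by (auto simp: eventually_sequentially)
  have le: "nm ((\<Sum>n<m. f n) - (\<Sum>n<n'. f n)) \<le> \<epsilon> / 2" if "n0 \<le> n'" "n' \<le> m" for m n'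
  proof -
    have "(\<Sum>n<m. f n) - (\<Sum>n<n'. f n) = (\<Sum>n\<in>{n'..<m}. f n)"
    proof -
      have "{..<m} = {..<n'} \<union> {n'..<m}" using that by auto
      then have "(\<Sum>n<m. f n) = (\<Sum>n<n'. f n) + (\<Sum>n\<in>{n'..<m}. f n)"
        by (metis finite_atLeastLessThan finite_lessThan ivl_disj_int_one(2) sum.union_disjoint)
      then show ?thesis by simp
    qed
    moreover have "nm (\<Sum>n\<in>{n'..<m}. f n) \<le> \<epsilon> / 2"
      by (rule sum_le) (use e n0 that in \<open>auto intro!: less_imp_le\<close>)
    ultimately show ?thesis by simp
  qed
  show "\<exists>n0. \<forall>m\<ge>n0. \<forall>n\<ge>n0. nm ((\<Sum>n<m. f n) - (\<Sum>n<n. f n)) < \<epsilon>"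
  proof (intro exI[of _ n0] allI impI)
    fix m n assume "n0 \<le> m" "n0 \<le> n"
    then show "nm ((\<Sum>n<m. f n) - (\<Sum>n<n. f n)) < \<epsilon>"
      using le[of n m] le[of m n] e minus_commute[of "\<Sum>n<m. f n"] by (cases "n \<le> m") auto
  qed
qed

lemma tends_additive:
  assumes s: "tends s l" and add: "\<And>x y. f (x + y) = f x + f y"
    and cont: "\<And>\<epsilon>. \<epsilon> > 0 \<Longrightarrow> \<exists>\<delta>>0. \<forall>x. nm x < \<delta> \<longrightarrow> nm (f x) < \<epsilon>"
  shows "tends (\<lambda>n. f (s n)) (f l)"
  unfolding tends_eventually
proof (intro allI impI)
  fix \<epsilon> :: real assume "\<epsilon> > 0"
  then obtain \<delta> where d: "\<delta> > 0" "\<And>x. nm x < \<delta> \<Longrightarrow> nm (f x) < \<epsilon>" using cont by blast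
  have fd: "f (x - y) = f x - f y" for x y using add[of "x - y" y] by simp
  have "\<forall>\<^sub>F n in sequentially. nm (s n - l) < \<delta>" using s d by (simp add: tends_eventually)
  then show "\<forall>\<^sub>F n in sequentially. nm (f (s n) - f l) < \<epsilon>"
    by eventually_elim (use d fd in metis)
qed

end

section \<open>Anderson modules and their exponential function\<close>

text \<open>For an element \<open>t\<close> with scalar \<open>\<partial>t = t\<close>, comparing
  the coefficients of \<open>\<tau>^n\<close> in \<open>exp (t x) = \<phi>_t (exp x)\<close> gives
  \<open>(t^(q^n) - t) e_n = \<Sum> P_m e_(n-m)^(q^m)\<close>, summed over
  \<open>1 \<le> m \<le> n\<close>, with \<open>P\<close> the coefficients of
  \<open>\<phi>_t\<close> and Frobenius acting on matrix entries. Scalarity is what lets the left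
  side be solved by a division.\<close>

fun exp_coeff :: "nat \<Rightarrow> 'c::field \<Rightarrow> (nat \<Rightarrow> 'c ^ 'd::finite ^ 'd) \<Rightarrow> nat \<Rightarrow> 'c ^ 'd ^ 'd" where
  "exp_coeff q t P n = (if n = 0 then mat 1 else
     (\<chi> i j. inverse (t ^ (q ^ n) - t) * (\<Sum>m\<in>{1..n}. P m ** frob_mat q m (exp_coeff q t P (n - m))) $ i $ j))"

declare exp_coeff.simps [simp del]

lemma vec_as_sum: "(x :: 'c::field ^ 'd::finite) = (\<Sum>i\<in>UNIV. x $ i *s axis i 1)"
  by (simp add: vec_eq_iff axis_def if_distrib cong: if_cong)

text \<open>Evaluation of a polynomial at an operator, so that the Frobenius identity for
  \<open>(X - a)^(p^m)\<close> can be used in the commutative polynomial ring.\<close>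

definition poly_op :: "('c::field ^ 'd::finite \<Rightarrow> 'c ^ 'd) \<Rightarrow> 'c poly \<Rightarrow> 'c ^ 'd \<Rightarrow> 'c ^ 'd" where
  "poly_op T p v = (\<Sum>i\<le>degree p. coeff p i *s (T ^^ i) v)"

lemma poly_op_bound:
  assumes "degree p \<le> n" shows "poly_op T p v = (\<Sum>i\<le>n. coeff p i *s (T ^^ i) v)"
  unfolding poly_op_def by (rule sum.mono_neutral_left) (use assms in \<open>auto simp: coeff_eq_0\<close>)

lemma linear_op_sum:
  fixes T :: "'c::field ^ 'd::finite \<Rightarrow> 'c ^ 'd"
  assumes "\<And>x y. T (x + y) = T x + T y" "\<And>c x. T (c *s x) = c *s T x"
  shows "T (\<Sum>i\<in>I. c i *s x i) = (\<Sum>i\<in>I. c i *s T (x i))"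
proof -
  have "T 0 = 0" using assms(2)[of 0 0] by simp
  then show ?thesis by (induction I rule: infinite_finite_induct) (auto simp: assms)
qed

lemma poly_op_linear_factor:
  fixes T :: "'c::field ^ 'd::finite \<Rightarrow> 'c ^ 'd"
  assumes T: "\<And>x y. T (x + y) = T x + T y" "\<And>c x. T (c *s x) = c *s T x"
  shows "poly_op T ([:- a, 1:] * p) v = T (poly_op T p v) - a *s poly_op T p v"
proof -
  define n where "n = degree p"
  have "degree ([:- a, 1:] * p) \<le> Suc n" using degree_mult_le[of "[:- a, 1:]" p] by (simp add: n_def)
  then have "poly_op T ([:- a, 1:] * p) v = (\<Sum>i\<le>Suc n. coeff ([:- a, 1:] * p) i *s (T ^^ i) v)"
    by (rule poly_op_bound)
  also have "\<dots> = (\<Sum>i\<le>Suc n. coeff (pCons 0 p) i *s (T ^^ i) v) - (\<Sum>i\<le>Suc n. (a * coeff p i) *s (T ^^ i) v)"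
    unfolding sum_subtractf[symmetric] by (rule sum.cong) (auto simp: vector_sub_rdistrib)
  also have "(\<Sum>i\<le>Suc n. coeff (pCons 0 p) i *s (T ^^ i) v) = (\<Sum>i\<le>n. coeff p i *s T ((T ^^ i) v))"
    by (subst sum.atMost_Suc_shift) simp
  also have "\<dots> = T (poly_op T p v)" unfolding poly_op_def n_def by (rule linear_op_sum[OF T, symmetric])
  also have "(\<Sum>i\<le>Suc n. (a * coeff p i) *s (T ^^ i) v) = a *s (\<Sum>i\<le>Suc n. coeff p i *s (T ^^ i) v)"
    by (simp add: vec.scale_sum_right vector_smult_assoc vector_add_ldistrib)
  also have "(\<Sum>i\<le>Suc n. coeff p i *s (T ^^ i) v) = poly_op T p v"
    by (rule poly_op_bound[symmetric]) (simp add: n_def)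
  finally show ?thesis .
qed

lemma poly_op_linear_power:
  fixes T :: "'c::field ^ 'd::finite \<Rightarrow> 'c ^ 'd"
  assumes T: "\<And>x y. T (x + y) = T x + T y" "\<And>c x. T (c *s x) = c *s T x"
  shows "poly_op T ([:- a, 1:] ^ m) v = ((\<lambda>y. T y - a *s y) ^^ m) v"
proof (induction m)
  case 0
  then show ?case by (simp add: poly_op_def)
next
  case (Suc m)
  then show ?case using poly_op_linear_factor[OF T, of a "[:- a, 1:] ^ m" v] by simp
qed

section \<open>Norms, the derived action and the action of \<open>A\<close> on points\<close>

locale anderson_ctx =
  fixes E :: "('c::field, 'd::finite) anderson_data" and u :: 'c
  assumes am: "anderson_module E" and uA': "u \<in> coord_ring E" and sep_u': "separating E u"
begin

sublocale curve_ctx E u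
  by standard (use am uA' sep_u' in \<open>auto simp: anderson_module_def\<close>)

abbreviation vn :: "'c ^ 'd \<Rightarrow> real" where "vn \<equiv> vnorm E"
abbreviation "lie \<equiv> lie_act E"
abbreviation "ph \<equiv> phi_act E"
abbreviation fr :: "nat \<Rightarrow> 'c ^ 'd \<Rightarrow> 'c ^ 'd" where "fr \<equiv> frob_vec q"

lemma vn_le_iff: "vn x \<le> B \<longleftrightarrow> (\<forall>i. N (x $ i) \<le> B)"
  unfolding vnorm_def by (subst Max_le_iff) auto

lemma N_le_vn: "N (x $ i) \<le> vn x"
  using vn_le_iff[of x "vn x"] by simp

lemma vn_nonneg: "vn x \<ge> 0"
  using N_le_vn[of x undefined] N_nonneg[of "x $ undefined"] by linarith

lemma vn_attained: "\<exists>i. vn x = N (x $ i)"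
proof -
  have "vn x \<in> range (\<lambda>i. N (x $ i))" unfolding vnorm_def by (rule Max_in) auto
  then show ?thesis by auto
qed

lemma vn_scale: "vn (c *s x) = N c * vn x"
proof (rule antisym)
  show "vn (c *s x) \<le> N c * vn x" unfolding vn_le_iff
    using N_le_vn[of x] N_nonneg[of c] by (auto simp: N_mult intro: mult_left_mono)
  obtain i where "vn x = N (x $ i)" using vn_attained by blast
  then show "N c * vn x \<le> vn (c *s x)" using N_le_vn[of "c *s x" i] by (simp add: N_mult)
qed

sublocale Cn: ultranorm N
proof
  fix s :: "nat \<Rightarrow> 'c"
  assume "\<forall>\<epsilon>>0. \<exists>n0. \<forall>m\<ge>n0. \<forall>n\<ge>n0. N (s m - s n) < \<epsilon>"
  then show "\<exists>l. (\<lambda>n. N (s n - l)) \<longlonglongrightarrow> 0" using complete by (auto simp: complete_wrt_def)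
qed (auto simp: N_nonneg N_0_iff N_uminus N_add)

sublocale Vn: ultranorm vn
proof
  fix x y :: "'c ^ 'd"
  show "0 \<le> vn x" by (rule vn_nonneg)
  show "(vn x = 0) = (x = 0)"
  proof
    assume "vn x = 0"
    then have "N (x $ i) = 0" for i using N_le_vn[of x i] N_nonneg[of "x $ i"] by simp
    then show "x = 0" by (simp add: N_0_iff vec_eq_iff)
  next
    assume "x = 0"
    then show "vn x = 0" using vn_le_iff[of x 0] vn_nonneg[of x] by simp
  qed
  show "vn (- x) = vn x" unfolding vnorm_def by (simp add: N_uminus)
  show "vn (x + y) \<le> max (vn x) (vn y)" unfolding vn_le_iff
  proof
    fix i
    show "N ((x + y) $ i) \<le> max (vn x) (vn y)"
      using N_add[of "x $ i" "y $ i"] N_le_vn[of x i] N_le_vn[of y i] by simp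
  qed
next
  fix s :: "nat \<Rightarrow> 'c ^ 'd"
  assume c: "\<forall>\<epsilon>>0. \<exists>n0. \<forall>m\<ge>n0. \<forall>n\<ge>n0. vn (s m - s n) < \<epsilon>"
  have "\<exists>l. (\<lambda>n. N (s n $ i - l)) \<longlonglongrightarrow> 0" for i
  proof (rule Cn.cauchy_converges, intro allI impI)
    fix \<epsilon> :: real assume "\<epsilon> > 0"
    then obtain n0 where n0: "\<forall>m\<ge>n0. \<forall>n\<ge>n0. vn (s m - s n) < \<epsilon>" using c by blast
    have "N (s m $ i - s n $ i) < \<epsilon>" if "m \<ge> n0" "n \<ge> n0" for m n
      using n0 that N_le_vn[of "s m - s n" i] by (metis le_less_trans vector_minus_component)
    then show "\<exists>n0. \<forall>m\<ge>n0. \<forall>n\<ge>n0. N (s m $ i - s n $ i) < \<epsilon>" by blast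
  qed
  then obtain l where l: "\<And>i. (\<lambda>n. N (s n $ i - l i)) \<longlonglongrightarrow> 0" by metis
  have "(\<lambda>n. \<Sum>i\<in>UNIV. N (s n $ i - l i)) \<longlonglongrightarrow> (\<Sum>i\<in>(UNIV :: 'd set). 0)"
    by (intro tendsto_sum l)
  then have *: "(\<lambda>n. \<Sum>i\<in>UNIV. N (s n $ i - l i)) \<longlonglongrightarrow> 0" by simp
  have "vn (s n - vec_lambda l) \<le> (\<Sum>i\<in>UNIV. N (s n $ i - l i))" for n
    unfolding vn_le_iff by (auto intro!: member_le_sum simp: N_nonneg)
  then show "\<exists>l. (\<lambda>n. vn (s n - l)) \<longlonglongrightarrow> 0"
    by (intro exI[of _ "vec_lambda l"] tendsto_sandwich[OF _ _ tendsto_const *]) (auto simp: vn_nonneg)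
qed

definition mn :: "'c ^ 'd ^ 'd \<Rightarrow> real" where "mn M = (MAX i. vn (M $ i))"

lemma mn_le_iff: "mn M \<le> B \<longleftrightarrow> (\<forall>i j. N (M $ i $ j) \<le> B)"
proof -
  have "mn M \<le> B \<longleftrightarrow> (\<forall>i. vn (M $ i) \<le> B)" unfolding mn_def by (subst Max_le_iff) auto
  then show ?thesis by (simp add: vn_le_iff)
qed

lemma N_le_mn: "N (M $ i $ j) \<le> mn M"
  using mn_le_iff[of M "mn M"] by simp

lemma mn_nonneg: "mn M \<ge> 0"
  using N_le_mn[of M undefined undefined] N_nonneg[of "M $ undefined $ undefined"] by linarith

lemma vn_mult: "vn (M *v x) \<le> mn M * vn x"
  unfolding vn_le_iff matrix_vector_mult_def
proof
  fix i
  have "N (\<Sum>j\<in>UNIV. M $ i $ j * x $ j) \<le> mn M * vn x"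
    by (rule Cn.sum_le) (auto simp: N_mult mn_nonneg vn_nonneg N_nonneg intro!: mult_mono N_le_mn N_le_vn)
  then show "N ((\<chi> i. \<Sum>j\<in>UNIV. M $ i $ j * x $ j) $ i) \<le> mn M * vn x" by simp
qed

lemma mn_mult: "mn (M ** M') \<le> mn M * mn M'"
  unfolding mn_le_iff matrix_matrix_mult_def
proof (intro allI)
  fix i j
  have "N (\<Sum>l\<in>UNIV. M $ i $ l * M' $ l $ j) \<le> mn M * mn M'"
    by (rule Cn.sum_le) (auto simp: N_mult mn_nonneg N_nonneg intro!: mult_mono N_le_mn)
  then show "N ((\<chi> i j. \<Sum>l\<in>UNIV. M $ i $ l * M' $ l $ j) $ i $ j) \<le> mn M * mn M'" by simp
qed

lemma mn_sum: "B \<ge> 0 \<Longrightarrow> (\<And>i. i \<in> I \<Longrightarrow> mn (f i) \<le> B) \<Longrightarrow> mn (\<Sum>i\<in>I. f i) \<le> B"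
  unfolding mn_le_iff by (auto intro!: Cn.sum_le)

lemma mn_frob: "mn (frob_mat q n M) \<le> mn M ^ (q ^ n)"
  unfolding mn_le_iff frob_mat_def by (auto simp: N_power intro!: power_mono N_le_mn N_nonneg)

lemma vn_frob: "vn (fr n x) \<le> vn x ^ (q ^ n)"
  unfolding vn_le_iff frob_vec_def by (auto simp: N_power intro!: power_mono N_le_vn N_nonneg)

lemma frob_sum: "(\<Sum>i\<in>I. f i :: 'c) ^ (q ^ n) = (\<Sum>i\<in>I. f i ^ (q ^ n))"
proof -
  have "0 < q" using q_ge_2 by simp
  then show ?thesis by (induction I rule: infinite_finite_induct) (auto simp: frob_add)
qed

lemma fr_add: "fr n (x + y) = fr n x + fr n y"
  by (simp add: frob_vec_def vec_eq_iff frob_add)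

lemma fr_scale: "fr n (c *s x) = c ^ (q ^ n) *s fr n x"
  by (simp add: frob_vec_def vec_eq_iff power_mult_distrib)

lemma fr_scale_F: "c \<in> F \<Longrightarrow> fr n (c *s x) = c *s fr n x"
  by (simp add: fr_scale frob_F)

lemma fr_mult: "fr n (M *v x) = frob_mat q n M *v fr n x"
  by (simp add: frob_vec_def frob_mat_def vec_eq_iff matrix_vector_mult_def frob_sum power_mult_distrib)

lemma fr_fr: "fr m (fr n x) = fr (m + n) x"
  by (simp add: frob_vec_def power_mult[symmetric] power_add mult.commute)

lemma fr_0 [simp]: "fr 0 x = x" by (simp add: frob_vec_def)

lemma fr_zero [simp]: "fr n 0 = 0"
  using q_ge_2 by (simp add: frob_vec_def vec_eq_iff)

lemma fr_sum: "fr n (\<Sum>i\<in>I. f i) = (\<Sum>i\<in>I. fr n (f i))"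
  by (induction I rule: infinite_finite_induct) (auto simp: fr_add)

lemma am_facts:
  shows base: "subfield_of (base_field E)"
    and phi_finite: "a \<in> A \<Longrightarrow> finite {n. phi E a n \<noteq> 0}"
    and phi_const: "c \<in> F \<Longrightarrow> phi E c n = (if n = 0 then mat c else 0)"
    and phi_add: "a \<in> A \<Longrightarrow> b \<in> A \<Longrightarrow> phi E (a + b) n = phi E a n + phi E b n"
    and phi_mult: "a \<in> A \<Longrightarrow> b \<in> A \<Longrightarrow>
      phi E (a * b) n = (\<Sum>i\<le>n. phi E a i ** frob_mat q i (phi E b (n - i)))"
    and phi_nilpotent: "a \<in> A \<Longrightarrow> \<exists>m. \<forall>x. (\<forall>i. x $ i \<in> base_field E) \<longrightarrow> ((\<lambda>y. lie a y - a *s y) ^^ m) x = 0"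
  using am by (auto simp: anderson_module_def)

lemma lie_add: "lie a (x + y) = lie a x + lie a y"
  by (simp add: lie_act_def matrix_vector_right_distrib)

lemma lie_scale: "lie a (c *s x) = c *s lie a x"
  by (simp add: lie_act_def vector_scalar_commute)

lemma lie_0 [simp]: "lie a 0 = 0" by (simp add: lie_act_def)

lemma lie_diff: "lie a (x - y) = lie a x - lie a y"
  using lie_add[of a "x - y" y] by simp

lemma lie_sum: "lie a (\<Sum>i\<in>I. f i) = (\<Sum>i\<in>I. lie a (f i))"
  by (induction I rule: infinite_finite_induct) (auto simp: lie_add)

lemma lie_plus: "a \<in> A \<Longrightarrow> b \<in> A \<Longrightarrow> lie (a + b) x = lie a x + lie b x"
  by (simp add: lie_act_def phi_add matrix_vector_mult_add_rdistrib)

lemma lie_mult: "a \<in> A \<Longrightarrow> b \<in> A \<Longrightarrow> lie (a * b) x = lie a (lie b x)"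
  by (simp add: lie_act_def phi_mult frob_mat_def matrix_vector_mul_assoc)

lemma lie_const: "c \<in> F \<Longrightarrow> lie c x = c *s x"
  by (simp add: lie_act_def phi_const matrix_vector_mult_def mat_def vec_eq_iff if_distrib[of "\<lambda>x. x * _"] cong: if_cong)

lemma lie_commute: "a \<in> A \<Longrightarrow> b \<in> A \<Longrightarrow> lie a (lie b x) = lie b (lie a x)"
  using lie_mult[of a b x] lie_mult[of b a x] by (simp add: mult.commute)

lemma lie_power: "a \<in> A \<Longrightarrow> lie (a ^ n) x = (lie a ^^ n) x"
  by (induction n) (auto simp: lie_mult lie_const subring_of_1[OF Fr] subring_of_power[OF A_subring])

lemma lie_bound: "vn (lie a x) \<le> mn (phi E a 0) * vn x"
  unfolding lie_act_def by (rule vn_mult)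

text \<open>In characteristic \<open>p\<close> the unipotent part dies under a \<open>p\<close>-power: \<open>\<partial>a\<close> raised to a large
  power of \<open>p\<close> is a scalar.\<close>

lemma lie_power_scalar:
  assumes a: "a \<in> A"
  shows "\<exists>e>0. \<forall>x. lie (a ^ e) x = a ^ e *s x"
proof -
  define T where "T = (\<lambda>y. lie a y - a *s y)"
  have T_add: "T (x + y) = T x + T y" and T_scale: "T (c *s x) = c *s T x" for x y c
    by (auto simp: T_def lie_add lie_scale vec.scale_right_distrib vec.scale_right_diff_distrib mult.commute)
  have Tm_add: "(T ^^ m) (x + y) = (T ^^ m) x + (T ^^ m) y" and Tm_scale: "(T ^^ m) (c *s x) = c *s (T ^^ m) x"
    for m x y c by (induction m) (auto simp: T_add T_scale)
  obtain m where m: "\<And>x. (\<forall>i. x $ i \<in> base_field E) \<Longrightarrow> (T ^^ m) x = 0"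
    using phi_nilpotent[OF a] unfolding T_def by blast
  \<comment> \<open>Nilpotency is given only on vectors over the base field; the standard basis
    vectors are such, and linearity over the whole ambient field does the rest.\<close>
  have ax: "(T ^^ m) (axis i 1) = 0" for i
    by (rule m) (use subring_of_0[OF subfield_of_subring[OF base]] subring_of_1[OF subfield_of_subring[OF base]]
      in \<open>auto simp: axis_def\<close>)
  have Tm: "(T ^^ m) x = 0" for x
  proof -
    have "(T ^^ m) x = (T ^^ m) (\<Sum>i\<in>UNIV. x $ i *s axis i 1)" by (subst (1) vec_as_sum) simp
    also have "\<dots> = (\<Sum>i\<in>UNIV. x $ i *s (T ^^ m) (axis i 1))" by (rule linear_op_sum[OF Tm_add Tm_scale])
    finally show ?thesis by (simp add: ax)
  qed
  define e where "e = CHAR('c) ^ m"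
  have "m < CHAR('c) ^ m" by (rule power_gt_expt) (use prime_gt_1_nat[OF prime_char] in simp)
  then have em: "e \<ge> m" "e > 0" using char_pos by (auto simp: e_def)
  have "(T ^^ e) x = (T ^^ (e - m)) ((T ^^ m) x)" for x
    using em by (simp add: funpow_add[symmetric, THEN fun_cong, simplified])
  then have Te: "(T ^^ e) x = 0" for x using Tm_scale[of "e - m" 0 0] Tm by simp
  have "[:- a, 1:] = [:- a:] + monom 1 1" by (simp add: monom_Suc monom_0)
  then have "[:- a, 1:] ^ e = [:- a:] ^ e + monom 1 1 ^ e"
    using freshmans_dream'[of e m "[:- a:]" "monom 1 1"] prime_char by (simp add: e_def)
  also have "monom (1::'c) 1 ^ e = monom 1 e" by (simp add: monom_power)
  also have "[:- a:] ^ e = [:(- a) ^ e:]" by (induction e) (auto simp: one_pCons mult.commute)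
  \<comment> \<open>In every characteristic, including 2, \<open>0 = (-a + a)^e\<close> splits by
    the Frobenius identity.\<close>
  also have "(- a) ^ e = - (a ^ e)"
    using freshmans_dream'[OF prime_char e_def, of "- a" a] em by (simp add: eq_neg_iff_add_eq_0 power_0_left)
  finally have pe: "[:- a, 1:] ^ e = [:- (a ^ e):] + monom 1 e" .
  have "0 = (lie a ^^ e) x - a ^ e *s x" for x
  proof -
    have "0 = poly_op (lie a) ([:- a, 1:] ^ e) x"
      using poly_op_linear_power[where T = "lie a" and a = a and m = e and v = x, OF lie_add lie_scale] Te
      unfolding T_def by simp
    also have "\<dots> = (\<Sum>i\<le>e. coeff ([:- (a ^ e):] + monom 1 e) i *s (lie a ^^ i) x)"
      unfolding pe by (rule poly_op_bound) (auto intro!: degree_add_le degree_monom_le)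
    also have "\<dots> = (\<Sum>i\<in>{0, e}. coeff ([:- (a ^ e):] + monom 1 e) i *s (lie a ^^ i) x)"
      by (rule sum.mono_neutral_right) (auto simp: coeff_pCons split: nat.splits)
    also have "\<dots> = (lie a ^^ e) x - a ^ e *s x" using em by (simp add: coeff_pCons split: nat.splits)
    finally show ?thesis .
  qed
  then have "lie (a ^ e) x = a ^ e *s x" for x using lie_power[OF a, of e x] by simp
  then show ?thesis using em by blast
qed

lemma ph_sum: assumes "\<And>n. n \<ge> D \<Longrightarrow> phi E a n = 0"
  shows "ph a x = (\<Sum>n<D. phi E a n *v fr n x)"
  unfolding phi_act_def by (rule sum.mono_neutral_left) (use assms in \<open>auto simp: not_le[symmetric]\<close>)

lemma phi_degree: assumes "a \<in> A" shows "\<exists>D>0. \<forall>n\<ge>D. phi E a n = 0"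
proof -
  obtain m where "\<forall>n\<in>{n. phi E a n \<noteq> 0}. n < m"
    using phi_finite[OF assms] finite_nat_set_iff_bounded by blast
  then show ?thesis by (intro exI[of _ "Suc m"]) force
qed

lemma ph_add: "ph a (x + y) = ph a x + ph a y"
  by (simp add: phi_act_def fr_add matrix_vector_right_distrib sum.distrib)

lemma ph_scale_F: "c \<in> F \<Longrightarrow> ph a (c *s x) = c *s ph a x"
  by (simp add: phi_act_def fr_scale_F vector_scalar_commute vec.scale_sum_right)

lemma ph_0 [simp]: "ph a 0 = 0" using ph_add[of a 0 0] by simp

lemma ph_diff: "ph a (x - y) = ph a x - ph a y"
  using ph_add[of a "x - y" y] by simp

lemma mat_sum_mult: "(\<Sum>i\<in>I. M i) *v x = (\<Sum>i\<in>I. M i *v (x :: 'c ^ 'd))"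
  by (induction I rule: infinite_finite_induct) (auto simp: matrix_vector_mult_add_rdistrib)

lemma mat_mult_sum: "M *v (\<Sum>i\<in>I. x i) = (\<Sum>i\<in>I. M *v (x i :: 'c ^ 'd))"
  by (induction I rule: infinite_finite_induct) (auto simp: matrix_vector_right_distrib)

text \<open>Composition of twisted polynomials: Frobenius passes a matrix by raising its entries to
  a power, which turns the composite into a Cauchy product. The triangle and the rectangle of index
  pairs carry the same nonzero terms.\<close>

lemma ph_mult:
  assumes a: "a \<in> A" and b: "b \<in> A" shows "ph (a * b) x = ph a (ph b x)"
proof -
  obtain D1 where D1: "\<forall>n\<ge>D1. phi E a n = 0" using phi_degree[OF a] by blast
  obtain D2 where D2: "\<forall>n\<ge>D2. phi E b n = 0" using phi_degree[OF b] by blast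
  define g where "g i j = (phi E a i ** frob_mat q i (phi E b j)) *v fr (i + j) x" for i j
  have fz: "frob_mat q i 0 = (0 :: 'c ^ 'd ^ 'd)" for i
    using q_ge_2 by (simp add: frob_mat_def vec_eq_iff)
  have g0: "g i j = 0" if "i \<ge> D1 \<or> j \<ge> D2" for i j
    using that D1 D2 by (auto simp: g_def fz)
  have ab0: "phi E (a * b) n = 0" if "n \<ge> D1 + D2" for n
    unfolding phi_mult[OF a b]
  proof (rule sum.neutral, intro ballI)
    fix i assume "i \<in> {..n}"
    show "phi E a i ** frob_mat q i (phi E b (n - i)) = 0"
    proof (cases "i \<ge> D1")
      case False
      then have "n - i \<ge> D2" using that by simp
      then show ?thesis using D2 by (simp add: fz)
    qed (use D1 in simp)
  qed
  have "ph (a * b) x = (\<Sum>n<D1 + D2. phi E (a * b) n *v fr n x)" by (rule ph_sum[OF ab0])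
  also have "\<dots> = (\<Sum>n<D1 + D2. \<Sum>i\<le>n. g i (n - i))"
    by (rule sum.cong[OF HOL.refl]) (simp add: phi_mult[OF a b] g_def mat_sum_mult)
  also have "\<dots> = (\<Sum>(i, j)\<in>{(i, j). i + j < D1 + D2}. g i j)" by (rule sum.triangle_reindex[symmetric])
  also have "\<dots> = (\<Sum>(i, j)\<in>{..<D1} \<times> {..<D2}. g i j)"
  proof (rule sum.mono_neutral_right)
    show "finite {(i, j). i + j < D1 + D2}"
      by (rule finite_subset[of _ "{..<D1+D2} \<times> {..<D1+D2}"]) auto
  qed (use g0 in \<open>force simp: not_less\<close>)+
  also have "\<dots> = (\<Sum>i<D1. \<Sum>j<D2. g i j)" by (rule sum.cartesian_product[symmetric])
  also have "\<dots> = (\<Sum>i<D1. phi E a i *v fr i (\<Sum>j<D2. phi E b j *v fr j x))"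
    by (simp add: g_def fr_sum fr_mult fr_fr matrix_vector_mul_assoc mat_mult_sum)
  also have "\<dots> = ph a (ph b x)" using ph_sum[of D1 a] ph_sum[of D2 b] D1 D2 by simp
  finally show ?thesis .
qed

lemma ph_commute: "a \<in> A \<Longrightarrow> b \<in> A \<Longrightarrow> ph a (ph b x) = ph b (ph a x)"
  using ph_mult[of a b x] ph_mult[of b a x] by (simp add: mult.commute)

text \<open>As \<open>q \<ge> 2\<close>, on the unit ball each term past the linear one is at most
  quadratic in the norm. This exponent is what the uniqueness and inversion arguments for the
  exponential function use.\<close>

lemma frob_term_bound:
  assumes "vn x \<le> 1" "n \<ge> 1" shows "vn (M *v fr n x) \<le> mn M * vn x ^ 2"
proof -
  have "2 \<le> q ^ n" using q_ge_2 assms(2) by (metis One_nat_def Suc_le_D le_trans mult.right_neutral one_le_power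
        power_increasing power_one_right le_numeral_extra(4) add_leE one_add_one)
  then have "vn x ^ (q ^ n) \<le> vn x ^ 2" using assms(1) vn_nonneg by (intro power_decreasing) auto
  then have "vn (fr n x) \<le> vn x ^ 2" using vn_frob[of n x] by linarith
  then show ?thesis using vn_mult[of M "fr n x"] mult_left_mono[of "vn (fr n x)" "vn x ^ 2" "mn M"] mn_nonneg[of M] by linarith
qed

lemma ph_lie_bound:
  assumes a: "a \<in> A"
  shows "\<exists>B\<ge>1. \<forall>x. vn x \<le> 1 \<longrightarrow> vn (ph a x - lie a x) \<le> B * vn x ^ 2"
proof -
  obtain D where D: "D > 0" "\<forall>n\<ge>D. phi E a n = 0" using phi_degree[OF a] by blast
  define B where "B = 1 + (\<Sum>n<D. mn (phi E a n))"
  have "B \<ge> 1" by (auto simp: B_def intro: sum_nonneg mn_nonneg)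
  moreover have "vn (ph a x - lie a x) \<le> B * vn x ^ 2" if "vn x \<le> 1" for x
  proof -
    have "ph a x = phi E a 0 *v fr 0 x + (\<Sum>n\<in>{1..<D}. phi E a n *v fr n x)"
      using ph_sum[of D a x] D by (simp add: lessThan_atLeast0 sum.atLeast_Suc_lessThan)
    then have "ph a x - lie a x = (\<Sum>n\<in>{1..<D}. phi E a n *v fr n x)" by (simp add: lie_act_def)
    also have "vn \<dots> \<le> B * vn x ^ 2"
    proof (rule Vn.sum_le)
      fix n assume n: "n \<in> {1..<D}"
      have "mn (phi E a n) \<le> (\<Sum>n<D. mn (phi E a n))" by (rule member_le_sum) (use n mn_nonneg in auto)
      then have "mn (phi E a n) * vn x ^ 2 \<le> B * vn x ^ 2" unfolding B_def by (intro mult_right_mono) auto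
      then show "vn (phi E a n *v fr n x) \<le> B * vn x ^ 2" using frob_term_bound[OF that, of n "phi E a n"] n by auto
    qed (use \<open>B \<ge> 1\<close> in auto)
    finally show ?thesis .
  qed
  ultimately show ?thesis by blast
qed

lemma ph_bound:
  assumes a: "a \<in> A"
  shows "\<exists>B\<ge>1. \<forall>x. vn x \<le> 1 \<longrightarrow> vn (ph a x) \<le> B * vn x"
proof -
  obtain B where B: "B \<ge> 1" "\<And>x. vn x \<le> 1 \<Longrightarrow> vn (ph a x - lie a x) \<le> B * vn x ^ 2" using ph_lie_bound[OF a] by blast
  define B' where "B' = B + mn (phi E a 0)"
  have "vn (ph a x) \<le> B' * vn x" if x: "vn x \<le> 1" for x
  proof -
    have "vn x ^ 2 \<le> vn x" using x vn_nonneg[of x] by (simp add: power2_eq_square mult_left_le)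
    then have "B * vn x ^ 2 \<le> B * vn x" using B by simp
    moreover have "B * vn x \<le> B' * vn x" "mn (phi E a 0) * vn x \<le> B' * vn x"
      using B mn_nonneg[of "phi E a 0"] vn_nonneg[of x] by (auto simp: B'_def intro!: mult_right_mono)
    ultimately have "vn (ph a x - lie a x) \<le> B' * vn x" "vn (lie a x) \<le> B' * vn x"
      using B(2)[OF x] lie_bound[of a x] by linarith+
    from Vn.add_le[OF this] show ?thesis by simp
  qed
  then show ?thesis using B mn_nonneg[of "phi E a 0"] by (intro exI[of _ B']) (auto simp: B'_def)
qed

end

section \<open>The exponential function: uniqueness, construction and local inverse\<close>

context anderson_ctx
begin

text \<open>A power of \<open>u\<close>; its derived action is a homothety expanding by
  \<open>N t\<close>, which makes the recursion and the estimates scalar.\<close>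

lemma exists_scalar_element: "\<exists>t\<in>A. (\<forall>x. lie t x = t *s x) \<and> N t > 1"
proof -
  obtain e where e: "e > 0" "\<forall>x. lie (u ^ e) x = u ^ e *s x" using lie_power_scalar[OF uA] by blast
  have "N (u ^ e) > 1" unfolding N_power using u_large e by simp
  moreover have "u ^ e \<in> A" using subring_of_power[OF A_subring uA] .
  ultimately show ?thesis using e by blast
qed

text \<open>Equivariance writes \<open>G x\<close> as \<open>m\<close> applications of
  \<open>\<phi>_t\<close> to \<open>G (x / t^m)\<close>. With \<open>s = |t|\<close>, quadratic
  smallness near 0 makes the inner value of order \<open>s^(-2m)\<close>, while
  \<open>\<phi>_t\<close> expands small vectors by at most \<open>s\<close> each time; so
  \<open>G x\<close> is of order \<open>s^(-m)\<close> for all large \<open>m\<close>. The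
  uniqueness of the exponential function and its compatibility with all of \<open>A\<close> are both
  instances.\<close>

lemma equivariant_quadratic_eq_0:
  assumes t: "t \<in> A" "\<And>x. lie t x = t *s x" "N t > 1"
    and G: "\<And>x. G (t *s x) = ph t (G x)"
    and small: "\<rho> > 0" "\<And>x. vn x \<le> \<rho> \<Longrightarrow> vn (G x) \<le> B * vn x ^ 2"
  shows "G x = 0"
proof -
  define s where "s = N t"
  have s1: "s > 1" using t by (simp add: s_def)
  have t0: "t \<noteq> 0" using t(3) by auto
  obtain B' where B': "B' \<ge> 1" "\<And>x. vn x \<le> 1 \<Longrightarrow> vn (ph t x - lie t x) \<le> B' * vn x ^ 2"
    using ph_lie_bound[OF t(1)] by blast
  \<comment> \<open>Within this radius the quadratic error \<open>B' |y|^2\<close> is at most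
    \<open>|y|\<close>, so \<open>\<phi>_t\<close> expands no more than its linear part.\<close>
  define r where "r = 1 / B'"
  have r: "r > 0" "r \<le> 1" using B' by (auto simp: r_def)
  have step: "vn (ph t y) \<le> s * vn y" if y: "vn y \<le> r" for y
  proof -
    have "B' * vn y \<le> 1" using y B' by (simp add: r_def field_simps)
    then have "B' * vn y * vn y \<le> 1 * vn y" by (intro mult_right_mono vn_nonneg)
    moreover have "1 * vn y \<le> s * vn y" using s1 by (intro mult_right_mono vn_nonneg) auto
    ultimately have "vn (ph t y - lie t y) \<le> s * vn y"
      using B'(2)[of y] y r by (simp add: power2_eq_square mult.assoc)
    moreover have "vn (lie t y) \<le> s * vn y" by (simp add: t vn_scale s_def)
    ultimately have "vn ((ph t y - lie t y) + lie t y) \<le> s * vn y" by (rule Vn.add_le)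
    then show ?thesis by simp
  qed
  have iter: "vn ((ph t ^^ m) y) \<le> s ^ m * vn y" if "s ^ m * vn y \<le> r" for m y
    using that
  proof (induction m)
    case (Suc m)
    have "s ^ m * vn y \<le> s ^ Suc m * vn y" using s1 vn_nonneg[of y] by (intro mult_right_mono power_increasing) auto
    then have 1: "s ^ m * vn y \<le> r" using Suc.prems by linarith
    then have 2: "vn ((ph t ^^ m) y) \<le> s ^ m * vn y" by (rule Suc.IH)
    then have "vn (ph t ((ph t ^^ m) y)) \<le> s * vn ((ph t ^^ m) y)" using 1 by (intro step) linarith
    also have "\<dots> \<le> s * (s ^ m * vn y)" using 2 s1 by (intro mult_left_mono) auto
    finally show ?case by simp
  qed simp
  define y where "y m = inverse t ^ m *s x" for m
  have Gx: "G x = (ph t ^^ m) (G (y m))" for m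
  proof (induction m)
    case (Suc m)
    have "y m = t *s y (Suc m)" using t0 by (simp add: y_def mult.assoc[symmetric])
    then have "G (y m) = ph t (G (y (Suc m)))" using G by simp
    then show ?case using Suc by (simp add: funpow_swap1)
  qed (simp add: y_def)
  have vy: "vn (y m) = inverse s ^ m * vn x" for m by (simp add: y_def vn_scale N_power N_inverse s_def)
  define b where "b m = max 0 B * vn x ^ 2 * inverse s ^ m" for m
  have lim: "(\<lambda>m. inverse s ^ m) \<longlonglongrightarrow> 0" using s1 by (intro LIMSEQ_realpow_zero) (auto simp: field_simps)
  have limb: "b \<longlonglongrightarrow> 0" unfolding b_def using tendsto_mult[OF tendsto_const[of "max 0 B * vn x ^ 2"] lim] by simp
  have "(\<lambda>m. inverse s ^ m * vn x) \<longlonglongrightarrow> 0" using tendsto_mult[OF lim tendsto_const[of "vn x"]] by simp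
  then have "\<forall>\<^sub>F m in sequentially. inverse s ^ m * vn x < \<rho>" by (rule order_tendstoD) (use small in auto)
  moreover have "\<forall>\<^sub>F m in sequentially. b m < r" using limb by (rule order_tendstoD) (use r in auto)
  ultimately have "\<forall>\<^sub>F m in sequentially. vn (G x) \<le> b m"
  proof eventually_elim
    case (elim m)
    have "vn (G (y m)) \<le> B * vn (y m) ^ 2" using elim vy by (intro small) auto
    also have "\<dots> \<le> max 0 B * vn (y m) ^ 2" by (intro mult_right_mono) auto
    finally have "s ^ m * vn (G (y m)) \<le> s ^ m * (max 0 B * vn (y m) ^ 2)" using s1 by (intro mult_left_mono) auto
    also have "\<dots> = b m" using s1
      by (simp add: vy b_def power_mult_distrib power2_eq_square power_inverse mult_ac)
    finally have le: "s ^ m * vn (G (y m)) \<le> b m" .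
    then have "vn ((ph t ^^ m) (G (y m))) \<le> s ^ m * vn (G (y m))" using elim by (intro iter) linarith
    then show ?case using le Gx[of m] by simp
  qed
  then have "vn (G x) \<le> 0" using limb tendsto_le[OF _ limb tendsto_const] by (metis trivial_limit_sequentially)
  then show ?thesis using vn_nonneg[of "G x"] Vn.zero_iff by (metis antisym)
qed

text \<open>Frobenius fixes the standard basis vectors, so convergence of the series there already
  forces the columns of the matrices \<open>e n\<close> to be bounded; the higher terms are then
  uniformly quadratic.\<close>

lemma exp_series_quadratic:
  assumes e0: "e 0 = mat 1" and ser: "\<And>x. Vn.tends (\<lambda>m. \<Sum>n<m. e n *v fr n x) (f x)"
  shows "\<exists>B\<ge>1. \<forall>x. vn x \<le> 1 \<longrightarrow> vn (f x - x) \<le> B * vn x ^ 2"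
proof -
  have fr_axis: "fr n (axis j 1) = axis j 1" for n j
    using q_ge_2 by (simp add: frob_vec_def axis_def vec_eq_iff power_0_left)
  have "\<exists>c. \<forall>n i. N (e n $ i $ j) \<le> c" for j
  proof -
    have "Vn.tends (\<lambda>n. e n *v axis j 1) 0"
      using Vn.tends_0_diff[OF ser[of "axis j 1"]] by (simp add: fr_axis)
    then have "(\<lambda>n. vn (e n *v axis j 1)) \<longlonglongrightarrow> 0" by (simp add: Vn.tends_def)
    then have "Bseq (\<lambda>n. vn (e n *v axis j 1))" by (meson convergentI convergent_imp_Bseq)
    then obtain c where "\<And>n. norm (vn (e n *v axis j 1)) \<le> c" by (auto simp: Bseq_def)
    then have c: "vn (e n *v axis j 1) \<le> c" for n by (metis abs_le_D1 real_norm_def)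
    have "N (e n $ i $ j) \<le> c" for n i
    proof -
      have "(e n *v axis j 1) $ i = e n $ i $ j"
        by (simp add: matrix_vector_mult_def axis_def if_distrib cong: if_cong)
      then show ?thesis using N_le_vn[of "e n *v axis j 1" i] c[of n] by simp
    qed
    then show ?thesis by blast
  qed
  then obtain c where c: "\<And>j n i. N (e n $ i $ j) \<le> c j" by metis
  define B where "B = 1 + (\<Sum>j\<in>UNIV. c j)"
  have c0: "c j \<ge> 0" for j using c[of 0 undefined j] N_nonneg[of "e 0 $ undefined $ j"] by linarith
  have mnB: "mn (e n) \<le> B" for n
    unfolding mn_le_iff
  proof (intro allI)
    fix i j
    have "c j \<le> (\<Sum>j\<in>UNIV. c j)" by (rule member_le_sum) (use c0 in auto)
    then show "N (e n $ i $ j) \<le> B" using c[of n i j] by (simp add: B_def)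
  qed
  have B1: "B \<ge> 1" unfolding B_def using c0 by (simp add: sum_nonneg)
  have "vn (f x - x) \<le> B * vn x ^ 2" if x: "vn x \<le> 1" for x
  proof (rule Vn.tends_bound)
    show "Vn.tends (\<lambda>m. (\<Sum>n<m. e n *v fr n x) - x) (f x - x)"
      by (intro Vn.tends_diff ser Vn.tends_const)
    have "vn ((\<Sum>n<Suc m. e n *v fr n x) - x) \<le> B * vn x ^ 2" for m
    proof -
      have "(\<Sum>n<Suc m. e n *v fr n x) - x = (\<Sum>n<m. e (Suc n) *v fr (Suc n) x)"
        by (simp add: sum.lessThan_Suc_shift e0 del: sum.lessThan_Suc)
      moreover have "vn (\<Sum>n<m. e (Suc n) *v fr (Suc n) x) \<le> B * vn x ^ 2"
      proof (rule Vn.sum_le)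
        fix n
        have "vn (e (Suc n) *v fr (Suc n) x) \<le> mn (e (Suc n)) * vn x ^ 2" using frob_term_bound[OF x, of "Suc n"] by simp
        also have "\<dots> \<le> B * vn x ^ 2" by (intro mult_right_mono mnB) auto
        finally show "vn (e (Suc n) *v fr (Suc n) x) \<le> B * vn x ^ 2" .
      qed (use B1 in auto)
      ultimately show ?thesis by simp
    qed
    then have "\<forall>m\<ge>1. vn ((\<Sum>n<m. e n *v fr n x) - x) \<le> B * vn x ^ 2" by (metis Suc_le_D One_nat_def)
    then show "\<forall>\<^sub>F m in sequentially. vn ((\<Sum>n<m. e n *v fr n x) - x) \<le> B * vn x ^ 2"
      unfolding eventually_sequentially by blast
  qed
  then show ?thesis using B1 by blast
qed

lemma is_exp_unique:
  assumes f: "is_exp E f" and f': "is_exp E f'" shows "f = f'"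
proof
  fix x
  obtain t where t: "t \<in> A" "\<And>x. lie t x = t *s x" "N t > 1" using exists_scalar_element by blast
  have q: "\<exists>B\<ge>1. \<forall>x. vn x \<le> 1 \<longrightarrow> vn (f x - x) \<le> B * vn x ^ 2" if f: "is_exp E f" for f
  proof -
    obtain e where "e 0 = mat 1" "\<forall>x. (\<lambda>m. vn ((\<Sum>n<m. e n *v fr n x) - f x)) \<longlonglongrightarrow> 0"
      using f unfolding is_exp_def by blast
    then show ?thesis using exp_series_quadratic[of e f] by (auto simp: Vn.tends_def)
  qed
  obtain B B' where B: "B \<ge> 1" "\<And>x. vn x \<le> 1 \<Longrightarrow> vn (f x - x) \<le> B * vn x ^ 2"
    and B': "B' \<ge> 1" "\<And>x. vn x \<le> 1 \<Longrightarrow> vn (f' x - x) \<le> B' * vn x ^ 2" using q[OF f] q[OF f'] by blast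
  have eq: "f (t *s x) = ph t (f x)" "f' (t *s x) = ph t (f' x)" for x
    using f f' t unfolding is_exp_def by metis+
  have "f x - f' x = 0"
  proof (rule equivariant_quadratic_eq_0[OF t, of "\<lambda>x. f x - f' x" 1 "B + B'"])
    show "f (t *s x) - f' (t *s x) = ph t (f x - f' x)" for x by (simp add: eq ph_diff)
    fix x assume x: "vn x \<le> 1"
    have "B * vn x ^ 2 \<le> (B + B') * vn x ^ 2" "B' * vn x ^ 2 \<le> (B + B') * vn x ^ 2"
      using B B' by (auto intro!: mult_right_mono)
    then have "vn ((f x - x) - (f' x - x)) \<le> (B + B') * vn x ^ 2"
      using B(2)[OF x] B'(2)[OF x] by (intro Vn.diff_le[of "f x - x" _ "f' x - x"]) linarith+
    then show "vn (f x - f' x) \<le> (B + B') * vn x ^ 2" by simp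
  qed simp
  then show "f x = f' x" by simp
qed

text \<open>Commutation is assumed for the single element \<open>t\<close>. For another
  \<open>a\<close> the defect \<open>\<phi>_a f - f \<partial>a\<close> is itself equivariant under
  \<open>t\<close>, since \<open>A\<close> is commutative, and quadratically small, hence
  zero.\<close>

lemma is_expI:
  assumes add: "\<And>x y. f (x + y) = f x + f y" and lin: "\<And>c x. c \<in> F \<Longrightarrow> f (c *s x) = c *s f x"
    and e0: "e 0 = mat 1" and ser: "\<And>x. Vn.tends (\<lambda>m. \<Sum>n<m. e n *v fr n x) (f x)"
    and t: "t \<in> A" "\<And>x. lie t x = t *s x" "N t > 1" and ft: "\<And>x. f (t *s x) = ph t (f x)"
  shows "is_exp E f"
proof -
  obtain B where B: "B \<ge> 1" "\<And>x. vn x \<le> 1 \<Longrightarrow> vn (f x - x) \<le> B * vn x ^ 2"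
    using exp_series_quadratic[OF e0 ser] by blast
  have "f (lie a x) = ph a (f x)" if a: "a \<in> A" for a x
  proof -
    obtain B' where B': "B' \<ge> 1" "\<And>x. vn x \<le> 1 \<Longrightarrow> vn (ph a x - lie a x) \<le> B' * vn x ^ 2"
      using ph_lie_bound[OF a] by blast
    define m where "m = 1 + mn (phi E a 0)"
    have m1: "m \<ge> 1" using mn_nonneg by (simp add: m_def)
    have lm: "vn (lie a x) \<le> m * vn x" for x
    proof -
      have "mn (phi E a 0) * vn x \<le> m * vn x" using vn_nonneg[of x] by (intro mult_right_mono) (auto simp: m_def)
      then show ?thesis using lie_bound[of a x] by linarith
    qed
    have "ph a (f x) - f (lie a x) = 0"
    \<comment> \<open>The three summands of the constant bound the errors of \<open>\<phi>_a\<close>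
      against \<open>\<partial>a\<close> at \<open>f x\<close>, of \<open>\<partial>a\<close>
      applied to \<open>f x - x\<close>, and of \<open>f\<close> against the identity at
      \<open>\<partial>a x\<close>. The radius keeps \<open>x\<close>, \<open>f x\<close> and
      \<open>\<partial>a x\<close> in the unit ball.\<close>
    proof (rule equivariant_quadratic_eq_0[OF t, of "\<lambda>x. ph a (f x) - f (lie a x)" "1 / (B * m)" "B' + m * B + B * m ^ 2"])
      show "ph a (f (t *s x)) - f (lie a (t *s x)) = ph t (ph a (f x) - f (lie a x))" for x
        using ph_commute[OF a t(1)] by (simp add: ft lie_scale ph_diff)
      show "1 / (B * m) > 0" using B m1 by simp
      fix x assume x: "vn x \<le> 1 / (B * m)"
      let ?X = "vn x ^ 2"
      let ?C = "B' + m * B + B * m ^ 2"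
      have "B * m \<ge> 1" using B m1 by (metis mult_mono mult_1 order_trans zero_le_one)
      then have "1 / (B * m) \<le> 1" by simp
      then have x1: "vn x \<le> 1" using x by linarith
      have "B * m * vn x \<le> 1" using x B m1 by (simp add: field_simps)
      moreover have "m * vn x \<le> B * (m * vn x)" "B * vn x \<le> m * (B * vn x)"
        using B m1 vn_nonneg[of x] mult_right_mono[of 1 B "m * vn x"] mult_right_mono[of 1 m "B * vn x"] by auto
      ultimately have mx: "m * vn x \<le> 1" and Bx: "B * vn x \<le> 1" by (auto simp: mult_ac)
      have fx: "vn (f x) \<le> vn x"
      proof -
        have "B * vn x * vn x \<le> 1 * vn x" using Bx by (intro mult_right_mono vn_nonneg)
        then have "vn (f x - x) \<le> vn x" using B(2)[OF x1] by (simp add: power2_eq_square mult.assoc)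
        from Vn.add_le[OF this, of x] show ?thesis by simp
      qed
      have "vn (ph a (f x) - lie a (f x)) \<le> B' * vn (f x) ^ 2" using fx x1 by (intro B') linarith
      also have "\<dots> \<le> B' * ?X" using fx B' vn_nonneg[of "f x"] by (intro mult_left_mono power_mono) auto
      also have "\<dots> \<le> ?C * ?X" using B B' m1 by (intro mult_right_mono) auto
      finally have 1: "vn (ph a (f x) - lie a (f x)) \<le> ?C * ?X" .
      have "vn (lie a (f x) - lie a x) \<le> m * vn (f x - x)" using lm[of "f x - x"] by (simp add: lie_diff)
      also have "\<dots> \<le> m * (B * ?X)" using B(2)[OF x1] m1 by (intro mult_left_mono) auto
      also have "\<dots> \<le> ?C * ?X" unfolding mult.assoc[symmetric] using B B' m1 by (intro mult_right_mono) auto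
      finally have 2: "vn (lie a (f x) - lie a x) \<le> ?C * ?X" .
      have "vn (f (lie a x) - lie a x) \<le> B * vn (lie a x) ^ 2" using lm[of x] mx by (intro B(2)) linarith
      also have "\<dots> \<le> B * (m * vn x) ^ 2" using B lm[of x] vn_nonneg by (intro mult_left_mono power_mono) auto
      also have "\<dots> \<le> ?C * ?X" unfolding power_mult_distrib mult.assoc[symmetric] using B B' m1 by (intro mult_right_mono) auto
      finally have 3: "vn (f (lie a x) - lie a x) \<le> ?C * ?X" .
      have "vn (((ph a (f x) - lie a (f x)) + (lie a (f x) - lie a x)) - (f (lie a x) - lie a x)) \<le> ?C * ?X"
        by (rule Vn.diff_le[OF Vn.add_le[OF 1 2] 3])
      then show "vn (ph a (f x) - f (lie a x)) \<le> ?C * ?X" by simp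
    qed
    then show ?thesis by simp
  qed
  then show ?thesis using add lin e0 ser unfolding is_exp_def Vn.tends_def by blast
qed

lemma power_q_exp: "((x::real) ^ (q ^ i)) ^ (q ^ j) = x ^ (q ^ (i + j))"
  by (simp add: power_mult[symmetric] power_add mult.commute)

text \<open>A crude bound \<open>c^(q^n)\<close> is bootstrapped: inserted into the recursion it is
  divided by \<open>s^(q^n)\<close>, which both absorbs \<open>B\<close> and divides
  \<open>c\<close> by a fixed number greater than 1. Repetition makes \<open>c\<close> as small as
  desired, which beats \<open>X^(q^n)\<close> for any \<open>X\<close>. \<open>D\<close> limits how
  far the recursion looks back, so a bound valid from some index on can be reused.\<close>

lemma exp_coeff_decay:
  assumes s: "s > (1::real)" and B: "B \<ge> 1" and en0: "\<And>n. en n \<ge> 0"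
    and rec: "\<And>n c. n \<ge> 1 \<Longrightarrow> c \<ge> 0 \<Longrightarrow> (\<And>m. 1 \<le> m \<Longrightarrow> m \<le> n \<Longrightarrow> m < D \<Longrightarrow> en (n - m) \<le> c ^ (q ^ (n - m))) \<Longrightarrow>
       s ^ (q ^ n) * en n \<le> B * c ^ (q ^ n)"
  shows "(\<lambda>n. en n * X ^ (q ^ n)) \<longlonglongrightarrow> 0"
proof -
  have large: "\<exists>n1\<ge>1. \<forall>n\<ge>n1. B \<le> \<sigma> ^ (q ^ n)" if s1: "\<sigma> > 1" for \<sigma> :: real
  proof -
    obtain n1 where n1: "B < \<sigma> ^ n1" using real_arch_pow[OF s1] by blast
    have "B \<le> \<sigma> ^ (q ^ n)" if "n \<ge> Suc n1" for n
    proof -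
      have "n < 2 ^ n" by (rule less_exp)
      also have "\<dots> \<le> q ^ n" using q_ge_2 by (rule power_mono) simp
      finally have "\<sigma> ^ n1 \<le> \<sigma> ^ (q ^ n)" using that \<open>\<sigma> > 1\<close> by (intro power_increasing) auto
      then show ?thesis using n1 by linarith
    qed
    then show ?thesis by (intro exI[of _ "Suc n1"]) auto
  qed
  have "\<exists>c>0. \<forall>n. en n \<le> c ^ (q ^ n)"
  proof -
    obtain n1 where n1: "n1 \<ge> 1" "\<And>n. n \<ge> n1 \<Longrightarrow> B \<le> s ^ (q ^ n)" using large[OF s] by blast
    define c where "c = 1 + (\<Sum>n<n1. en n)"
    have c1: "c \<ge> 1" unfolding c_def using en0 by (simp add: sum_nonneg)
    have "en n \<le> c ^ (q ^ n)" for n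
    proof (induction n rule: less_induct)
      case (less n)
      show ?case
      proof (cases "n < n1")
        case True
        have "en n \<le> (\<Sum>n<n1. en n)" by (rule member_le_sum) (use True en0 in auto)
        then have "en n \<le> c ^ 1" by (simp add: c_def)
        also have "\<dots> \<le> c ^ (q ^ n)" using c1 q_ge_2 by (intro power_increasing) (auto simp: Suc_le_eq)
        finally show ?thesis .
      next
        case False
        then have n: "n \<ge> 1" using n1 by simp
        have "s ^ (q ^ n) * en n \<le> B * c ^ (q ^ n)" by (rule rec[OF n]) (use c1 less n in auto)
        also have "\<dots> \<le> s ^ (q ^ n) * c ^ (q ^ n)" using n1(2)[of n] False c1 by (intro mult_right_mono) auto
        finally show ?thesis using s by simp
      qed
    qed
    then show ?thesis using c1 by (intro exI[of _ c]) auto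
  qed
  then obtain c where c: "c > 0" "\<And>n. en n \<le> c ^ (q ^ n)" by blast
  \<comment> \<open>The gain \<open>s^(q^n)\<close> is shared: one factor
    \<open>\<sigma>^(q^n)\<close> absorbs \<open>B\<close> for large \<open>n\<close>, the other
    divides the current base by \<open>\<sigma>\<close>.\<close>
  define \<sigma> where "\<sigma> = sqrt s"
  have sg: "\<sigma> > 1" "\<sigma> * \<sigma> = s" using s by (auto simp: \<sigma>_def)
  have improve: "\<exists>n0. \<forall>n\<ge>n0. en n \<le> (c / \<sigma> ^ j) ^ (q ^ n)" for j
  proof (induction j)
    case 0
    then show ?case using c by auto
  next
    case (Suc j)
    then obtain n0 where n0: "\<And>n. n \<ge> n0 \<Longrightarrow> en n \<le> (c / \<sigma> ^ j) ^ (q ^ n)" by blast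
    obtain n1 where n1: "n1 \<ge> 1" "\<And>n. n \<ge> n1 \<Longrightarrow> B \<le> \<sigma> ^ (q ^ n)" using large[OF sg(1)] by blast
    have "en n \<le> (c / \<sigma> ^ Suc j) ^ (q ^ n)" if n: "n \<ge> n0 + D + n1" for n
    proof -
      let ?c = "c / \<sigma> ^ j"
      have c0: "?c \<ge> 0" using c sg by simp
      have "\<sigma> ^ (q ^ n) * (\<sigma> ^ (q ^ n) * en n) = s ^ (q ^ n) * en n"
        by (simp add: sg(2)[symmetric] power_mult_distrib)
      also have "\<dots> \<le> B * ?c ^ (q ^ n)" by (rule rec) (use n n1 c0 n0 in auto)
      also have "\<dots> \<le> \<sigma> ^ (q ^ n) * ?c ^ (q ^ n)" using n1(2)[of n] n c0 by (intro mult_right_mono) auto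
      finally have "\<sigma> ^ (q ^ n) * en n \<le> ?c ^ (q ^ n)" using sg by simp
      then show ?thesis using sg by (simp add: power_divide power_mult_distrib field_simps)
    qed
    then show ?case by blast
  qed
  obtain j where j: "2 * c * (\<bar>X\<bar> + 1) < \<sigma> ^ j" using real_arch_pow[OF sg(1)] by blast
  define Y where "Y = \<bar>X\<bar> + 1"
  have half: "c / \<sigma> ^ j * Y \<le> 1 / 2" using j sg by (simp add: Y_def field_simps)
  obtain n0 where n0: "\<And>n. n \<ge> n0 \<Longrightarrow> en n \<le> (c / \<sigma> ^ j) ^ (q ^ n)" using improve[of j] by blast
  have "norm (en n * X ^ (q ^ n)) \<le> (1 / 2) ^ n" if "n \<ge> n0" for n
  proof -
    have "norm (en n * X ^ (q ^ n)) = en n * \<bar>X\<bar> ^ (q ^ n)" using en0 by (simp add: abs_mult power_abs)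
    also have "\<dots> \<le> (c / \<sigma> ^ j) ^ (q ^ n) * Y ^ (q ^ n)"
      using n0[OF that] c sg by (intro mult_mono power_mono) (auto simp: Y_def)
    also have "\<dots> = (c / \<sigma> ^ j * Y) ^ (q ^ n)" by (rule power_mult_distrib[symmetric])
    also have "\<dots> \<le> (1 / 2) ^ (q ^ n)" using half c sg by (intro power_mono) (auto simp: Y_def)
    also have "\<dots> \<le> (1 / 2) ^ n"
    proof (rule power_decreasing)
      have "n < 2 ^ n" by (rule less_exp)
      also have "\<dots> \<le> q ^ n" using q_ge_2 by (rule power_mono) simp
      finally show "n \<le> q ^ n" by simp
    qed auto
    finally show ?thesis .
  qed
  then have "\<forall>\<^sub>F n in sequentially. norm (en n * X ^ (q ^ n)) \<le> (1 / 2) ^ n"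
    unfolding eventually_sequentially by blast
  then show ?thesis by (rule Lim_null_comparison) (rule LIMSEQ_realpow_zero, auto)
qed

lemma scale_matrix_mult: "(\<chi> i j. c * M $ i $ j) *v x = c *s (M *v (x :: 'c ^ 'd))"
  by (simp add: matrix_vector_mult_def vec_eq_iff sum_distrib_left mult.assoc)

lemma exists_is_exp: "\<exists>f. is_exp E f"
proof -
  obtain t where t: "t \<in> A" "\<And>x. lie t x = t *s x" "N t > 1" using exists_scalar_element by blast
  define P where "P = phi E t"
  obtain D where D: "D > 0" "\<And>n. n \<ge> D \<Longrightarrow> P n = 0" using phi_degree[OF t(1)] by (auto simp: P_def)
  define e where "e = exp_coeff q t P"
  define s where "s = N t"
  have s1: "s > 1" using t by (simp add: s_def)
  have e0: "e 0 = mat 1" by (simp add: e_def exp_coeff.simps)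
  have eS: "e n = (\<chi> i j. inverse (t ^ (q ^ n) - t) * (\<Sum>m\<in>{1..n}. P m ** frob_mat q m (e (n - m))) $ i $ j)"
    if "n \<ge> 1" for n
    using that exp_coeff.simps[of q t P n] by (simp add: e_def)
  have qn: "q ^ n > 1" if "n \<ge> 1" for n using that q_ge_2 by (metis less_le_trans one_less_power one_less_numeral_iff semiring_norm(76) zero_less_one less_one linorder_not_less Suc_1 lessI Suc_le_eq)
  \<comment> \<open>\<open>|t| < |t^(q^n)|\<close>, so in the ultrametric norm only the larger term
    counts; in particular the recursion divides by something nonzero.\<close>
  have Ntn: "N (t ^ (q ^ n) - t) = s ^ (q ^ n)" if "n \<ge> 1" for n
  proof -
    have "s ^ 1 < s ^ (q ^ n)" using s1 qn[OF that] by (intro power_strict_increasing) auto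
    then have "N ((t ^ (q ^ n) - t) - t ^ (q ^ n)) < N (t ^ (q ^ n))" by (simp add: N_uminus N_power s_def)
    from Cn.eq_of_close[OF this] show ?thesis by (simp add: N_power s_def)
  qed
  have tn0: "t ^ (q ^ n) - t \<noteq> 0" if "n \<ge> 1" for n
    using Ntn[OF that] s1 by (metis N_0 less_numeral_extra(1) less_trans power_eq_0_iff less_irrefl)
  define B where "B = 1 + (\<Sum>n<D. mn (P n))"
  have B1: "B \<ge> 1" by (auto simp: B_def intro: sum_nonneg mn_nonneg)
  have mnP: "mn (P n) \<le> B" for n
  proof (cases "n < D")
    case True
    have "mn (P n) \<le> (\<Sum>n<D. mn (P n))" by (rule member_le_sum) (use True mn_nonneg in auto)
    then show ?thesis by (simp add: B_def)
  next
    case False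
    then have "mn (P n) \<le> 0" using D(2)[of n] by (simp add: mn_le_iff)
    then show ?thesis using B1 by simp
  qed
  have decay: "(\<lambda>n. mn (e n) * X ^ (q ^ n)) \<longlonglongrightarrow> 0" for X
  proof (rule exp_coeff_decay[OF s1 B1, of "\<lambda>n. mn (e n)" D])
    fix n c assume n: "n \<ge> 1" and c: "c \<ge> (0::real)"
      and IH: "\<And>m. 1 \<le> m \<Longrightarrow> m \<le> n \<Longrightarrow> m < D \<Longrightarrow> mn (e (n - m)) \<le> c ^ (q ^ (n - m))"
    define S where "S = (\<Sum>m\<in>{1..n}. P m ** frob_mat q m (e (n - m)))"
    have "mn S \<le> B * c ^ (q ^ n)" unfolding S_def
    proof (rule mn_sum)
      fix m assume m: "m \<in> {1..n}"
      show "mn (P m ** frob_mat q m (e (n - m))) \<le> B * c ^ (q ^ n)"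
      proof (cases "m < D")
        case True
        have "mn (frob_mat q m (e (n - m))) \<le> mn (e (n - m)) ^ (q ^ m)" by (rule mn_frob)
        also have "\<dots> \<le> (c ^ (q ^ (n - m))) ^ (q ^ m)" using IH[of m] m True by (intro power_mono mn_nonneg) auto
        also have "\<dots> = c ^ (q ^ n)" using m by (simp add: power_q_exp)
        finally have "mn (P m) * mn (frob_mat q m (e (n - m))) \<le> B * c ^ (q ^ n)"
          using mnP[of m] B1 by (intro mult_mono) (auto simp: mn_nonneg)
        then show ?thesis using mn_mult[of "P m" "frob_mat q m (e (n - m))"] by linarith
      next
        case False
        then have "P m ** frob_mat q m (e (n - m)) = 0" using D(2)[of m] by simp
        then have "mn (P m ** frob_mat q m (e (n - m))) \<le> 0" by (simp add: mn_le_iff)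
        moreover have "0 \<le> B * c ^ (q ^ n)" using B1 c by simp
        ultimately show ?thesis by linarith
      qed
    qed (use B1 c in auto)
    moreover have "s ^ (q ^ n) * mn (e n) \<le> mn S"
    proof -
      have "mn (e n) \<le> inverse (s ^ (q ^ n)) * mn S"
        unfolding mn_le_iff eS[OF n] S_def[symmetric]
        using Ntn[OF n] s1 by (auto simp: N_mult N_inverse intro!: mult_left_mono N_le_mn)
      then have "s ^ (q ^ n) * mn (e n) \<le> s ^ (q ^ n) * (inverse (s ^ (q ^ n)) * mn S)"
        using s1 by (intro mult_left_mono) auto
      then show ?thesis using s1 by (simp add: mult.assoc[symmetric])
    qed
    ultimately show "s ^ (q ^ n) * mn (e n) \<le> B * c ^ (q ^ n)" by linarith
  qed (rule mn_nonneg)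
  have trm: "vn (e n *v fr n x) \<le> mn (e n) * vn x ^ (q ^ n)" for n x
    using vn_mult[of "e n" "fr n x"] vn_frob[of n x] mult_left_mono[of "vn (fr n x)" "vn x ^ (q ^ n)" "mn (e n)"] mn_nonneg[of "e n"]
    by linarith
  have "\<exists>l. Vn.tends (\<lambda>m. \<Sum>n<m. e n *v fr n x) l" for x
  proof (rule Vn.sum_converges)
    show "(\<lambda>n. vn (e n *v fr n x)) \<longlonglongrightarrow> 0"
      by (rule tendsto_sandwich[OF _ _ tendsto_const decay[of "vn x"]]) (auto simp: vn_nonneg trm)
  qed
  then obtain f where ser: "\<And>x. Vn.tends (\<lambda>m. \<Sum>n<m. e n *v fr n x) (f x)" by metis
  have add: "f (x + y) = f x + f y" for x y
  proof (rule Vn.tends_unique[OF ser])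
    show "Vn.tends (\<lambda>m. \<Sum>n<m. e n *v fr n (x + y)) (f x + f y)"
      using Vn.tends_add[OF ser[of x] ser[of y]] by (simp add: fr_add matrix_vector_right_distrib sum.distrib)
  qed
  have scale: "Vn.tends (\<lambda>m. c *s s m) (c *s l)" if "Vn.tends s l" for c s l
    using tendsto_mult[OF tendsto_const[of "N c"] that[unfolded Vn.tends_def]]
    by (simp add: Vn.tends_def vn_scale[symmetric] vector_ssub_ldistrib)
  have lin: "f (c *s x) = c *s f x" if "c \<in> F" for c x
  proof (rule Vn.tends_unique[OF ser])
    show "Vn.tends (\<lambda>m. \<Sum>n<m. e n *v fr n (c *s x)) (c *s f x)"
      using scale[OF ser[of x], of c] by (simp add: fr_scale_F[OF that] vector_scalar_commute vec.scale_sum_right)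
  qed
  have ft: "f (t *s x) = ph t (f x)" for x
  proof -
    \<comment> \<open>\<open>g i j\<close> is the contribution of \<open>P i\<close> and
      \<open>e j\<close> to \<open>\<phi>_t (exp x)\<close>. The recursion says precisely that the
      antidiagonal sums of \<open>g\<close> are the terms of \<open>exp (t x)\<close>.\<close>
    define g where "g i j = (P i ** frob_mat q i (e j)) *v fr (i + j) x" for i j
    have g0: "g i j = 0" if "i \<ge> D" for i j using D(2)[OF that] by (simp add: g_def)
    have P0: "P 0 *v y = t *s y" for y using t(2)[of y] by (simp add: lie_act_def P_def)
    have diag: "e n *v fr n (t *s x) = (\<Sum>i\<le>n. g i (n - i))" for n
    proof (cases "n = 0")
      case True
      have "frob_mat q 0 (mat 1) = (mat 1 :: 'c ^ 'd ^ 'd)" by (simp add: frob_mat_def vec_eq_iff)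
      then show ?thesis using True by (simp add: g_def e0 P0)
    next
      case False
      then have n: "n \<ge> 1" by simp
      define S where "S = (\<Sum>m\<in>{1..n}. P m ** frob_mat q m (e (n - m)))"
      have "e n *v y = inverse (t ^ (q ^ n) - t) *s (S *v y)" for y
        unfolding eS[OF n] S_def by (rule scale_matrix_mult)
      then have "(t ^ (q ^ n) - t) *s (e n *v y) = S *v y" for y using tn0[OF n] by simp
      then have "t ^ (q ^ n) *s (e n *v fr n x) = t *s (e n *v fr n x) + S *v fr n x"
        by (metis add.commute diff_add_cancel vector_sub_rdistrib)
      also have "t *s (e n *v fr n x) = g 0 n"
        by (simp add: g_def P0 matrix_vector_mul_assoc[symmetric] frob_mat_def)
      also have "S *v fr n x = (\<Sum>i\<in>{1..n}. g i (n - i))"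
        unfolding S_def mat_sum_mult by (rule sum.cong) (auto simp: g_def)
      also have "g 0 n + (\<Sum>i\<in>{1..n}. g i (n - i)) = (\<Sum>i\<le>n. g i (n - i))"
        by (simp add: atMost_atLeast0 sum.atLeast_Suc_atMost)
      finally show ?thesis by (simp add: fr_scale vector_scalar_commute)
    qed
    define S where "S m = (\<Sum>n<m. e n *v fr n x)" for m
    have phS: "ph t (S m) = (\<Sum>i<D. \<Sum>j<m. g i j)" for m
      using ph_sum[of D t "S m"] D(2)
      by (simp add: P_def S_def g_def fr_sum fr_mult fr_fr matrix_vector_mul_assoc mat_mult_sum)
    \<comment> \<open>The two partial sums differ only in pairs with \<open>i < D\<close> and
      \<open>j < m \<le> i + j\<close>; there \<open>j\<close> exceeds \<open>m - D\<close>, so the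
      terms are small once \<open>m\<close> is large.\<close>
    have diff: "ph t (S m) - (\<Sum>n<m. e n *v fr n (t *s x)) = (\<Sum>(i, j)\<in>{(i, j). i < D \<and> j < m \<and> m \<le> i + j}. g i j)" for m
    proof -
      have "(\<Sum>n<m. e n *v fr n (t *s x)) = (\<Sum>(i, j)\<in>{(i, j). i + j < m}. g i j)"
        unfolding diag by (rule sum.triangle_reindex[symmetric])
      also have "\<dots> = (\<Sum>(i, j)\<in>{(i, j). i < D \<and> i + j < m}. g i j)"
      proof (rule sum.mono_neutral_right)
        show "finite {(i, j). i + j < m}" by (rule finite_subset[of _ "{..<m} \<times> {..<m}"]) auto
        show "\<forall>p\<in>{(i, j). i + j < m} - {(i, j). i < D \<and> i + j < m}. (case p of (i, j) \<Rightarrow> g i j) = 0"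
        proof
          fix p assume "p \<in> {(i, j). i + j < m} - {(i, j). i < D \<and> i + j < m}"
          then have "D \<le> fst p" by auto
          then show "(case p of (i, j) \<Rightarrow> g i j) = 0" using g0[of "fst p" "snd p"] by (simp add: case_prod_unfold)
        qed
      qed auto
      finally have 1: "(\<Sum>n<m. e n *v fr n (t *s x)) = (\<Sum>(i, j)\<in>{(i, j). i < D \<and> i + j < m}. g i j)" .
      have "ph t (S m) = (\<Sum>(i, j)\<in>{..<D} \<times> {..<m}. g i j)" unfolding phS by (rule sum.cartesian_product)
      then have "ph t (S m) - (\<Sum>n<m. e n *v fr n (t *s x)) =
          (\<Sum>(i, j)\<in>{..<D} \<times> {..<m} - {(i, j). i < D \<and> i + j < m}. g i j)"
        unfolding 1 by (subst sum_diff) auto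
      also have "{..<D} \<times> {..<m} - {(i, j). i < D \<and> i + j < m} = {(i, j). i < D \<and> j < m \<and> m \<le> i + j}" by auto
      finally show ?thesis .
    qed
    have gb: "vn (g i j) \<le> B * (mn (e j) * vn x ^ (q ^ j)) ^ (q ^ i)" for i j
    proof -
      have "vn (g i j) \<le> mn (P i ** frob_mat q i (e j)) * vn (fr (i + j) x)" unfolding g_def by (rule vn_mult)
      also have "\<dots> \<le> (B * mn (e j) ^ (q ^ i)) * vn x ^ (q ^ (i + j))"
      proof (intro mult_mono vn_frob)
        have "mn (P i) * mn (frob_mat q i (e j)) \<le> B * mn (e j) ^ (q ^ i)"
          using mnP B1 mn_frob by (intro mult_mono) (auto simp: mn_nonneg)
        then show "mn (P i ** frob_mat q i (e j)) \<le> B * mn (e j) ^ (q ^ i)"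
          using mn_mult[of "P i" "frob_mat q i (e j)"] by linarith
      qed (use B1 mn_nonneg vn_nonneg in auto)
      also have "\<dots> = B * (mn (e j) * vn x ^ (q ^ j)) ^ (q ^ i)"
        by (simp add: power_mult_distrib power_q_exp add.commute mult.assoc)
      finally show ?thesis .
    qed
    have lim0: "Vn.tends (\<lambda>m. ph t (S m) - (\<Sum>n<m. e n *v fr n (t *s x))) 0"
      unfolding Vn.tends_eventually
    proof (intro allI impI)
      fix \<epsilon> :: real assume ep: "\<epsilon> > 0"
      define d where "d = min 1 (\<epsilon> / (2 * B))"
      have d: "d > 0" "d \<le> 1" "B * d < \<epsilon>" using ep B1 by (auto simp: d_def min_def field_simps)
      have "\<forall>\<^sub>F n in sequentially. mn (e n) * vn x ^ (q ^ n) < d"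
        using order_tendstoD(2)[OF decay[of "vn x"] d(1)] .
      then obtain n0 where n0: "\<And>n. n \<ge> n0 \<Longrightarrow> mn (e n) * vn x ^ (q ^ n) < d" by (auto simp: eventually_sequentially)
      have "vn (ph t (S m) - (\<Sum>n<m. e n *v fr n (t *s x)) - 0) < \<epsilon>" if m: "m \<ge> n0 + D" for m
      proof -
        have "vn (\<Sum>(i, j)\<in>{(i, j). i < D \<and> j < m \<and> m \<le> i + j}. g i j) \<le> B * d"
        proof (rule Vn.sum_le)
          fix p assume p: "p \<in> {(i, j). i < D \<and> j < m \<and> m \<le> i + j}"
          obtain i j where ij: "p = (i, j)" "i < D" "j < m" "m \<le> i + j" using p by auto
          have lt: "mn (e j) * vn x ^ (q ^ j) < d" using m ij by (intro n0) auto
          have nn: "0 \<le> mn (e j) * vn x ^ (q ^ j)" by (intro mult_nonneg_nonneg mn_nonneg zero_le_power vn_nonneg)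
          have "(mn (e j) * vn x ^ (q ^ j)) ^ (q ^ i) \<le> d ^ (q ^ i)" using lt nn by (intro power_mono) auto
          also have "\<dots> \<le> d ^ 1" using d q_ge_2 by (intro power_decreasing) (auto simp: Suc_le_eq)
          finally have "B * (mn (e j) * vn x ^ (q ^ j)) ^ (q ^ i) \<le> B * d" using B1 by (intro mult_left_mono) auto
          then show "vn (case p of (i, j) \<Rightarrow> g i j) \<le> B * d" using gb[of i j] ij by simp
        qed (use B1 d in auto)
        then show ?thesis unfolding diff using d by simp
      qed
      then show "\<forall>\<^sub>F m in sequentially. vn (ph t (S m) - (\<Sum>n<m. e n *v fr n (t *s x)) - 0) < \<epsilon>"
        unfolding eventually_sequentially by blast
    qed
    obtain Bt where Bt: "Bt \<ge> 1" "\<And>x. vn x \<le> 1 \<Longrightarrow> vn (ph t x) \<le> Bt * vn x" using ph_bound[OF t(1)] by blast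
    have "Vn.tends (\<lambda>m. ph t (S m)) (ph t (f x))"
    proof (rule Vn.tends_additive[where f = "ph t" and s = S])
      show "Vn.tends S (f x)" using ser[of x] unfolding S_def[abs_def] .
      fix \<epsilon> :: real assume ep: "\<epsilon> > 0"
      show "\<exists>\<delta>>0. \<forall>x. vn x < \<delta> \<longrightarrow> vn (ph t x) < \<epsilon>"
      proof (intro exI[of _ "min 1 (\<epsilon> / Bt)"] conjI allI impI)
        fix x assume "vn x < min 1 (\<epsilon> / Bt)"
        then have "vn x \<le> 1" "Bt * vn x < \<epsilon>" using Bt by (auto simp: field_simps)
        then show "vn (ph t x) < \<epsilon>" using Bt(2)[of x] by linarith
      qed (use ep Bt in auto)
    qed (rule ph_add)
    from Vn.tends_diff[OF this lim0] have "Vn.tends (\<lambda>m. \<Sum>n<m. e n *v fr n (t *s x)) (ph t (f x))" by simp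
    then show ?thesis using Vn.tends_unique[OF ser[of "t *s x"]] by simp
  qed
  show ?thesis using is_expI[OF add lin e0 ser t ft] by blast
qed

abbreviation "ex \<equiv> exp_E E"

lemma exp_is_exp: "is_exp E ex"
proof -
  obtain f where f: "is_exp E f" using exists_is_exp by (rule exE)
  show ?thesis unfolding exp_E_def by (rule theI[of "is_exp E", OF f]) (rule is_exp_unique[OF _ f])
qed

lemma ex_add: "ex (x + y) = ex x + ex y" and ex_scale_F: "c \<in> F \<Longrightarrow> ex (c *s x) = c *s ex x"
  and ex_lie: "a \<in> A \<Longrightarrow> ex (lie a x) = ph a (ex x)"
  using exp_is_exp by (auto simp: is_exp_def)

lemma ex_0 [simp]: "ex 0 = 0" using ex_add[of 0 0] by simp

lemma ex_diff: "ex (x - y) = ex x - ex y" using ex_add[of "x - y" y] by simp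

text \<open>Quadratic closeness to the identity makes the exponential function an isometry on a
  small ball, and \<open>ex x = y\<close> is solved by successive correction of the error. Isometry
  near 0 also says that nonzero periods are not small.\<close>

lemma exp_local:
  "\<exists>\<rho>>0. (\<forall>x. vn x \<le> \<rho> \<longrightarrow> vn (ex x) = vn x) \<and> (\<forall>y. vn y \<le> \<rho> \<longrightarrow> (\<exists>x. ex x = y \<and> vn x = vn y))"
proof -
  obtain e where "e 0 = mat 1" "\<forall>x. (\<lambda>m. vn ((\<Sum>n<m. e n *v fr n x) - ex x)) \<longlonglongrightarrow> 0"
    using exp_is_exp unfolding is_exp_def by blast
  then obtain B where B: "B \<ge> 1" "\<And>x. vn x \<le> 1 \<Longrightarrow> vn (ex x - x) \<le> B * vn x ^ 2"
    using exp_series_quadratic[of e ex] by (auto simp: Vn.tends_def)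
  \<comment> \<open>The factor 2 makes the error at most half of \<open>|x|\<close>: strictly
    smaller than \<open>|x|\<close> for the isometry, and contracting for the iteration.\<close>
  define \<rho> where "\<rho> = 1 / (2 * B)"
  have r: "\<rho> > 0" "\<rho> \<le> 1" using B by (auto simp: \<rho>_def)
  define g where "g x = ex x - x" for x
  have half: "vn (g x) \<le> vn x / 2" if x: "vn x \<le> \<rho>" for x
  proof -
    have "B * vn x \<le> 1 / 2" using x B by (simp add: \<rho>_def field_simps)
    then have "B * vn x * vn x \<le> 1 / 2 * vn x" by (intro mult_right_mono vn_nonneg)
    then show ?thesis using B(2)[of x] x r by (simp add: g_def power2_eq_square mult.assoc)
  qed
  have iso: "vn (ex x) = vn x" if x: "vn x \<le> \<rho>" for x
  proof (cases "x = 0")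
    case False
    then have "vn x > 0" using vn_nonneg[of x] Vn.zero_iff[of x] by (metis less_eq_real_def)
    then have "vn (ex x - x) < vn x" using half[OF x] by (simp add: g_def)
    then show ?thesis by (rule Vn.eq_of_close)
  qed simp
  have "\<exists>x. ex x = y \<and> vn x = vn y" if y: "vn y \<le> \<rho>" for y
  proof -
    \<comment> \<open>\<open>z k\<close> is the error left after \<open>k\<close> corrections: the
      exponential of the sum of the first \<open>m\<close> of them is
      \<open>y - z m\<close>.\<close>
    define z where "z k = ((\<lambda>x. - g x) ^^ k) y" for k
    have zb: "vn (z k) \<le> (1/2) ^ k * vn y \<and> vn (z k) \<le> \<rho>" for k
    proof (induction k)
      case (Suc k)
      have "vn (z (Suc k)) = vn (g (z k))" by (simp add: z_def Vn.minus)
      also have "\<dots> \<le> vn (z k) / 2" using half Suc by blast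
      finally show ?case using Suc vn_nonneg[of "z k"] by (auto intro: order_trans)
    qed (simp add: z_def y)
    have lim: "(\<lambda>k. (1/2) ^ k * vn y) \<longlonglongrightarrow> 0"
      using tendsto_mult[OF LIMSEQ_realpow_zero[of "1/2"] tendsto_const[of "vn y"]] by simp
    have zlim: "(\<lambda>k. vn (z k)) \<longlonglongrightarrow> 0"
      by (rule tendsto_sandwich[OF _ _ tendsto_const lim]) (use zb vn_nonneg in auto)
    then obtain x where x: "Vn.tends (\<lambda>m. \<Sum>k<m. z k) x" using Vn.sum_converges by blast
    have "vn x \<le> \<rho>" by (rule Vn.tends_bound[OF x]) (use zb r in \<open>auto intro!: always_eventually Vn.sum_le\<close>)
    moreover have "ex x = y"
    proof (rule Vn.tends_unique)
      show "Vn.tends (\<lambda>m. ex (\<Sum>k<m. z k)) (ex x)"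
      proof (rule Vn.tends_additive[OF x ex_add])
        fix \<epsilon> :: real assume "\<epsilon> > 0"
        then show "\<exists>\<delta>>0. \<forall>x. vn x < \<delta> \<longrightarrow> vn (ex x) < \<epsilon>" using iso r
          by (intro exI[of _ "min \<rho> \<epsilon>"]) auto
      qed
      have "ex (\<Sum>k<m. z k) = y - z m" for m
      proof (induction m)
        case (Suc m)
        have "ex (z m) = z m - z (Suc m)" by (simp add: z_def g_def)
        then show ?case using Suc by (simp add: ex_add)
      qed (simp add: z_def)
      moreover have "Vn.tends z 0" using zlim by (simp add: Vn.tends_def)
      then have "Vn.tends (\<lambda>m. y - z m) (y - 0)" by (intro Vn.tends_diff Vn.tends_const)
      ultimately show "Vn.tends (\<lambda>m. ex (\<Sum>k<m. z k)) y" by simp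
    qed
    ultimately show ?thesis using iso[of x] by (intro exI[of _ x]) simp
  qed
  then show ?thesis using iso r(1) by (intro exI[of _ \<rho>] conjI allI impI) auto
qed

end

section \<open>Formal sums modulo the tensor relations\<close>

text \<open>One treatment for the tensor products in play: \<open>A \<otimes> V\<close> and
  \<open>A \<otimes> \<Lambda>\<close> over \<open>F\<close>, and
  \<open>A \<otimes> \<Lambda>\<close> over \<open>F[u]\<close>. \<open>M\<close> is a set because
  the periods do not fill their type.\<close>

locale tensor_data =
  fixes R A :: "'a::comm_ring_1 set" and act :: "'a \<Rightarrow> 'm::ab_group_add \<Rightarrow> 'm" and M :: "'m set"
  assumes R0: "0 \<in> R" and RA: "R \<subseteq> A" and Aadd: "\<And>a b. a \<in> A \<Longrightarrow> b \<in> A \<Longrightarrow> a + b \<in> A"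
    and Amult: "\<And>a b. a \<in> A \<Longrightarrow> b \<in> A \<Longrightarrow> a * b \<in> A"
    and M0: "0 \<in> M" and Madd: "\<And>x y. x \<in> M \<Longrightarrow> y \<in> M \<Longrightarrow> x + y \<in> M"
    and Mact: "\<And>r x. r \<in> R \<Longrightarrow> x \<in> M \<Longrightarrow> act r x \<in> M"
    and act0: "\<And>x. x \<in> M \<Longrightarrow> act 0 x = 0"
begin

abbreviation "tcong \<equiv> tensor_cong R A act M"
abbreviation "trel \<equiv> tensor_rel R A act M"

definition valid :: "('a \<times> 'm) multiset \<Rightarrow> bool" where "valid x \<longleftrightarrow> set_mset x \<subseteq> A \<times> M"

lemma valid_simps [simp]:
  "valid {#}" "valid (x + y) \<longleftrightarrow> valid x \<and> valid y" "valid (add_mset p x) \<longleftrightarrow> p \<in> A \<times> M \<and> valid x"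
  by (auto simp: valid_def)

lemma A0: "0 \<in> A" using R0 RA by auto

lemma cong_valid: "tcong x y \<Longrightarrow> valid x \<and> valid y"
  by (induction rule: tensor_cong.induct) (use RA in \<open>auto simp: valid_def A0 Aadd Amult Madd Mact\<close>)

lemma cong_refl: "valid x \<Longrightarrow> tcong x x"
  by (rule tensor_cong.refl) (simp add: valid_def)

lemma cong_plus: assumes "tcong x y" "tcong x' y'" shows "tcong (x + x') (y + y')"
proof -
  have "tcong (x + x') (y + x')" using assms cong_valid[OF assms(2)] by (intro tensor_cong.add) (auto simp: valid_def)
  moreover have "tcong (x' + y) (y' + y)" using assms cong_valid[OF assms(1)] by (intro tensor_cong.add) (auto simp: valid_def)
  ultimately show ?thesis by (metis add.commute tensor_cong.trans)
qed

definition cls :: "('a \<times> 'm) multiset \<Rightarrow> ('a \<times> 'm) multiset set" where "cls x = trel `` {x}"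

lemma mem_cls: "y \<in> cls x \<longleftrightarrow> tcong x y"
  by (auto simp: cls_def tensor_rel_def)

lemma cls_eq: "tcong x y \<Longrightarrow> cls x = cls y"
  unfolding set_eq_iff mem_cls by (meson tensor_cong.sym tensor_cong.trans)

lemma cls_eq_iff: "valid y \<Longrightarrow> cls x = cls y \<longleftrightarrow> tcong x y"
  using cls_eq[of x y] cong_refl[of y] mem_cls by blast

lemma tensor_cls: "tensor R A act M = cls ` Collect valid"
  unfolding tensor_def quotient_def cls_def[abs_def] valid_def by blast

text \<open>The universal property of the tensor product: each generating relation is respected by a
  balanced biadditive map, and the rule \<open>zero\<close> follows from additivity.\<close>

lemma cong_sum:
  fixes \<beta> :: "'a \<Rightarrow> 'm \<Rightarrow> 'n::ab_group_add"
  assumes "tcong x y"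
    and addl: "\<And>a a' m. a \<in> A \<Longrightarrow> a' \<in> A \<Longrightarrow> m \<in> M \<Longrightarrow> \<beta> (a + a') m = \<beta> a m + \<beta> a' m"
    and addr: "\<And>a m m'. a \<in> A \<Longrightarrow> m \<in> M \<Longrightarrow> m' \<in> M \<Longrightarrow> \<beta> a (m + m') = \<beta> a m + \<beta> a m'"
    and bal: "\<And>r a m. r \<in> R \<Longrightarrow> a \<in> A \<Longrightarrow> m \<in> M \<Longrightarrow> \<beta> (r * a) m = \<beta> a (act r m)"
  shows "(\<Sum>(a, m)\<in>#x. \<beta> a m) = (\<Sum>(a, m)\<in>#y. \<beta> a m)"
  using assms(1)
proof (induction rule: tensor_cong.induct)
  case (zero m)
  have "\<beta> 0 m = 0" using addl[of 0 0 m] A0 zero by simp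
  then show ?case by simp
qed (auto simp: addl addr bal)

text \<open>The generating relations only cancel \<open>0 \<otimes> m\<close>; balancing with the
  scalar 0 moves the zero to the right factor.\<close>

lemma cong_zero_right: assumes "a \<in> A" shows "tcong {#(a, 0)#} {#}"
proof -
  have "tcong {#(0 * a, 0)#} {#(a, act 0 0)#}" by (rule tensor_cong.balance) (use assms R0 M0 in auto)
  then have "tcong {#(0, 0)#} {#(a, 0)#}" using act0 M0 by simp
  moreover have "tcong {#(0, 0)#} {#}" using M0 by (rule tensor_cong.zero)
  ultimately show ?thesis using tensor_cong.sym tensor_cong.trans by blast
qed

lemma A_sum: "(\<And>i. i \<in> I \<Longrightarrow> f i \<in> A) \<Longrightarrow> sum f I \<in> A"
  by (induction I rule: infinite_finite_induct) (auto simp: A0 Aadd)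

lemma M_sum_mset: "(\<And>p. p \<in># x \<Longrightarrow> f p \<in> M) \<Longrightarrow> (\<Sum>p\<in>#x. f p) \<in> M"
  by (induction x) (auto simp: M0 Madd)

lemma cong_sum_left:
  assumes "finite I" "\<And>i. i \<in> I \<Longrightarrow> f i \<in> A" "m \<in> M"
  shows "tcong {#(sum f I, m)#} (\<Sum>i\<in>I. {#(f i, m)#})"
  using assms(1,2)
proof (induction I rule: finite_induct)
  case empty
  then show ?case using assms(3) by (simp add: tensor_cong.zero)
next
  case (insert i I)
  have "tcong {#(f i + sum f I, m)#} {#(f i, m), (sum f I, m)#}"
    by (rule tensor_cong.add_left) (use insert assms(3) in \<open>auto intro!: A_sum\<close>)
  moreover have "tcong ({#(f i, m)#} + {#(sum f I, m)#}) ({#(f i, m)#} + (\<Sum>i\<in>I. {#(f i, m)#}))"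
    by (rule cong_plus[OF cong_refl]) (use insert assms(3) in auto)
  ultimately show ?case using insert by (simp add: add_mset_commute) (meson tensor_cong.trans)
qed

lemma cong_sum_family:
  assumes "finite I" "\<And>i. i \<in> I \<Longrightarrow> tcong (f i) (g i)"
  shows "tcong (\<Sum>i\<in>I. f i) (\<Sum>i\<in>I. g i)"
  using assms by (induction I rule: finite_induct) (auto intro: cong_plus cong_refl)

text \<open>Each left factor is expanded over the \<open>b i\<close> and the coefficients move to
  the right. Used with part of the \<open>F\<close>-basis of \<open>A\<close> this gives coordinates
  in \<open>V\<close>, with the \<open>R\<close>-basis coordinates in the periods.\<close>

lemma cong_normal_form:
  assumes I: "finite I" and b: "\<And>i. i \<in> I \<Longrightarrow> b i \<in> A"
    and v: "valid x" and rho: "\<And>i a m. i \<in> I \<Longrightarrow> (a, m) \<in># x \<Longrightarrow> \<rho> i a \<in> R"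
    and ex: "\<And>a m. (a, m) \<in># x \<Longrightarrow> a = (\<Sum>i\<in>I. \<rho> i a * b i)"
  shows "tcong x (\<Sum>i\<in>I. {#(b i, \<Sum>(a, m)\<in>#x. act (\<rho> i a) m)#})"
  using v rho ex
proof (induction x)
  case empty
  have "tcong (\<Sum>i\<in>I. {#(b i, 0)#}) (\<Sum>i\<in>I. {#})" using I by (rule cong_sum_family) (use b in \<open>auto intro: cong_zero_right\<close>)
  then show ?case by (simp add: tensor_cong.sym)
next
  case (add p x)
  obtain a m where p: "p = (a, m)" by (metis surj_pair)
  have am: "a \<in> A" "m \<in> M" using add.prems(1) p by auto
  have rR: "\<rho> i a \<in> R" if "i \<in> I" for i using add.prems(2)[OF that] p by auto
  let ?S = "\<lambda>i. \<Sum>(a, m)\<in>#x. act (\<rho> i a) m"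
  have SM: "?S i \<in> M" if "i \<in> I" for i
  proof (rule M_sum_mset)
    fix p' assume p': "p' \<in># x"
    obtain a' m' where e: "p' = (a', m')" by (metis surj_pair)
    then have "m' \<in> M" using p' add.prems(1) by (auto simp: valid_def)
    then show "(case p' of (a, m) \<Rightarrow> act (\<rho> i a) m) \<in> M" using e add.prems(2)[OF that, of a' m'] p' Mact by auto
  qed
  have IH: "tcong x (\<Sum>i\<in>I. {#(b i, ?S i)#})"
  proof (rule add.IH)
    show "a = (\<Sum>i\<in>I. \<rho> i a * b i)" if "(a, m) \<in># x" for a m using add.prems(3)[of a m] that by simp
  qed (use add.prems in auto)
  have eq: "a = (\<Sum>i\<in>I. \<rho> i a * b i)" using add.prems(3)[of a m] p by simp
  have "tcong {#(\<Sum>i\<in>I. \<rho> i a * b i, m)#} (\<Sum>i\<in>I. {#(\<rho> i a * b i, m)#})"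
    by (rule cong_sum_left[OF I]) (use rR RA b am in \<open>auto intro!: Amult\<close>)
  moreover have "tcong (\<Sum>i\<in>I. {#(\<rho> i a * b i, m)#}) (\<Sum>i\<in>I. {#(b i, act (\<rho> i a) m)#})"
    using I by (rule cong_sum_family) (use rR b am in \<open>auto intro: tensor_cong.balance\<close>)
  ultimately have "tcong {#(\<Sum>i\<in>I. \<rho> i a * b i, m)#} (\<Sum>i\<in>I. {#(b i, act (\<rho> i a) m)#})"
    by (rule tensor_cong.trans)
  then have 1: "tcong {#(a, m)#} (\<Sum>i\<in>I. {#(b i, act (\<rho> i a) m)#})"
    unfolding eq[symmetric] .
  have 2: "tcong (\<Sum>i\<in>I. {#(b i, act (\<rho> i a) m)#} + {#(b i, ?S i)#}) (\<Sum>i\<in>I. {#(b i, act (\<rho> i a) m + ?S i)#})"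
    using I
  proof (rule cong_sum_family)
    fix i assume i: "i \<in> I"
    have "tcong {#(b i, act (\<rho> i a) m + ?S i)#} {#(b i, act (\<rho> i a) m), (b i, ?S i)#}"
      by (rule tensor_cong.add_right) (use i b rR am SM Mact in auto)
    then show "tcong ({#(b i, act (\<rho> i a) m)#} + {#(b i, ?S i)#}) {#(b i, act (\<rho> i a) m + ?S i)#}"
      by (simp add: tensor_cong.sym add_mset_commute)
  qed
  have "tcong ({#(a, m)#} + x) ((\<Sum>i\<in>I. {#(b i, act (\<rho> i a) m)#}) + (\<Sum>i\<in>I. {#(b i, ?S i)#}))"
    by (rule cong_plus[OF 1 IH])
  with 2 have "tcong ({#(a, m)#} + x) (\<Sum>i\<in>I. {#(b i, act (\<rho> i a) m + ?S i)#})"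
    unfolding sum.distrib by (meson tensor_cong.trans)
  then show ?case by (simp add: p)
qed

lemma cong_map_left:
  assumes "tcong x y" and f: "\<And>a. a \<in> A \<Longrightarrow> f a \<in> A" "\<And>a b. a \<in> A \<Longrightarrow> b \<in> A \<Longrightarrow> f (a + b) = f a + f b"
    "\<And>r a. r \<in> R \<Longrightarrow> a \<in> A \<Longrightarrow> f (r * a) = r * f a"
  shows "tcong (fs_map_left f x) (fs_map_left f y)"
  using assms(1)
proof (induction rule: tensor_cong.induct)
  case (zero m)
  have "f 0 = 0" using f(2)[of 0 0] A0 by simp
  then show ?case using zero by (simp add: fs_map_left_def tensor_cong.zero)
next
  case (refl x)
  then show ?case by (intro tensor_cong.refl) (auto simp: fs_map_left_def f)
next
  case (add x y z)
  then have "tcong (fs_map_left f x + fs_map_left f z) (fs_map_left f y + fs_map_left f z)"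
    by (intro tensor_cong.add) (auto simp: fs_map_left_def f)
  then show ?case by (simp add: fs_map_left_def)
next
  case (sym x y)
  from sym.IH show ?case by (rule tensor_cong.sym)
next
  case (trans x y z)
  from trans.IH show ?case by (rule tensor_cong.trans)
next
  case (add_left a a' m)
  then show ?case using tensor_cong.add_left[of "f a" A "f a'" m M R act] by (simp add: fs_map_left_def f)
next
  case (add_right a m m')
  then show ?case using tensor_cong.add_right[of "f a" A m M m' R act] by (simp add: fs_map_left_def f)
next
  case (balance r a m)
  then show ?case using tensor_cong.balance[of r R "f a" A m M act] by (simp add: fs_map_left_def f)
qed

lemma cong_map_right:
  assumes "tcong x y" and f: "\<And>a. a \<in> M \<Longrightarrow> f a \<in> M" "\<And>a b. a \<in> M \<Longrightarrow> b \<in> M \<Longrightarrow> f (a + b) = f a + f b"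
    "\<And>r a. r \<in> R \<Longrightarrow> a \<in> M \<Longrightarrow> f (act r a) = act r (f a)"
  shows "tcong (fs_map_right f x) (fs_map_right f y)"
  using assms(1)
proof (induction rule: tensor_cong.induct)
  case (refl x)
  then show ?case by (intro tensor_cong.refl) (auto simp: fs_map_right_def f)
next
  case (add x y z)
  then have "tcong (fs_map_right f x + fs_map_right f z) (fs_map_right f y + fs_map_right f z)"
    by (intro tensor_cong.add) (auto simp: fs_map_right_def f)
  then show ?case by (simp add: fs_map_right_def)
next
  case (zero m)
  then show ?case by (simp add: fs_map_right_def tensor_cong.zero f)
next
  case (sym x y)
  from sym.IH show ?case by (rule tensor_cong.sym)
next
  case (trans x y z)
  from trans.IH show ?case by (rule tensor_cong.trans)
next
  case (add_left a a' m)
  then show ?case using tensor_cong.add_left[of a A a' "f m" M R act] by (simp add: fs_map_right_def f)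
next
  case (add_right a m m')
  then show ?case using tensor_cong.add_right[of a A "f m" M "f m'" R act] by (simp add: fs_map_right_def f)
next
  case (balance r a m)
  then show ?case using tensor_cong.balance[of r R a A "f m" M act] by (simp add: fs_map_right_def f)
qed

lemma quot_map_cls:
  assumes "valid x" "\<And>y. tcong x y \<Longrightarrow> r `` {f y} = r `` {f x}"
  shows "quot_map r f (cls x) = r `` {f x}"
proof -
  have "x \<in> cls x" using assms(1) cong_refl by (simp add: mem_cls)
  then show ?thesis unfolding quot_map_def
    by (rule UN_constant_eq) (use assms(2) mem_cls in blast)
qed

end

section \<open>A basis of the coordinate ring over the constant field\<close>

locale curve_basis = curve_ctx C u
  for C :: "('c::field, 'z) curve_data_scheme" and u :: 'c +
  fixes r :: nat and ba bc :: "nat \<Rightarrow> 'c"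
  assumes ba: "\<And>i. i < r \<Longrightarrow> ba i \<in> A" and bc: "\<And>i. i < r \<Longrightarrow> bc i \<in> ext.cod"
    and ba_sum: "\<And>x. x \<in> K \<Longrightarrow> (\<Sum>i<r. ext.tr (bc i * x) * ba i) = x"
    and dual: "\<And>i j. i < r \<Longrightarrow> j < r \<Longrightarrow> ext.tr (bc i * ba j) = (if i = j then 1 else 0)"
    and bc_sum: "\<And>x. x \<in> K \<Longrightarrow> (\<Sum>i<r. ext.tr (x * ba i) * bc i) = x"
    and ba_bc: "(\<Sum>i<r. ba i * bc i) = 1"
begin

lemma r_pos: "r > 0"
  using ba_bc by (cases "r = 0") auto

text \<open>The enumeration makes multiplication by \<open>u\<close> the index shift by
  \<open>r\<close>.\<close>

definition bs :: "nat \<Rightarrow> 'c" where "bs m = u ^ (m div r) * ba (m mod r)"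

text \<open>The dual coordinates: \<open>m mod r\<close> selects the pairing with an element of the
  codifferent, \<open>m div r\<close> the power of \<open>u\<close> in its polynomial value.\<close>

definition cf :: "nat \<Rightarrow> 'c \<Rightarrow> 'c" where "cf m x = coeff (pol (ext.tr (bc (m mod r) * x))) (m div r)"

lemma A_K: "x \<in> A \<Longrightarrow> x \<in> K" using ext.AK by auto

lemma bcK: "i < r \<Longrightarrow> bc i \<in> K" using bc by (auto simp: ext.cod_def)

lemma mod_r [simp]: "m mod r < r" using r_pos by simp

lemma bs_A: "bs m \<in> A"
  unfolding bs_def by (intro subring_of_mult[OF A_subring] subring_of_power[OF A_subring] uA ba mod_r)

lemma tr_R: "i < r \<Longrightarrow> x \<in> A \<Longrightarrow> ext.tr (bc i * x) \<in> R"
  using bc[of i] by (auto simp: ext.cod_def)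

lemma bc_mult_K: "i < r \<Longrightarrow> x \<in> A \<Longrightarrow> bc i * x \<in> K"
  using bcK A_K subring_of_mult[OF Kr] by auto

lemma tr_scale: "x \<in> K \<Longrightarrow> c \<in> k \<Longrightarrow> ext.tr (c * x) = c * ext.tr x"
  using ext.functionalD(3)[OF ext.tr_functional] by auto

lemma tr_bc_add: "i < r \<Longrightarrow> x \<in> A \<Longrightarrow> y \<in> A \<Longrightarrow> ext.tr (bc i * (x + y)) = ext.tr (bc i * x) + ext.tr (bc i * y)"
  using ext.functionalD(2)[OF ext.tr_functional bc_mult_K[of i x] bc_mult_K[of i y]] by (simp add: distrib_left)

lemma tr_bc_scale: "i < r \<Longrightarrow> x \<in> A \<Longrightarrow> c \<in> k \<Longrightarrow> ext.tr (bc i * (c * x)) = c * ext.tr (bc i * x)"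
  using tr_scale[OF bc_mult_K[of i x], of c] by (simp add: mult.left_commute)

lemma cf_F: "x \<in> A \<Longrightarrow> cf m x \<in> F"
  unfolding cf_def using polys_over_coeff[OF pol(1)[OF tr_R[OF mod_r]]] by auto

lemma cf_add: "x \<in> A \<Longrightarrow> y \<in> A \<Longrightarrow> cf m (x + y) = cf m x + cf m y"
  unfolding cf_def by (simp add: tr_bc_add pol_add tr_R)

lemma cf_scale: "x \<in> A \<Longrightarrow> c \<in> F \<Longrightarrow> cf m (c * x) = c * cf m x"
  unfolding cf_def using k_sub by (subst tr_bc_scale) (auto simp: pol_smult tr_R)

lemma cf_0 [simp]: "cf m 0 = 0"
  using cf_scale[of 0 0 m] subring_of_0[OF A_subring] subring_of_0[OF Fr] by simp

lemma cf_uminus: "x \<in> A \<Longrightarrow> cf m (- x) = - cf m x"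
  using cf_scale[of x "-1" m] subring_of_uminus[OF Fr subring_of_1[OF Fr]] by simp

lemma cf_sum: "(\<And>i. i \<in> I \<Longrightarrow> f i \<in> A) \<Longrightarrow> cf m (\<Sum>i\<in>I. f i) = (\<Sum>i\<in>I. cf m (f i))"
  by (induction I rule: infinite_finite_induct) (auto simp: cf_add subring_of_sum[OF A_subring])

lemma cf_u: assumes "x \<in> A" shows "cf m (u * x) = (if m < r then 0 else cf (m - r) x)"
proof -
  have "ext.tr (bc (m mod r) * (u * x)) = u * ext.tr (bc (m mod r) * x)"
    using tr_bc_scale[OF mod_r assms] k_sub by blast
  then have "cf m (u * x) = coeff (pCons 0 (pol (ext.tr (bc (m mod r) * x)))) (m div r)"
    unfolding cf_def by (simp add: pol_u_mult tr_R assms)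
  also have "\<dots> = (if m < r then 0 else cf (m - r) x)"
  proof (cases "m < r")
    case False
    then have "m mod r = (m - r) mod r" "m div r = Suc ((m - r) div r)"
      using r_pos by (auto simp: le_mod_geq le_div_geq)
    then show ?thesis using False by (simp add: cf_def)
  qed (simp add: coeff_pCons)
  finally show ?thesis .
qed

lemma cf_u_power: "x \<in> A \<Longrightarrow> m < n * r \<Longrightarrow> cf m (u ^ n * x) = 0"
proof (induction n arbitrary: m)
  case (Suc n)
  have "u ^ n * x \<in> A" using Suc.prems(1) uA by (intro subring_of_mult[OF A_subring] subring_of_power[OF A_subring])
  from cf_u[OF this, of m] show ?case using Suc by (cases "m < r") (auto simp: mult.assoc)
qed simp

lemma bs_u: "u * bs m = bs (m + r)"
  using r_pos by (simp add: bs_def mult.assoc)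

lemma bs_split: "bs l = u ^ (l div r) * bs (l mod r)"
  using r_pos by (simp add: bs_def)

lemma div_mult_gt: "l \<ge> m + r \<Longrightarrow> m < l div r * r"
  using r_pos div_mult_mod_eq[of l r] mod_less_divisor[of r l] by linarith

text \<open>\<open>a * bs l\<close> is divisible in \<open>A\<close> by \<open>u^(l div r)\<close>,
  which kills its low coordinates. Thus each coordinate of a product sees only finitely many
  coordinates of the factor, and multiplication extends to arbitrary sequences by finite
  sums.\<close>

lemma cf_mult_bs: assumes "a \<in> A" "l \<ge> m + r" shows "cf m (a * bs l) = 0"
proof -
  have "a * bs l = u ^ (l div r) * (a * bs (l mod r))" by (subst bs_split) (simp add: mult_ac)
  moreover have "cf m (u ^ (l div r) * (a * bs (l mod r))) = 0"
    by (rule cf_u_power[OF subring_of_mult[OF A_subring assms(1) bs_A] div_mult_gt[OF assms(2)]])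
  ultimately show ?thesis by metis
qed

lemma cf_bs: "cf m (bs l) = (if m = l then 1 else 0)"
proof -
  have "ext.tr (bc (m mod r) * bs l) = u ^ (l div r) * ext.tr (bc (m mod r) * ba (l mod r))"
    unfolding bs_def using subring_of_power[OF subfield_of_subring[OF k_sub(1)] k_sub(3)]
    by (intro tr_bc_scale) (auto simp: ba)
  also have "\<dots> = poly (monom (if m mod r = l mod r then 1 else 0) (l div r)) u"
    by (simp add: dual poly_monom)
  finally have "pol (ext.tr (bc (m mod r) * bs l)) = monom (if m mod r = l mod r then 1 else 0) (l div r)"
    using pol_poly polys_over_monom[OF Fr] subring_of_0[OF Fr] subring_of_1[OF Fr] by simp
  then have "cf m (bs l) = (if m div r = l div r \<and> m mod r = l mod r then 1 else 0)" by (auto simp: cf_def)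
  moreover have "m div r = l div r \<and> m mod r = l mod r \<longleftrightarrow> m = l" by (metis div_mult_mod_eq)
  ultimately show ?thesis by simp
qed

lemma tr_expansion:
  assumes x: "x \<in> A" and i: "i < r" and L: "\<And>m. m \<ge> L * r \<Longrightarrow> cf m x = 0"
  shows "ext.tr (bc i * x) = (\<Sum>d<L. cf (d * r + i) x * u ^ d)"
proof -
  let ?p = "pol (ext.tr (bc i * x))"
  have c: "coeff ?p d = cf (d * r + i) x" for d using i r_pos by (simp add: cf_def)
  have "ext.tr (bc i * x) = poly ?p u" using pol(2)[OF tr_R[OF i x]] by simp
  also have "\<dots> = (\<Sum>d\<le>degree ?p + L. coeff ?p d * u ^ d)"
    unfolding poly_altdef by (rule sum.mono_neutral_left) (auto simp: coeff_eq_0)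
  also have "\<dots> = (\<Sum>d<L. coeff ?p d * u ^ d)"
  proof (rule sum.mono_neutral_right, goal_cases)
    case 3
    have "coeff ?p d = 0" if "d \<ge> L" for d unfolding c using that by (intro L) (simp add: trans_le_add1)
    then show ?case by auto
  qed auto
  finally show ?thesis by (simp add: c)
qed

lemma cf_support: assumes x: "x \<in> A" shows "\<exists>L. \<forall>m\<ge>L. cf m x = 0"
proof -
  define d where "d = Suc (\<Sum>i<r. degree (pol (ext.tr (bc i * x))))"
  have "cf m x = 0" if "m \<ge> d * r" for m
  proof -
    have "d \<le> m div r" using that r_pos by (simp add: less_eq_div_iff_mult_less_eq)
    moreover have "degree (pol (ext.tr (bc (m mod r) * x))) \<le> (\<Sum>i<r. degree (pol (ext.tr (bc i * x))))"
      by (rule member_le_sum) auto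
    ultimately show ?thesis unfolding cf_def by (intro coeff_eq_0) (simp add: d_def)
  qed
  then show ?thesis by blast
qed

lemma bs_expansion:
  assumes x: "x \<in> A" and L: "\<And>m. m \<ge> L \<Longrightarrow> cf m x = 0"
  shows "(\<Sum>m<L. cf m x * bs m) = x"
proof -
  have L': "cf m x = 0" if "m \<ge> L * r" for m
    using that r_pos by (intro L) (metis Suc_leI le_trans mult.right_neutral mult_le_mono2 One_nat_def)
  have "(\<Sum>m<L. cf m x * bs m) = (\<Sum>m<L * r. cf m x * bs m)"
  proof (rule sum.mono_neutral_left)
    have "L * 1 \<le> L * r" using r_pos by (intro mult_le_mono2) simp
    then show "{..<L} \<subseteq> {..<L * r}" by auto
  qed (use L in \<open>auto simp: not_less\<close>)
  also have "\<dots> = (\<Sum>d<L. \<Sum>m\<in>{d * r..<d * r + r}. cf m x * bs m)"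
    by (rule sum.nat_group[symmetric])
  also have "\<dots> = (\<Sum>d<L. \<Sum>i<r. cf (d * r + i) x * u ^ d * ba i)"
  proof (rule sum.cong[OF HOL.refl])
    fix d
    have "(\<Sum>m\<in>{d * r..<d * r + r}. cf m x * bs m) = (\<Sum>i<r. cf (i + d * r) x * bs (i + d * r))"
      using sum.shift_bounds_nat_ivl[of "\<lambda>m. cf m x * bs m" 0 "d * r" r] by (simp add: lessThan_atLeast0 add.commute)
    also have "\<dots> = (\<Sum>i<r. cf (d * r + i) x * u ^ d * ba i)"
      by (rule sum.cong) (auto simp: bs_def add.commute mult.assoc)
    finally show "(\<Sum>m\<in>{d * r..<d * r + r}. cf m x * bs m) = (\<Sum>i<r. cf (d * r + i) x * u ^ d * ba i)" .
  qed
  also have "\<dots> = (\<Sum>i<r. (\<Sum>d<L. cf (d * r + i) x * u ^ d) * ba i)"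
    by (subst sum.swap) (simp add: sum_distrib_right)
  also have "\<dots> = (\<Sum>i<r. ext.tr (bc i * x) * ba i)"
    by (rule sum.cong[OF HOL.refl]) (use tr_expansion[OF x _ L'] in auto)
  also have "\<dots> = x" using ba_sum A_K[OF x] by simp
  finally show ?thesis .
qed

lemma cf_mult_expansion:
  assumes a: "a \<in> A" and x: "x \<in> A"
  shows "cf m (a * x) = (\<Sum>l<m + r. cf m (a * bs l) * cf l x)"
proof -
  obtain L where L: "\<And>m. m \<ge> L \<Longrightarrow> cf m x = 0" using cf_support[OF x] by blast
  define L' where "L' = L + m + r"
  have L'': "cf l x = 0" if "l \<ge> L'" for l using that L by (simp add: L'_def)
  have abs: "a * bs l \<in> A" for l using subring_of_mult[OF A_subring a bs_A] .
  have "a * x = a * (\<Sum>l<L'. cf l x * bs l)" using bs_expansion[OF x L''] by simp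
  also have "\<dots> = (\<Sum>l<L'. cf l x * (a * bs l))" by (simp add: sum_distrib_left mult.left_commute)
  finally have "a * x = (\<Sum>l<L'. cf l x * (a * bs l))" .
  moreover have "cf m (\<Sum>l<L'. cf l x * (a * bs l)) = (\<Sum>l<L'. cf m (cf l x * (a * bs l)))"
    by (rule cf_sum, rule subring_of_mult[OF A_subring _ abs]) (use cf_F[OF x] F_A in auto)
  ultimately have "cf m (a * x) = (\<Sum>l<L'. cf m (cf l x * (a * bs l)))" by simp
  also have "\<dots> = (\<Sum>l<L'. cf m (a * bs l) * cf l x)"
    by (rule sum.cong[OF HOL.refl], subst cf_scale[OF abs cf_F[OF x]], rule mult.commute)
  also have "\<dots> = (\<Sum>l<m + r. cf m (a * bs l) * cf l x)"
    by (rule sum.mono_neutral_right) (auto simp: L'_def cf_mult_bs[OF a] not_less)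
  finally show ?thesis .
qed

end

section \<open>Completed tensor products as spaces of null sequences\<close>

lemma quot_map2_eq:
  assumes "x \<in> X" "y \<in> Y" "\<And>x' y'. x' \<in> X \<Longrightarrow> y' \<in> Y \<Longrightarrow> r `` {f x' y'} = Z"
  shows "quot_map2 r f X Y = Z"
proof -
  have "(\<Union>y\<in>Y. r `` {f x' y}) = Z" if "x' \<in> X" for x'
    by (rule UN_constant_eq[OF assms(2)]) (use assms(3) that in auto)
  then show ?thesis unfolding quot_map2_def by (intro UN_constant_eq[OF assms(1)]) auto
qed

locale ct_model = curve_basis C u r ba bc + Un: ultranorm nm
  for C :: "('c::field, 'z) curve_data_scheme" and u :: 'c and r :: nat and ba bc :: "nat \<Rightarrow> 'c"
    and nm :: "'v::ab_group_add \<Rightarrow> real" +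
  fixes act :: "'c \<Rightarrow> 'v \<Rightarrow> 'v"
  assumes act_add: "\<And>c v w. c \<in> F \<Longrightarrow> act c (v + w) = act c v + act c w"
    and act_plus: "\<And>c c' v. c \<in> F \<Longrightarrow> c' \<in> F \<Longrightarrow> act (c + c') v = act c v + act c' v"
    and act_mult: "\<And>c c' v. c \<in> F \<Longrightarrow> c' \<in> F \<Longrightarrow> act (c * c') v = act c (act c' v)"
    and act_1: "\<And>v. act 1 v = v"
    and nm_act: "\<And>c v. c \<in> F \<Longrightarrow> nm (act c v) \<le> nm v"
begin

lemma act_0 [simp]: "act 0 v = 0"
  using act_plus[of 0 0 v] subring_of_0[OF Fr] by simp

lemma act_zero [simp]: "c \<in> F \<Longrightarrow> act c 0 = 0"
  using act_add[of c 0 0] by simp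

lemma act_uminus: assumes "c \<in> F" shows "act (- c) v = - act c v"
proof -
  have "act (- c + c) v = act (- c) v + act c v" using assms subring_of_uminus[OF Fr] by (intro act_plus) auto
  then show ?thesis by (simp add: eq_neg_iff_add_eq_0)
qed

lemma act_sum_scalar: "(\<And>i. i \<in> I \<Longrightarrow> c i \<in> F) \<Longrightarrow> act (\<Sum>i\<in>I. c i) v = (\<Sum>i\<in>I. act (c i) v)"
  by (induction I rule: infinite_finite_induct) (auto simp: act_plus subring_of_sum[OF Fr])

sublocale T: tensor_data F A act UNIV
  by standard (use subring_of_0[OF Fr] F_A subring_of_add[OF A_subring] subring_of_mult[OF A_subring] in auto)

lemma valid_iff: "T.valid x \<longleftrightarrow> (\<forall>p\<in>#x. fst p \<in> A)"
  by (auto simp: T.valid_def)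

lemma valid_sum: "(\<And>i. i \<in> I \<Longrightarrow> a i \<in> A) \<Longrightarrow> T.valid (\<Sum>i\<in>I. {#(a i, v i)#})"
  by (induction I rule: infinite_finite_induct) auto

definition co :: "('c \<times> 'v) multiset \<Rightarrow> nat \<Rightarrow> 'v" where
  "co x m = (\<Sum>(a, v)\<in>#x. act (cf m a) v)"

lemma co_simps [simp]: "co {#} m = 0" "co (x + y) m = co x m + co y m"
    "co (add_mset p x) m = act (cf m (fst p)) (snd p) + co x m"
  by (auto simp: co_def case_prod_unfold)

lemma co_cong: assumes "T.tcong x y" shows "co x = co y"
proof
  fix m
  show "co x m = co y m" unfolding co_def
    by (rule T.cong_sum[OF assms])
      (use F_A in \<open>auto simp: cf_add cf_scale cf_F act_add act_plus act_mult[symmetric] mult.commute\<close>)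
qed

lemma co_sum_basis: "finite I \<Longrightarrow> co (\<Sum>m\<in>I. {#(bs m, w m)#}) l = (if l \<in> I then w l else 0)"
proof (induction I rule: finite_induct)
  case (insert m I)
  then show ?case by (auto simp: cf_bs act_1)
qed simp

lemma co_support: assumes "T.valid x" shows "\<exists>L. \<forall>p\<in>#x. \<forall>m\<ge>L. cf m (fst p) = 0"
  using assms
proof (induction x)
  case (add p x)
  then obtain L where L: "\<forall>p\<in>#x. \<forall>m\<ge>L. cf m (fst p) = 0" by auto
  obtain L' where "\<forall>m\<ge>L'. cf m (fst p) = 0" using cf_support[of "fst p"] add.prems by auto
  then show ?case using L by (intro exI[of _ "max L L'"]) auto
qed simp

lemma co_eq_0: assumes "\<And>p. p \<in># x \<Longrightarrow> cf m (fst p) = 0" shows "co x m = 0"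
  using assms by (induction x) auto

lemma normal_form:
  assumes v: "T.valid x" and L: "\<forall>p\<in>#x. \<forall>m\<ge>L. cf m (fst p) = 0"
  shows "T.tcong x (\<Sum>m<L. {#(bs m, co x m)#})"
  unfolding co_def
proof (rule T.cong_normal_form[OF _ _ v])
  fix a w assume aw: "(a, w) \<in># x"
  then have a: "a \<in> A" using v by (auto simp: valid_iff)
  then show "cf i a \<in> F" for i by (rule cf_F)
  have "cf m a = 0" if "m \<ge> L" for m using L aw that by force
  then show "a = (\<Sum>i<L. cf i a * bs i)" using bs_expansion[OF a] by metis
qed (auto simp: bs_A)

lemma cong_iff_co: assumes "T.valid x" "T.valid y" shows "T.tcong x y \<longleftrightarrow> co x = co y"
proof
  assume eq: "co x = co y"
  obtain L L' where L: "\<forall>p\<in>#x. \<forall>m\<ge>L. cf m (fst p) = 0" "\<forall>p\<in>#y. \<forall>m\<ge>L'. cf m (fst p) = 0"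
    using co_support assms by meson
  have "T.tcong x (\<Sum>m<max L L'. {#(bs m, co x m)#})" by (rule normal_form) (use assms L in auto)
  moreover have "T.tcong y (\<Sum>m<max L L'. {#(bs m, co y m)#})" by (rule normal_form) (use assms L in auto)
  ultimately show "T.tcong x y" unfolding eq by (meson tensor_cong.sym tensor_cong.trans)
qed (rule co_cong)

abbreviation "S \<equiv> tensor F A act (UNIV :: 'v set)"
abbreviation "d \<equiv> tensor_dist (ct_base C act) nm"

lemma ct_base_eq: "ct_base C act = T.trel" by (simp add: ct_base_def)

lemma S_eq: "S = T.cls ` Collect T.valid" by (rule T.tensor_cls)

definition CO :: "('c \<times> 'v) multiset set \<Rightarrow> nat \<Rightarrow> 'v" where "CO X = co (SOME x. x \<in> X)"

lemma CO_cls: assumes "T.valid x" shows "CO (T.cls x) = co x"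
proof -
  have "x \<in> T.cls x" using assms by (simp add: T.mem_cls T.cong_refl)
  then have "(SOME y. y \<in> T.cls x) \<in> T.cls x" by (metis someI)
  then show ?thesis unfolding CO_def using co_cong[of x] by (simp add: T.mem_cls)
qed

lemma S_obtain: assumes "X \<in> S" obtains x where "T.valid x" "X = T.cls x" "CO X = co x"
  using assms CO_cls by (auto simp: S_eq)

lemma cls_S: "T.valid x \<Longrightarrow> T.cls x \<in> S" by (auto simp: S_eq)

text \<open>Each representation bounds the coordinates, because these are combinations of its
  entries with constants of absolute value at most 1; the normal form is a representation whose
  entries are the coordinates.\<close>

lemma tensor_norm_le:
  assumes x: "T.valid x" and B: "B \<ge> 0"
  shows "tensor_norm nm (T.cls x) \<le> B \<longleftrightarrow> (\<forall>m. nm (co x m) \<le> B)"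
proof -
  let ?f = "\<lambda>x :: ('c \<times> 'v) multiset. Max (insert 0 ((\<lambda>(b, v). nm v) ` set_mset x))"
  have f0: "?f y \<ge> 0" for y by simp
  have bdd: "bdd_below (?f ` T.cls x)" using f0 by (auto intro!: bdd_belowI[of _ 0])
  have ne: "T.cls x \<noteq> {}" using x T.cong_refl T.mem_cls by blast
  have ge: "nm (co y m) \<le> ?f y" if y: "T.valid y" for y m
  proof -
    have el: "nm (act (cf m a) v) \<le> ?f y" if "(a, v) \<in># y" for a v
    proof -
      have "nm (act (cf m a) v) \<le> nm v" by (rule nm_act, rule cf_F) (use that y in \<open>auto simp: valid_iff\<close>)
      also have "\<dots> \<le> ?f y" by (rule Max_ge) (use that in force)+
      finally show ?thesis .
    qed
    have "(\<And>a v. (a, v) \<in># z \<Longrightarrow> nm (act (cf m a) v) \<le> B') \<Longrightarrow> B' \<ge> 0 \<Longrightarrow> nm (co z m) \<le> B'" for z B'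
    proof (induction z)
      case (add p z)
      have "nm (act (cf m (fst p)) (snd p)) \<le> B'" using add.prems(1)[of "fst p" "snd p"] by simp
      moreover have "nm (co z m) \<le> B'" using add by auto
      ultimately show ?case by (simp add: Un.add_le)
    qed simp
    then show ?thesis using el f0 by blast
  qed
  show ?thesis
  proof
    assume le: "tensor_norm nm (T.cls x) \<le> B"
    show "\<forall>m. nm (co x m) \<le> B"
    proof
      fix m
      have "nm (co x m) \<le> (INF y\<in>T.cls x. ?f y)"
      proof (rule cINF_greatest[OF ne])
        fix y assume "y \<in> T.cls x"
        then have "T.tcong x y" by (simp add: T.mem_cls)
        then show "nm (co x m) \<le> ?f y" using co_cong[of x y] ge[of y m] T.cong_valid by metis
      qed
      then show "nm (co x m) \<le> B" using le by (simp add: tensor_norm_def)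
    qed
  next
    assume le: "\<forall>m. nm (co x m) \<le> B"
    obtain L where L: "\<forall>p\<in>#x. \<forall>m\<ge>L. cf m (fst p) = 0" using co_support[OF x] by blast
    define y where "y = (\<Sum>m<L. {#(bs m, co x m)#})"
    have "y \<in> T.cls x" using normal_form[OF x L] by (simp add: T.mem_cls y_def)
    then have "(INF y\<in>T.cls x. ?f y) \<le> ?f y" by (rule cINF_lower[OF bdd])
    also have "\<dots> \<le> B"
    proof (rule Max.boundedI)
      fix z assume z: "z \<in> insert 0 ((\<lambda>(b, v). nm v) ` set_mset y)"
      have "set_mset y = (\<lambda>m. (bs m, co x m)) ` {..<L}" unfolding y_def by (induction L) (auto simp: lessThan_Suc)
      then show "z \<le> B" using z B le by auto
    qed auto
    finally show "tensor_norm nm (T.cls x) \<le> B" by (simp add: tensor_norm_def)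
  qed
qed

lemma tensor_norm_nonneg: assumes "T.valid x" shows "tensor_norm nm (T.cls x) \<ge> 0"
proof -
  have "T.cls x \<noteq> {}" using assms T.cong_refl T.mem_cls by blast
  then show ?thesis unfolding tensor_norm_def by (rule cINF_greatest) simp
qed

lemma fs_diff_props:
  assumes "T.valid x" "T.valid y"
  shows "T.valid (fs_diff x y)" "co (fs_diff x y) = (\<lambda>m. co x m - co y m)"
proof -
  have "T.valid y \<Longrightarrow> T.valid (fs_map_left uminus y) \<and> (\<forall>m. co (fs_map_left uminus y) m = - co y m)" for y
    by (induction y) (auto simp: fs_map_left_def subring_of_uminus[OF A_subring] cf_uminus act_uminus cf_F)
  then show "T.valid (fs_diff x y)" "co (fs_diff x y) = (\<lambda>m. co x m - co y m)"
    using assms by (auto simp: fs_diff_def)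
qed

lemma quot_map2_binary:
  assumes "T.valid x" "T.valid y"
    and f: "\<And>x y. T.valid x \<Longrightarrow> T.valid y \<Longrightarrow> T.valid (f x y) \<and> co (f x y) = G (co x) (co y)"
  shows "quot_map2 (ct_base C act) f (T.cls x) (T.cls y) = T.cls (f x y)"
proof (rule quot_map2_eq)
  show "x \<in> T.cls x" "y \<in> T.cls y" using assms by (auto simp: T.mem_cls T.cong_refl)
  fix x' y' assume "x' \<in> T.cls x" "y' \<in> T.cls y"
  then have c: "T.tcong x x'" "T.tcong y y'" by (auto simp: T.mem_cls)
  then have v: "T.valid x'" "T.valid y'" using T.cong_valid by auto
  have "T.tcong (f x y) (f x' y')" using f[OF assms(1,2)] f[OF v] co_cong[OF c(1)] co_cong[OF c(2)]
    by (subst cong_iff_co) auto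
  then show "ct_base C act `` {f x' y'} = T.cls (f x y)"
    using T.cls_eq by (simp add: ct_base_eq T.cls_def)
qed

lemma d_cls: assumes "T.valid x" "T.valid y" shows "d (T.cls x) (T.cls y) = tensor_norm nm (T.cls (fs_diff x y))"
  unfolding tensor_dist_def
  by (subst quot_map2_binary[OF assms, of fs_diff "\<lambda>a b m. a m - b m"]) (auto simp: fs_diff_props)

lemma d_le: assumes "X \<in> S" "Y \<in> S" "B \<ge> 0" shows "d X Y \<le> B \<longleftrightarrow> (\<forall>m. nm (CO X m - CO Y m) \<le> B)"
proof -
  obtain x y where "T.valid x" "X = T.cls x" "CO X = co x" "T.valid y" "Y = T.cls y" "CO Y = co y"
    using assms S_obtain by metis
  then show ?thesis using d_cls tensor_norm_le[OF fs_diff_props(1)] fs_diff_props(2) assms(3) by simp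
qed

lemma d_nonneg: assumes "X \<in> S" "Y \<in> S" shows "d X Y \<ge> 0"
proof -
  obtain x y where "T.valid x" "X = T.cls x" "T.valid y" "Y = T.cls y" using assms S_obtain by metis
  then show ?thesis using d_cls tensor_norm_nonneg[OF fs_diff_props(1)] by simp
qed

lemma CO_le_d: assumes "X \<in> S" "Y \<in> S" shows "nm (CO X m - CO Y m) \<le> d X Y"
  using d_le[OF assms d_nonneg[OF assms]] by simp

section \<open>Null sequences as limits of coordinate sequences\<close>

definition c0 :: "(nat \<Rightarrow> 'v) set" where "c0 = {w. (\<lambda>m. nm (w m)) \<longlonglongrightarrow> 0}"

lemma c0_iff: "w \<in> c0 \<longleftrightarrow> (\<forall>\<epsilon>>0. \<exists>L. \<forall>m\<ge>L. nm (w m) < \<epsilon>)"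
  unfolding c0_def LIMSEQ_iff by (simp add: Un.nonneg)

lemma c0_bounded: assumes "w \<in> c0" shows "\<exists>W\<ge>0. \<forall>m. nm (w m) \<le> W"
proof -
  have "Bseq (\<lambda>m. nm (w m))" using assms unfolding c0_def by (auto intro: convergent_imp_Bseq convergentI)
  then obtain W where "\<And>m. norm (nm (w m)) \<le> W" "W > 0" by (auto simp: Bseq_def)
  then show ?thesis by (intro exI[of _ W]) (auto dest: abs_le_D1)
qed

lemma finite_support_c0: "(\<And>m. m \<ge> L \<Longrightarrow> w m = 0) \<Longrightarrow> w \<in> c0"
  unfolding c0_iff by (auto intro!: exI[of _ L])

lemma co_c0: assumes "T.valid x" shows "co x \<in> c0"
proof -
  obtain L where "\<forall>p\<in>#x. \<forall>m\<ge>L. cf m (fst p) = 0" using co_support[OF assms] by blast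
  then show ?thesis by (intro finite_support_c0[of L] co_eq_0) auto
qed

lemma CO_c0: "X \<in> S \<Longrightarrow> CO X \<in> c0"
  using S_obtain co_c0 by metis

definition close :: "real \<Rightarrow> (nat \<Rightarrow> 'v) \<Rightarrow> (nat \<Rightarrow> 'v) \<Rightarrow> bool" where
  "close \<epsilon> w w' \<longleftrightarrow> (\<forall>m. nm (w m - w' m) \<le> \<epsilon>)"

lemma close_sym: "close \<epsilon> w w' \<Longrightarrow> close \<epsilon> w' w"
  by (simp add: close_def Un.minus_commute)

lemma close_trans: "close \<epsilon> w w' \<Longrightarrow> close \<epsilon> w' w'' \<Longrightarrow> close \<epsilon> w w''"
  unfolding close_def using Un.add_le[of "w m - w' m" \<epsilon> "w' m - w'' m" for m] by force

definition conv :: "(nat \<Rightarrow> ('c \<times> 'v) multiset set) \<Rightarrow> (nat \<Rightarrow> 'v) \<Rightarrow> bool" where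
  "conv s w \<longleftrightarrow> (\<forall>\<epsilon>>0. \<exists>n0. \<forall>n\<ge>n0. close \<epsilon> (CO (s n)) w)"

lemma conv_unique: assumes "conv s w" "conv s w'" shows "w = w'"
proof
  fix m
  have "nm (w m - w' m) \<le> 0"
  proof (rule field_le_epsilon)
    fix \<epsilon> :: real assume e: "\<epsilon> > 0"
    then obtain n0 n1 where "\<forall>n\<ge>n0. close \<epsilon> (CO (s n)) w" "\<forall>n\<ge>n1. close \<epsilon> (CO (s n)) w'"
      using assms unfolding conv_def by meson
    then have "close \<epsilon> w w'" using close_sym close_trans by (metis nle_le)
    then show "nm (w m - w' m) \<le> 0 + \<epsilon>" by (simp add: close_def)
  qed
  then show "w m = w' m" using Un.nonneg[of "w m - w' m"] Un.zero_iff[of "w m - w' m"] by simp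
qed

lemma conv_cauchy: assumes "\<And>n. s n \<in> S" "conv s w" shows "s \<in> cauchy_seqs S d"
  unfolding cauchy_seqs_def
proof (intro CollectI conjI allI impI)
  fix \<epsilon> :: real assume e: "\<epsilon> > 0"
  then obtain n0 where n0: "\<And>n. n \<ge> n0 \<Longrightarrow> close (\<epsilon> / 2) (CO (s n)) w"
    using assms(2) unfolding conv_def by (meson half_gt_zero)
  have "d (s m) (s n) < \<epsilon>" if "m \<ge> n0" "n \<ge> n0" for m n
  proof -
    have "close (\<epsilon> / 2) (CO (s m)) (CO (s n))" using close_trans[OF n0 close_sym[OF n0]] that by blast
    then have "d (s m) (s n) \<le> \<epsilon> / 2" using d_le[OF assms(1) assms(1), of "\<epsilon> / 2" m n] e by (simp add: close_def)
    then show ?thesis using e by simp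
  qed
  then show "\<exists>n0. \<forall>m\<ge>n0. \<forall>n\<ge>n0. d (s m) (s n) < \<epsilon>" by blast
qed (use assms in auto)

lemma cauchy_conv: assumes s: "s \<in> cauchy_seqs S d" shows "\<exists>w\<in>c0. conv s w"
proof -
  have sS: "s n \<in> S" for n using s by (auto simp: cauchy_seqs_def)
  have cau: "\<exists>n0. \<forall>m\<ge>n0. \<forall>n\<ge>n0. d (s m) (s n) < \<epsilon>" if "\<epsilon> > 0" for \<epsilon>
    using s that by (auto simp: cauchy_seqs_def)
  have "\<exists>l. Un.tends (\<lambda>n. CO (s n) m) l" for m
    unfolding Un.tends_def
  proof (rule Un.cauchy_converges, intro allI impI)
    fix \<epsilon> :: real assume "\<epsilon> > 0"
    then obtain n0 where "\<forall>m\<ge>n0. \<forall>n\<ge>n0. d (s m) (s n) < \<epsilon>" using cau by blast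
    then show "\<exists>n0. \<forall>l\<ge>n0. \<forall>n\<ge>n0. nm (CO (s l) m - CO (s n) m) < \<epsilon>"
      using CO_le_d[OF sS sS] le_less_trans by blast
  qed
  then obtain w where w: "\<And>m. Un.tends (\<lambda>n. CO (s n) m) (w m)" by metis
  have conv: "conv s w" unfolding conv_def
  proof (intro allI impI)
    fix \<epsilon> :: real assume "\<epsilon> > 0"
    then obtain n0 where n0: "\<And>m n. m \<ge> n0 \<Longrightarrow> n \<ge> n0 \<Longrightarrow> d (s m) (s n) < \<epsilon>" using cau by blast
    have "nm (CO (s n) m - w m) \<le> \<epsilon>" if n: "n \<ge> n0" for n m
    proof (rule Un.tends_bound[OF Un.tends_diff[OF Un.tends_const w]])
      have "nm (CO (s n) m - CO (s n') m) \<le> \<epsilon>" if "n' \<ge> n0" for n'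
        using CO_le_d[OF sS sS, of n m n'] n0[OF n that] by linarith
      then show "\<forall>\<^sub>F n' in sequentially. nm (CO (s n) m - CO (s n') m) \<le> \<epsilon>"
        unfolding eventually_sequentially by blast
    qed
    then show "\<exists>n0. \<forall>n\<ge>n0. close \<epsilon> (CO (s n)) w" by (auto simp: close_def)
  qed
  have "w \<in> c0" unfolding c0_iff
  proof (intro allI impI)
    fix \<epsilon> :: real assume e: "\<epsilon> > 0"
    then obtain n where n: "close (\<epsilon> / 2) (CO (s n)) w" using conv unfolding conv_def by (meson half_gt_zero order_refl)
    obtain L where L: "\<And>m. m \<ge> L \<Longrightarrow> nm (CO (s n) m) < \<epsilon> / 2"
      using CO_c0[OF sS[of n]] e unfolding c0_iff by (meson half_gt_zero)
    have "nm (w m) < \<epsilon>" if "m \<ge> L" for m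
      using Un.ultra_diff[of "CO (s n) m" "CO (s n) m - w m"] L[OF that] n e by (auto simp: close_def dest: spec[of _ m])
    then show "\<exists>L. \<forall>m\<ge>L. nm (w m) < \<epsilon>" by blast
  qed
  then show ?thesis using conv by blast
qed

definition trunc :: "(nat \<Rightarrow> 'v) \<Rightarrow> nat \<Rightarrow> ('c \<times> 'v) multiset set" where
  "trunc w n = T.cls (\<Sum>m<n. {#(bs m, w m)#})"

lemma trunc_S: "trunc w n \<in> S" unfolding trunc_def by (intro cls_S valid_sum bs_A)

lemma CO_trunc: "CO (trunc w n) m = (if m < n then w m else 0)"
  unfolding trunc_def by (subst CO_cls) (auto simp: valid_sum bs_A co_sum_basis)

lemma trunc_conv: assumes "w \<in> c0" shows "conv (trunc w) w"
  unfolding conv_def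
proof (intro allI impI)
  fix \<epsilon> :: real assume e: "\<epsilon> > 0"
  then obtain L where L: "\<And>m. m \<ge> L \<Longrightarrow> nm (w m) < \<epsilon>" using assms unfolding c0_iff by blast
  have "close \<epsilon> (CO (trunc w n)) w" if "n \<ge> L" for n
    unfolding close_def CO_trunc using L e that by (auto simp: Un.minus intro!: less_imp_le)
  then show "\<exists>n0. \<forall>n\<ge>n0. close \<epsilon> (CO (trunc w n)) w" by blast
qed

text \<open>Points of the completion are classes of Cauchy sequences of tensors, so the point with
  limit coordinates \<open>w\<close> is this whole class; \<open>trunc w\<close> is its standard
  member.\<close>

definition Psi :: "(nat \<Rightarrow> 'v) \<Rightarrow> ('c, 'v) ctens" where "Psi w = {s. (\<forall>n. s n \<in> S) \<and> conv s w}"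

lemma trunc_Psi: "w \<in> c0 \<Longrightarrow> trunc w \<in> Psi w"
  by (simp add: Psi_def trunc_S trunc_conv)

lemma Psi_class: assumes "s \<in> Psi w" shows "ct_rel C act nm `` {s} = Psi w"
proof -
  have s: "\<And>n. s n \<in> S" "conv s w" using assms by (auto simp: Psi_def)
  have sc: "s \<in> cauchy_seqs S d" by (rule conv_cauchy[OF s])
  have "(s, t) \<in> null_rel S d \<longleftrightarrow> t \<in> Psi w" for t
  proof
    assume "(s, t) \<in> null_rel S d"
    then have t: "t \<in> cauchy_seqs S d" "(\<lambda>n. d (s n) (t n)) \<longlonglongrightarrow> 0" by (auto simp: null_rel_def)
    then have tS: "t n \<in> S" for n by (auto simp: cauchy_seqs_def)
    have "conv t w" unfolding conv_def
    proof (intro allI impI)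
      fix \<epsilon> :: real assume e: "\<epsilon> > 0"
      obtain n0 where n0: "\<And>n. n \<ge> n0 \<Longrightarrow> close \<epsilon> (CO (s n)) w" using s(2) e unfolding conv_def by blast
      have "\<forall>\<^sub>F n in sequentially. d (s n) (t n) < \<epsilon>" using t(2) e by (rule order_tendstoD)
      then obtain n1 where n1: "\<And>n. n \<ge> n1 \<Longrightarrow> d (s n) (t n) < \<epsilon>" by (auto simp: eventually_sequentially)
      have "close \<epsilon> (CO (t n)) w" if "n \<ge> max n0 n1" for n
      proof -
        have "close \<epsilon> (CO (s n)) (CO (t n))" unfolding close_def using n1[of n] that d_le[OF s(1) tS, of \<epsilon> n n] e by simp
        then show ?thesis using close_trans[OF close_sym n0] that by auto
      qed
      then show "\<exists>n0. \<forall>n\<ge>n0. close \<epsilon> (CO (t n)) w" by blast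
    qed
    then show "t \<in> Psi w" using tS by (simp add: Psi_def)
  next
    assume "t \<in> Psi w"
    then have t: "\<And>n. t n \<in> S" "conv t w" by (auto simp: Psi_def)
    have "(\<lambda>n. d (s n) (t n)) \<longlonglongrightarrow> 0" unfolding LIMSEQ_iff
    proof (intro allI impI)
      fix \<epsilon> :: real assume e: "\<epsilon> > 0"
      obtain n0 where n0: "\<And>n. n \<ge> n0 \<Longrightarrow> close (\<epsilon> / 2) (CO (s n)) w"
        using s(2) e unfolding conv_def by (meson half_gt_zero)
      obtain n1 where n1: "\<And>n. n \<ge> n1 \<Longrightarrow> close (\<epsilon> / 2) (CO (t n)) w"
        using t(2) e unfolding conv_def by (meson half_gt_zero)
      have "norm (d (s n) (t n) - 0) < \<epsilon>" if "n \<ge> max n0 n1" for n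
      proof -
        have "close (\<epsilon> / 2) (CO (s n)) (CO (t n))" using close_trans[OF n0 close_sym[OF n1]] that by auto
        then have "d (s n) (t n) \<le> \<epsilon> / 2" using d_le[OF s(1) t(1), of "\<epsilon> / 2" n n] e by (simp add: close_def)
        then show ?thesis using d_nonneg[OF s(1) t(1), of n n] e by simp
      qed
      then show "\<exists>n0. \<forall>n\<ge>n0. norm (d (s n) (t n) - 0) < \<epsilon>" by blast
    qed
    then show "(s, t) \<in> null_rel S d" using sc conv_cauchy[OF t] by (simp add: null_rel_def)
  qed
  then show ?thesis by (auto simp: ct_rel_def)
qed

lemma ctensor_eq: "ctensor C act nm = Psi ` c0"
proof
  show "ctensor C act nm \<subseteq> Psi ` c0"
  proof
    fix X assume "X \<in> ctensor C act nm"
    then obtain s where s: "s \<in> cauchy_seqs S d" "X = null_rel S d `` {s}"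
      by (auto simp: ctensor_def completion_def quotient_def)
    obtain w where w: "w \<in> c0" "conv s w" using cauchy_conv[OF s(1)] by blast
    then have "s \<in> Psi w" using s(1) by (auto simp: Psi_def cauchy_seqs_def)
    then have "X = Psi w" using Psi_class s(2) by (simp add: ct_rel_def)
    then show "X \<in> Psi ` c0" using w by blast
  qed
  show "Psi ` c0 \<subseteq> ctensor C act nm"
  proof
    fix X assume "X \<in> Psi ` c0"
    then obtain w where w: "w \<in> c0" "X = Psi w" by blast
    have "trunc w \<in> cauchy_seqs S d" by (rule conv_cauchy[OF trunc_S trunc_conv[OF w(1)]])
    moreover have "X = null_rel S d `` {trunc w}" using Psi_class[OF trunc_Psi[OF w(1)]] w by (simp add: ct_rel_def)
    ultimately show "X \<in> ctensor C act nm" by (auto simp: ctensor_def completion_def quotient_def)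
  qed
qed

lemma Psi_inj: assumes "w \<in> c0" "Psi w = Psi w'" shows "w = w'"
proof -
  have "trunc w \<in> Psi w'" using trunc_Psi[OF assms(1)] assms(2) by simp
  then show ?thesis using conv_unique[OF trunc_conv[OF assms(1)]] by (simp add: Psi_def)
qed

text \<open>An operator given termwise on formal sums is replaced by its effect \<open>G\<close> on
  coordinates: classes are determined by coordinates, so representatives do not matter, and
  continuity of \<open>G\<close> at \<open>w\<close> carries the effect to the limit.\<close>

lemma ct_map_Psi:
  assumes f: "\<And>x. T.valid x \<Longrightarrow> T.valid (f x) \<and> co (f x) = G (co x)"
    and w: "w \<in> c0"
    and cont: "\<And>\<epsilon>. \<epsilon> > 0 \<Longrightarrow> \<exists>\<delta>>0. \<forall>w'\<in>c0. close \<delta> w' w \<longrightarrow> close \<epsilon> (G w') (G w)"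
  shows "ct_map C act nm f (Psi w) = Psi (G w)"
proof -
  have "ct_rel C act nm `` {\<lambda>n. quot_map (ct_base C act) f (s n)} = Psi (G w)" if "s \<in> Psi w" for s
  proof (rule Psi_class)
    have s: "\<And>n. s n \<in> S" "conv s w" using that by (auto simp: Psi_def)
    have q: "quot_map (ct_base C act) f (s n) \<in> S \<and> CO (quot_map (ct_base C act) f (s n)) = G (CO (s n))" for n
    proof -
      obtain x where x: "T.valid x" "s n = T.cls x" "CO (s n) = co x" using S_obtain[OF s(1)] by blast
      have "quot_map (ct_base C act) f (T.cls x) = T.cls (f x)"
        unfolding T.cls_def[of "f x"] ct_base_eq
      proof (rule T.quot_map_cls[OF x(1)])
        fix y assume y: "T.tcong x y"
        then have "T.tcong (f x) (f y)" using f[OF x(1)] f[of y] T.cong_valid[OF y] co_cong[OF y] by (subst cong_iff_co) auto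
        then show "T.trel `` {f y} = T.trel `` {f x}" using T.cls_eq by (simp add: T.cls_def)
      qed
      then show ?thesis using f[OF x(1)] x CO_cls cls_S by simp
    qed
    have "conv (\<lambda>n. quot_map (ct_base C act) f (s n)) (G w)" unfolding conv_def
    proof (intro allI impI)
      fix \<epsilon> :: real assume "\<epsilon> > 0"
      then obtain \<delta> where de: "\<delta> > 0" "\<forall>w'\<in>c0. close \<delta> w' w \<longrightarrow> close \<epsilon> (G w') (G w)" using cont by blast
      then obtain n0 where "\<forall>n\<ge>n0. close \<delta> (CO (s n)) w" using s(2) unfolding conv_def by blast
      then show "\<exists>n0. \<forall>n\<ge>n0. close \<epsilon> (CO (quot_map (ct_base C act) f (s n))) (G w)"
        using de(2) CO_c0[OF s(1)] q by auto
    qed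
    then show "(\<lambda>n. quot_map (ct_base C act) f (s n)) \<in> Psi (G w)" using q by (simp add: Psi_def)
  qed
  then show ?thesis unfolding ct_map_def quot_map_def[of "ct_rel C act nm"]
    by (intro UN_constant_eq[OF trunc_Psi[OF w]]) auto
qed

lemma ct_map2_Psi:
  assumes "s0 \<in> Z" "w \<in> c0"
    and H: "\<And>s t. s \<in> Z \<Longrightarrow> t \<in> Psi w \<Longrightarrow> (\<lambda>n. quot_map2 (ct_base C act) f (s n) (t n)) \<in> Psi w'"
  shows "ct_map2 C act nm f Z (Psi w) = Psi w'"
  unfolding ct_map2_def
  by (rule quot_map2_eq[OF assms(1) trunc_Psi[OF assms(2)]]) (rule Psi_class, rule H)

lemma ct_map2_binary:
  assumes f: "\<And>x y. T.valid x \<Longrightarrow> T.valid y \<Longrightarrow> T.valid (f x y) \<and> co (f x y) = G (co x) (co y)"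
    and c: "\<And>\<epsilon> w1 w2 w1' w2'. \<epsilon> > 0 \<Longrightarrow> close \<epsilon> w1 w1' \<Longrightarrow> close \<epsilon> w2 w2' \<Longrightarrow> close \<epsilon> (G w1 w2) (G w1' w2')"
    and w: "w1 \<in> c0" "w2 \<in> c0"
  shows "ct_map2 C act nm f (Psi w1) (Psi w2) = Psi (G w1 w2)"
proof (rule ct_map2_Psi[OF trunc_Psi[OF w(1)] w(2)])
  fix s t assume "s \<in> Psi w1" "t \<in> Psi w2"
  then have st: "\<And>n. s n \<in> S" "conv s w1" "\<And>n. t n \<in> S" "conv t w2" by (auto simp: Psi_def)
  have q: "quot_map2 (ct_base C act) f (s n) (t n) \<in> S \<and>
      CO (quot_map2 (ct_base C act) f (s n) (t n)) = G (CO (s n)) (CO (t n))" for n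
  proof -
    obtain x y where xy: "T.valid x" "s n = T.cls x" "CO (s n) = co x" "T.valid y" "t n = T.cls y" "CO (t n) = co y"
      using S_obtain[OF st(1)[of n]] S_obtain[OF st(3)[of n]] by metis
    have "quot_map2 (ct_base C act) f (s n) (t n) = T.cls (f x y)"
      unfolding xy(2) xy(5) by (rule quot_map2_binary[where G = G, OF xy(1,4)]) (rule f)
    then show ?thesis using f[OF xy(1,4)] CO_cls cls_S xy by simp
  qed
  have "conv (\<lambda>n. quot_map2 (ct_base C act) f (s n) (t n)) (G w1 w2)" unfolding conv_def
  proof (intro allI impI)
    fix \<epsilon> :: real assume e: "\<epsilon> > 0"
    then obtain n0 n1 where "\<forall>n\<ge>n0. close \<epsilon> (CO (s n)) w1" "\<forall>n\<ge>n1. close \<epsilon> (CO (t n)) w2"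
      using st unfolding conv_def by meson
    then show "\<exists>n0. \<forall>n\<ge>n0. close \<epsilon> (CO (quot_map2 (ct_base C act) f (s n) (t n))) (G w1 w2)"
      using c[OF e] q by (intro exI[of _ "max n0 n1"]) auto
  qed
  then show "(\<lambda>n. quot_map2 (ct_base C act) f (s n) (t n)) \<in> Psi (G w1 w2)" using q by (simp add: Psi_def)
qed

text \<open>The matrix of multiplication by \<open>a\<close> in the basis \<open>bs\<close>. Row
  \<open>m\<close> ends before \<open>m + r\<close>, so the formula makes sense for every sequence,
  null or not.\<close>

definition Lm :: "'c \<Rightarrow> (nat \<Rightarrow> 'v) \<Rightarrow> nat \<Rightarrow> 'v" where
  "Lm a w m = (\<Sum>l<m + r. act (cf m (a * bs l)) (w l))"

lemma co_map_left:
  assumes a: "a \<in> A" and x: "T.valid x"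
  shows "T.valid (fs_map_left ((*) a) x)" "co (fs_map_left ((*) a) x) = Lm a (co x)"
proof -
  show "T.valid (fs_map_left ((*) a) x)"
    using x a subring_of_mult[OF A_subring] by (auto simp: valid_iff fs_map_left_def)
  show "co (fs_map_left ((*) a) x) = Lm a (co x)"
  proof
    fix m
    have abs: "cf m (a * bs l) \<in> F" for l using subring_of_mult[OF A_subring a bs_A] by (rule cf_F)
    show "co (fs_map_left ((*) a) x) m = Lm a (co x) m"
      using x
    proof (induction x)
      case empty
      then show ?case by (simp add: fs_map_left_def Lm_def abs)
    next
      case (add p x)
      obtain b v where p: "p = (b, v)" by (metis surj_pair)
      have b: "b \<in> A" using add.prems p by simp
      have "act (cf m (a * b)) v = (\<Sum>l<m + r. act (cf m (a * bs l)) (act (cf l b) v))"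
        unfolding cf_mult_expansion[OF a b]
        by (subst act_sum_scalar) (auto simp: abs cf_F[OF b] act_mult subring_of_mult[OF Fr])
      moreover have "co (fs_map_left ((*) a) x) m = Lm a (co x) m" using add by simp
      ultimately show ?case using abs by (simp add: fs_map_left_def p Lm_def act_add sum.distrib)
    qed
  qed
qed

lemma Lm_diff: assumes "a \<in> A" shows "Lm a w m - Lm a w' m = Lm a (\<lambda>l. w l - w' l) m"
proof -
  have abs: "cf m (a * bs l) \<in> F" for l using subring_of_mult[OF A_subring assms bs_A] by (rule cf_F)
  have ad: "act c (x - y) = act c x - act c y" if "c \<in> F" for c x y using act_add[OF that, of "x - y" y] by simp
  show ?thesis unfolding Lm_def by (simp add: sum_subtractf[symmetric] ad[OF abs])
qed

lemma Lm_le: assumes "a \<in> A" "B \<ge> 0" "\<And>l. nm (w l) \<le> B" shows "nm (Lm a w m) \<le> B"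
proof -
  have abs: "cf m (a * bs l) \<in> F" for l using subring_of_mult[OF A_subring assms(1) bs_A] by (rule cf_F)
  show ?thesis unfolding Lm_def by (rule Un.sum_le[OF assms(2)]) (use nm_act[OF abs] assms(3) order_trans in blast)
qed

text \<open>Late \<open>w l\<close> are small and constants do not enlarge them; the finitely many
  early ones meet products \<open>a * bs l\<close> with only finitely many nonzero
  coordinates.\<close>

lemma Lm_c0: assumes a: "a \<in> A" and w: "w \<in> c0" shows "Lm a w \<in> c0"
  unfolding c0_iff
proof (intro allI impI)
  fix \<epsilon> :: real assume e: "\<epsilon> > 0"
  have aA: "a * bs l \<in> A" for l using subring_of_mult[OF A_subring a bs_A] .
  obtain L where L: "\<And>m. m \<ge> L \<Longrightarrow> nm (w m) < \<epsilon> / 2" using w e unfolding c0_iff by (meson half_gt_zero)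
  have "\<forall>l. \<exists>M. \<forall>m\<ge>M. cf m (a * bs l) = 0" using cf_support[OF aA] by blast
  then obtain M where M: "\<And>l m. m \<ge> M l \<Longrightarrow> cf m (a * bs l) = 0" by metis
  define M' where "M' = (\<Sum>l<L. M l)"
  have "nm (Lm a w m) < \<epsilon>" if m: "m \<ge> M'" for m
  proof -
    have "nm (Lm a w m) \<le> \<epsilon> / 2" unfolding Lm_def
    proof (rule Un.sum_le)
      fix l
      show "nm (act (cf m (a * bs l)) (w l)) \<le> \<epsilon> / 2"
      proof (cases "l < L")
        case True
        have "M l \<le> M'" unfolding M'_def by (rule member_le_sum) (use True in auto)
        then show ?thesis using M[of l m] m e by simp
      next
        case False
        then show ?thesis using nm_act[OF cf_F[OF aA], of m l "w l"] L[of l] by linarith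
      qed
    qed (use e in auto)
    then show ?thesis using e by simp
  qed
  then show "\<exists>L. \<forall>m\<ge>L. nm (Lm a w m) < \<epsilon>" by blast
qed

lemma ct_left_Psi:
  assumes a: "a \<in> A" and w: "w \<in> c0"
  shows "ct_map C act nm (fs_map_left ((*) a)) (Psi w) = Psi (Lm a w)"
proof (rule ct_map_Psi[OF _ w])
  show "T.valid (fs_map_left ((*) a) x) \<and> co (fs_map_left ((*) a) x) = Lm a (co x)" if "T.valid x" for x
    using co_map_left[OF a that] by blast
  fix \<epsilon> :: real assume e: "\<epsilon> > 0"
  then show "\<exists>\<delta>>0. \<forall>w'\<in>c0. close \<delta> w' w \<longrightarrow> close \<epsilon> (Lm a w') (Lm a w)"
    using Lm_le[OF a, of \<epsilon>] by (intro exI[of _ \<epsilon>]) (auto simp: close_def Lm_diff[OF a])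
qed

lemma ct_right_Psi:
  assumes add: "\<And>x y. g (x + y) = g x + g y" and lin: "\<And>c x. c \<in> F \<Longrightarrow> g (act c x) = act c (g x)"
    and cont: "\<And>\<epsilon>. \<epsilon> > 0 \<Longrightarrow> \<exists>\<delta>>0. \<forall>x. nm x \<le> \<delta> \<longrightarrow> nm (g x) \<le> \<epsilon>" and w: "w \<in> c0"
  shows "ct_map C act nm (fs_map_right g) (Psi w) = Psi (\<lambda>m. g (w m))"
proof (rule ct_map_Psi[where G = "\<lambda>w m. g (w m)", OF _ w])
  have g0: "g 0 = 0" using add[of 0 0] by simp
  have gd: "g (x - y) = g x - g y" for x y using add[of "x - y" y] by simp
  show "T.valid (fs_map_right g x) \<and> co (fs_map_right g x) = (\<lambda>m. g (co x m))" if "T.valid x" for x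
    using that by (induction x) (auto simp: fs_map_right_def g0 add lin cf_F)
  fix \<epsilon> :: real assume "\<epsilon> > 0"
  then obtain \<delta> where "\<delta> > 0" "\<forall>x. nm x \<le> \<delta> \<longrightarrow> nm (g x) \<le> \<epsilon>" using cont by blast
  then show "\<exists>\<delta>>0. \<forall>w'\<in>c0. close \<delta> w' w \<longrightarrow> close \<epsilon> (\<lambda>m. g (w' m)) (\<lambda>m. g (w m))"
    by (intro exI[of _ \<delta>]) (auto simp: close_def gd[symmetric])
qed

lemma right_c0:
  assumes cont: "\<And>\<epsilon>. \<epsilon> > 0 \<Longrightarrow> \<exists>\<delta>>0. \<forall>x. nm x \<le> \<delta> \<longrightarrow> nm (g x) \<le> \<epsilon>" and w: "w \<in> c0"
  shows "(\<lambda>m. g (w m)) \<in> c0"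
  unfolding c0_iff
proof (intro allI impI)
  fix \<epsilon> :: real assume e: "\<epsilon> > 0"
  then obtain \<delta> where de: "\<delta> > 0" "\<forall>x. nm x \<le> \<delta> \<longrightarrow> nm (g x) \<le> \<epsilon> / 2" using cont[of "\<epsilon> / 2"] by auto
  then obtain L where "\<forall>m\<ge>L. nm (w m) < \<delta>" using w unfolding c0_iff by blast
  then have "nm (g (w m)) \<le> \<epsilon> / 2" if "m \<ge> L" for m using de that by (simp add: less_imp_le)
  moreover have "\<epsilon> / 2 < \<epsilon>" using e by simp
  ultimately show "\<exists>L. \<forall>m\<ge>L. nm (g (w m)) < \<epsilon>" by (meson le_less_trans)
qed

lemma ct_add_Psi: "w \<in> c0 \<Longrightarrow> w' \<in> c0 \<Longrightarrow> ct_map2 C act nm (+) (Psi w) (Psi w') = Psi (\<lambda>m. w m + w' m)"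
proof (rule ct_map2_binary)
  fix \<epsilon> :: real and w1 w2 w1' w2'
  assume "close \<epsilon> w1 w1'" "close \<epsilon> w2 w2'"
  then show "close \<epsilon> (\<lambda>m. w1 m + w2 m) (\<lambda>m. w1' m + w2' m)"
    unfolding close_def using Un.add_le[of "w1 m - w1' m" \<epsilon> "w2 m - w2' m" for m] by (simp add: algebra_simps)
qed auto

lemma ct_diff_Psi: "w \<in> c0 \<Longrightarrow> w' \<in> c0 \<Longrightarrow> ct_map2 C act nm fs_diff (Psi w) (Psi w') = Psi (\<lambda>m. w m - w' m)"
proof (rule ct_map2_binary)
  fix \<epsilon> :: real and w1 w2 w1' w2'
  assume "close \<epsilon> w1 w1'" "close \<epsilon> w2 w2'"
  then show "close \<epsilon> (\<lambda>m. w1 m - w2 m) (\<lambda>m. w1' m - w2' m)"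
    unfolding close_def using Un.diff_le[of "w1 m - w1' m" \<epsilon> "w2 m - w2' m" for m] by (simp add: algebra_simps)
qed (auto simp: fs_diff_props)

lemma add_c0: "w \<in> c0 \<Longrightarrow> w' \<in> c0 \<Longrightarrow> (\<lambda>m. w m + w' m) \<in> c0"
  unfolding c0_iff
proof (intro allI impI)
  fix \<epsilon> :: real assume w: "\<forall>\<epsilon>>0. \<exists>L. \<forall>m\<ge>L. nm (w m) < \<epsilon>" "\<forall>\<epsilon>>0. \<exists>L. \<forall>m\<ge>L. nm (w' m) < \<epsilon>" "\<epsilon> > 0"
  then obtain L L' where "\<forall>m\<ge>L. nm (w m) < \<epsilon>" "\<forall>m\<ge>L'. nm (w' m) < \<epsilon>" by meson
  then show "\<exists>L. \<forall>m\<ge>L. nm (w m + w' m) < \<epsilon>"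
    by (intro exI[of _ "max L L'"]) (use Un.ultra in \<open>fastforce intro: le_less_trans\<close>)
qed

lemma diff_c0: assumes "w \<in> c0" "w' \<in> c0" shows "(\<lambda>m. w m - w' m) \<in> c0"
proof -
  have "(\<lambda>m. - w' m) \<in> c0" using assms(2) unfolding c0_iff by (simp add: Un.minus)
  from add_c0[OF assms(1) this] show ?thesis by simp
qed

lemma Lm_u: "Lm u w m = (if m < r then 0 else w (m - r))"
proof -
  have "Lm u w m = (\<Sum>l<m + r. act (if m = l + r then 1 else 0) (w l))"
    by (simp add: Lm_def bs_u cf_bs)
  also have "\<dots> = (\<Sum>l<m + r. if l + r = m then w l else 0)"
    by (rule sum.cong) (auto simp: act_1)
  also have "\<dots> = (if m < r then 0 else w (m - r))"
  proof (cases "m < r")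
    case False
    have "(\<Sum>l<m + r. if l + r = m then w l else 0) = (\<Sum>l<m + r. if l = m - r then w l else 0)"
      by (rule sum.cong) (use False in auto)
    moreover have "m - r < m + r" using False r_pos by linarith
    ultimately show ?thesis using False by simp
  qed (auto intro!: sum.neutral)
  finally show ?thesis .
qed

lemma Lm_u_commute: assumes a: "a \<in> A" shows "Lm a (Lm u w) = Lm u (Lm a w)"
proof
  fix m
  have aA: "a * bs l \<in> A" for l using subring_of_mult[OF A_subring a bs_A] .
  have F: "cf m (a * bs l) \<in> F" for l by (rule cf_F[OF aA])
  have "Lm a (Lm u w) m = (\<Sum>l<m + r. act (cf m (a * bs l)) (if l < r then 0 else w (l - r)))"
    by (simp only: Lm_def[of a] Lm_u)
  also have "\<dots> = (\<Sum>l\<in>{r..<m + r}. act (cf m (a * bs l)) (w (l - r)))"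
    by (rule sum.mono_neutral_cong_right) (auto simp: F)
  also have "\<dots> = (\<Sum>l<m. act (cf m (a * bs (l + r))) (w l))"
    using sum.shift_bounds_nat_ivl[of "\<lambda>l. act (cf m (a * bs l)) (w (l - r))" 0 r m] by (simp add: lessThan_atLeast0)
  also have "\<dots> = (\<Sum>l<m. act (cf m (u * (a * bs l))) (w l))" by (simp add: bs_u[symmetric] mult.left_commute)
  also have "\<dots> = (\<Sum>l<m. act (if m < r then 0 else cf (m - r) (a * bs l)) (w l))" by (simp add: cf_u[OF aA])
  also have "\<dots> = Lm u (Lm a w) m"
  proof (cases "m < r")
    case False
    then have "m - r + r = m" by simp
    then show ?thesis unfolding Lm_u using False by (simp add: Lm_def)
  qed (simp add: Lm_u)
  finally show "Lm a (Lm u w) m = Lm u (Lm a w) m" .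
qed

lemma Lm_right_commute:
  assumes a: "a \<in> A" and add: "\<And>x y. g (x + y) = g x + g y" and lin: "\<And>c x. c \<in> F \<Longrightarrow> g (act c x) = act c (g x)"
  shows "Lm a (\<lambda>m. g (w m)) = (\<lambda>m. g (Lm a w m))"
proof
  fix m
  have F: "cf m (a * bs l) \<in> F" for l using subring_of_mult[OF A_subring a bs_A] by (rule cf_F)
  have g0: "g 0 = 0" using add[of 0 0] by simp
  have "g (\<Sum>i\<in>I. f i) = (\<Sum>i\<in>I. g (f i))" for I and f :: "nat \<Rightarrow> 'v"
    by (induction I rule: infinite_finite_induct) (auto simp: g0 add)
  then show "Lm a (\<lambda>m. g (w m)) m = g (Lm a w m)" by (simp add: Lm_def lin[OF F])
qed

end

section \<open>Operators on \<open>Lie\<^sub>E(T)\<close> and \<open>E(T)\<close> in coordinates\<close>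

locale anderson_basis = anderson_ctx E u + curve_basis E u r ba bc
  for E :: "('c::field, 'd::finite) anderson_data" and u :: 'c and r :: nat and ba bc :: "nat \<Rightarrow> 'c"
begin

sublocale V: ct_model E u r ba bc vn "(*s)"
  by standard (auto simp: vector_add_ldistrib vector_sadd_rdistrib vector_smult_assoc vn_scale F_N_le vn_nonneg
      intro!: mult_left_le_one_le N_nonneg)

sublocale T: ct_model E u r ba bc N "(*)"
  by standard (auto simp: distrib_left distrib_right mult.assoc N_mult F_N_le N_nonneg intro!: mult_left_le_one_le)

lemma LieT_eq: "LieT E = V.Psi ` V.c0" by (simp add: LieT_def V.ctensor_eq)

lemma ET_eq: "ET E = V.Psi ` V.c0" by (simp add: ET_def V.ctensor_eq)

lemma tate_eq: "tate_ring E = T.Psi ` T.c0" by (simp add: tate_ring_def T.ctensor_eq)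

lemma ct_left_eq: "a \<in> A \<Longrightarrow> w \<in> V.c0 \<Longrightarrow> ct_left E a (V.Psi w) = V.Psi (V.Lm a w)"
  unfolding ct_left_def by (rule V.ct_left_Psi)

lemma lie_cont: assumes "\<epsilon> > 0" shows "\<exists>\<delta>>0. \<forall>x. vn x \<le> \<delta> \<longrightarrow> vn (lie a x) \<le> \<epsilon>"
proof (intro exI[of _ "\<epsilon> / (mn (phi E a 0) + 1)"] conjI allI impI)
  have m: "mn (phi E a 0) + 1 > 0" using mn_nonneg[of "phi E a 0"] by simp
  then show "\<epsilon> / (mn (phi E a 0) + 1) > 0" using assms by simp
  fix x assume "vn x \<le> \<epsilon> / (mn (phi E a 0) + 1)"
  then have "(mn (phi E a 0) + 1) * vn x \<le> \<epsilon>" using m by (simp add: field_simps)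
  moreover have "mn (phi E a 0) * vn x \<le> (mn (phi E a 0) + 1) * vn x" using vn_nonneg[of x] by (intro mult_right_mono) auto
  ultimately show "vn (lie a x) \<le> \<epsilon>" using lie_bound[of a x] by linarith
qed

lemma ph_cont: assumes "a \<in> A" "\<epsilon> > 0" shows "\<exists>\<delta>>0. \<forall>x. vn x \<le> \<delta> \<longrightarrow> vn (ph a x) \<le> \<epsilon>"
proof -
  obtain B where B: "B \<ge> 1" "\<And>x. vn x \<le> 1 \<Longrightarrow> vn (ph a x) \<le> B * vn x" using ph_bound[OF assms(1)] by blast
  show ?thesis
  proof (intro exI[of _ "min 1 (\<epsilon> / B)"] conjI allI impI)
    fix x assume x: "vn x \<le> min 1 (\<epsilon> / B)"
    then have "B * vn x \<le> \<epsilon>" using B by (simp add: field_simps)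
    then show "vn (ph a x) \<le> \<epsilon>" using B(2)[of x] x by linarith
  qed (use B assms in auto)
qed

lemma ex_cont: assumes "\<epsilon> > 0" shows "\<exists>\<delta>>0. \<forall>x. vn x \<le> \<delta> \<longrightarrow> vn (ex x) \<le> \<epsilon>"
proof -
  obtain \<rho> where "\<rho> > 0" "\<forall>x. vn x \<le> \<rho> \<longrightarrow> vn (ex x) = vn x" using exp_local by blast
  then show ?thesis using assms by (intro exI[of _ "min \<rho> \<epsilon>"]) auto
qed

lemma lieT_right_eq: "w \<in> V.c0 \<Longrightarrow> lieT_right E a (V.Psi w) = V.Psi (\<lambda>m. lie a (w m))"
  unfolding lieT_right_def by (rule V.ct_right_Psi) (auto simp: lie_add lie_scale lie_cont)

lemma ET_right_eq: "a \<in> A \<Longrightarrow> w \<in> V.c0 \<Longrightarrow> ET_right E a (V.Psi w) = V.Psi (\<lambda>m. ph a (w m))"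
  unfolding ET_right_def by (rule V.ct_right_Psi) (auto simp: ph_add ph_scale_F ph_cont)

lemma id_exp_eq: "w \<in> V.c0 \<Longrightarrow> id_exp E (V.Psi w) = V.Psi (\<lambda>m. ex (w m))"
  unfolding id_exp_def by (rule V.ct_right_Psi) (auto simp: ex_add ex_scale_F ex_cont)

lemma ct_add_eq: "w \<in> V.c0 \<Longrightarrow> w' \<in> V.c0 \<Longrightarrow> ct_add E (V.Psi w) (V.Psi w') = V.Psi (\<lambda>m. w m + w' m)"
  unfolding ct_add_def by (rule V.ct_add_Psi)

lemma lie_c0: "w \<in> V.c0 \<Longrightarrow> (\<lambda>m. lie a (w m)) \<in> V.c0" by (rule V.right_c0[OF lie_cont])

lemma ex_c0: "w \<in> V.c0 \<Longrightarrow> (\<lambda>m. ex (w m)) \<in> V.c0" by (rule V.right_c0[OF ex_cont])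

section \<open>Inverting \<open>1 \<otimes> \<partial>u - u \<otimes> 1\<close> on null
  sequences\<close>

definition th :: "(nat \<Rightarrow> 'c ^ 'd) \<Rightarrow> nat \<Rightarrow> 'c ^ 'd" where "th w m = lie u (w m) - V.Lm u w m"

lemma th_c0: "w \<in> V.c0 \<Longrightarrow> th w \<in> V.c0"
  unfolding th_def[abs_def] by (intro V.diff_c0 lie_c0 V.Lm_c0 uA)

lemma theta_eq: assumes "w \<in> V.c0" shows "theta E u (V.Psi w) = V.Psi (th w)"
  unfolding theta_def ct_diff_def th_def[abs_def]
  using assms by (simp add: lieT_right_eq ct_left_eq uA V.ct_diff_Psi lie_c0 V.Lm_c0)

definition e0 :: nat where "e0 = (SOME e. e > 0 \<and> (\<forall>x. lie (u ^ e) x = u ^ e *s x))"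

lemma e0: "e0 > 0" "lie (u ^ e0) x = u ^ e0 *s x"
  using someI_ex[OF lie_power_scalar[OF uA]] unfolding e0_def by auto

text \<open>The inverse of \<open>\<partial>u\<close>, obtained from the scalar power:
  \<open>\<partial>u\<close> composed with \<open>\<partial>(u^(e0 - 1))\<close> is the scalar
  \<open>u^e0\<close>.\<close>

definition J :: "'c ^ 'd \<Rightarrow> 'c ^ 'd" where "J x = inverse (u ^ e0) *s lie (u ^ (e0 - 1)) x"

lemma u_nonzero: "u \<noteq> 0" using u_large by auto

lemma upow_A: "u ^ n \<in> A" by (rule subring_of_power[OF A_subring uA])

lemma u_pow_e0: "lie u (lie (u ^ (e0 - 1)) x) = u ^ e0 *s x" "lie (u ^ (e0 - 1)) (lie u x) = u ^ e0 *s x"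
proof -
  have "u * u ^ (e0 - 1) = u ^ e0" "u ^ (e0 - 1) * u = u ^ e0" using e0(1) by (auto simp: power_eq_if mult.commute)
  then show "lie u (lie (u ^ (e0 - 1)) x) = u ^ e0 *s x" "lie (u ^ (e0 - 1)) (lie u x) = u ^ e0 *s x"
    using lie_mult[OF uA upow_A, of "e0 - 1" x] lie_mult[OF upow_A uA, of "e0 - 1" x] e0(2)[of x] by simp_all
qed

lemma J_inv: "lie u (J x) = x" "J (lie u x) = x"
  using u_nonzero by (simp_all add: J_def lie_scale u_pow_e0[unfolded One_nat_def] vector_smult_assoc)

lemma J_add: "J (x + y) = J x + J y" by (simp add: J_def lie_add vector_add_ldistrib)

lemma J_0 [simp]: "J 0 = 0" by (simp add: J_def)

lemma J_sum: "J (\<Sum>i\<in>I. f i) = (\<Sum>i\<in>I. J (f i))"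
  by (induction I rule: infinite_finite_induct) (auto simp: J_add)

lemma J_scale: "J (c *s x) = c *s J x" by (simp add: J_def lie_scale vector_smult_assoc mult.commute)

lemma Jn_scale: "(J ^^ n) (c *s x) = c *s (J ^^ n) x" by (induction n) (auto simp: J_scale)

lemma J_e0: "(J ^^ e0) x = inverse (u ^ e0) *s x"
proof -
  have "lie (u ^ n) ((J ^^ n) x) = x" for n
  proof (induction n)
    case (Suc n)
    have "lie (u ^ Suc n) ((J ^^ Suc n) x) = lie (u ^ n) (lie u (J ((J ^^ n) x)))"
      using lie_mult[OF upow_A uA, of n] by (simp add: mult.commute)
    then show ?case using Suc by (simp add: J_inv)
  qed (simp add: lie_const subring_of_1[OF Fr])
  then have "u ^ e0 *s (J ^^ e0) x = x" using e0(2) by metis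
  then have "inverse (u ^ e0) *s (u ^ e0 *s (J ^^ e0) x) = inverse (u ^ e0) *s x" by simp
  then show ?thesis using u_nonzero by (simp add: vector_smult_assoc)
qed

text \<open>\<open>J^e0\<close> is the scalar \<open>u^(-e0)\<close> of absolute value below 1, so
  powers of \<open>J\<close> decay along multiples of \<open>e0\<close>; the remaining fewer than
  \<open>e0\<close> factors cost the constant \<open>M\<close>.\<close>

lemma J_decay: "\<exists>b M. M \<ge> 1 \<and> b \<longlonglongrightarrow> 0 \<and> (\<forall>n. 0 \<le> b n \<and> b n \<le> M) \<and> (\<forall>n x. vn ((J ^^ n) x) \<le> b n * vn x)"
proof -
  define c where "c = max 1 (N (inverse (u ^ e0)) * mn (phi E (u ^ (e0 - 1)) 0))"
  have Jc: "vn (J x) \<le> c * vn x" for x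
  proof -
    have "vn (J x) \<le> N (inverse (u ^ e0)) * (mn (phi E (u ^ (e0 - 1)) 0) * vn x)"
      unfolding J_def vn_scale by (intro mult_left_mono lie_bound N_nonneg)
    also have "\<dots> \<le> c * vn x" unfolding mult.assoc[symmetric] by (intro mult_right_mono vn_nonneg) (simp add: c_def)
    finally show ?thesis .
  qed
  have c1: "c \<ge> 1" by (simp add: c_def)
  have Jn: "vn ((J ^^ n) x) \<le> c ^ n * vn x" for n x
  proof (induction n)
    case (Suc n)
    have "vn ((J ^^ Suc n) x) \<le> c * vn ((J ^^ n) x)" using Jc by simp
    also have "\<dots> \<le> c * (c ^ n * vn x)" using Suc c1 by (intro mult_left_mono) auto
    finally show ?case by (simp add: mult.assoc)
  qed simp
  define s where "s = N (inverse (u ^ e0))"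
  have s: "0 \<le> s" "s < 1"
    using u_large e0(1) one_less_power[of "N u" e0] by (auto simp: s_def N_inverse N_power inverse_less_1_iff)
  define M where "M = c ^ e0"
  have M1: "M \<ge> 1" using c1 by (simp add: M_def)
  define b where "b n = s ^ (n div e0) * M" for n
  have Jk: "(J ^^ (k * e0)) x = inverse (u ^ e0) ^ k *s x" for k x
    by (induction k arbitrary: x) (auto simp: funpow_add J_e0 Jn_scale vector_smult_assoc mult.commute)
  have "vn ((J ^^ n) x) \<le> b n * vn x" for n x
  proof -
    have "(J ^^ n) x = (J ^^ (n div e0 * e0)) ((J ^^ (n mod e0)) x)"
      by (metis comp_apply div_mult_mod_eq funpow_add)
    then have "vn ((J ^^ n) x) = s ^ (n div e0) * vn ((J ^^ (n mod e0)) x)" by (simp add: Jk vn_scale N_power s_def)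
    also have "\<dots> \<le> s ^ (n div e0) * (M * vn x)"
    proof (rule mult_left_mono)
      have "c ^ (n mod e0) \<le> M" unfolding M_def using c1 e0(1) by (intro power_increasing) (auto simp: less_imp_le)
      then show "vn ((J ^^ (n mod e0)) x) \<le> M * vn x" using Jn[of "n mod e0" x] vn_nonneg[of x] by (meson mult_right_mono order_trans)
    qed (use s in auto)
    finally show ?thesis by (simp add: b_def mult.assoc)
  qed
  moreover have "0 \<le> b n \<and> b n \<le> M" for n
    using s M1 power_le_one[of s "n div e0"] by (auto simp: b_def intro!: mult_left_le_one_le)
  moreover have "b \<longlonglongrightarrow> 0"
  proof -
    have "filterlim (\<lambda>n. n div e0) at_top sequentially"
    proof (rule filterlim_at_top[THEN iffD2], intro allI)
      fix Z
      show "\<forall>\<^sub>F n in sequentially. Z \<le> n div e0" unfolding eventually_sequentially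
        using e0(1) by (intro exI[of _ "Z * e0"]) (auto simp: less_eq_div_iff_mult_less_eq)
    qed
    then have "(\<lambda>n. s ^ (n div e0)) \<longlonglongrightarrow> 0" using LIMSEQ_realpow_zero[OF s] by (rule filterlim_compose[rotated])
    from tendsto_mult[OF this tendsto_const[of M]] show ?thesis unfolding b_def by simp
  qed
  ultimately show ?thesis using M1 by blast
qed

text \<open>The geometric series \<open>J + J^2 shift + J^3 shift^2 + ...\<close> for the inverse of
  \<open>\<partial>u - shift\<close>. The \<open>k\<close>-th power of the shift moves the index by
  \<open>k r\<close>, so at index \<open>m\<close> only \<open>k \<le> m div r\<close>
  contribute.\<close>

definition Sv :: "(nat \<Rightarrow> 'c ^ 'd) \<Rightarrow> nat \<Rightarrow> 'c ^ 'd" where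
  "Sv w m = (\<Sum>k\<le>m div r. (J ^^ Suc k) (w (m - k * r)))"

lemma Sv_rec: "Sv w m = J (w m + V.Lm u (Sv w) m)"
proof (cases "m < r")
  case True
  then show ?thesis by (simp add: Sv_def V.Lm_u)
next
  case False
  then obtain j where j: "m div r = Suc j" "(m - r) div r = j"
    using r_pos by (metis div_greater_zero_iff gr0_implies_Suc le_div_geq diff_Suc_1 not_less)
  have "Sv w m = J (w m) + (\<Sum>k\<le>j. (J ^^ Suc (Suc k)) (w (m - Suc k * r)))"
    unfolding Sv_def j(1) by (subst sum.atMost_Suc_shift) simp
  also have "(\<Sum>k\<le>j. (J ^^ Suc (Suc k)) (w (m - Suc k * r))) = J (Sv w (m - r))"
    unfolding Sv_def j(2) J_sum by (rule sum.cong) auto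
  finally show ?thesis using False by (simp add: V.Lm_u J_add)
qed

text \<open>Each term has a late argument, which is small, or a high power of \<open>J\<close>,
  which decays; in the ultrametric norm the terms do not add up.\<close>

lemma Sv_c0: assumes w: "w \<in> V.c0" shows "Sv w \<in> V.c0"
  unfolding V.c0_iff
proof (intro allI impI)
  fix \<epsilon> :: real assume e: "\<epsilon> > 0"
  obtain b M where b: "M \<ge> 1" "b \<longlonglongrightarrow> 0" "\<And>n. 0 \<le> b n" "\<And>n. b n \<le> M" "\<And>n x. vn ((J ^^ n) x) \<le> b n * vn x"
    using J_decay by blast
  obtain W where W: "W \<ge> 0" "\<And>m. vn (w m) \<le> W" using V.c0_bounded[OF w] by blast
  have "\<epsilon> / (2 * M) > 0" using e b(1) by simp
  then obtain L where L: "\<And>m. m \<ge> L \<Longrightarrow> vn (w m) < \<epsilon> / (2 * M)" using w unfolding V.c0_iff by blast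
  have "(\<lambda>n. b n * W) \<longlonglongrightarrow> 0" using tendsto_mult[OF b(2) tendsto_const[of W]] by simp
  then have "\<forall>\<^sub>F n in sequentially. b n * W < \<epsilon> / 2" by (rule order_tendstoD) (use e in auto)
  then obtain n1 where n1: "\<And>n. n \<ge> n1 \<Longrightarrow> b n * W < \<epsilon> / 2" by (auto simp: eventually_sequentially)
  have "vn (Sv w m) < \<epsilon>" if m: "m \<ge> L + n1 * r" for m
  proof -
    have "vn (Sv w m) \<le> \<epsilon> / 2" unfolding Sv_def
    proof (rule Vn.sum_le)
      fix k
      have bk: "vn ((J ^^ Suc k) (w (m - k * r))) \<le> b (Suc k) * vn (w (m - k * r))" by (rule b(5))
      show "vn ((J ^^ Suc k) (w (m - k * r))) \<le> \<epsilon> / 2"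
      proof (cases "m - k * r \<ge> L")
        case True
        have "b (Suc k) * vn (w (m - k * r)) \<le> M * (\<epsilon> / (2 * M))"
          using L[OF True] b(1) b(4)[of "Suc k"] vn_nonneg by (intro mult_mono) auto
        then show ?thesis using bk b(1) by simp
      next
        case False
        then have "n1 * r \<le> k * r" using m by linarith
        then have "n1 \<le> Suc k" using r_pos by simp
        moreover have "b (Suc k) * vn (w (m - k * r)) \<le> b (Suc k) * W" by (intro mult_left_mono W b)
        ultimately show ?thesis using bk n1[of "Suc k"] by linarith
      qed
    qed (use e in auto)
    then show ?thesis using e by simp
  qed
  then show "\<exists>L. \<forall>m\<ge>L. vn (Sv w m) < \<epsilon>" by blast
qed

lemma th_Sv: "th (Sv w) = w"
proof
  fix m
  have "lie u (Sv w m) = w m + V.Lm u (Sv w) m" by (subst Sv_rec) (rule J_inv)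
  then show "th (Sv w) m = w m" by (simp add: th_def)
qed

text \<open>The equation is triangular: \<open>\<partial>u (w m)\<close> is determined by the image
  and by \<open>w (m - r)\<close>. So injectivity holds for arbitrary sequences, and
  \<open>Sv\<close> inherits every compatibility of \<open>th\<close> by uniqueness.\<close>

lemma th_inj: assumes "th w = th w'" shows "w = w'"
proof
  fix m
  show "w m = w' m"
  proof (induction m rule: less_induct)
    case (less m)
    have "V.Lm u w m = V.Lm u w' m" using less r_pos by (simp add: V.Lm_u)
    then have "lie u (w m) = lie u (w' m)" using fun_cong[OF assms, of m] by (simp add: th_def)
    then show ?case using J_inv(2) by metis
  qed
qed

lemma Sv_th: "Sv (th w) = w" by (rule th_inj) (rule th_Sv)

lemma Sv_eqI: "th y = w \<Longrightarrow> Sv w = y" using Sv_th by blast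

lemma Lm_add: "a \<in> A \<Longrightarrow> V.Lm a (\<lambda>m. w m + w' m) m = V.Lm a w m + V.Lm a w' m"
  by (simp add: V.Lm_def vector_add_ldistrib sum.distrib)

lemma th_add: "th (\<lambda>m. w m + w' m) = (\<lambda>m. th w m + th w' m)"
  by (rule HOL.ext) (simp add: th_def lie_add Lm_add uA)

lemma th_diff: "th (\<lambda>m. w m - w' m) = (\<lambda>m. th w m - th w' m)"
  by (rule HOL.ext) (simp add: th_def lie_diff V.Lm_diff[OF uA, symmetric])

lemma Sv_add: "Sv (\<lambda>m. w m + w' m) = (\<lambda>m. Sv w m + Sv w' m)"
  by (rule Sv_eqI) (simp add: th_add th_Sv)

lemma Sv_diff: "Sv (\<lambda>m. w m - w' m) = (\<lambda>m. Sv w m - Sv w' m)"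
  by (rule Sv_eqI) (simp add: th_diff th_Sv)

lemma Sv_0: "Sv (\<lambda>m. 0) = (\<lambda>m. 0)"
  by (rule Sv_eqI) (simp add: th_def[abs_def] V.Lm_u)

lemma th_Lm: assumes a: "a \<in> A" shows "th (V.Lm a w) = V.Lm a (th w)"
proof
  fix m
  have "V.Lm a (th w) m = V.Lm a (\<lambda>m. lie u (w m)) m - V.Lm a (V.Lm u w) m"
    unfolding th_def[abs_def] by (rule V.Lm_diff[OF a, symmetric])
  then show "th (V.Lm a w) m = V.Lm a (th w) m"
    by (simp add: V.Lm_right_commute[where g = "lie u", OF a lie_add lie_scale] V.Lm_u_commute[OF a] th_def)
qed

lemma Sv_Lm: "a \<in> A \<Longrightarrow> Sv (V.Lm a w) = V.Lm a (Sv w)"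
  by (rule Sv_eqI) (simp add: th_Lm th_Sv)

lemma th_lie: assumes "a \<in> A" shows "th (\<lambda>m. lie a (w m)) = (\<lambda>m. lie a (th w m))"
  by (rule HOL.ext) (simp add: th_def lie_diff lie_commute[OF assms uA] V.Lm_right_commute[where g = "lie a", OF uA lie_add lie_scale])

lemma Sv_lie: "a \<in> A \<Longrightarrow> Sv (\<lambda>m. lie a (w m)) = (\<lambda>m. lie a (Sv w m))"
  by (rule Sv_eqI) (simp add: th_lie th_Sv)

lemma theta_bij: "bij_betw (theta E u) (LieT E) (LieT E)"
proof (rule bij_betwI')
  fix X Y assume "X \<in> LieT E" "Y \<in> LieT E"
  then obtain w w' where w: "w \<in> V.c0" "X = V.Psi w" "w' \<in> V.c0" "Y = V.Psi w'" by (auto simp: LieT_eq)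
  show "(theta E u X = theta E u Y) = (X = Y)"
    using V.Psi_inj[OF th_c0[OF w(1)], of "th w'"] V.Psi_inj[OF w(1), of w'] th_inj[of w w'] w theta_eq by metis
next
  fix X assume "X \<in> LieT E"
  then show "theta E u X \<in> LieT E" by (auto simp: LieT_eq theta_eq th_c0)
next
  fix Y assume "Y \<in> LieT E"
  then obtain w where w: "w \<in> V.c0" "Y = V.Psi w" by (auto simp: LieT_eq)
  then have "Y = theta E u (V.Psi (Sv w))" by (simp add: theta_eq Sv_c0 th_Sv)
  then show "\<exists>X\<in>LieT E. Y = theta E u X" using w Sv_c0 by (auto simp: LieT_eq)
qed

lemma inv_theta: assumes "w \<in> V.c0" shows "inv_into (LieT E) (theta E u) (V.Psi w) = V.Psi (Sv w)"
proof -
  have "theta E u (V.Psi (Sv w)) = V.Psi w" using assms by (simp add: theta_eq Sv_c0 th_Sv)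
  moreover have "V.Psi (Sv w) \<in> LieT E" using assms Sv_c0 by (auto simp: LieT_eq)
  ultimately show ?thesis using bij_betw_imp_inj_on[OF theta_bij] inv_into_f_eq by fastforce
qed

text \<open>Scalar multiplication by the Tate ring, in terms of the structure constants of the basis
  \<open>bs\<close>. Indices from \<open>m + r\<close> on contribute nothing to coordinate
  \<open>m\<close>, so finite sums suffice.\<close>

definition Mul :: "(nat \<Rightarrow> 'c) \<Rightarrow> (nat \<Rightarrow> 'c ^ 'd) \<Rightarrow> nat \<Rightarrow> 'c ^ 'd" where
  "Mul t w m = (\<Sum>i<m + r. \<Sum>j<m + r. (cf m (bs i * bs j) * t i) *s w j)"

lemma bsbs_A: "bs i * bs j \<in> A" using subring_of_mult[OF A_subring bs_A bs_A] .

lemma Mul_term_le: "vn ((cf m (bs i * bs j) * c) *s v) \<le> N c * vn v"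
proof -
  have "N (cf m (bs i * bs j)) * (N c * vn v) \<le> N c * vn v"
    using F_N_le[OF cf_F[OF bsbs_A]] N_nonneg vn_nonneg by (intro mult_left_le_one_le mult_nonneg_nonneg) auto
  then show ?thesis by (simp add: vn_scale N_mult mult.assoc)
qed

lemma Mul_c0: assumes t: "t \<in> T.c0" and w: "w \<in> V.c0" shows "Mul t w \<in> V.c0"
  unfolding V.c0_iff
proof (intro allI impI)
  fix \<epsilon> :: real assume e: "\<epsilon> > 0"
  obtain W1 W2 where W: "W1 \<ge> 0" "\<And>m. N (t m) \<le> W1" "W2 \<ge> 0" "\<And>m. vn (w m) \<le> W2"
    using T.c0_bounded[OF t] V.c0_bounded[OF w] by metis
  \<comment> \<open>With the bound \<open>\<epsilon> / D\<close> on the late entries of both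
    factors, a product involving a late index is at most \<open>\<epsilon> / 2\<close>, whichever
    factor it comes from.\<close>
  define D where "D = 2 * (W1 + W2 + 1)"
  have D: "D > 0" "W1 * (\<epsilon> / D) \<le> \<epsilon> / 2" "(\<epsilon> / D) * W2 \<le> \<epsilon> / 2" using W e by (auto simp: D_def field_simps)
  then have "\<epsilon> / D > 0" using e by simp
  then obtain L1 L2 where "\<And>m. m \<ge> L1 \<Longrightarrow> N (t m) < \<epsilon> / D" "\<And>m. m \<ge> L2 \<Longrightarrow> vn (w m) < \<epsilon> / D"
    using t w unfolding V.c0_iff T.c0_iff by meson
  then obtain L where L: "\<And>m. m \<ge> L \<Longrightarrow> N (t m) \<le> \<epsilon> / D" "\<And>m. m \<ge> L \<Longrightarrow> vn (w m) \<le> \<epsilon> / D"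
    using max.boundedE less_imp_le by metis
  have "\<forall>i j. \<exists>M. \<forall>m\<ge>M. cf m (bs i * bs j) = 0" using cf_support[OF bsbs_A] by blast
  then obtain M where M: "\<And>i j m. m \<ge> M i j \<Longrightarrow> cf m (bs i * bs j) = 0" by metis
  define M' where "M' = (\<Sum>p\<in>{..<L} \<times> {..<L}. M (fst p) (snd p))"
  have "vn (Mul t w m) < \<epsilon>" if m: "m \<ge> M'" for m
  proof -
    have "vn (Mul t w m) \<le> \<epsilon> / 2" unfolding Mul_def
    proof (intro Vn.sum_le)
      fix i j
      show "vn ((cf m (bs i * bs j) * t i) *s w j) \<le> \<epsilon> / 2"
      proof (cases "i < L \<and> j < L")
        case True
        have "M (fst (i, j)) (snd (i, j)) \<le> M'" unfolding M'_def
          by (rule member_le_sum[where f = "\<lambda>p. M (fst p) (snd p)"]) (use True in auto)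
        then have "cf m (bs i * bs j) = 0" using m by (intro M) simp
        then show ?thesis using e by simp
      next
        case False
        have "N (t i) * vn (w j) \<le> \<epsilon> / 2"
        proof (cases "i < L")
          case True
          then have "N (t i) * vn (w j) \<le> W1 * (\<epsilon> / D)" using False W L e D by (intro mult_mono) (auto simp: vn_nonneg)
          then show ?thesis using D by linarith
        next
          case False
          then have "N (t i) * vn (w j) \<le> (\<epsilon> / D) * W2" using W L e D by (intro mult_mono) (auto simp: vn_nonneg)
          then show ?thesis using D by linarith
        qed
        then show ?thesis using Mul_term_le[of m i j "t i" "w j"] by linarith
      qed
    qed (use e in auto)
    then show ?thesis using e by simp
  qed
  then show "\<exists>L. \<forall>m\<ge>L. vn (Mul t w m) < \<epsilon>" by blast
qed

lemma Mul_diff_left: "Mul t w m - Mul t' w m = Mul (\<lambda>i. t i - t' i) w m"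
  unfolding Mul_def by (simp add: sum_subtractf[symmetric] right_diff_distrib vector_sub_rdistrib)

lemma Mul_diff_right: "Mul t w m - Mul t w' m = Mul t (\<lambda>i. w i - w' i) m"
  unfolding Mul_def by (simp add: sum_subtractf[symmetric] vector_ssub_ldistrib)

lemma Mul_le: assumes "\<And>i. N (t i) \<le> B1" "\<And>j. vn (w j) \<le> B2" "B1 \<ge> 0" "B2 \<ge> 0" shows "vn (Mul t w m) \<le> B1 * B2"
  unfolding Mul_def
proof (intro Vn.sum_le)
  fix i j
  have "N (t i) * vn (w j) \<le> B1 * B2" by (intro mult_mono assms vn_nonneg)
  then show "vn ((cf m (bs i * bs j) * t i) *s w j) \<le> B1 * B2" using Mul_term_le[of m i j "t i" "w j"] by linarith
qed (use assms in auto)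

lemma cf_mult_expansion2:
  assumes a: "a \<in> A" and b: "b \<in> A"
  shows "cf m (a * b) = (\<Sum>i<m + r. \<Sum>j<m + r. cf m (bs i * bs j) * (cf i a * cf j b))"
proof -
  have "cf m (a * b) = (\<Sum>j<m + r. cf m (a * bs j) * cf j b)" by (rule cf_mult_expansion[OF a b])
  also have "\<dots> = (\<Sum>j<m + r. (\<Sum>i<m + r. cf m (bs j * bs i) * cf i a) * cf j b)"
    using cf_mult_expansion[OF bs_A a] by (simp add: mult.commute)
  also have "\<dots> = (\<Sum>i<m + r. \<Sum>j<m + r. cf m (bs i * bs j) * (cf i a * cf j b))"
    unfolding sum_distrib_right by (subst sum.swap) (simp add: mult_ac)
  finally show ?thesis .
qed

lemma co_scale:
  assumes x: "T.T.valid x" and y: "V.T.valid y"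
  shows "V.T.valid (fs_scale (*s) x y)" "V.co (fs_scale (*s) x y) = Mul (T.co x) (V.co y)"
proof -
  have v1: "V.T.valid (image_mset (\<lambda>q. (a * fst q, c *s snd q)) y) \<and>
      V.co (image_mset (\<lambda>q. (a * fst q, c *s snd q)) y) m = Mul (\<lambda>i. cf i a * c) (V.co y) m" if a: "a \<in> A" for a c m
    using y
  proof (induction y)
    case empty
    then show ?case by (simp add: Mul_def)
  next
    case (add p y)
    obtain b v where p: "p = (b, v)" by (metis surj_pair)
    have b: "b \<in> A" using add.prems p by simp
    have "(cf m (a * b) * c) *s v = (\<Sum>i<m + r. \<Sum>j<m + r. (cf m (bs i * bs j) * (cf i a * c) * cf j b) *s v)"
      unfolding cf_mult_expansion2[OF a b] sum_distrib_right vec.scale_sum_left by (simp add: mult_ac)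
    then have "V.co (image_mset (\<lambda>q. (a * fst q, c *s snd q)) (add_mset p y)) m =
        (\<Sum>i<m + r. \<Sum>j<m + r. (cf m (bs i * bs j) * (cf i a * c) * cf j b) *s v) + Mul (\<lambda>i. cf i a * c) (V.co y) m"
      using add by (simp add: p vector_smult_assoc)
    also have "\<dots> = Mul (\<lambda>i. cf i a * c) (V.co (add_mset p y)) m"
      by (simp add: Mul_def p vector_add_ldistrib sum.distrib vector_smult_assoc)
    finally have "V.co (image_mset (\<lambda>q. (a * fst q, c *s snd q)) (add_mset p y)) m = Mul (\<lambda>i. cf i a * c) (V.co (add_mset p y)) m" .
    moreover have "V.T.valid (image_mset (\<lambda>q. (a * fst q, c *s snd q)) (add_mset p y))"
      using add p a b subring_of_mult[OF A_subring] by simp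
    ultimately show ?case by blast
  qed
  have "V.T.valid (fs_scale (*s) x y) \<and> V.co (fs_scale (*s) x y) m = Mul (T.co x) (V.co y) m" for m
    using x
  proof (induction x)
    case empty
    then show ?case by (simp add: Mul_def fs_scale_def)
  next
    case (add p x)
    obtain a c where p: "p = (a, c)" by (metis surj_pair)
    have a: "a \<in> A" using add.prems p by simp
    show ?case using add v1[OF a, of c m]
      by (simp add: fs_scale_def p Mul_def distrib_left vector_sadd_rdistrib sum.distrib)
  qed
  then show "V.T.valid (fs_scale (*s) x y)" "V.co (fs_scale (*s) x y) = Mul (T.co x) (V.co y)" by auto
qed

text \<open>Continuity of a bilinear map: the difference of two products is split by changing one
  factor at a time, while the approximating vectors stay bounded by \<open>D\<close>.\<close>

lemma lieT_scale_eq: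
  assumes t: "t \<in> T.c0" and w: "w \<in> V.c0"
  shows "lieT_scale E (T.Psi t) (V.Psi w) = V.Psi (Mul t w)"
  unfolding lieT_scale_def
proof (rule V.ct_map2_Psi[OF T.trunc_Psi[OF t] w])
  fix s s' assume "s \<in> T.Psi t" "s' \<in> V.Psi w"
  then have st: "\<And>n. s n \<in> T.S" "T.conv s t" "\<And>n. s' n \<in> V.S" "V.conv s' w" by (auto simp: T.Psi_def V.Psi_def)
  let ?q = "\<lambda>n. quot_map2 (ct_base E (*s)) (fs_scale (*s)) (s n) (s' n)"
  have q: "?q n \<in> V.S \<and> V.CO (?q n) = Mul (T.CO (s n)) (V.CO (s' n))" for n
  proof -
    obtain x where x: "T.T.valid x" "s n = T.T.cls x" "T.CO (s n) = T.co x" using T.S_obtain[OF st(1)] by blast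
    obtain y where y: "V.T.valid y" "s' n = V.T.cls y" "V.CO (s' n) = V.co y" using V.S_obtain[OF st(3)] by blast
    have "?q n = V.T.cls (fs_scale (*s) x y)" unfolding x(2) y(2)
    proof (rule quot_map2_eq)
      show "x \<in> T.T.cls x" "y \<in> V.T.cls y" using x y by (auto simp: T.T.mem_cls T.T.cong_refl V.T.mem_cls V.T.cong_refl)
      fix x' y' assume "x' \<in> T.T.cls x" "y' \<in> V.T.cls y"
      then have c: "T.T.tcong x x'" "V.T.tcong y y'" by (auto simp: T.T.mem_cls V.T.mem_cls)
      then have v: "T.T.valid x'" "V.T.valid y'" using T.T.cong_valid V.T.cong_valid by auto
      have "V.T.tcong (fs_scale (*s) x y) (fs_scale (*s) x' y')"
        using co_scale[OF x(1) y(1)] co_scale[OF v] T.co_cong[OF c(1)] V.co_cong[OF c(2)]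
        by (subst V.cong_iff_co) auto
      then show "ct_base E (*s) `` {fs_scale (*s) x' y'} = V.T.cls (fs_scale (*s) x y)"
        using V.T.cls_eq by (simp add: V.ct_base_eq V.T.cls_def)
    qed
    then show ?thesis using co_scale[OF x(1) y(1)] V.CO_cls V.cls_S x y by simp
  qed
  have "V.conv ?q (Mul t w)" unfolding V.conv_def
  proof (intro allI impI)
    fix \<epsilon> :: real assume e: "\<epsilon> > 0"
    obtain W1 W2 where W: "W1 \<ge> 0" "\<And>m. N (t m) \<le> W1" "W2 \<ge> 0" "\<And>m. vn (w m) \<le> W2"
      using T.c0_bounded[OF t] V.c0_bounded[OF w] by metis
    define D where "D = W1 + W2 + 1"
    define \<delta> where "\<delta> = min 1 (\<epsilon> / D)"
    have D0: "D > 0" using W by (simp add: D_def)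
    have de: "\<delta> > 0" "\<delta> \<le> 1" "\<delta> * D \<le> \<epsilon>" using e D0 by (auto simp: \<delta>_def min_def field_simps)
    obtain n0 n1 where n0: "\<And>n. n \<ge> n0 \<Longrightarrow> T.close \<delta> (T.CO (s n)) t" and n1: "\<And>n. n \<ge> n1 \<Longrightarrow> V.close \<delta> (V.CO (s' n)) w"
      using st de(1) unfolding T.conv_def V.conv_def by meson
    have "V.close \<epsilon> (V.CO (?q n)) (Mul t w)" if n: "n \<ge> max n0 n1" for n
      unfolding V.close_def
    proof
      fix m
      let ?t = "T.CO (s n)" and ?w = "V.CO (s' n)"
      have ct: "N (?t i - t i) \<le> \<delta>" for i using n0[of n] n by (simp add: T.close_def)
      have cw: "vn (?w i - w i) \<le> \<delta>" for i using n1[of n] n by (simp add: V.close_def)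
      have wb: "vn (?w i) \<le> D" for i
      proof -
        have "vn (?w i) \<le> max (vn (?w i - w i)) (vn (w i))" using Vn.ultra[of "?w i - w i" "w i"] by simp
        then show ?thesis using cw[of i] W(4)[of i] W(1) W(3) de(2) unfolding D_def by linarith
      qed
      have "vn (Mul (\<lambda>i. ?t i - t i) ?w m) \<le> \<delta> * D" by (rule Mul_le) (use ct wb de D0 in auto)
      moreover have "vn (Mul t (\<lambda>i. ?w i - w i) m) \<le> W1 * \<delta>" by (rule Mul_le) (use cw W de in auto)
      moreover have "W1 * \<delta> \<le> \<delta> * D" using W de by (simp add: D_def mult.commute)
      ultimately have "vn ((Mul ?t ?w m - Mul t ?w m) + (Mul t ?w m - Mul t w m)) \<le> \<epsilon>"
        unfolding Mul_diff_left Mul_diff_right using de(3) by (intro Vn.add_le) linarith+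
      then show "vn (V.CO (?q n) m - Mul t w m) \<le> \<epsilon>" using q by simp
    qed
    then show "\<exists>n0. \<forall>n\<ge>n0. V.close \<epsilon> (V.CO (?q n)) (Mul t w)" by blast
  qed
  then show "?q \<in> V.Psi (Mul t w)" using q by (simp add: V.Psi_def)
qed

lemma Mul_Lm_u: "Mul t (V.Lm u w) = V.Lm u (Mul t w)"
proof
  fix m
  have "Mul t (V.Lm u w) m = (\<Sum>i<m + r. \<Sum>j<m + r. (cf m (bs i * bs j) * t i) *s (if j < r then 0 else w (j - r)))"
    by (simp only: Mul_def V.Lm_u)
  also have "\<dots> = (\<Sum>i<m + r. \<Sum>j<m. (cf m (u * (bs i * bs j)) * t i) *s w j)"
  proof (rule sum.cong[OF HOL.refl])
    fix i
    have "(\<Sum>j<m + r. (cf m (bs i * bs j) * t i) *s (if j < r then 0 else w (j - r)))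
        = (\<Sum>j\<in>{r..<m + r}. (cf m (bs i * bs j) * t i) *s w (j - r))"
      by (rule sum.mono_neutral_cong_right) auto
    also have "\<dots> = (\<Sum>j<m. (cf m (bs i * bs (j + r)) * t i) *s w j)"
      using sum.shift_bounds_nat_ivl[of "\<lambda>j. (cf m (bs i * bs j) * t i) *s w (j - r)" 0 r m] by (simp add: lessThan_atLeast0)
    finally show "(\<Sum>j<m + r. (cf m (bs i * bs j) * t i) *s (if j < r then 0 else w (j - r)))
        = (\<Sum>j<m. (cf m (u * (bs i * bs j)) * t i) *s w j)" by (simp add: bs_u[symmetric] mult.left_commute)
  qed
  also have "\<dots> = (\<Sum>i<m + r. \<Sum>j<m. ((if m < r then 0 else cf (m - r) (bs i * bs j)) * t i) *s w j)"
    by (simp add: cf_u[OF bsbs_A])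
  also have "\<dots> = V.Lm u (Mul t w) m"
  proof (cases "m < r")
    case False
    then have mr: "m - r + r = m" by simp
    have "(\<Sum>i<m + r. \<Sum>j<m. (cf (m - r) (bs i * bs j) * t i) *s w j) = (\<Sum>i<m. \<Sum>j<m. (cf (m - r) (bs i * bs j) * t i) *s w j)"
    proof (rule sum.mono_neutral_right)
      show "\<forall>i\<in>{..<m + r} - {..<m}. (\<Sum>j<m. (cf (m - r) (bs i * bs j) * t i) *s w j) = 0"
      proof
        fix i assume "i \<in> {..<m + r} - {..<m}"
        then have "cf (m - r) (bs j * bs i) = 0" for j using mr by (intro cf_mult_bs bs_A) auto
        then show "(\<Sum>j<m. (cf (m - r) (bs i * bs j) * t i) *s w j) = 0" by (simp add: mult.commute[of "bs i"])
      qed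
    qed auto
    then show ?thesis unfolding V.Lm_u Mul_def[of t w "m - r"] mr using False by simp
  qed (simp add: V.Lm_u)
  finally show "Mul t (V.Lm u w) m = V.Lm u (Mul t w) m" .
qed

lemma th_Mul: "th (Mul t w) = Mul t (th w)"
proof
  fix m
  have "lie u (Mul t w m) = Mul t (\<lambda>j. lie u (w j)) m"
    unfolding Mul_def by (simp add: lie_sum lie_scale)
  then show "th (Mul t w) m = Mul t (th w) m"
    unfolding th_def[abs_def] Mul_diff_right[symmetric] by (simp add: Mul_Lm_u)
qed

lemma theta_T_linear: "T_linear_endo E (theta E u)"
  unfolding T_linear_endo_def
proof (intro conjI ballI)
  show "theta E u \<in> LieT E \<rightarrow> LieT E" by (auto simp: LieT_eq theta_eq th_c0)
next
  fix X Y assume "X \<in> LieT E" "Y \<in> LieT E"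
  then obtain w w' where "w \<in> V.c0" "X = V.Psi w" "w' \<in> V.c0" "Y = V.Psi w'" by (auto simp: LieT_eq)
  then show "theta E u (ct_add E X Y) = ct_add E (theta E u X) (theta E u Y)"
    by (simp add: ct_add_eq theta_eq V.add_c0 th_c0 th_add)
next
  fix t X assume "t \<in> tate_ring E" "X \<in> LieT E"
  then obtain t' w where "t' \<in> T.c0" "t = T.Psi t'" "w \<in> V.c0" "X = V.Psi w" by (auto simp: LieT_eq tate_eq)
  then show "theta E u (lieT_scale E t X) = lieT_scale E t (theta E u X)"
    by (simp add: lieT_scale_eq theta_eq Mul_c0 th_c0 th_Mul)
qed

end

section \<open>Periods, the map \<open>\<delta>\<close> and the different\<close>

text \<open>Growing scalars or a growing module only add relations. Two instances are used: the
  projection from tensors over \<open>F\<close> to tensors over \<open>F[u]\<close>, and the map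
  from \<open>A \<otimes> \<Lambda>\<close> into \<open>A \<otimes> V\<close>.\<close>

lemma tensor_cong_mono:
  assumes "tensor_cong R A act M x y" and "R \<subseteq> R'" "M \<subseteq> M'"
    and "\<And>r m. r \<in> R \<Longrightarrow> m \<in> M \<Longrightarrow> act r m = act' r m"
  shows "tensor_cong R' A act' M' x y"
  using assms(1)
proof (induction rule: tensor_cong.induct)
  case (refl x)
  then show ?case using assms(3) by (intro tensor_cong.refl) blast
next
  case (sym x y)
  from sym.IH show ?case by (rule tensor_cong.sym)
next
  case (trans x y z)
  from trans.IH show ?case by (rule tensor_cong.trans)
next
  case (add x y z)
  then show ?case using assms(3) by (intro tensor_cong.add) blast+
next
  case (zero m)
  then show ?case using assms(3) by (intro tensor_cong.zero) blast
next
  case (add_left a a' m)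
  then show ?case using assms(3) by (intro tensor_cong.add_left) blast+
next
  case (add_right a m m')
  then show ?case using assms(3) by (intro tensor_cong.add_right) blast+
next
  case (balance r a m)
  then have "tensor_cong R' A act' M' {#(r * a, m)#} {#(a, act' r m)#}"
    using assms(2,3) by (intro tensor_cong.balance) blast+
  then show ?case using assms(4) balance by simp
qed

section \<open>Tensors of periods and the map \<open>\<delta>\<close>\<close>

context anderson_basis
begin

abbreviation "Lam \<equiv> periods E"

lemma Lam_iff: "x \<in> Lam \<longleftrightarrow> ex x = 0" by (simp add: periods_def)

lemma Lam_0: "0 \<in> Lam" by (simp add: Lam_iff)

lemma Lam_add: "x \<in> Lam \<Longrightarrow> y \<in> Lam \<Longrightarrow> x + y \<in> Lam" by (simp add: Lam_iff ex_add)

lemma Lam_lie: "a \<in> A \<Longrightarrow> x \<in> Lam \<Longrightarrow> lie a x \<in> Lam" by (simp add: Lam_iff ex_lie)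

lemma Lam_scale: "c \<in> F \<Longrightarrow> x \<in> Lam \<Longrightarrow> c *s x \<in> Lam" by (simp add: Lam_iff ex_scale_F)

sublocale U: tensor_data R A lie Lam
  by standard (use subring_of_0[OF R_sub(1)] R_A subring_of_add[OF A_subring] subring_of_mult[OF A_subring]
    Lam_0 Lam_add Lam_lie lie_const[OF subring_of_0[OF Fr]] in auto)

sublocale P: tensor_data F A "(*s)" Lam
  by standard (use subring_of_0[OF Fr] F_A subring_of_add[OF A_subring] subring_of_mult[OF A_subring]
    Lam_0 Lam_add Lam_scale in auto)

lemma U_valid_V: "U.valid x \<Longrightarrow> V.T.valid x" by (auto simp: U.valid_def V.T.valid_def)

lemma P_valid_U: "P.valid x \<longleftrightarrow> U.valid x" by (simp add: P.valid_def U.valid_def)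

lemma Au_periods_eq: "Au_periods E u = U.cls ` Collect U.valid"
  by (simp add: Au_periods_def U.tensor_cls)

lemma Au_rel_eq: "Au_rel E u = U.trel" by (simp add: Au_rel_def)

lemma P_cong_U: "P.tcong x y \<Longrightarrow> U.tcong x y"
  by (erule tensor_cong_mono) (use R_sub lie_const in auto)

lemma P_cong_V: "P.tcong x y \<Longrightarrow> V.T.tcong x y"
  by (erule tensor_cong_mono) auto

lemma co_Lam: "U.valid x \<Longrightarrow> V.co x m \<in> Lam"
proof (induction x)
  case (add p x)
  then have "cf m (fst p) *s snd p \<in> Lam" by (intro Lam_scale cf_F) auto
  then show ?case using add by (simp add: Lam_add)
qed (simp add: Lam_0)

definition dl :: "('c \<times> ('c ^ 'd)) multiset \<Rightarrow> nat \<Rightarrow> 'c ^ 'd" where "dl x m = ex (Sv (V.co x) m)"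

lemma dl_c0: "U.valid x \<Longrightarrow> dl x \<in> V.c0"
  unfolding dl_def[abs_def] by (intro ex_c0 Sv_c0 V.co_c0 U_valid_V)

lemma dl_plus: "dl (x + y) = (\<lambda>m. dl x m + dl y m)"
proof -
  have "V.co (x + y) = (\<lambda>m. V.co x m + V.co y m)" by (rule HOL.ext) simp
  then show ?thesis by (intro HOL.ext) (simp add: dl_def Sv_add ex_add)
qed

lemma dl_empty: "dl {#} m = 0"
proof -
  have "V.co {#} = (\<lambda>m. 0)" by (rule HOL.ext) simp
  then show ?thesis by (simp add: dl_def Sv_0)
qed

lemma dl_sum_mset: "dl x m = (\<Sum>(a, l)\<in>#x. dl {#(a, l)#} m)"
proof (induction x)
  case (add p x)
  have "dl (add_mset p x) m = dl {#p#} m + dl x m" using dl_plus[of "{#p#}" x] by simp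
  then show ?case using add by (simp add: case_prod_unfold)
qed (simp add: dl_empty)

lemma dl_eqI: "V.co x = V.co y \<Longrightarrow> dl x = dl y" by (simp add: dl_def[abs_def])

text \<open>\<open>th\<close> sends \<open>a \<otimes> l\<close> to
  \<open>a \<otimes> \<partial>u l - u a \<otimes> l\<close>. Hence after inverting
  \<open>th\<close> the two sides differ by \<open>a \<otimes> l\<close>, which the exponential
  function kills because \<open>l\<close> is a period. This is why the map descends to the tensor
  product over \<open>F[u]\<close>.\<close>

lemma dl_single_u: assumes a: "a \<in> A" and l: "l \<in> Lam" shows "dl {#(u * a, l)#} m = dl {#(a, lie u l)#} m"
proof -
  define y where "y m = cf m a *s l" for m
  have "th y m = V.co {#(a, lie u l)#} m - V.co {#(u * a, l)#} m" for m
    by (simp add: th_def y_def lie_scale V.Lm_u cf_u[OF a])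
  then have "th y = (\<lambda>m. V.co {#(a, lie u l)#} m - V.co {#(u * a, l)#} m)" by (rule HOL.ext)
  then have "y = (\<lambda>m. Sv (V.co {#(a, lie u l)#}) m - Sv (V.co {#(u * a, l)#}) m)"
    using Sv_th[of y] by (simp only: Sv_diff)
  from fun_cong[OF this, of m] have "ex (y m) = dl {#(a, lie u l)#} m - dl {#(u * a, l)#} m"
    unfolding dl_def ex_diff[symmetric] by (rule arg_cong)
  moreover have "ex (y m) = 0" using l by (simp add: y_def ex_scale_F cf_F a Lam_iff)
  ultimately show ?thesis by simp
qed

lemma dl_single_add_left: "a \<in> A \<Longrightarrow> a' \<in> A \<Longrightarrow> dl {#(a + a', l)#} m = dl {#(a, l)#} m + dl {#(a', l)#} m"
  using dl_eqI[of "{#(a + a', l)#}" "{#(a, l)#} + {#(a', l)#}"] fun_cong[OF dl_plus[of "{#(a, l)#}" "{#(a', l)#}"], of m]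
  by (simp add: fun_eq_iff cf_add vector_sadd_rdistrib)

lemma dl_single_add_right: "dl {#(a, l + l')#} m = dl {#(a, l)#} m + dl {#(a, l')#} m"
  using dl_eqI[of "{#(a, l + l')#}" "{#(a, l)#} + {#(a, l')#}"] fun_cong[OF dl_plus[of "{#(a, l)#}" "{#(a, l')#}"], of m]
  by (simp add: fun_eq_iff vector_add_ldistrib)

lemma dl_single_const: "a \<in> A \<Longrightarrow> c \<in> F \<Longrightarrow> dl {#(c * a, l)#} m = dl {#(a, c *s l)#} m"
proof -
  assume "a \<in> A" "c \<in> F"
  then have "V.co {#(c * a, l)#} = V.co {#(a, c *s l)#}"
    by (intro HOL.ext) (simp add: cf_scale vector_smult_assoc mult.commute[of "cf _ a"])
  from fun_cong[OF dl_eqI[OF this]] show ?thesis .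
qed

text \<open>Horner's scheme passes from constants and \<open>u\<close> to all of
  \<open>F[u]\<close>.\<close>

lemma dl_single_balance:
  assumes "p \<in> polys_over F" "a \<in> A" "l \<in> Lam"
  shows "dl {#(poly p u * a, l)#} m = dl {#(a, lie (poly p u) l)#} m"
  using assms
proof (induction p arbitrary: l)
  case 0
  have "dl {#(0 * a, l)#} m = dl {#(a, 0 *s l)#} m" using 0 subring_of_0[OF Fr] by (intro dl_single_const)
  then show ?case using lie_const[OF subring_of_0[OF Fr]] by simp
next
  case (pCons c p)
  have c: "c \<in> F" and p: "p \<in> polys_over F"
    using pCons.prems(1) by (auto simp: polys_over_def coeff_pCons dest: spec[of _ 0] spec[of _ "Suc _"])
  have pA: "poly p u \<in> A" using R_A p by (auto simp: adjoin_ring_def)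
  have pa: "poly p u * a \<in> A" "c * a \<in> A" "u * (poly p u * a) \<in> A" "u * poly p u \<in> A" "c \<in> A"
    using pA pCons.prems(2) c F_A uA subring_of_mult[OF A_subring] by auto
  have "dl {#(poly (pCons c p) u * a, l)#} m = dl {#(c * a + u * (poly p u * a), l)#} m"
    by (simp add: distrib_right mult.assoc)
  also have "\<dots> = dl {#(c * a, l)#} m + dl {#(u * (poly p u * a), l)#} m" using pa by (intro dl_single_add_left)
  also have "dl {#(c * a, l)#} m = dl {#(a, lie c l)#} m" using dl_single_const c pCons.prems by (simp add: lie_const)
  also have "dl {#(u * (poly p u * a), l)#} m = dl {#(poly p u * a, lie u l)#} m"
    using pa pCons.prems by (intro dl_single_u)
  also have "\<dots> = dl {#(a, lie (poly p u) (lie u l))#} m"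
    using pCons.IH[OF p pCons.prems(2) Lam_lie[OF uA pCons.prems(3)]] .
  also have "dl {#(a, lie c l)#} m + dl {#(a, lie (poly p u) (lie u l))#} m
      = dl {#(a, lie c l + lie (poly p u) (lie u l))#} m" by (simp add: dl_single_add_right)
  also have "lie c l + lie (poly p u) (lie u l) = lie (poly (pCons c p) u) l"
    using pA pa uA by (simp add: lie_plus lie_mult lie_commute[OF uA])
  finally show ?case .
qed

lemma dl_cong: assumes "U.tcong x y" shows "dl x = dl y"
proof
  fix m
  show "dl x m = dl y m" unfolding dl_sum_mset[of x] dl_sum_mset[of y]
  proof (rule U.cong_sum[OF assms])
    fix s a l assume "s \<in> R" "a \<in> A" "l \<in> Lam"
    then show "dl {#(s * a, l)#} m = dl {#(a, lie s l)#} m"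
      using dl_single_balance by (auto simp: adjoin_ring_def)
  qed (auto simp: dl_single_add_left dl_single_add_right)
qed

definition delta :: "('c \<times> ('c ^ 'd)) multiset set \<Rightarrow> ('c, 'c ^ 'd) ctens" where
  "delta X = V.Psi (dl (SOME x. x \<in> X))"

lemma delta_cls: assumes "U.valid x" shows "delta (U.cls x) = V.Psi (dl x)"
proof -
  have "x \<in> U.cls x" using assms by (simp add: U.mem_cls U.cong_refl)
  then have "(SOME y. y \<in> U.cls x) \<in> U.cls x" by (metis someI)
  then show ?thesis unfolding delta_def using dl_cong by (simp add: U.mem_cls)
qed

lemma Au_add_cls: assumes "U.valid x" "U.valid y" shows "Au_add E u (U.cls x) (U.cls y) = U.cls (x + y)"
  unfolding Au_add_def Au_rel_eq
proof (rule quot_map2_eq)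
  show "x \<in> U.cls x" "y \<in> U.cls y" using assms by (auto simp: U.mem_cls U.cong_refl)
  fix x' y' assume "x' \<in> U.cls x" "y' \<in> U.cls y"
  then have "U.tcong (x + y) (x' + y')" by (intro U.cong_plus) (auto simp: U.mem_cls)
  then show "U.trel `` {x' + y'} = U.cls (x + y)" using U.cls_eq by (simp add: U.cls_def)
qed

lemma map_left_cong: "a \<in> A \<Longrightarrow> U.tcong x y \<Longrightarrow> U.tcong (fs_map_left ((*) a) x) (fs_map_left ((*) a) y)"
  by (rule U.cong_map_left) (auto simp: subring_of_mult[OF A_subring] distrib_left mult.left_commute)

lemma map_right_cong: assumes a: "a \<in> A" and c: "U.tcong x y" shows "U.tcong (fs_map_right (lie a) x) (fs_map_right (lie a) y)"
proof (rule U.cong_map_right[OF c])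
  fix s l assume "s \<in> R"
  then have "s \<in> A" using R_A by auto
  then show "lie a (lie s l) = lie s (lie a l)" by (rule lie_commute[OF a])
qed (use a in \<open>auto simp: Lam_lie lie_add\<close>)

lemma Au_left_cls: assumes a: "a \<in> A" and x: "U.valid x" shows "Au_left E u a (U.cls x) = U.cls (fs_map_left ((*) a) x)"
  unfolding Au_left_def Au_rel_eq U.cls_def[of "fs_map_left ((*) a) x"]
proof (rule U.quot_map_cls[OF x])
  fix y assume "U.tcong x y"
  then show "U.trel `` {fs_map_left ((*) a) y} = U.trel `` {fs_map_left ((*) a) x}"
    using U.cls_eq[OF map_left_cong[OF a]] by (simp add: U.cls_def)
qed

lemma Au_right_cls: assumes a: "a \<in> A" and x: "U.valid x" shows "Au_right E u a (U.cls x) = U.cls (fs_map_right (lie a) x)"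
  unfolding Au_right_def Au_rel_eq U.cls_def[of "fs_map_right (lie a) x"]
proof (rule U.quot_map_cls[OF x])
  fix y assume "U.tcong x y"
  then show "U.trel `` {fs_map_right (lie a) y} = U.trel `` {fs_map_right (lie a) x}"
    using U.cls_eq[OF map_right_cong[OF a]] by (simp add: U.cls_def)
qed

lemma valid_map_left: "a \<in> A \<Longrightarrow> U.valid x \<Longrightarrow> U.valid (fs_map_left ((*) a) x)"
  by (force simp: U.valid_def fs_map_left_def intro: subring_of_mult[OF A_subring])

lemma valid_map_right: "a \<in> A \<Longrightarrow> U.valid x \<Longrightarrow> U.valid (fs_map_right (lie a) x)"
  by (force simp: U.valid_def fs_map_right_def intro: Lam_lie)

lemma dl_map_left: assumes a: "a \<in> A" and x: "U.valid x" shows "dl (fs_map_left ((*) a) x) = V.Lm a (dl x)"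
proof -
  have "V.Lm a (\<lambda>m. ex (Sv (V.co x) m)) = (\<lambda>m. ex (V.Lm a (Sv (V.co x)) m))"
    by (rule V.Lm_right_commute[OF a]) (auto simp: ex_add ex_scale_F)
  then show ?thesis
    unfolding dl_def[abs_def] V.co_map_left(2)[OF a U_valid_V[OF x]] by (simp add: Sv_Lm[OF a])
qed

lemma co_map_right: "V.co (fs_map_right (lie a) x) m = lie a (V.co x m)"
  by (induction x) (auto simp: fs_map_right_def lie_add lie_scale)

lemma dl_map_right: assumes a: "a \<in> A" shows "dl (fs_map_right (lie a) x) = (\<lambda>m. ph a (dl x m))"
proof -
  have "V.co (fs_map_right (lie a) x) = (\<lambda>m. lie a (V.co x m))" by (rule HOL.ext) (rule co_map_right)
  then show ?thesis unfolding dl_def[abs_def] by (simp add: Sv_lie[OF a] ex_lie[OF a])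
qed

lemma delta_proj:
  assumes "X \<in> A_periods E"
  shows "delta (Au_proj E u X) = id_exp E (inv_into (LieT E) (theta E u) (A_periods_incl E X))"
proof -
  obtain x where x: "P.valid x" "X = P.cls x" using assms by (auto simp: A_periods_def P.tensor_cls)
  have Ux: "U.valid x" using x P_valid_U by simp
  have "Au_proj E u X = U.cls x" unfolding Au_proj_def Au_rel_eq x(2) U.cls_def
    by (rule P.quot_map_cls[OF x(1)]) (use U.cls_eq[OF P_cong_U] in \<open>simp add: U.cls_def\<close>)
  then have 1: "delta (Au_proj E u X) = V.Psi (dl x)" using delta_cls[OF Ux] by simp
  have "quot_map (ct_base E (*s)) (\<lambda>x. x) X = V.T.cls x" unfolding V.ct_base_eq x(2) V.T.cls_def
    by (rule P.quot_map_cls[OF x(1)]) (use V.T.cls_eq[OF P_cong_V] in \<open>simp add: V.T.cls_def\<close>)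
  moreover have "(\<lambda>n::nat. V.T.cls x) \<in> V.Psi (V.co x)"
    using V.cls_S[OF U_valid_V[OF Ux]] V.CO_cls[OF U_valid_V[OF Ux]] by (auto simp: V.Psi_def V.conv_def V.close_def)
  ultimately have "A_periods_incl E X = V.Psi (V.co x)" unfolding A_periods_incl_def using V.Psi_class by simp
  then have "id_exp E (inv_into (LieT E) (theta E u) (A_periods_incl E X)) = V.Psi (\<lambda>m. ex (Sv (V.co x) m))"
    using V.co_c0[OF U_valid_V[OF Ux]] by (simp add: inv_theta id_exp_eq Sv_c0)
  then show ?thesis using 1 by (simp add: dl_def[abs_def])
qed

text \<open>The preimage \<open>s\<close> of the tensor under \<open>th\<close> satisfies
  \<open>\<partial>u s = co x + shift s\<close>; the coordinates of \<open>x\<close> are periods, so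
  applying the exponential function leaves the equation for \<open>dl x\<close>.\<close>

lemma dl_equation: assumes x: "U.valid x" shows "V.Lm u (dl x) = (\<lambda>m. ph u (dl x m))"
proof
  fix m
  let ?s = "Sv (V.co x)"
  have "lie u (?s m) = V.co x m + V.Lm u ?s m"
    using fun_cong[OF th_Sv[of "V.co x"], of m] by (simp add: th_def algebra_simps)
  then have "ex (lie u (?s m)) = ex (V.co x m) + ex (V.Lm u ?s m)" by (simp add: ex_add)
  then have "ph u (dl x m) = ex (V.Lm u ?s m)" using co_Lam[OF x, of m] by (simp add: ex_lie uA Lam_iff dl_def)
  also have "\<dots> = V.Lm u (dl x) m" by (simp add: V.Lm_u dl_def)
  finally show "V.Lm u (dl x) m = ph u (dl x m)" by simp
qed

lemma delta_range: "delta \<in> Au_periods E u \<rightarrow> {w \<in> ET E. ct_left E u w = ET_right E u w}"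
proof
  fix X assume "X \<in> Au_periods E u"
  then obtain x where x: "U.valid x" "X = U.cls x" by (auto simp: Au_periods_eq)
  then show "delta X \<in> {w \<in> ET E. ct_left E u w = ET_right E u w}"
    using dl_c0[OF x(1)] by (auto simp: delta_cls ET_eq ct_left_eq ET_right_eq uA dl_equation)
qed

lemma delta_add:
  assumes "X \<in> Au_periods E u" "Y \<in> Au_periods E u"
  shows "delta (Au_add E u X Y) = ct_add E (delta X) (delta Y)"
proof -
  obtain x y where "U.valid x" "X = U.cls x" "U.valid y" "Y = U.cls y" using assms by (auto simp: Au_periods_eq)
  then show ?thesis by (simp add: Au_add_cls delta_cls dl_plus ct_add_eq dl_c0)
qed

lemma delta_left:
  assumes "a \<in> A" "X \<in> Au_periods E u"
  shows "delta (Au_left E u a X) = ct_left E a (delta X)"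
proof -
  obtain x where x: "U.valid x" "X = U.cls x" using assms by (auto simp: Au_periods_eq)
  then show ?thesis using assms by (simp add: Au_left_cls delta_cls valid_map_left dl_map_left ct_left_eq dl_c0)
qed

lemma delta_right:
  assumes "a \<in> A" "X \<in> Au_periods E u"
  shows "delta (Au_right E u a X) = ET_right E a (delta X)"
proof -
  obtain x where x: "U.valid x" "X = U.cls x" using assms by (auto simp: Au_periods_eq)
  then show ?thesis using assms by (simp add: Au_right_cls delta_cls valid_map_right dl_map_right ET_right_eq dl_c0)
qed

text \<open>For \<open>c\<close> in the codifferent, these maps separate the points of \<open>A \<otimes>\<^bsub>R\<^esub> \<Lambda>\<close>.\<close>

definition hh :: "'c \<Rightarrow> ('c \<times> ('c ^ 'd)) multiset \<Rightarrow> 'c ^ 'd" where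
  "hh c x = (\<Sum>(a, l)\<in>#x. lie (ext.tr (c * a)) l)"

lemma hh_simps [simp]: "hh c {#} = 0" "hh c (add_mset p x) = lie (ext.tr (c * fst p)) (snd p) + hh c x"
  "hh c (x + y) = hh c x + hh c y"
  by (auto simp: hh_def case_prod_unfold)

lemma cod_tr_R: "c \<in> ext.cod \<Longrightarrow> a \<in> A \<Longrightarrow> ext.tr (c * a) \<in> R" by (auto simp: ext.cod_def)

lemma cod_tr_A: "c \<in> ext.cod \<Longrightarrow> a \<in> A \<Longrightarrow> ext.tr (c * a) \<in> A" using cod_tr_R R_A by blast

lemma codK: "c \<in> ext.cod \<Longrightarrow> c \<in> K" by (auto simp: ext.cod_def)

lemma cod_multA: "c \<in> ext.cod \<Longrightarrow> a \<in> A \<Longrightarrow> c * a \<in> ext.cod"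
  using ext.cod_mult[of a c] by (simp add: mult.commute)

lemma hh_cong: assumes c: "c \<in> ext.cod" and "U.tcong x y" shows "hh c x = hh c y"
  unfolding hh_def
proof (rule U.cong_sum[OF assms(2)])
  have cK: "c * a \<in> K" if "a \<in> A" for a using codK[OF c] A_K[OF that] subring_of_mult[OF Kr] by auto
  fix a l assume a: "a \<in> A"
  show "lie (ext.tr (c * (a + a'))) l = lie (ext.tr (c * a)) l + lie (ext.tr (c * a')) l" if "a' \<in> A" for a'
    using ext.functionalD(2)[OF ext.tr_functional cK[OF a] cK[OF that]] cod_tr_A[OF c] a that
    by (simp add: distrib_left lie_plus)
  show "lie (ext.tr (c * (s * a))) l = lie (ext.tr (c * a)) (lie s l)" if s: "s \<in> R" for s
  proof -
    have "ext.tr (c * (s * a)) = s * ext.tr (c * a)"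
      using tr_scale[OF cK[OF a], of s] R_k s by (auto simp: mult.left_commute)
    then show ?thesis using lie_mult[of s "ext.tr (c * a)" l] lie_commute[of s "ext.tr (c * a)" l] s R_A cod_tr_A[OF c a] by auto
  qed
qed (simp add: lie_add)

lemma U_normal_form: assumes x: "U.valid x" shows "U.tcong x (\<Sum>i<r. {#(ba i, hh (bc i) x)#})"
  unfolding hh_def
proof (rule U.cong_normal_form[OF _ _ x])
  fix a l assume "(a, l) \<in># x"
  then have a: "a \<in> A" using x by (auto simp: U.valid_def)
  show "ext.tr (bc i * a) \<in> R" if "i \<in> {..<r}" for i using that tr_R a by auto
  show "a = (\<Sum>i<r. ext.tr (bc i * a) * ba i)" using ba_sum A_K[OF a] by simp
qed (auto simp: ba)

lemma U_cong_hh: assumes "U.valid x" "U.valid y" "\<And>i. i < r \<Longrightarrow> hh (bc i) x = hh (bc i) y" shows "U.tcong x y"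
proof -
  have "(\<Sum>i<r. {#(ba i, hh (bc i) x)#}) = (\<Sum>i<r. {#(ba i, hh (bc i) y)#})"
    by (rule sum.cong) (use assms(3) in auto)
  then have "U.tcong y (\<Sum>i<r. {#(ba i, hh (bc i) x)#})" using U_normal_form[OF assms(2)] by simp
  from tensor_cong.trans[OF U_normal_form[OF assms(1)] tensor_cong.sym[OF this]] show ?thesis .
qed

lemma lie_sum_left: "(\<And>i. i \<in> I \<Longrightarrow> f i \<in> A) \<Longrightarrow> lie (\<Sum>i\<in>I. f i) x = (\<Sum>i\<in>I. lie (f i) x)"
proof (induction I rule: infinite_finite_induct)
  case (insert i I)
  then show ?case by (simp add: lie_plus subring_of_sum[OF A_subring])
qed (simp_all add: lie_const subring_of_0[OF Fr])

text \<open>Links the two coordinate systems: the \<open>R\<close>-coordinate at \<open>i\<close>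
  collects the \<open>F\<close>-coordinates in the residue class of \<open>i\<close> modulo
  \<open>r\<close>, with \<open>u^e\<close> acting through \<open>\<partial>\<close>.\<close>

lemma hh_co:
  assumes x: "V.T.valid x" and i: "i < r" and L: "\<forall>p\<in>#x. \<forall>m\<ge>L * r. cf m (fst p) = 0"
  shows "hh (bc i) x = (\<Sum>e<L. lie (u ^ e) (V.co x (e * r + i)))"
  using x L
proof (induction x)
  case (add p x)
  obtain a l where p: "p = (a, l)" by (metis surj_pair)
  have a: "a \<in> A" using add.prems p by simp
  have La: "cf m a = 0" if "m \<ge> L * r" for m using add.prems(2) p that by auto
  have cA: "cf m a * u ^ e \<in> A" for m e
    by (rule subring_of_mult[OF A_subring subsetD[OF F_A cf_F[OF a]] upow_A])
  have "lie (ext.tr (bc i * a)) l = (\<Sum>e<L. lie (cf (e * r + i) a * u ^ e) l)"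
    by (subst tr_expansion[OF a i La]) (assumption, rule lie_sum_left, rule cA)
  also have "\<dots> = (\<Sum>e<L. lie (u ^ e) (cf (e * r + i) a *s l))"
  proof (rule sum.cong[OF HOL.refl])
    fix e
    have "cf (e * r + i) a \<in> A" using cf_F[OF a] F_A by auto
    then show "lie (cf (e * r + i) a * u ^ e) l = lie (u ^ e) (cf (e * r + i) a *s l)"
      using lie_mult[OF _ upow_A] by (simp add: lie_const cf_F[OF a] lie_scale)
  qed
  finally show ?case using add p by (simp add: lie_add sum.distrib)
qed simp

text \<open>Discreteness of the periods: where the exponential function is isometric, a period must
  be 0.\<close>

lemma Lam_c0_finite: assumes "z \<in> V.c0" "\<And>m. z m \<in> Lam" shows "\<exists>L. \<forall>m\<ge>L. z m = 0"
proof -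
  obtain \<rho> where rho: "\<rho> > 0" "\<forall>x. vn x \<le> \<rho> \<longrightarrow> vn (ex x) = vn x" using exp_local by blast
  obtain L where L: "\<And>m. m \<ge> L \<Longrightarrow> vn (z m) < \<rho>" using assms(1) rho(1) unfolding V.c0_iff by blast
  have "z m = 0" if "m \<ge> L" for m
  proof -
    have "vn (ex (z m)) = vn (z m)" using rho(2) L[OF that] by simp
    then have "vn (z m) = 0" using assms(2)[of m] by (simp add: Lam_iff)
    then show ?thesis using Vn.zero_iff by blast
  qed
  then show ?thesis by blast
qed

text \<open>The preimages under \<open>th\<close> differ by a null sequence \<open>z\<close> of
  periods, hence by a finite one. So \<open>x - y\<close> has the coordinates of
  \<open>(\<partial>u - u) z\<close>, which vanishes over \<open>F[u]\<close>; concretely, its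
  \<open>R\<close>-coordinates telescope to 0.\<close>

lemma dl_inj: assumes x: "U.valid x" and y: "U.valid y" and eq: "dl x = dl y" shows "U.tcong x y"
proof -
  define z where "z = Sv (\<lambda>m. V.co x m - V.co y m)"
  have z: "z m = Sv (V.co x) m - Sv (V.co y) m" for m by (simp add: z_def Sv_diff)
  have "ex (z m) = 0" for m using fun_cong[OF eq, of m] by (simp add: z ex_diff dl_def)
  then have zL: "z m \<in> Lam" for m by (simp add: Lam_iff)
  have "z \<in> V.c0" unfolding z_def by (intro Sv_c0 V.diff_c0 V.co_c0 U_valid_V x y)
  then obtain L0 where L0: "\<And>m. m \<ge> L0 \<Longrightarrow> z m = 0" using Lam_c0_finite zL by blast
  have thz: "th z m = V.co x m - V.co y m" for m by (simp add: z_def th_Sv)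
  obtain L1 L2 where L12: "\<forall>p\<in>#x. \<forall>m\<ge>L1. cf m (fst p) = 0" "\<forall>p\<in>#y. \<forall>m\<ge>L2. cf m (fst p) = 0"
    using V.co_support[OF U_valid_V[OF x]] V.co_support[OF U_valid_V[OF y]] by blast
  \<comment> \<open>Past all three supports; the extra 1 puts the last term of the telescoping sum,
    \<open>z\<close> at \<open>(L - 1) r + i\<close>, outside the support of
    \<open>z\<close>.\<close>
  define L where "L = Suc (L0 + L1 + L2)"
  have Lr: "L0 + L1 + L2 \<le> (L - 1) * r" "L0 + L1 + L2 \<le> L * r" using r_pos by (auto simp: L_def trans_le_add2)
  have hx: "hh (bc i) x = (\<Sum>e<L. lie (u ^ e) (V.co x (e * r + i)))" if "i < r" for i
    by (rule hh_co[OF U_valid_V[OF x] that]) (use L12 Lr in auto)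
  have hy: "hh (bc i) y = (\<Sum>e<L. lie (u ^ e) (V.co y (e * r + i)))" if "i < r" for i
    by (rule hh_co[OF U_valid_V[OF y] that]) (use L12 Lr in auto)
  have "hh (bc i) x = hh (bc i) y" if i: "i < r" for i
  proof -
    have tele: "(\<Sum>e<Suc n. lie (u ^ e) (th z (e * r + i))) = lie (u ^ Suc n) (z (n * r + i))" for n
    proof (induction n)
      case 0
      then show ?case using i by (simp add: th_def V.Lm_u lie_const subring_of_1[OF Fr])
    next
      case (Suc n)
      have "\<not> Suc n * r + i < r" "Suc n * r + i - r = n * r + i" by auto
      then have "th z (Suc n * r + i) = lie u (z (Suc n * r + i)) - z (n * r + i)" by (simp only: th_def V.Lm_u if_False)
      then have "lie (u ^ Suc n) (th z (Suc n * r + i)) = lie (u ^ Suc n) (lie u (z (Suc n * r + i))) - lie (u ^ Suc n) (z (n * r + i))"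
        by (simp only: lie_diff)
      moreover have "lie (u ^ Suc n) (lie u (z (Suc n * r + i))) = lie (u ^ Suc (Suc n)) (z (Suc n * r + i))"
        using lie_mult[OF upow_A uA, of "Suc n"] by (simp add: mult.commute mult.left_commute)
      ultimately show ?case using Suc by (simp only: sum.lessThan_Suc) simp
    qed
    have "hh (bc i) x - hh (bc i) y = (\<Sum>e<L. lie (u ^ e) (th z (e * r + i)))"
      unfolding hx[OF i] hy[OF i] thz by (simp add: lie_diff sum_subtractf)
    also have "\<dots> = lie (u ^ L) (z ((L - 1) * r + i))" using tele[of "L - 1"] by (simp add: L_def)
    also have "z ((L - 1) * r + i) = 0" by (rule L0) (use Lr in linarith)
    finally show ?thesis by simp
  qed
  then show ?thesis by (rule U_cong_hh[OF x y])
qed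

lemma delta_inj: "inj_on delta (Au_periods E u)"
proof (rule inj_onI)
  fix X Y assume "X \<in> Au_periods E u" "Y \<in> Au_periods E u" and eq: "delta X = delta Y"
  then obtain x y where xy: "U.valid x" "X = U.cls x" "U.valid y" "Y = U.cls y" by (auto simp: Au_periods_eq)
  then have "V.Psi (dl x) = V.Psi (dl y)" using eq by (simp add: delta_cls)
  then have "dl x = dl y" by (rule V.Psi_inj[OF dl_c0[OF xy(1)]])
  then show "X = Y" using dl_inj[OF xy(1,3)] U.cls_eq xy by simp
qed

text \<open>The preimages of the terms under the exponential function must again form a null
  sequence \<open>y\<close>, so wherever a term is small the preimage of the same norm is taken.
  Then \<open>th y\<close> is a null sequence of periods, hence finite, and is the coordinate
  sequence of a genuine tensor.\<close>

lemma delta_onto: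
  assumes w: "w \<in> V.c0" and eq: "V.Lm u w = (\<lambda>m. ph u (w m))"
  shows "\<exists>x. U.valid x \<and> dl x = w"
proof -
  obtain \<rho> where rho: "\<rho> > 0" "\<And>y. vn y \<le> \<rho> \<Longrightarrow> \<exists>x. ex x = y \<and> vn x = vn y" using exp_local by blast
  obtain L where L: "\<And>m. m \<ge> L \<Longrightarrow> vn (w m) < \<rho>" using w rho(1) unfolding V.c0_iff by blast
  \<comment> \<open>Descent by steps of \<open>r\<close>: the term at \<open>m\<close> is
    \<open>\<phi>_u\<close> of the term at \<open>m + r\<close>, so \<open>\<partial>u\<close>
    carries a preimage at \<open>m + r\<close> to one at \<open>m\<close>.\<close>
  have desc: "m + j * r \<ge> L \<Longrightarrow> \<exists>x. ex x = w m" for m j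
  proof (induction j arbitrary: m)
    case 0
    then show ?case using rho(2)[of "w m"] L[of m] by (auto simp: less_imp_le)
  next
    case (Suc j)
    have "L \<le> m + r + j * r" using Suc.prems by simp
    then obtain x where "ex x = w (m + r)" using Suc.IH[of "m + r"] by blast
    then have "ex (lie u x) = ph u (w (m + r))" by (simp add: ex_lie uA)
    also have "\<dots> = V.Lm u w (m + r)" using fun_cong[OF eq, of "m + r"] by simp
    also have "\<dots> = w m" by (simp add: V.Lm_u)
    finally show ?case by blast
  qed
  have "\<exists>x. ex x = w m \<and> (vn (w m) \<le> \<rho> \<longrightarrow> vn x = vn (w m))" for m
  proof (cases "vn (w m) \<le> \<rho>")
    case False
    have "L * 1 \<le> L * r" using r_pos by (intro mult_le_mono2) simp
    then have "L \<le> m + L * r" by linarith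
    then show ?thesis using desc[of m L] False by blast
  qed (use rho in auto)
  then obtain y where y: "\<And>m. ex (y m) = w m" "\<And>m. vn (w m) \<le> \<rho> \<Longrightarrow> vn (y m) = vn (w m)" by metis
  have yc: "y \<in> V.c0" unfolding V.c0_iff
  proof (intro allI impI)
    fix \<epsilon> :: real assume "\<epsilon> > 0"
    then obtain L' where "\<And>m. m \<ge> L' \<Longrightarrow> vn (w m) < min \<epsilon> \<rho>" using w rho(1) unfolding V.c0_iff by (meson min_less_iff_conj)
    then have "vn (y m) < \<epsilon>" if "m \<ge> L'" for m using y(2)[of m] that by fastforce
    then show "\<exists>L. \<forall>m\<ge>L. vn (y m) < \<epsilon>" by blast
  qed
  have thL: "th y m \<in> Lam" for m
  proof -
    have "ex (V.Lm u y m) = V.Lm u w m" by (simp add: V.Lm_u y)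
    then have "ex (th y m) = ph u (w m) - V.Lm u w m" by (simp add: th_def ex_diff ex_lie uA y)
    then show ?thesis using fun_cong[OF eq, of m] by (simp add: Lam_iff)
  qed
  obtain M where M: "\<And>m. m \<ge> M \<Longrightarrow> th y m = 0" using Lam_c0_finite[OF th_c0[OF yc] thL] by blast
  define x where "x = (\<Sum>m<M. {#(bs m, th y m)#})"
  have "U.valid (\<Sum>m\<in>I. {#(bs m, th y m)#})" for I
    by (induction I rule: infinite_finite_induct) (auto simp: bs_A thL)
  then have "U.valid x" by (simp add: x_def)
  moreover have "V.co x = th y"
  proof
    fix m
    have "V.co x m = (if m \<in> {..<M} then th y m else 0)" unfolding x_def by (rule V.co_sum_basis) simp
    then show "V.co x m = th y m" using M[of m] by auto
  qed
  then have "dl x = w" using y(1) by (simp add: dl_def[abs_def] Sv_th)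
  ultimately show ?thesis by blast
qed

text \<open>\<open>delta\<close> commutes with both actions and is injective on the whole tensor
  product over \<open>F[u]\<close>, so the diagonal condition can be checked after applying it; a
  special function satisfies the equation for \<open>u\<close> and therefore has a preimage.\<close>

lemma delta_bij: "bij_betw delta (Au_diagonal E u) (special_functions E)"
  unfolding bij_betw_def
proof
  have sub: "Au_diagonal E u \<subseteq> Au_periods E u" by (auto simp: Au_diagonal_def)
  show "inj_on delta (Au_diagonal E u)" using delta_inj sub by (rule inj_on_subset)
  show "delta ` Au_diagonal E u = special_functions E"
  proof
    show "delta ` Au_diagonal E u \<subseteq> special_functions E"
    proof
      fix w assume "w \<in> delta ` Au_diagonal E u"
      then obtain X where X: "X \<in> Au_periods E u" "w = delta X" "\<And>a. a \<in> A \<Longrightarrow> Au_left E u a X = Au_right E u a X"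
        by (auto simp: Au_diagonal_def)
      have "ct_left E a w = ET_right E a w" if "a \<in> A" for a
        using delta_left[OF that X(1)] delta_right[OF that X(1)] X(3)[OF that] X(2) by simp
      moreover have "w \<in> ET E" using delta_range X by auto
      ultimately show "w \<in> special_functions E" by (auto simp: special_functions_def)
    qed
    show "special_functions E \<subseteq> delta ` Au_diagonal E u"
    proof
      fix Z assume "Z \<in> special_functions E"
      then have Z: "Z \<in> ET E" "\<And>a. a \<in> A \<Longrightarrow> ct_left E a Z = ET_right E a Z" by (auto simp: special_functions_def)
      then obtain w where w: "w \<in> V.c0" "Z = V.Psi w" by (auto simp: ET_eq)
      have "V.Psi (V.Lm u w) = V.Psi (\<lambda>m. ph u (w m))" using Z(2)[OF uA] w by (simp add: ct_left_eq ET_right_eq uA)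
      then have "V.Lm u w = (\<lambda>m. ph u (w m))" by (rule V.Psi_inj[OF V.Lm_c0[OF uA w(1)]])
      then obtain x where x: "U.valid x" "dl x = w" using delta_onto[OF w(1)] by blast
      then have dX: "delta (U.cls x) = Z" using w by (simp add: delta_cls)
      have X: "U.cls x \<in> Au_periods E u" using x by (auto simp: Au_periods_eq)
      have "Au_left E u a (U.cls x) = Au_right E u a (U.cls x)" if a: "a \<in> A" for a
      proof (rule inj_onD[OF delta_inj])
        show "delta (Au_left E u a (U.cls x)) = delta (Au_right E u a (U.cls x))"
          using delta_left[OF a X] delta_right[OF a X] dX Z(2)[OF a] by simp
        show "Au_left E u a (U.cls x) \<in> Au_periods E u" "Au_right E u a (U.cls x) \<in> Au_periods E u"
          using a x by (auto simp: Au_left_cls Au_right_cls Au_periods_eq valid_map_left valid_map_right)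
      qed
      then have "U.cls x \<in> Au_diagonal E u" using X by (auto simp: Au_diagonal_def)
      then show "Z \<in> delta ` Au_diagonal E u" using dX by blast
    qed
  qed
qed

section \<open>The function field acting on the Lie algebra, and the different\<close>

lemma lie_bij: assumes a: "a \<in> A" "a \<noteq> 0" shows "\<exists>!w. lie a w = v"
proof -
  obtain e where e: "e > 0" "\<And>x. lie (a ^ e) x = a ^ e *s x" using lie_power_scalar[OF a(1)] by blast
  have aA: "a ^ (e - 1) \<in> A" using a subring_of_power[OF A_subring] by auto
  have ae: "a * a ^ (e - 1) = a ^ e" "a ^ (e - 1) * a = a ^ e" using e(1) by (auto simp: power_eq_if mult.commute)
  have 1: "lie a (lie (a ^ (e - 1)) x) = a ^ e *s x" "lie (a ^ (e - 1)) (lie a x) = a ^ e *s x" for x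
    using lie_mult[OF a(1) aA, of x] lie_mult[OF aA a(1), of x] e(2)[of x] ae by simp_all
  show ?thesis
  proof (rule ex1I[of _ "lie (a ^ (e - 1)) (inverse (a ^ e) *s v)"])
    show "lie a (lie (a ^ (e - 1)) (inverse (a ^ e) *s v)) = v" using a by (simp add: 1[unfolded One_nat_def] vector_smult_assoc)
    fix w assume "lie a w = v"
    then have "lie (a ^ (e - 1)) (inverse (a ^ e) *s v) = inverse (a ^ e) *s (a ^ e *s w)"
      using 1(2)[of w] by (simp add: lie_scale)
    then show "w = lie (a ^ (e - 1)) (inverse (a ^ e) *s v)" using a by (simp add: vector_smult_assoc)
  qed
qed

lemma lie_inj: "a \<in> A \<Longrightarrow> a \<noteq> 0 \<Longrightarrow> lie a v = lie a w \<Longrightarrow> v = w"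
  using lie_bij[of a "lie a w"] by auto

text \<open>As \<open>\<partial>a\<close> is invertible for \<open>a \<noteq> 0\<close>, the action of \<open>A\<close> extends to \<open>K\<close>.\<close>

definition kact :: "'c \<Rightarrow> 'c ^ 'd \<Rightarrow> 'c ^ 'd" where
  "kact x v = (THE w. \<forall>b\<in>A. b * x \<in> A \<longrightarrow> lie b w = lie (b * x) v)"

text \<open>One nonzero denominator decides: commutativity of \<open>A\<close> transfers the
  defining equation to any other denominator, and \<open>\<partial>b\<close> is injective.\<close>

lemma kactI: assumes b: "b \<in> A" "b \<noteq> 0" "b * x \<in> A" and eq: "lie b w = lie (b * x) v" shows "kact x v = w"
  unfolding kact_def
proof (rule the_equality)
  show "\<forall>b\<in>A. b * x \<in> A \<longrightarrow> lie b w = lie (b * x) v"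
  proof (intro ballI impI)
    fix b' assume b': "b' \<in> A" "b' * x \<in> A"
    have "lie b (lie b' w) = lie b' (lie (b * x) v)" using lie_commute[OF b(1) b'(1)] eq by simp
    also have "\<dots> = lie b (lie (b' * x) v)"
      using lie_mult[OF b'(1) b(3), of v] lie_mult[OF b(1) b'(2), of v] by (simp add: mult.left_commute)
    finally show "lie b' w = lie (b' * x) v" by (rule lie_inj[OF b(1,2)])
  qed
  fix w' assume "\<forall>b\<in>A. b * x \<in> A \<longrightarrow> lie b w' = lie (b * x) v"
  then have "lie b w' = lie b w" using b eq by simp
  then show "w' = w" by (rule lie_inj[OF b(1,2)])
qed

lemma K_denominator: "x \<in> K \<Longrightarrow> \<exists>b\<in>A. b \<noteq> 0 \<and> b * x \<in> A" using A_frac R_A by blast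

lemma kactD: assumes x: "x \<in> K" and b: "b \<in> A" "b * x \<in> A" shows "lie b (kact x v) = lie (b * x) v"
proof (cases "b = 0")
  case True
  then show ?thesis using lie_const[OF subring_of_0[OF Fr]] by simp
next
  case False
  obtain w where w: "lie b w = lie (b * x) v" using lie_bij[OF b(1) False, of "lie (b * x) v"] by blast
  then show ?thesis using kactI[OF b(1) False b(2) w] by simp
qed

lemma kact_A: "a \<in> A \<Longrightarrow> kact a v = lie a v"
  by (rule kactI[of 1]) (auto simp: subring_of_1[OF A_subring] lie_const subring_of_1[OF Fr])

lemma kact_mult: assumes x: "x \<in> K" and y: "y \<in> K" shows "kact (x * y) v = kact x (kact y v)"
proof -
  obtain b b' where b: "b \<in> A" "b \<noteq> 0" "b * x \<in> A" and b': "b' \<in> A" "b' \<noteq> 0" "b' * y \<in> A"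
    using K_denominator x y by metis
  note mA = subring_of_mult[OF A_subring]
  show ?thesis
  proof (rule kactI[of "b' * b"])
    show "b' * b \<in> A" "b' * b \<noteq> 0" using b b' mA by auto
    have e: "b' * b * (x * y) = (b * x) * (b' * y)" by (simp add: mult_ac)
    show "b' * b * (x * y) \<in> A" unfolding e by (rule mA[OF b(3) b'(3)])
    have "lie (b' * b) (kact x (kact y v)) = lie b' (lie (b * x) (kact y v))" using lie_mult[OF b'(1) b(1)] kactD[OF x b(1,3)] by simp
    also have "\<dots> = lie (b * x) (lie (b' * y) v)" using lie_commute[OF b'(1) b(3)] kactD[OF y b'(1,3)] by simp
    finally show "lie (b' * b) (kact x (kact y v)) = lie (b' * b * (x * y)) v" unfolding e lie_mult[OF b(3) b'(3)] .
  qed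
qed

lemma kact_plus: assumes x: "x \<in> K" and y: "y \<in> K" shows "kact (x + y) v = kact x v + kact y v"
proof -
  obtain b b' where b: "b \<in> A" "b \<noteq> 0" "b * x \<in> A" and b': "b' \<in> A" "b' \<noteq> 0" "b' * y \<in> A"
    using K_denominator x y by metis
  note mA = subring_of_mult[OF A_subring]
  have A1: "b' * b * x \<in> A" "b' * b * y \<in> A" "b' * b \<in> A"
    using mA[OF b'(1) b(3)] mA[OF b(1) b'(3)] mA[OF b'(1) b(1)] by (auto simp: mult_ac)
  show ?thesis
  proof (rule kactI[of "b' * b"])
    show "b' * b \<in> A" "b' * b \<noteq> 0" using A1 b b' by auto
    show "b' * b * (x + y) \<in> A" using A1 subring_of_add[OF A_subring] by (simp add: distrib_left)
    show "lie (b' * b) (kact x v + kact y v) = lie (b' * b * (x + y)) v"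
      using kactD[OF x A1(3,1)] kactD[OF y A1(3,2)] A1 by (simp add: lie_add distrib_left lie_plus)
  qed
qed

lemma kact_add: assumes x: "x \<in> K" shows "kact x (v + w) = kact x v + kact x w"
proof -
  obtain b where b: "b \<in> A" "b \<noteq> 0" "b * x \<in> A" using K_denominator x by metis
  show ?thesis by (rule kactI[OF b]) (simp add: lie_add kactD[OF x b(1,3)])
qed

lemma kact_sum_left: "(\<And>i. i \<in> I \<Longrightarrow> f i \<in> K) \<Longrightarrow> kact (\<Sum>i\<in>I. f i) v = (\<Sum>i\<in>I. kact (f i) v)"
proof (induction I rule: infinite_finite_induct)
  case (insert i I)
  then show ?case by (simp add: kact_plus subring_of_sum[OF Kr])
qed (simp_all add: kact_A subring_of_0[OF A_subring] lie_const subring_of_0[OF Fr])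

lemma kact_sum_right: "x \<in> K \<Longrightarrow> kact x (\<Sum>i\<in>I. f i) = (\<Sum>i\<in>I. kact x (f i))"
proof (induction I rule: infinite_finite_induct)
  case (insert i I)
  then show ?case by (simp add: kact_add)
qed (use kact_add[of x 0 0] in simp_all)

text \<open>The quotient of the period module by the codifferent, formed inside the whole Lie
  algebra by means of the action of \<open>K\<close>.\<close>

definition W :: "('c ^ 'd) set" where "W = {v. \<forall>c\<in>ext.cod. kact c v \<in> Lam}"

text \<open>Traces of elements of \<open>A\<close> lie in \<open>R\<close>, so 1 belongs to the
  codifferent.\<close>

lemma dif_A: "ext.dif \<subseteq> A"
proof
  fix y assume y: "y \<in> ext.dif"
  have "1 \<in> ext.cod"
    using subring_of_1[OF Kr] ext.tr_integral A_integral A_K by (auto simp: ext.cod_def)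
  then have "y * 1 \<in> A" using y by (auto simp: ext.dif_def simp del: mult_1_right)
  then show "y \<in> A" by simp
qed

text \<open>One inclusion is formal. For the other, \<open>1 = \<Sum> d e\<close> with
  \<open>d\<close> in the different and \<open>e\<close> in the codifferent gives
  \<open>v = \<Sum> d (e v)\<close>, where every \<open>e v\<close> is a period.\<close>

lemma different_periods_eq: "different_periods E u = W"
proof
  have WA: "A_submodule E W" unfolding A_submodule_def
  proof (intro conjI ballI)
    show "0 \<in> W" using kact_add[of _ 0 0] codK by (auto simp: W_def Lam_0)
    show "x + y \<in> W" if "x \<in> W" "y \<in> W" for x y using that codK by (auto simp: W_def kact_add Lam_add)
    fix a x assume a: "a \<in> A" and x: "x \<in> W"
    have "kact c (lie a x) \<in> Lam" if c: "c \<in> ext.cod" for c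
    proof -
      have "kact c (lie a x) = kact (c * a) x" using kact_mult[OF codK[OF c] A_K[OF a]] kact_A[OF a] by simp
      then show ?thesis using x cod_multA[OF c a] by (auto simp: W_def)
    qed
    then show "lie a x \<in> W" by (simp add: W_def)
  qed
  have gen: "{lie_act E a l | a l. a \<in> different E u \<and> l \<in> periods E} \<subseteq> W"
  proof
    fix v assume "v \<in> {lie_act E a l | a l. a \<in> different E u \<and> l \<in> periods E}"
    then obtain a l where v: "v = lie a l" "a \<in> ext.dif" "l \<in> Lam" by (auto simp: dif_eq)
    have "kact c v \<in> Lam" if c: "c \<in> ext.cod" for c
    proof -
      have a: "a \<in> A" using dif_A v by auto
      have ca: "c * a \<in> A" using v(2) c by (auto simp: ext.dif_def mult.commute)
      have "kact c v = kact (c * a) l" using kact_mult[OF codK[OF c] A_K[OF a]] kact_A[OF a] v by simp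
      then show ?thesis using kact_A[OF ca] Lam_lie[OF ca v(3)] by simp
    qed
    then show "v \<in> W" by (simp add: W_def)
  qed
  show "different_periods E u \<subseteq> W" unfolding different_periods_def by (rule hull_minimal[of _ W "A_submodule E", OF gen WA])
  show "W \<subseteq> different_periods E u"
  proof
    fix v assume v: "v \<in> W"
    obtain I :: "(nat \<times> nat) set" and d e where de: "finite I" "\<And>p. p \<in> I \<Longrightarrow> d p \<in> ext.dif" "\<And>p. p \<in> I \<Longrightarrow> e p \<in> ext.cod"
      "(\<Sum>p\<in>I. d p * e p) = 1" using ext.cod_invertible by blast
    have sm: "A_submodule E (different_periods E u)"
      unfolding different_periods_def by (rule hull_in) (auto simp: A_submodule_def)
    have sums: "finite I' \<Longrightarrow> (\<And>p. p \<in> I' \<Longrightarrow> f p \<in> different_periods E u) \<Longrightarrow> sum f I' \<in> different_periods E u"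
      for I' :: "(nat \<times> nat) set" and f
      by (induction I' rule: finite_induct) (use sm in \<open>auto simp: A_submodule_def\<close>)
    have dK: "d p \<in> K" if "p \<in> I" for p using de(2)[OF that] dif_A A_K by auto
    have "v = kact (\<Sum>p\<in>I. d p * e p) v"
      using kact_A[OF subring_of_1[OF A_subring], of v] de(4) by (simp add: lie_const subring_of_1[OF Fr])
    also have "\<dots> = (\<Sum>p\<in>I. kact (d p * e p) v)"
      by (rule kact_sum_left) (use dK de codK subring_of_mult[OF Kr] in auto)
    also have "\<dots> = (\<Sum>p\<in>I. lie (d p) (kact (e p) v))"
    proof (rule sum.cong[OF HOL.refl])
      fix p assume p: "p \<in> I"
      have "d p \<in> A" using de(2)[OF p] dif_A by auto
      then show "kact (d p * e p) v = lie (d p) (kact (e p) v)"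
        using kact_mult[OF dK[OF p] codK[OF de(3)[OF p]]] kact_A by simp
    qed
    also have "\<dots> \<in> different_periods E u"
    proof (rule sums[OF de(1)])
      fix p assume p: "p \<in> I"
      have "kact (e p) v \<in> Lam" using v de(3)[OF p] by (auto simp: W_def)
      then have "lie (d p) (kact (e p) v) \<in> {lie_act E a l | a l. a \<in> different E u \<and> l \<in> periods E}"
        using de(2)[OF p] by (auto simp: dif_eq)
      then show "lie (d p) (kact (e p) v) \<in> different_periods E u"
        unfolding different_periods_def by (rule subsetD[OF hull_subset])
    qed
    finally show "v \<in> different_periods E u" .
  qed
qed

definition mu :: "('c \<times> ('c ^ 'd)) multiset \<Rightarrow> 'c ^ 'd" where "mu x = (\<Sum>(a, l)\<in>#x. lie a l)"

lemma mu_cong: assumes "U.tcong x y" shows "mu x = mu y"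
  unfolding mu_def
proof (rule U.cong_sum[OF assms])
  fix s a l assume "s \<in> R" "a \<in> A"
  then have "s \<in> A" "a \<in> A" using R_A by auto
  then show "lie (s * a) l = lie a (lie s l)" using lie_mult[of s a l] lie_commute[of s a l] by simp
qed (auto simp: lie_plus lie_add)

lemma Au_mult_cls: assumes "U.valid x" shows "Au_mult E u (U.cls x) = mu x"
proof -
  have x: "x \<in> U.cls x" using assms by (simp add: U.mem_cls U.cong_refl)
  have eq: "mu y = mu x" if "y \<in> U.cls x" for y
    using mu_cong[of x y] that by (simp only: U.mem_cls)
  have "mu ` U.cls x = {mu x}"
  proof (rule equalityI)
    show "mu ` U.cls x \<subseteq> {mu x}" by (rule image_subsetI) (simp only: eq singleton_iff)
    show "{mu x} \<subseteq> mu ` U.cls x" using imageI[OF x, of mu] by simp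
  qed
  then have "(\<lambda>x. \<Sum>(a, l)\<in>#x. lie_act E a l) ` U.cls x = {mu x}" unfolding mu_def[abs_def] .
  then show ?thesis by (simp add: Au_mult_def)
qed

lemma mu_sum: "mu (\<Sum>i\<in>I. {#(f i, g i)#}) = (\<Sum>i\<in>I. lie (f i) (g i))"
  by (induction I rule: infinite_finite_induct) (auto simp: mu_def)

lemma hh_sum: "hh c (\<Sum>i\<in>I. {#(f i, g i)#}) = (\<Sum>i\<in>I. lie (ext.tr (c * f i)) (g i))"
  by (induction I rule: infinite_finite_induct) auto

lemma hh_map_left: "hh c (fs_map_left ((*) a) x) = hh (c * a) x"
  by (induction x) (auto simp: fs_map_left_def mult.assoc)

lemma hh_map_right: assumes "c \<in> ext.cod" "a \<in> A" "U.valid x" shows "hh c (fs_map_right (lie a) x) = lie a (hh c x)"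
  using assms(3)
proof (induction x)
  case (add p x)
  then have "lie (ext.tr (c * fst p)) (lie a (snd p)) = lie a (lie (ext.tr (c * fst p)) (snd p))"
    using assms by (intro lie_commute cod_tr_A) auto
  then show ?case using add by (auto simp: fs_map_right_def lie_add)
qed (simp add: fs_map_right_def)

lemma ba_bc_kact: "(\<Sum>i<r. lie (ba i) (kact (bc i) v)) = v"
proof -
  have "(\<Sum>i<r. lie (ba i) (kact (bc i) v)) = (\<Sum>i<r. kact (ba i * bc i) v)"
  proof (rule sum.cong[OF HOL.refl])
    fix i assume "i \<in> {..<r}"
    then have "ba i \<in> A" "bc i \<in> K" using ba bcK by auto
    then show "lie (ba i) (kact (bc i) v) = kact (ba i * bc i) v" by (simp add: kact_mult A_K kact_A)
  qed
  also have "\<dots> = kact (\<Sum>i<r. ba i * bc i) v"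
    by (rule kact_sum_left[symmetric]) (use ba bcK A_K subring_of_mult[OF Kr] in auto)
  also have "\<dots> = v" using ba_bc kact_A[OF subring_of_1[OF A_subring], of v] by (simp add: lie_const subring_of_1[OF Fr])
  finally show ?thesis .
qed

text \<open>On the diagonal, moving \<open>a\<close> across the tensor shows that
  \<open>hh (c * a) x\<close> is \<open>a\<close> applied to \<open>hh c x\<close>. Clearing
  denominators, \<open>c\<close> applied to \<open>hh c' x\<close> equals \<open>c'\<close> applied
  to \<open>hh c x\<close> for all \<open>c, c'\<close> in the codifferent. Inserted in the basis
  expansion of \<open>mu x\<close>, this leaves \<open>hh c x\<close> because the products
  \<open>ba i * bc i\<close> sum to 1.\<close>

lemma diagonal_hh:
  assumes x: "U.valid x" and D: "\<And>a. a \<in> A \<Longrightarrow> U.tcong (fs_map_left ((*) a) x) (fs_map_right (lie a) x)"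
    and c: "c \<in> ext.cod"
  shows "kact c (mu x) = hh c x"
proof -
  have lin: "hh (c * a) x = lie a (hh c x)" if "c \<in> ext.cod" "a \<in> A" for c a
    using hh_cong[OF that(1) D[OF that(2)]] hh_map_right[OF that x] by (simp add: hh_map_left)
  have comm: "kact c (hh c' x) = kact c' (hh c x)" if c: "c \<in> ext.cod" and c': "c' \<in> ext.cod" for c c'
  proof -
    obtain b b' where b: "b \<in> A" "b \<noteq> 0" "b * c \<in> A" and b': "b' \<in> A" "b' \<noteq> 0" "b' * c' \<in> A"
      using K_denominator codK c c' by metis
    note mA = subring_of_mult[OF A_subring]
    have A1: "b' * b * c \<in> A" "b' * b * c' \<in> A" "b' * b \<in> A"
      using mA[OF b'(1) b(3)] mA[OF b(1) b'(3)] mA[OF b'(1) b(1)] by (auto simp: mult_ac)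
    have "lie (b' * b) (kact c (hh c' x)) = hh (c' * (b' * b * c)) x" using kactD[OF codK[OF c] A1(3,1)] lin[OF c' A1(1)] by simp
    also have "c' * (b' * b * c) = c * (b' * b * c')" by (simp add: mult_ac)
    also have "hh \<dots> x = lie (b' * b) (kact c' (hh c x))" using kactD[OF codK[OF c'] A1(3,2)] lin[OF c A1(2)] by simp
    finally have "lie (b' * b) (kact c (hh c' x)) = lie (b' * b) (kact c' (hh c x))" .
    moreover have "b' * b \<noteq> 0" using b b' by simp
    ultimately show ?thesis using lie_inj[OF A1(3)] by blast
  qed
  have "mu x = (\<Sum>i<r. lie (ba i) (hh (bc i) x))" using mu_cong[OF U_normal_form[OF x]] by (simp add: mu_sum)
  then have "kact c (mu x) = (\<Sum>i<r. kact c (lie (ba i) (hh (bc i) x)))" using kact_sum_right[OF codK[OF c]] by simp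
  also have "\<dots> = (\<Sum>i<r. lie (ba i) (kact (bc i) (hh c x)))"
  proof (rule sum.cong[OF HOL.refl])
    fix i assume "i \<in> {..<r}"
    then have i: "ba i \<in> A" "bc i \<in> ext.cod" using ba bc by auto
    have "kact c (lie (ba i) (hh (bc i) x)) = kact (c * ba i) (hh (bc i) x)"
      using kact_mult[OF codK[OF c] A_K[OF i(1)]] kact_A[OF i(1)] by simp
    also have "\<dots> = lie (ba i) (kact c (hh (bc i) x))"
      using kact_mult[OF A_K[OF i(1)] codK[OF c]] kact_A[OF i(1)] by (simp add: mult.commute)
    finally show "kact c (lie (ba i) (hh (bc i) x)) = lie (ba i) (kact (bc i) (hh c x))" using comm[OF c i(2)] by simp
  qed
  also have "\<dots> = hh c x" by (rule ba_bc_kact)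
  finally show ?thesis .
qed

lemma diagonal_obtain:
  assumes "X \<in> Au_diagonal E u"
  obtains x where "U.valid x" "X = U.cls x" "\<And>a. a \<in> A \<Longrightarrow> U.tcong (fs_map_left ((*) a) x) (fs_map_right (lie a) x)"
proof -
  obtain x where x: "U.valid x" "X = U.cls x" "\<And>a. a \<in> A \<Longrightarrow> Au_left E u a X = Au_right E u a X"
    using assms by (auto simp: Au_diagonal_def Au_periods_eq)
  have "U.tcong (fs_map_left ((*) a) x) (fs_map_right (lie a) x)" if a: "a \<in> A" for a
    using x(3)[OF a] x a by (simp add: Au_left_cls Au_right_cls U.cls_eq_iff valid_map_right)
  then show ?thesis using that x by blast
qed

lemma diagonalI:
  assumes "U.valid x" "\<And>a. a \<in> A \<Longrightarrow> U.tcong (fs_map_left ((*) a) x) (fs_map_right (lie a) x)"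
  shows "U.cls x \<in> Au_diagonal E u"
  using assms U.cls_eq by (auto simp: Au_diagonal_def Au_periods_eq Au_left_cls Au_right_cls)

text \<open>For a diagonal tensor, \<open>mu x\<close> determines all \<open>hh c x\<close>, hence
  the class of \<open>x\<close>, and its multiples by the codifferent are periods. Conversely
  \<open>v\<close> in \<open>W\<close> comes from the sum of \<open>ba i \<otimes> bc i v\<close>,
  whose image under \<open>hh c\<close> is \<open>c v\<close> because \<open>c\<close> expands over
  the \<open>bc i\<close> with coefficients \<open>tr(c * ba i)\<close>.\<close>

lemma mult_bij: "bij_betw (Au_mult E u) (Au_diagonal E u) (different_periods E u)"
  unfolding different_periods_eq bij_betw_def
proof
  show "inj_on (Au_mult E u) (Au_diagonal E u)"
  proof (rule inj_onI)
    fix X Y assume XY: "X \<in> Au_diagonal E u" "Y \<in> Au_diagonal E u" and eq: "Au_mult E u X = Au_mult E u Y"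
    obtain x where x: "U.valid x" "X = U.cls x" "\<And>a. a \<in> A \<Longrightarrow> U.tcong (fs_map_left ((*) a) x) (fs_map_right (lie a) x)"
      using diagonal_obtain[OF XY(1)] by blast
    obtain y where y: "U.valid y" "Y = U.cls y" "\<And>a. a \<in> A \<Longrightarrow> U.tcong (fs_map_left ((*) a) y) (fs_map_right (lie a) y)"
      using diagonal_obtain[OF XY(2)] by blast
    have "mu x = mu y" using eq x y by (simp add: Au_mult_cls)
    then have "hh (bc i) x = hh (bc i) y" if "i < r" for i
      using diagonal_hh[OF x(1,3) bc[OF that]] diagonal_hh[OF y(1,3) bc[OF that]] by simp
    then show "X = Y" using U_cong_hh[OF x(1) y(1)] U.cls_eq x y by simp
  qed
  show "Au_mult E u ` Au_diagonal E u = W"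
  proof
    show "Au_mult E u ` Au_diagonal E u \<subseteq> W"
    proof
      fix v assume "v \<in> Au_mult E u ` Au_diagonal E u"
      then obtain X where X: "X \<in> Au_diagonal E u" "v = Au_mult E u X" by blast
      obtain x where x: "U.valid x" "X = U.cls x" "\<And>a. a \<in> A \<Longrightarrow> U.tcong (fs_map_left ((*) a) x) (fs_map_right (lie a) x)"
        using diagonal_obtain[OF X(1)] by blast
      have "hh c x \<in> Lam" if c: "c \<in> ext.cod" for c
        using x(1) by (induction x) (auto intro!: Lam_0 Lam_add Lam_lie cod_tr_A[OF c])
      then show "v \<in> W" using diagonal_hh[OF x(1,3)] X x by (auto simp: W_def Au_mult_cls)
    qed
    show "W \<subseteq> Au_mult E u ` Au_diagonal E u"
    proof
      fix v assume v: "v \<in> W"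
      define x where "x = (\<Sum>i<r. {#(ba i, kact (bc i) v)#})"
      have "I \<subseteq> {..<r} \<Longrightarrow> U.valid (\<Sum>i\<in>I. {#(ba i, kact (bc i) v)#})" for I
        using v ba bc by (induction I rule: infinite_finite_induct) (auto simp: W_def)
      then have x: "U.valid x" by (simp add: x_def)
      have hx: "hh c x = kact c v" if c: "c \<in> ext.cod" for c
      proof -
        have "hh c x = (\<Sum>i<r. kact (ext.tr (c * ba i) * bc i) v)"
          unfolding x_def hh_sum
        proof (rule sum.cong[OF HOL.refl])
          fix i assume "i \<in> {..<r}"
          then have "ext.tr (c * ba i) \<in> A" "bc i \<in> K" using cod_tr_A[OF c ba] bcK by auto
          then show "lie (ext.tr (c * ba i)) (kact (bc i) v) = kact (ext.tr (c * ba i) * bc i) v"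
            by (simp add: kact_mult A_K kact_A)
        qed
        also have "\<dots> = kact (\<Sum>i<r. ext.tr (c * ba i) * bc i) v"
          by (rule kact_sum_left[symmetric]) (use cod_tr_A[OF c ba] bcK A_K subring_of_mult[OF Kr] in auto)
        also have "(\<Sum>i<r. ext.tr (c * ba i) * bc i) = c" using bc_sum codK[OF c] by simp
        finally show ?thesis .
      qed
      have "U.tcong (fs_map_left ((*) a) x) (fs_map_right (lie a) x)" if a: "a \<in> A" for a
      proof (rule U_cong_hh[OF valid_map_left[OF a x] valid_map_right[OF a x]])
        fix i assume "i < r"
        then have c: "bc i \<in> ext.cod" by (rule bc)
        have "hh (bc i) (fs_map_left ((*) a) x) = kact (a * bc i) v"
          using hx[OF cod_multA[OF c a]] by (simp add: hh_map_left mult.commute)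
        also have "\<dots> = lie a (kact (bc i) v)" using kact_mult[OF A_K[OF a] codK[OF c]] kact_A[OF a] by simp
        also have "\<dots> = hh (bc i) (fs_map_right (lie a) x)" using hh_map_right[OF c a x] hx[OF c] by simp
        finally show "hh (bc i) (fs_map_left ((*) a) x) = hh (bc i) (fs_map_right (lie a) x)" .
      qed
      then have "U.cls x \<in> Au_diagonal E u" by (rule diagonalI[OF x])
      moreover have "Au_mult E u (U.cls x) = v"
        using x by (simp add: Au_mult_cls) (simp add: x_def mu_sum ba_bc_kact)
      ultimately show "v \<in> Au_mult E u ` Au_diagonal E u" by blast
    qed
  qed
qed

lemma diagonal_add:
  assumes "X \<in> Au_diagonal E u" "Y \<in> Au_diagonal E u"
  shows "Au_add E u X Y \<in> Au_diagonal E u" "Au_mult E u (Au_add E u X Y) = Au_mult E u X + Au_mult E u Y"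
proof -
  obtain x where x: "U.valid x" "X = U.cls x" "\<And>a. a \<in> A \<Longrightarrow> U.tcong (fs_map_left ((*) a) x) (fs_map_right (lie a) x)"
    using diagonal_obtain[OF assms(1)] by blast
  obtain y where y: "U.valid y" "Y = U.cls y" "\<And>a. a \<in> A \<Longrightarrow> U.tcong (fs_map_left ((*) a) y) (fs_map_right (lie a) y)"
    using diagonal_obtain[OF assms(2)] by blast
  have "U.cls (x + y) \<in> Au_diagonal E u"
  proof (rule diagonalI)
    show "U.valid (x + y)" using x y by simp
    fix a assume a: "a \<in> A"
    show "U.tcong (fs_map_left ((*) a) (x + y)) (fs_map_right (lie a) (x + y))"
      using U.cong_plus[OF x(3)[OF a] y(3)[OF a]] by (simp add: fs_map_left_def fs_map_right_def)
  qed
  then show "Au_add E u X Y \<in> Au_diagonal E u" using x y by (simp add: Au_add_cls)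
  show "Au_mult E u (Au_add E u X Y) = Au_mult E u X + Au_mult E u Y"
    using x y by (simp add: Au_add_cls Au_mult_cls mu_def)
qed

lemma diagonal_left:
  assumes "X \<in> Au_diagonal E u" and a: "a \<in> A"
  shows "Au_left E u a X \<in> Au_diagonal E u" "Au_mult E u (Au_left E u a X) = lie a (Au_mult E u X)"
proof -
  obtain x where x: "U.valid x" "X = U.cls x" "\<And>a. a \<in> A \<Longrightarrow> U.tcong (fs_map_left ((*) a) x) (fs_map_right (lie a) x)"
    using diagonal_obtain[OF assms(1)] by blast
  have "U.cls (fs_map_left ((*) a) x) \<in> Au_diagonal E u"
  proof (rule diagonalI[OF valid_map_left[OF a x(1)]])
    fix b assume b: "b \<in> A"
    have "fs_map_left ((*) b) (fs_map_left ((*) a) x) = fs_map_left ((*) a) (fs_map_left ((*) b) x)"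
      by (simp add: fs_map_left_def multiset.map_comp comp_def case_prod_unfold mult.left_commute)
    moreover have "fs_map_right (lie b) (fs_map_left ((*) a) x) = fs_map_left ((*) a) (fs_map_right (lie b) x)"
      by (simp add: fs_map_left_def fs_map_right_def multiset.map_comp comp_def case_prod_unfold)
    ultimately show "U.tcong (fs_map_left ((*) b) (fs_map_left ((*) a) x)) (fs_map_right (lie b) (fs_map_left ((*) a) x))"
      using map_left_cong[OF a x(3)[OF b]] by simp
  qed
  then show "Au_left E u a X \<in> Au_diagonal E u" using x a by (simp add: Au_left_cls)
  have "mu (fs_map_left ((*) a) x) = lie a (mu x)" using x(1)
    by (induction x) (auto simp: mu_def fs_map_left_def lie_mult[OF a] lie_add)
  then show "Au_mult E u (Au_left E u a X) = lie a (Au_mult E u X)"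
    using x a by (simp add: Au_left_cls Au_mult_cls valid_map_left)
qed

text \<open>Sums and multiples of diagonal tensors are diagonal again, and there
  \<open>Au_mult\<close> is injective; so its inverse is linear, and linearity of
  \<open>delta\<close> finishes the composite.\<close>

lemma delta_u_linear:
  defines "\<delta> \<equiv> \<lambda>l. delta (inv_into (Au_diagonal E u) (Au_mult E u) l)"
  shows "bij_betw \<delta> (different_periods E u) (special_functions E)"
    and "x \<in> different_periods E u \<Longrightarrow> y \<in> different_periods E u \<Longrightarrow> \<delta> (x + y) = ct_add E (\<delta> x) (\<delta> y)"
    and "a \<in> A \<Longrightarrow> x \<in> different_periods E u \<Longrightarrow> \<delta> (lie a x) = ct_left E a (\<delta> x)"
proof -
  let ?i = "inv_into (Au_diagonal E u) (Au_mult E u)"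
  show "bij_betw \<delta> (different_periods E u) (special_functions E)"
    unfolding \<delta>_def using bij_betw_trans[OF bij_betw_inv_into[OF mult_bij] delta_bij] by (simp add: comp_def)
  have i: "?i x \<in> Au_diagonal E u" "Au_mult E u (?i x) = x" if "x \<in> different_periods E u" for x
    using that mult_bij bij_betw_inv_into_right[OF mult_bij that] bij_betwE[OF bij_betw_inv_into[OF mult_bij]] by auto
  have ieq: "?i (Au_mult E u X) = X" if "X \<in> Au_diagonal E u" for X
    by (rule bij_betw_inv_into_left[OF mult_bij that])
  have sub: "X \<in> Au_periods E u" if "X \<in> Au_diagonal E u" for X using that by (simp add: Au_diagonal_def)
  show "\<delta> (x + y) = ct_add E (\<delta> x) (\<delta> y)" if xy: "x \<in> different_periods E u" "y \<in> different_periods E u"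
  proof -
    have "?i (x + y) = Au_add E u (?i x) (?i y)"
      using ieq[OF diagonal_add(1)[OF i(1)[OF xy(1)] i(1)[OF xy(2)]]] diagonal_add(2)[OF i(1)[OF xy(1)] i(1)[OF xy(2)]]
      by (simp add: i(2) xy)
    then show ?thesis unfolding \<delta>_def using delta_add[OF sub[OF i(1)[OF xy(1)]] sub[OF i(1)[OF xy(2)]]] by simp
  qed
  show "\<delta> (lie a x) = ct_left E a (\<delta> x)" if a: "a \<in> A" and x: "x \<in> different_periods E u"
  proof -
    have "?i (lie a x) = Au_left E u a (?i x)"
      using ieq[OF diagonal_left(1)[OF i(1)[OF x] a]] diagonal_left(2)[OF i(1)[OF x] a] by (simp add: i(2) x)
    then show ?thesis unfolding \<delta>_def using delta_left[OF a sub[OF i(1)[OF x]]] by simp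
  qed
qed

end

theorem theorem3p11:
  fixes E :: "('c::field, 'd::finite) anderson_data" and u :: 'c
  assumes "anderson_module E"
    and "u \<in> coord_ring E" and "separating E u"
  shows "T_linear_endo E (theta E u) \<and> bij_betw (theta E u) (LieT E) (LieT E) \<and>
    (\<exists>delta.
       (\<forall>X\<in>A_periods E.
          delta (Au_proj E u X) = id_exp E (inv_into (LieT E) (theta E u) (A_periods_incl E X))) \<and>
       delta \<in> Au_periods E u \<rightarrow> {w \<in> ET E. ct_left E u w = ET_right E u w} \<and>
       (\<forall>X\<in>Au_periods E u. \<forall>Y\<in>Au_periods E u.
          delta (Au_add E u X Y) = ct_add E (delta X) (delta Y)) \<and>
       (\<forall>a\<in>coord_ring E. \<forall>X\<in>Au_periods E u.
          delta (Au_left E u a X) = ct_left E a (delta X) \<and>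
          delta (Au_right E u a X) = ET_right E a (delta X)) \<and>
       bij_betw (Au_mult E u) (Au_diagonal E u) (different_periods E u) \<and>
       bij_betw delta (Au_diagonal E u) (special_functions E) \<and>
       (let delta_u = (\<lambda>l. delta (inv_into (Au_diagonal E u) (Au_mult E u) l)) in
          bij_betw delta_u (different_periods E u) (special_functions E) \<and>
          (\<forall>x\<in>different_periods E u. \<forall>y\<in>different_periods E u.
             delta_u (x + y) = ct_add E (delta_u x) (delta_u y)) \<and>
          (\<forall>a\<in>coord_ring E. \<forall>x\<in>different_periods E u.
             delta_u (lie_act E a x) = ct_left E a (delta_u x))))"
proof -
  interpret ctx: anderson_ctx E u by standard (use assms in auto)
  \<comment> \<open>The trace-dual basis is an existence statement about the curve, so the locale
    that fixes it can be entered only here; the witness \<open>delta\<close> is written in the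
    coordinates of this choice.\<close>
  obtain r :: nat and ba bc where b: "\<forall>i<r. ba i \<in> coord_ring E \<and> bc i \<in> ctx.ext.cod"
    "\<forall>x\<in>fun_field E. (\<Sum>i<r. ctx.ext.tr (bc i * x) * ba i) = x"
    "\<forall>i<r. \<forall>j<r. ctx.ext.tr (bc i * ba j) = (if i = j then 1 else 0)"
    "\<forall>x\<in>fun_field E. (\<Sum>i<r. ctx.ext.tr (x * ba i) * bc i) = x" "(\<Sum>i<r. ba i * bc i) = 1"
    using ctx.ext.exists_trace_dual_basis by blast
  interpret anderson_basis E u r ba bc by standard (use b in auto)
  show ?thesis
    unfolding Let_def
    by (intro conjI exI[of _ delta] ballI theta_T_linear theta_bij delta_proj delta_range delta_add delta_left
        delta_right mult_bij delta_bij delta_u_linear)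
qed

end
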